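(* Fix $\alpha\ge0$, $\eta,\theta>0$. For $\epsilon>0$ let $q=e^{-\epsilon}$, $a=e^{-\alpha\epsilon}$, $Q=q^\eta$, $\tilde Q=q^\theta$, and let $(\omega_{i,j})_{i,j\ge1}$ be independent with $\omega_{i,j}\sim\mathrm{Geom}(aQ^{i-1/2}\tilde Q^{j-1/2})$. Let $L^{\rm geo}_1=\sup_\pi\sum_{(i,j)\in\pi}\omega_{i,j}$ over all finite lattice paths $\pi$ starting at $(1,1)$ with steps $(1,0)$ or $(0,1)$, and $L^{\rm geo}_2=\sup_\varpi\sum_{(i,j)\in\varpi}\omega_{i,j}$ over all finite lattice paths $\varpi$ from a point $(n,1)$ to a point $(1,n')$ ($n,n'\ge1$) with steps $(-1,0)$ or $(0,1)$. Then $L^{\rm geo}_1$ and $L^{\rm geo}_2$ are a.s. finite and equal in distribution, and for $L\in\{L^{\rm geo}_1,L^{\rm geo}_2\}$ and every $s\in\mathbb R$, $$\lim_{\epsilon\to0^+}\mathbb P\Big(\epsilon L+\frac{\log(\epsilon\eta)}{\eta}+\frac{\log(\epsilon\theta)}{\theta}<s\Big)=\det(1-\tilde K_{he})_{L^2(s,\infty)},\qquad \tilde K_{he}(x,y)=e^{-\frac x2-\frac y2}K_{he}(0,e^{-x};0,e^{-y}).$$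
   Context: $X\sim\mathrm{Geom}(p)$ means $\mathbb P(X=k)=(1-p)p^k$, $k=0,1,\dots$. $F_{he}(0,\zeta)=\Gamma(\frac{\alpha}{2\eta}-\frac{\zeta}{\eta}+\frac12)/\Gamma(\frac{\alpha}{2\theta}+\frac{\zeta}{\theta}+\frac12)$. Fix $0<\delta<(\alpha+\min(\eta,\theta))/2$; $\Gamma_+$: ray from $+\infty-i\delta$ to $\delta-i\delta$, segment to $\delta+i\delta$, ray to $+\infty+i\delta$; $\Gamma_-$: ray from $-\infty-i\delta$ to $-\delta-i\delta$, segment to $-\delta+i\delta$, ray to $-\infty+i\delta$. For $x,y>0$, $$K_{he}(0,x;0,y)=\frac{1}{\sqrt{xy}}\int_{\Gamma_+}\frac{d\zeta}{2\pi i}\int_{\Gamma_-}\frac{d\omega}{2\pi i}\frac{F_{he}(0,\zeta)}{F_{he}(0,\omega)}\frac{x^\zeta}{y^\omega}\frac{1}{\zeta-\omega}.$$ $\det(1-K)_{L^2(s,\infty)}$ is the Fredholm determinant on $L^2(s,\infty)$. *)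

theory Defs
  imports "HOL-Probability.Probability" "HOL-Library.Extended_Nat"
begin

definition up_right_path :: "(nat \<times> nat) list \<Rightarrow> bool" where
  "up_right_path xs \<longleftrightarrow> xs \<noteq> [] \<and> hd xs = (1,1) \<and>
     (\<forall>k. Suc k < length xs \<longrightarrow>
        xs ! Suc k = (fst (xs ! k) + 1, snd (xs ! k)) \<or>
        xs ! Suc k = (fst (xs ! k), snd (xs ! k) + 1))"

definition left_up_path :: "(nat \<times> nat) list \<Rightarrow> bool" where
  "left_up_path xs \<longleftrightarrow> xs \<noteq> [] \<and>
     fst (hd xs) \<ge> 1 \<and> snd (hd xs) = 1 \<and>
     fst (last xs) = 1 \<and> snd (last xs) \<ge> 1 \<and>
     (\<forall>k. Suc k < length xs \<longrightarrow>
        (fst (xs ! Suc k) + 1 = fst (xs ! k) \<and> snd (xs ! Suc k) = snd (xs ! k)) \<or>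
        xs ! Suc k = (fst (xs ! k), snd (xs ! k) + 1))"

definition path_weight :: "(nat \<times> nat \<Rightarrow> nat) \<Rightarrow> (nat \<times> nat) list \<Rightarrow> enat" where
  "path_weight w xs = sum_list (map (\<lambda>p. enat (w p)) xs)"

definition Lgeo1 :: "(nat \<times> nat \<Rightarrow> nat) \<Rightarrow> enat" where
  "Lgeo1 w = (SUP xs \<in> {xs. up_right_path xs}. path_weight w xs)"

definition Lgeo2 :: "(nat \<times> nat \<Rightarrow> nat) \<Rightarrow> enat" where
  "Lgeo2 w = (SUP xs \<in> {xs. left_up_path xs}. path_weight w xs)"

definition F_he :: "real \<Rightarrow> real \<Rightarrow> real \<Rightarrow> complex \<Rightarrow> complex" where
  "F_he \<alpha> \<eta> \<theta> \<zeta> =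
     Gamma (of_real (\<alpha> / (2*\<eta>)) - \<zeta> / of_real \<eta> + 1/2) /
     Gamma (of_real (\<alpha> / (2*\<theta>)) + \<zeta> / of_real \<theta> + 1/2)"

text \<open>Parametrisation t \<in> \<real> of the contour Gamma_plus and its derivative
  (the derivative is irrelevant on the null set {-delta, delta}).\<close>
definition gamma_plus :: "real \<Rightarrow> real \<Rightarrow> complex" where
  "gamma_plus \<delta> t =
     (if t \<le> -\<delta> then Complex (-t) (-\<delta>)
      else if t \<le> \<delta> then Complex \<delta> t
      else Complex t \<delta>)"

definition gamma_plus' :: "real \<Rightarrow> real \<Rightarrow> complex" where
  "gamma_plus' \<delta> t = (if t \<le> -\<delta> then -1 else if t \<le> \<delta> then \<i> else 1)"

definition gamma_minus :: "real \<Rightarrow> real \<Rightarrow> complex" where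
  "gamma_minus \<delta> t =
     (if t \<le> -\<delta> then Complex t (-\<delta>)
      else if t \<le> \<delta> then Complex (-\<delta>) t
      else Complex (-t) \<delta>)"

definition gamma_minus' :: "real \<Rightarrow> real \<Rightarrow> complex" where
  "gamma_minus' \<delta> t = (if t \<le> -\<delta> then 1 else if t \<le> \<delta> then \<i> else -1)"

text \<open>K_he(0,x;0,y): the double contour integral written as a Lebesgue (Bochner)
  integral over the parameters (t,u) in R x R of the two contours.\<close>
definition K_he :: "real \<Rightarrow> real \<Rightarrow> real \<Rightarrow> real \<Rightarrow> real \<Rightarrow> real \<Rightarrow> complex" where
  "K_he \<alpha> \<eta> \<theta> \<delta> x y =
     of_real (1 / sqrt (x * y)) *
     integral\<^sup>L (lborel :: (real \<times> real) measure)
       (\<lambda>(t, u).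
          let \<zeta> = gamma_plus \<delta> t; \<omega> = gamma_minus \<delta> u in
          (gamma_plus' \<delta> t / (2 * pi * \<i>)) * (gamma_minus' \<delta> u / (2 * pi * \<i>)) *
          (F_he \<alpha> \<eta> \<theta> \<zeta> / F_he \<alpha> \<eta> \<theta> \<omega>) *
          (of_real x powr \<zeta> / of_real y powr \<omega>) * (1 / (\<zeta> - \<omega>)))"

definition K_he_tilde :: "real \<Rightarrow> real \<Rightarrow> real \<Rightarrow> real \<Rightarrow> real \<Rightarrow> real \<Rightarrow> complex" where
  "K_he_tilde \<alpha> \<eta> \<theta> \<delta> x y =
     of_real (exp (- x / 2 - y / 2)) * K_he \<alpha> \<eta> \<theta> \<delta> (exp (-x)) (exp (-y))"

definition kernel_det :: "(real \<Rightarrow> real \<Rightarrow> complex) \<Rightarrow> nat \<Rightarrow> (nat \<Rightarrow> real) \<Rightarrow> complex" where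
  "kernel_det K n x =
     (\<Sum>p | p permutes {..<n}. of_int (sign p) * (\<Prod>i<n. K (x i) (x (p i))))"

definition fredholm_term :: "(real \<Rightarrow> real \<Rightarrow> complex) \<Rightarrow> real \<Rightarrow> nat \<Rightarrow> complex" where
  "fredholm_term K s n =
     ((-1) ^ n / of_nat (fact n)) *
     integral\<^sup>L (Pi\<^sub>M {..<n} (\<lambda>_. restrict_space lborel {s<..})) (kernel_det K n)"

definition fredholm_det :: "(real \<Rightarrow> real \<Rightarrow> complex) \<Rightarrow> real \<Rightarrow> complex" where
  "fredholm_det K s = (\<Sum>n. fredholm_term K s n)"

definition geo_param :: "real \<Rightarrow> real \<Rightarrow> real \<Rightarrow> real \<Rightarrow> nat \<Rightarrow> nat \<Rightarrow> real" where
  "geo_param \<alpha> \<eta> \<theta> \<epsilon> i j =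
     (let q = exp (-\<epsilon>); a = exp (-\<alpha> * \<epsilon>); Q = q powr \<eta>; Qt = q powr \<theta> in
      a * Q powr (real i - 1/2) * Qt powr (real j - 1/2))"

end

theory Submission
  imports Defs "Jordan_Normal_Form.Determinant" "HOL-Computational_Algebra.Polynomial"
    "HOL-Library.Nat_Bijection" "HOL-Real_Asymp.Real_Asymp" "HOL-Complex_Analysis.Complex_Analysis"
begin

text \<open>
  Restricted to an \<open>n \<times> n\<close> box with weights of parameter \<open>x\<^sub>i y\<^sub>j\<close>, the local growth rules for
  partitions turn the generating function of the last passage time into a Cauchy sum of Schur
  functions over partitions with first row at most \<open>N\<close>, so the law of the last passage time is a
  ratio of the determinants of \<open>(1 - (x\<^sub>i y\<^sub>j)\<^sup>M) / (1 - x\<^sub>i y\<^sub>j)\<close> and \<open>1 / (1 - x\<^sub>i y\<^sub>j)\<close> with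
  \<open>M = N + n\<close>.  This ratio is symmetric in the \<open>x\<^sub>i\<close>, and reversing the rows exchanges the two
  models.  Inverting the Cauchy matrix writes the ratio as \<open>det (1 - K)\<close> with an explicit matrix
  \<open>K\<close>, expanded as a sum over finite sets of indices.  Dominated convergence in this expansion
  gives first \<open>n \<longrightarrow> \<infinity>\<close> and then \<open>\<epsilon> \<longrightarrow> 0\<close>, where the \<open>q\<close>-Pochhammer symbols become Gamma
  functions.  On the other side, moving the contours across the poles of the Gamma functions
  expands \<open>K_he\<close> into exponentials, and integrating the exponentials over \<open>(s, \<infinity>)\<close> turns the
  Fredholm determinant into the same sum over finite sets of indices.
\<close>

section \<open>Growth of partitions and last passage percolation\<close>

text \<open>The cutoff \<open>N\<close> on the first row keeps every sum finite, so the passage from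
  weights to determinants involves no convergence. The Cauchy determinant is never evaluated: its
  reciprocal enters as a constant fixed by the total mass 1 as \<open>N\<close> grows, and it equals
  the determinant of the inverse Cauchy matrix. Both ends are brought to determinants over the index
  set of the poles of Gamma, not over functions on the half-line. Before the limit this is built in,
  since the row and column parameters are \<open>exp (- \<epsilon> p)\<close> with \<open>p\<close>
  such a pole; after it, the residue expansion factors \<open>K_he\<close> through that set, and the
  two factors may be exchanged in the determinant. Domination is by rows only: if the entries in row
  \<open>i\<close> are at most \<open>g i\<close>, a minor over \<open>S\<close> is at most the
  product of \<open>(i + 1) g i\<close> over \<open>S\<close>. This is summable thanks to the factor
  \<open>1 / k!\<close> in the residues of Gamma and its analogue before the limit. The logarithmic
  centring arises because the normalisations produce powers of \<open>\<epsilon> \<theta>\<close>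
  and \<open>\<epsilon> \<eta>\<close> whose exponents are affine in the pole, so that they merge
  with the cutoff into one exponential rate.\<close>

definition bounded_partitions :: "nat \<Rightarrow> nat \<Rightarrow> (nat \<Rightarrow> nat) set" where
  "bounded_partitions N k = {l. antimono l \<and> l 0 \<le> N \<and> (\<forall>i\<ge>k. l i = 0)}"

text \<open>The skew diagram \<open>l / m\<close> is a horizontal strip. The inequalities alone
  already make both sequences weakly decreasing.\<close>

definition interlaces :: "(nat \<Rightarrow> nat) \<Rightarrow> (nat \<Rightarrow> nat) \<Rightarrow> bool" where
  "interlaces m l \<longleftrightarrow> (\<forall>i. l (Suc i) \<le> m i \<and> m i \<le> l i)"

definition psize :: "(nat \<Rightarrow> nat) \<Rightarrow> nat" where
  "psize l = (\<Sum>i | l i \<noteq> 0. l i)"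

text \<open>The skew Schur function of \<open>l / m\<close> in the single variable
  \<open>x\<close>.\<close>

definition branch :: "real \<Rightarrow> (nat \<Rightarrow> nat) \<Rightarrow> (nat \<Rightarrow> nat) \<Rightarrow> real" where
  "branch x m l = (if interlaces m l then x ^ (psize l - psize m) else 0)"

lemma psize_eq:
  assumes "l \<in> bounded_partitions N k" "k \<le> m" shows "psize l = (\<Sum>i<m. l i)"
  unfolding psize_def
proof (rule sum.mono_neutral_left)
  show "{i. l i \<noteq> 0} \<subseteq> {..<m}"
  proof
    fix i assume "i \<in> {i. l i \<noteq> 0}"
    then have "\<not> k \<le> i" using assms(1) by (auto simp: bounded_partitions_def)
    then show "i \<in> {..<m}" using assms(2) by simp
  qed
qed auto

lemma finite_bounded_partitions [simp]: "finite (bounded_partitions N k)"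
proof -
  have "bounded_partitions N k \<subseteq> {f. \<forall>i. (i \<in> {..<k} \<longrightarrow> f i \<in> {..N}) \<and> (i \<notin> {..<k} \<longrightarrow> f i = 0)}"
    by (auto simp: bounded_partitions_def antimono_def intro: order_trans)
  moreover have "finite \<dots>" by (rule finite_set_of_finite_funs) auto
  ultimately show ?thesis by (rule finite_subset)
qed

lemma interlaces_psize_le:
  assumes "interlaces m l" "m \<in> bounded_partitions N k" "l \<in> bounded_partitions N k'"
  shows "psize m \<le> psize l"
  using assms by (simp add: psize_eq[OF assms(2), of "max k k'"] psize_eq[OF assms(3), of "max k k'"]
    interlaces_def sum_mono)

lemma zero_bounded_partition [simp]: "(\<lambda>_. 0) \<in> bounded_partitions N k"
  by (auto simp: bounded_partitions_def antimono_def)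

lemma bounded_partitions_0 [simp]: "bounded_partitions N 0 = {\<lambda>_. 0}"
  by (auto simp: bounded_partitions_def antimono_def)

lemma antimono_interlaces:
  assumes "interlaces m l" shows "antimono l"
  using assms by (intro antimonoI) (rule lift_Suc_antimono_le, auto simp: interlaces_def intro: order_trans)

text \<open>The corner rule of RSK growth diagrams: from a corner \<open>m\<close>, its two
  neighbours \<open>l\<close>, \<open>r\<close> and the entry \<open>w\<close> of the cell it
  produces the opposite corner. The subtraction of naturals never truncates when \<open>m\<close>
  interlaces both neighbours, since then \<open>m i\<close> is at most
  \<open>min (l i) (r i)\<close>.\<close>

definition grow :: "(nat \<Rightarrow> nat) \<Rightarrow> (nat \<Rightarrow> nat) \<Rightarrow> (nat \<Rightarrow> nat) \<times> nat \<Rightarrow> nat \<Rightarrow> nat" where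
  "grow l r = (\<lambda>(m, w) i. case i of 0 \<Rightarrow> max (l 0) (r 0) + w
     | Suc i \<Rightarrow> max (l (Suc i)) (r (Suc i)) + min (l i) (r i) - m i)"

definition shrink :: "(nat \<Rightarrow> nat) \<Rightarrow> (nat \<Rightarrow> nat) \<Rightarrow> (nat \<Rightarrow> nat) \<Rightarrow> (nat \<Rightarrow> nat) \<times> nat" where
  "shrink l r v = ((\<lambda>i. max (l (Suc i)) (r (Suc i)) + min (l i) (r i) - v (Suc i)), v 0 - max (l 0) (r 0))"

lemma grow_interlaces:
  assumes "interlaces m l" "interlaces m r"
  shows "interlaces l (grow l r (m, w))" "interlaces r (grow l r (m, w))"
proof -
  have a: "l (Suc i) \<le> m i" "m i \<le> l i" "r (Suc i) \<le> m i" "m i \<le> r i" for i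
    using assms by (auto simp: interlaces_def)
  have "grow l r (m,w) (Suc i) \<le> l i \<and> l i \<le> grow l r (m,w) i \<and> grow l r (m,w) (Suc i) \<le> r i \<and> r i \<le> grow l r (m,w) i" for i
    using a[of i] a[of "i - 1"] by (cases i) (auto simp: grow_def)
  then show "interlaces l (grow l r (m, w))" "interlaces r (grow l r (m, w))"
    by (auto simp: interlaces_def)
qed

text \<open>In every row after the first the rule reflects \<open>m i\<close> in the interval from
  \<open>max (l (Suc i)) (r (Suc i))\<close> to \<open>min (l i) (r i)\<close>, an involution; in
  the first row \<open>w\<close> is the excess over \<open>max (l 0) (r 0)\<close>. The cutoff
  concerns only the first row, so the bijection restricts to it. The extra row of \<open>l\<close>
  is not passed on to \<open>m\<close>, since \<open>m\<close> lies below \<open>r\<close>.\<close>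

lemma grow_bij:
  assumes l: "l \<in> bounded_partitions N (Suc k)" and r: "r \<in> bounded_partitions N k"
  defines "A \<equiv> {(m, w). m \<in> bounded_partitions N k \<and> interlaces m l \<and> interlaces m r \<and> max (l 0) (r 0) + w \<le> N}"
  defines "B \<equiv> {v \<in> bounded_partitions N (Suc k). interlaces l v \<and> interlaces r v}"
  shows "bij_betw (grow l r) A B"
proof (rule bij_betw_byWitness[where f' = "shrink l r"])
  have anti: "antimono l" "antimono r" using l r by (auto simp: bounded_partitions_def)
  then have la: "l (Suc i) \<le> l i" "r (Suc i) \<le> r i" for i by (auto simp: antimono_def)
  show "\<forall>a\<in>A. shrink l r (grow l r a) = a"
  proof (clarify)
    fix m w assume "(m, w) \<in> A"
    then have "interlaces m l" "interlaces m r" by (auto simp: A_def)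
    then have a: "l (Suc i) \<le> m i" "m i \<le> l i" "r (Suc i) \<le> m i" "m i \<le> r i" for i
      by (auto simp: interlaces_def)
    have "max (l (Suc i)) (r (Suc i)) \<le> m i" "m i \<le> min (l i) (r i)" for i using a[of i] by auto
    then have "max (l (Suc i)) (r (Suc i)) + min (l i) (r i) -
        (max (l (Suc i)) (r (Suc i)) + min (l i) (r i) - m i) = m i" for i
      by (meson diff_diff_cancel le_add2 le_trans)
    then show "shrink l r (grow l r (m, w)) = (m, w)" by (simp add: shrink_def grow_def)
  qed
  show "\<forall>v\<in>B. grow l r (shrink l r v) = v"
  proof
    fix v assume "v \<in> B"
    then have a: "v (Suc i) \<le> l i" "l i \<le> v i" "v (Suc i) \<le> r i" "r i \<le> v i" for i
      by (auto simp: B_def interlaces_def)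
    show "grow l r (shrink l r v) = v"
    proof
      fix i show "grow l r (shrink l r v) i = v i"
      proof (cases i)
        case 0 then show ?thesis using a[of 0] by (simp add: grow_def shrink_def)
      next
        case (Suc j)
        have "v (Suc j) \<le> min (l j) (r j)" "max (l (Suc j)) (r (Suc j)) \<le> v (Suc j)"
          using a[of j] a[of "Suc j"] by auto
        then have "max (l (Suc j)) (r (Suc j)) + min (l j) (r j) -
            (max (l (Suc j)) (r (Suc j)) + min (l j) (r j) - v (Suc j)) = v (Suc j)"
          by (meson diff_diff_cancel le_add2 le_trans)
        then show ?thesis using Suc by (simp add: grow_def shrink_def)
      qed
    qed
  qed
  show "grow l r ` A \<subseteq> B"
  proof (rule image_subsetI, clarify)
    fix m w assume mw: "(m, w) \<in> A"
    then have i: "interlaces m l" "interlaces m r" by (auto simp: A_def)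
    have "grow l r (m, w) i = 0" if ik: "i \<ge> Suc k" for i
    proof -
      obtain j where j: "i = Suc j" "j \<ge> k" using ik by (cases i) auto
      then show ?thesis using l r by (auto simp: grow_def bounded_partitions_def)
    qed
    moreover have "grow l r (m, w) 0 \<le> N" using mw by (auto simp: A_def grow_def)
    ultimately show "grow l r (m, w) \<in> B"
      using grow_interlaces[OF i] antimono_interlaces[OF grow_interlaces(1)[OF i]]
      by (auto simp: B_def bounded_partitions_def)
  qed
  show "shrink l r ` B \<subseteq> A"
  proof (rule image_subsetI)
    fix v assume v: "v \<in> B"
    then have a: "v (Suc i) \<le> l i" "l i \<le> v i" "v (Suc i) \<le> r i" "r i \<le> v i" for i
      by (auto simp: B_def interlaces_def)
    define m where "m = fst (shrink l r v)"
    have b: "v (Suc i) \<le> min (l i) (r i)" "max (l (Suc i)) (r (Suc i)) \<le> v (Suc i)" for i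
      using a[of i] a[of "Suc i"] by auto
    have m: "m i \<le> min (l i) (r i)" "max (l (Suc i)) (r (Suc i)) \<le> m i" for i
      using b[of i] by (auto simp: m_def shrink_def)
    have il: "interlaces m l" "interlaces m r" using m by (auto simp: interlaces_def)
    have "m (Suc i) \<le> m i" for i using m[of i] m[of "Suc i"] by linarith
    then have "antimono m" by (intro antimonoI) (rule lift_Suc_antimono_le)
    moreover have "m i = 0" if "i \<ge> k" for i using m(1)[of i] r that by (auto simp: bounded_partitions_def)
    moreover have "m 0 \<le> N" using m(1)[of 0] r by (auto simp: bounded_partitions_def)
    moreover have "max (l 0) (r 0) + (v 0 - max (l 0) (r 0)) \<le> N"
      using a[of 0] v by (auto simp: B_def bounded_partitions_def)
    moreover have "shrink l r v = (m, v 0 - max (l 0) (r 0))" by (simp add: m_def shrink_def)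
    ultimately show "shrink l r v \<in> A" using il by (simp add: A_def bounded_partitions_def)
  qed
qed

text \<open>In each row the maximum and the minimum of \<open>l i\<close> and \<open>r i\<close> add
  up to \<open>l i + r i\<close>. The minima run one row behind the maxima, and the one that is
  missing, in row \<open>k\<close>, vanishes with \<open>r k\<close>.\<close>

lemma psize_grow:
  assumes l: "l \<in> bounded_partitions N (Suc k)" and r: "r \<in> bounded_partitions N k"
    and m: "m \<in> bounded_partitions N k" and i: "interlaces m l" "interlaces m r"
    and w: "max (l 0) (r 0) + w \<le> N"
  shows "psize (grow l r (m, w)) + psize m = psize l + psize r + w"
proof -
  have v: "grow l r (m, w) \<in> bounded_partitions N (Suc k)"
    using bij_betwE[OF grow_bij[OF l r]] m i w by auto
  have le: "m i \<le> max (l (Suc i)) (r (Suc i)) + min (l i) (r i)" for i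
    using i unfolding interlaces_def by (meson le_add2 le_trans min.boundedI)
  have rk: "r k = 0" using r by (auto simp: bounded_partitions_def)
  have "psize (grow l r (m, w)) + psize m = (\<Sum>i<Suc k. grow l r (m, w) i) + (\<Sum>i<k. m i)"
    using psize_eq[OF v, of "Suc k"] psize_eq[OF m, of k] by simp
  also have "\<dots> = max (l 0) (r 0) + w + (\<Sum>i<k. (max (l (Suc i)) (r (Suc i)) + min (l i) (r i) - m i) + m i)"
    by (simp add: sum.lessThan_Suc_shift grow_def sum.distrib del: sum.lessThan_Suc)
  also have "\<dots> = max (l 0) (r 0) + w + (\<Sum>i<k. max (l (Suc i)) (r (Suc i)) + min (l i) (r i))"
    using le by simp
  also have "\<dots> = w + (\<Sum>i<Suc k. max (l i) (r i)) + (\<Sum>i<Suc k. min (l i) (r i))"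
    using rk by (subst sum.lessThan_Suc_shift[of "\<lambda>i. max (l i) (r i)"]) (simp add: sum.distrib)
  also have "\<dots> = w + (\<Sum>i<Suc k. max (l i) (r i) + min (l i) (r i))" by (simp add: sum.distrib)
  also have "(\<Sum>i<Suc k. max (l i) (r i) + min (l i) (r i)) = (\<Sum>i<Suc k. l i + r i)"
    by (intro sum.cong refl) (auto simp: max_def min_def)
  also have "\<dots> = psize l + psize r"
    using psize_eq[OF l, of "Suc k"] psize_eq[OF r, of "Suc k"] by (simp add: sum.distrib)
  finally show ?thesis by simp
qed

text \<open>Fomin's local rule. The new first part is \<open>max (l 0) (r 0) + w\<close>, which is the recursion of
  last passage times; this is why the test function \<open>f\<close> may be carried along.\<close>

lemma branch_local_rule:
  fixes f :: "nat \<Rightarrow> real"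
  assumes l: "l \<in> bounded_partitions N (Suc k)" and r: "r \<in> bounded_partitions N k"
  shows "(\<Sum>m\<in>bounded_partitions N k. \<Sum>w\<le>N. branch y m r * branch x m l * (x * y) ^ w *
            (if max (r 0) (l 0) + w \<le> N then f (max (r 0) (l 0) + w) else 0)) =
         (\<Sum>v\<in>bounded_partitions N (Suc k). branch x r v * branch y l v * f (v 0))"
proof -
  define A where "A = {(m, w). m \<in> bounded_partitions N k \<and> interlaces m l \<and> interlaces m r \<and> max (l 0) (r 0) + w \<le> N}"
  define B where "B = {v \<in> bounded_partitions N (Suc k). interlaces l v \<and> interlaces r v}"
  have bij: "bij_betw (grow l r) A B" unfolding A_def B_def by (rule grow_bij[OF l r])
  have "(\<Sum>m\<in>bounded_partitions N k. \<Sum>w\<le>N. branch y m r * branch x m l * (x * y) ^ w *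
            (if max (r 0) (l 0) + w \<le> N then f (max (r 0) (l 0) + w) else 0)) =
        (\<Sum>(m, w)\<in>A. branch y m r * branch x m l * (x * y) ^ w * f (max (r 0) (l 0) + w))"
    unfolding sum.cartesian_product
  proof (rule sum.mono_neutral_cong_right)
    show "\<forall>i\<in>bounded_partitions N k \<times> {..N} - A. (case i of (m, w) \<Rightarrow>
        branch y m r * branch x m l * (x * y) ^ w *
          (if max (r 0) (l 0) + w \<le> N then f (max (r 0) (l 0) + w) else 0)) = 0"
    proof clarify
      fix m w assume "m \<in> bounded_partitions N k" "(m, w) \<notin> A"
      then consider "\<not> interlaces m l" | "\<not> interlaces m r" | "\<not> max (r 0) (l 0) + w \<le> N"
        by (auto simp: A_def max.commute)
      then show "branch y m r * branch x m l * (x * y) ^ w *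
          (if max (r 0) (l 0) + w \<le> N then f (max (r 0) (l 0) + w) else 0) = 0"
        by cases (auto simp: branch_def)
    qed
  qed (auto simp: A_def)
  also have "\<dots> = (\<Sum>a\<in>A. branch x r (grow l r a) * branch y l (grow l r a) * f (grow l r a 0))"
  proof (rule sum.cong[OF refl], clarify)
    fix m w assume "(m, w) \<in> A"
    then have m: "m \<in> bounded_partitions N k" and i: "interlaces m l" "interlaces m r"
      and w: "max (l 0) (r 0) + w \<le> N" by (auto simp: A_def)
    have sz: "psize (grow l r (m, w)) + psize m = psize l + psize r + w"
      by (rule psize_grow[OF l r m i w])
    have le: "psize m \<le> psize l" "psize m \<le> psize r"
      using interlaces_psize_le[OF i(1) m l] interlaces_psize_le[OF i(2) m r] by auto
    have e: "psize (grow l r (m, w)) - psize r = psize l - psize m + w"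
         "psize (grow l r (m, w)) - psize l = psize r - psize m + w" using sz le by auto
    show "branch y m r * branch x m l * (x * y) ^ w * f (max (r 0) (l 0) + w) =
      branch x r (grow l r (m, w)) * branch y l (grow l r (m, w)) * f (grow l r (m, w) 0)"
      using i grow_interlaces[OF i, of w] 
      by (simp add: branch_def e power_add power_mult_distrib) (simp add: grow_def max.commute)
  qed
  also have "\<dots> = (\<Sum>v\<in>B. branch x r v * branch y l v * f (v 0))"
    by (rule sum.reindex_bij_betw[OF bij])
  also have "\<dots> = (\<Sum>v\<in>bounded_partitions N (Suc k). branch x r v * branch y l v * f (v 0))"
    by (rule sum.mono_neutral_left) (auto simp: B_def branch_def)
  finally show ?thesis .
qed

text \<open>The lists hold the first parts of a chain of partitions, the last one in front.\<close>

primrec chain_sum :: "nat \<Rightarrow> (nat \<Rightarrow> real) \<Rightarrow> nat \<Rightarrow> (nat list \<Rightarrow> (nat \<Rightarrow> nat) \<Rightarrow> real) \<Rightarrow> real" where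
  "chain_sum N x 0 F = F [] (\<lambda>_. 0)"
| "chain_sum N x (Suc n) F = chain_sum N x n
     (\<lambda>g m. \<Sum>l\<in>bounded_partitions N (Suc n). branch (x n) m l * F (l 0 # g) l)"

definition hd0 :: "nat list \<Rightarrow> nat" where "hd0 g = (case g of [] \<Rightarrow> 0 | a # _ \<Rightarrow> a)"

lemma hd0_simps [simp]: "hd0 [] = 0" "hd0 (a # g) = a" by (auto simp: hd0_def)

text \<open>The list holds the passage times of the previous column, last row in front;
  \<open>h\<close> is the new column as far as it is built. The length of the remaining list tells
  the row, hence the index of \<open>x\<close>. The cutoff is imposed at every cell, which keeps the
  intermediate partitions in the truncated index sets.\<close>

primrec column_sum :: "nat \<Rightarrow> (nat \<Rightarrow> real) \<Rightarrow> real \<Rightarrow> nat list \<Rightarrow> (nat list \<Rightarrow> real) \<Rightarrow> real" where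
  "column_sum N x y [] f = f []"
| "column_sum N x y (a # g) f = column_sum N x y g (\<lambda>h. \<Sum>w\<le>N. (x (length g) * y) ^ w *
     (if max (hd0 h) a + w \<le> N then f ((max (hd0 h) a + w) # h) else 0))"

text \<open>Along a chain the list and the partition are not independent: the head of the list is
  the first part of the current partition. This link is what turns \<open>max (hd0 g) (l 0)\<close>
  into the first row of the local rule.\<close>

lemma chain_sum_cong:
  assumes "\<And>g l. hd0 g = l 0 \<Longrightarrow> length g = n \<Longrightarrow> l \<in> bounded_partitions N n \<Longrightarrow> F g l = F' g l"
  shows "chain_sum N x n F = chain_sum N x n F'"
  using assms
proof (induction n arbitrary: F F')
  case (Suc n)
  show ?case unfolding chain_sum.simps
    by (rule Suc.IH) (auto intro!: sum.cong Suc.prems)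
qed auto

lemma chain_sum_linear:
  "finite A \<Longrightarrow> chain_sum N x n (\<lambda>g l. \<Sum>a\<in>A. F a g l) = (\<Sum>a\<in>A. chain_sum N x n (F a))"
proof (induction n arbitrary: F)
  case (Suc n)
  have "(\<lambda>g m. \<Sum>l\<in>bounded_partitions N (Suc n). branch (x n) m l * (\<Sum>a\<in>A. F a (l 0 # g) l)) =
    (\<lambda>g m. \<Sum>a\<in>A. \<Sum>l\<in>bounded_partitions N (Suc n). branch (x n) m l * F a (l 0 # g) l)"
    by (auto simp: sum_distrib_left fun_eq_iff intro: sum.swap)
  then show ?case using Suc.IH[OF Suc.prems] by simp
qed auto

text \<open>A whole column passes through the chain by one application of the local rule per row.
  What remains of it is the operator on the boundary weight \<open>h\<close> that adds the variable
  \<open>y\<close>; the recursion over the list disappears.\<close>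

lemma chain_sum_column:
  "chain_sum N x n (\<lambda>g l. h l * column_sum N x y g f) =
   chain_sum N x n (\<lambda>g v. (\<Sum>l\<in>bounded_partitions N n. branch y l v * h l) * f g)"
proof (induction n arbitrary: h f)
  case 0
  then show ?case by (simp add: branch_def interlaces_def)
next
  case (Suc n)
  define P where "P = bounded_partitions N (Suc n)"
  define fl where "fl l = (\<lambda>g. \<Sum>w\<le>N. (x n * y) ^ w *
     (if max (hd0 g) (l 0) + w \<le> N then f ((max (hd0 g) (l 0) + w) # g) else 0))" for l :: "nat \<Rightarrow> nat"
  have fP: "finite P" by (simp add: P_def)
  have "chain_sum N x (Suc n) (\<lambda>g l. h l * column_sum N x y g f) =
     chain_sum N x n (\<lambda>g m. \<Sum>l\<in>P. branch (x n) m l * (h l * column_sum N x y (l 0 # g) f))"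
    by (simp add: P_def)
  also have "\<dots> = chain_sum N x n (\<lambda>g m. \<Sum>l\<in>P. (branch (x n) m l * h l) * column_sum N x y g (fl l))"
    by (rule chain_sum_cong) (simp add: fl_def mult.assoc)
  also have "\<dots> = (\<Sum>l\<in>P. chain_sum N x n (\<lambda>g m. (branch (x n) m l * h l) * column_sum N x y g (fl l)))"
    by (rule chain_sum_linear[OF fP])
  also have "\<dots> = (\<Sum>l\<in>P. chain_sum N x n (\<lambda>g v. (\<Sum>m\<in>bounded_partitions N n. branch y m v * (branch (x n) m l * h l)) * fl l g))"
    by (simp add: Suc.IH)
  also have "\<dots> = chain_sum N x n (\<lambda>g v. \<Sum>l\<in>P. (\<Sum>m\<in>bounded_partitions N n. branch y m v * (branch (x n) m l * h l)) * fl l g)"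
    by (rule chain_sum_linear[OF fP, symmetric])
  \<comment> \<open>The sum over \<open>m\<close> comes from the induction hypothesis and the sum
    over weights from \<open>fl\<close>; together they form the left side of the local rule at the
    cell between \<open>l\<close> and \<open>r\<close>.\<close>
  also have "\<dots> = chain_sum N x n (\<lambda>g r. \<Sum>l\<in>P. h l * (\<Sum>v\<in>P. branch (x n) r v * branch y l v * f (v 0 # g)))"
  proof (rule chain_sum_cong, rule sum.cong[OF refl])
    fix g and r l :: "nat \<Rightarrow> nat" assume g: "hd0 g = r 0" and r: "r \<in> bounded_partitions N n" and l: "l \<in> P"
    have "(\<Sum>m\<in>bounded_partitions N n. branch y m r * (branch (x n) m l * h l)) * fl l g =
       h l * (\<Sum>m\<in>bounded_partitions N n. \<Sum>w\<le>N. branch y m r * branch (x n) m l * (x n * y) ^ w *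
            (if max (r 0) (l 0) + w \<le> N then f ((max (r 0) (l 0) + w) # g) else 0))"
      unfolding fl_def g sum_product unfolding sum_distrib_left by (intro sum.cong refl) (simp add: mult_ac)
    also have "\<dots> = h l * (\<Sum>v\<in>P. branch (x n) r v * branch y l v * f (v 0 # g))"
      unfolding P_def by (subst branch_local_rule[OF _ r]) (use l in \<open>auto simp: P_def\<close>)
    finally show "(\<Sum>m\<in>bounded_partitions N n. branch y m r * (branch (x n) m l * h l)) * fl l g =
       h l * (\<Sum>v\<in>P. branch (x n) r v * branch y l v * f (v 0 # g))" .
  qed
  also have "\<dots> = chain_sum N x n (\<lambda>g r. \<Sum>v\<in>P. branch (x n) r v * ((\<Sum>l\<in>P. branch y l v * h l) * f (v 0 # g)))"
    by (rule chain_sum_cong)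
       (simp add: sum_distrib_left sum_distrib_right mult_ac, subst sum.swap, simp)
  finally show ?case by (simp add: P_def)
qed

text \<open>Schur polynomials by the branching rule. The cutoff \<open>N\<close> only makes the
  index set finite: \<open>m 0 \<le> l 0\<close> by interlacing, so nothing is lost for
  \<open>l 0 \<le> N\<close>.\<close>

primrec schur :: "nat \<Rightarrow> (nat \<Rightarrow> real) \<Rightarrow> nat \<Rightarrow> (nat \<Rightarrow> nat) \<Rightarrow> real" where
  "schur N x 0 l = (if l = (\<lambda>_. 0) then 1 else 0)"
| "schur N x (Suc n) l = (\<Sum>m\<in>bounded_partitions N n. branch (x n) m l * schur N x n m)"

lemma schur_eq_0:
  assumes "schur N x n l \<noteq> 0" "i \<ge> n" shows "l i = 0"
proof (cases n)
  case 0 then show ?thesis using assms by (auto split: if_splits)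
next
  case (Suc m)
  then obtain m' where "m' \<in> bounded_partitions N m" "interlaces m' l"
    using assms(1) by (force simp: branch_def elim!: sum.not_neutral_contains_not_neutral split: if_splits)
  then show ?thesis using assms(2) Suc
    by (cases i) (auto simp: bounded_partitions_def interlaces_def, metis le_zero_eq)
qed

text \<open>Schur polynomials in \<open>j\<close> variables vanish on partitions with more than
  \<open>j\<close> rows, so the sums for all columns may share the index set with \<open>n\<close>
  rows on which the chain lives.\<close>

lemma schur_Suc:
  assumes "j \<le> n"
  shows "(\<Sum>m\<in>bounded_partitions N n. branch y m l * schur N x j m) = 
    (\<Sum>m\<in>bounded_partitions N j. branch y m l * schur N x j m)"
proof (rule sum.mono_neutral_right)
  show "bounded_partitions N j \<subseteq> bounded_partitions N n" using assms by (auto simp: bounded_partitions_def)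
  show "\<forall>i\<in>bounded_partitions N n - bounded_partitions N j. branch y i l * schur N x j i = 0"
    using schur_eq_0[of N x j] by (auto simp: bounded_partitions_def)
qed auto

lemma chain_sum_schur:
  "chain_sum N x n (\<lambda>g l. h l) = (\<Sum>l\<in>bounded_partitions N n. schur N x n l * h l)"
proof (induction n arbitrary: h)
  case (Suc n)
  show ?case
    by (simp add: Suc.IH sum_distrib_left sum_distrib_right, subst sum.swap, simp add: mult_ac)
qed auto

text \<open>The starting state: before any column is added all passage times are zero and the
  boundary weight is concentrated on the empty partition.\<close>

lemma chain_sum_delta:
  "chain_sum N x n (\<lambda>g l. (if l = (\<lambda>_. 0) then 1 else 0) * f g) = f (replicate n 0)"
proof (induction n arbitrary: f)
  case (Suc n)
  have "chain_sum N x (Suc n) (\<lambda>g l. (if l = (\<lambda>_. 0) then 1 else 0) * f g) =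
     chain_sum N x n (\<lambda>g m. branch (x n) m (\<lambda>_. 0) * f (0 # g))"
    unfolding chain_sum.simps
    by (rule chain_sum_cong, subst sum.remove[of _ "\<lambda>_. 0"]) (auto intro!: sum.neutral)
  also have "\<dots> = chain_sum N x n (\<lambda>g m. (if m = (\<lambda>_. 0) then 1 else 0) * f (0 # g))"
    by (rule chain_sum_cong) (auto simp: branch_def interlaces_def psize_def fun_eq_iff)
  finally show ?case using Suc.IH[of "\<lambda>g. f (0 # g)"] by simp
qed auto

primrec lpp_sum :: "nat \<Rightarrow> (nat \<Rightarrow> real) \<Rightarrow> nat \<Rightarrow> (nat \<Rightarrow> real) \<Rightarrow> nat \<Rightarrow> (nat list \<Rightarrow> real) \<Rightarrow> real" where
  "lpp_sum N x n y 0 f = f (replicate n 0)"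
| "lpp_sum N x n y (Suc j) f = lpp_sum N x n y j (\<lambda>g. column_sum N x (y j) g f)"

lemma lpp_sum_chain:
  "j \<le> n \<Longrightarrow> lpp_sum N x n y j f = chain_sum N x n (\<lambda>g l. schur N y j l * f g)"
proof (induction j arbitrary: f)
  case 0 show ?case by (simp only: lpp_sum.simps schur.simps chain_sum_delta)
next
  case (Suc j)
  have "schur N y (Suc j) l = (\<Sum>m\<in>bounded_partitions N n. branch (y j) m l * schur N y j m)" for l
    unfolding schur.simps by (rule schur_Suc[symmetric]) (use Suc.prems in simp)
  then show ?case using Suc by (simp only: lpp_sum.simps chain_sum_column Suc_leD)
qed

text \<open>With a constant test function the chain in the variables \<open>x\<close> collapses to
  its end point, and the columns have produced the Schur polynomial in \<open>y\<close>
  there.\<close>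

theorem lpp_sum_eq_cauchy_sum:
  "lpp_sum N x n y n (\<lambda>_. 1) = (\<Sum>l\<in>bounded_partitions N n. schur N x n l * schur N y n l)"
  using chain_sum_schur[of N x n "schur N y n"] by (simp add: lpp_sum_chain)

section \<open>Determinants over finite index sets\<close>

text \<open>The Leibniz formula over an arbitrary finite index set, so that principal minors need no
  renumbering; for \<open>{..<n}\<close> the facts come from the determinant of matrices.\<close>

definition pdet :: "nat set \<Rightarrow> (nat \<Rightarrow> nat \<Rightarrow> 'a :: comm_ring_1) \<Rightarrow> 'a" where
  "pdet S A = (\<Sum>p | p permutes S. of_int (sign p) * (\<Prod>i\<in>S. A i (p i)))"

lemma permutes_nat_less: "p permutes {0..<n::nat} \<Longrightarrow> i < n \<Longrightarrow> p i < n"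
  using permutes_in_image[of p "{0..<n}" i] by simp

lemma pdet_eq_det: "pdet {..<n} A = Determinant.det (Matrix.mat n n (\<lambda>(i, j). A i j))"
proof -
  have "Determinant.det (Matrix.mat n n (\<lambda>(i, j). A i j)) =
    (\<Sum>p | p permutes {0..<n}. of_int (sign p) * (\<Prod>i = 0..<n. Matrix.mat n n (\<lambda>(i, j). A i j) $$ (i, p i)))"
    by (rule det_def') simp
  also have "\<dots> = (\<Sum>p | p permutes {0..<n}. of_int (sign p) * (\<Prod>i = 0..<n. A i (p i)))"
    by (intro sum.cong prod.cong arg_cong2[where f = "(*)"] refl) (auto dest: permutes_nat_less)
  finally show ?thesis by (simp add: pdet_def lessThan_atLeast0)
qed

lemma pdet_cong: "(\<And>i j. i \<in> S \<Longrightarrow> j \<in> S \<Longrightarrow> A i j = B i j) \<Longrightarrow> pdet S A = pdet S B"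
  unfolding pdet_def
  by (intro sum.cong prod.cong arg_cong2[where f = "(*)"] refl) (auto simp: permutes_in_image)

lemma pdet_empty [simp]: "pdet {} A = 1"
  by (simp add: pdet_def)

lemma pdet_mult:
  "pdet {..<n} (\<lambda>i j. \<Sum>k<n. A i k * B k j) = pdet {..<n} A * pdet {..<n} B"
proof -
  have "Matrix.mat n n (\<lambda>(i, j). A i j) * Matrix.mat n n (\<lambda>(i, j). B i j) =
     Matrix.mat n n (\<lambda>(i, j). \<Sum>k<n. A i k * B k j)"
    by (rule eq_matI) (auto simp: scalar_prod_def lessThan_atLeast0)
  then show ?thesis
    unfolding pdet_eq_det by (subst det_mult[symmetric, of _ n]) auto
qed

lemma pdet_transpose: "pdet {..<n} (\<lambda>i j. A j i) = pdet {..<n} A"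
proof -
  have "transpose_mat (Matrix.mat n n (\<lambda>(i, j). A i j)) = Matrix.mat n n (\<lambda>(i, j). A j i)"
    by (rule eq_matI) auto
  then show ?thesis unfolding pdet_eq_det
    by (metis det_transpose mat_carrier)
qed

lemma pdet_columns:
  "pdet {..<n} A = (\<Sum>p | p permutes {..<n}. of_int (sign p) * (\<Prod>j<n. A (p j) j))"
  using pdet_transpose[of n A] by (simp add: pdet_def)

lemma pdet_scale_columns:
  "pdet {..<n} (\<lambda>i j. c j * A i j) = (\<Prod>j<n. c j) * pdet {..<n} A"
  unfolding pdet_columns by (simp add: prod.distrib sum_distrib_left mult_ac)

lemma pdet_scale_rows:
  "pdet S (\<lambda>i j. c i * A i j) = (\<Prod>j\<in>S. c j) * pdet S A"
  unfolding pdet_def by (simp add: prod.distrib sum_distrib_left mult_ac)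

lemma pdet_permute_columns:
  assumes s: "s permutes {..<n}"
  shows "pdet {..<n} (\<lambda>i j. A i (s j)) = of_int (sign s) * pdet {..<n} A"
proof -
  have "pdet {..<n} (\<lambda>i j. A i (s j)) = pdet {..<n} (\<lambda>j i. A i (s j))"
    by (rule pdet_transpose)
  also have "\<dots> = Determinant.det (Matrix.mat n n (\<lambda>(j, i). Matrix.mat n n (\<lambda>(j, i). A i j) $$ (s j, i)))"
    unfolding pdet_eq_det using s
    by (intro arg_cong[where f = Determinant.det] eq_matI) (auto simp: lessThan_atLeast0 permutes_nat_less)
  also have "\<dots> = of_int (sign s) * Determinant.det (Matrix.mat n n (\<lambda>(j, i). A i j))"
    by (rule det_permute_rows) (use s in \<open>auto simp: lessThan_atLeast0\<close>)
  also have "Determinant.det (Matrix.mat n n (\<lambda>(j, i). A i j)) = pdet {..<n} A"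
    using pdet_transpose[of n A] by (simp add: pdet_eq_det)
  finally show ?thesis .
qed

lemma pdet_identical_columns:
  assumes "a < n" "b < n" "a \<noteq> b" "\<And>i. i < n \<Longrightarrow> A i a = A i b"
  shows "pdet {..<n} A = 0"
  unfolding pdet_eq_det
  by (rule det_identical_columns[of _ n a b]) (use assms in \<open>auto simp: vec_eq_iff\<close>)

lemma pdet_sum_columns:
  assumes "\<And>j. j < n \<Longrightarrow> finite (Q j)"
  shows "pdet {..<n} (\<lambda>i j. \<Sum>q\<in>Q j. f i j q) = (\<Sum>m\<in>PiE {..<n} Q. pdet {..<n} (\<lambda>i j. f i j (m j)))"
proof -
  have "pdet {..<n} (\<lambda>i j. \<Sum>q\<in>Q j. f i j q) =
     (\<Sum>p | p permutes {..<n}. \<Sum>m\<in>PiE {..<n} Q. of_int (sign p) * (\<Prod>j<n. f (p j) j (m j)))"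
    unfolding pdet_columns using assms by (subst prod_sum_PiE) (auto simp: sum_distrib_left)
  also have "\<dots> = (\<Sum>m\<in>PiE {..<n} Q. \<Sum>p | p permutes {..<n}. of_int (sign p) * (\<Prod>j<n. f (p j) j (m j)))"
    by (rule sum.swap)
  finally show ?thesis by (simp add: pdet_columns)
qed

lemma pdet_last_row:
  assumes "\<And>j. j < n \<Longrightarrow> A n j = 0"
  shows "pdet {..<Suc n} A = A n n * pdet {..<n} A"
proof -
  have sub: "p permutes {..<Suc n}" if "p permutes {..<n}" for p
    using that by (rule permutes_subset) auto
  have zero: "of_int (sign p) * (\<Prod>i<Suc n. A i (p i)) = 0"
    if p: "p permutes {..<Suc n}" "\<not> p permutes {..<n}" for p
  proof -
    have "p n \<noteq> n"
    proof
      assume "p n = n"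
      then have "p x = x" if "x \<in> {..<Suc n} - {..<n}" for x using that by (auto simp: less_Suc_eq)
      then show False using p permutes_superset[OF p(1)] by blast
    qed
    moreover have "p n < Suc n" using permutes_in_image[OF p(1), of n] by simp
    ultimately have "A n (p n) = 0" using assms by simp
    then show ?thesis by simp
  qed
  have "pdet {..<Suc n} A = (\<Sum>p | p permutes {..<n}. of_int (sign p) * (\<Prod>i<Suc n. A i (p i)))"
    unfolding pdet_def using sub zero
    by (intro sum.mono_neutral_right finite_permutations ballI) blast+
  also have "\<dots> = (\<Sum>p | p permutes {..<n}. A n n * (of_int (sign p) * (\<Prod>i<n. A i (p i))))"
    by (intro sum.cong refl) (auto simp: permutes_def mult_ac)
  finally show ?thesis by (simp add: pdet_def sum_distrib_left)
qed

lemma pdet_unitriangular: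
  assumes "\<And>i j. i < j \<Longrightarrow> A i j = 0" "\<And>i. A i i = 1"
  shows "pdet {..<n} A = 1"
proof (induction n)
  case (Suc n)
  have "pdet {..<Suc n} A = pdet {..<Suc n} (\<lambda>i j. A j i)" by (rule pdet_transpose[symmetric])
  also have "\<dots> = A n n * pdet {..<n} (\<lambda>i j. A j i)" by (rule pdet_last_row) (use assms in auto)
  also have "\<dots> = 1" using Suc pdet_transpose[of n A] assms by simp
  finally show ?case .
qed (simp add: lessThan_0)

section \<open>Schur polynomials as ratios of alternants\<close>

definition alternant :: "nat \<Rightarrow> (nat \<Rightarrow> real) \<Rightarrow> (nat \<Rightarrow> nat) \<Rightarrow> real" where
  "alternant n x l = pdet {..<n} (\<lambda>i j. x i ^ (l j + (n - Suc j)))"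

text \<open>The difference of two neighbouring columns of an alternant becomes a multiple of
  \<open>u - v\<close>, and the remaining sum runs over the values that interlacing allows for one
  part.\<close>

lemma geometric_telescope:
  fixes a b :: nat and u v :: real
  assumes "a \<le> b"
  shows "(u - v) * (\<Sum>q\<in>{a..b}. v ^ (b - q) * u ^ q) = u ^ Suc b - v ^ Suc (b - a) * u ^ a"
  using assms
proof (induction rule: dec_induct)
  case base show ?case by (simp add: algebra_simps)
next
  case (step b)
  have "(\<Sum>q\<in>{a..Suc b}. v ^ (Suc b - q) * u ^ q) = v * (\<Sum>q\<in>{a..b}. v ^ (b - q) * u ^ q) + u ^ Suc b"
    using step.hyps by (simp add: sum_distrib_left Suc_diff_le mult.assoc)
  then have "(u - v) * (\<Sum>q\<in>{a..Suc b}. v ^ (Suc b - q) * u ^ q) =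
     v * (u ^ Suc b - v ^ Suc (b - a) * u ^ a) + (u - v) * u ^ Suc b"
    by (simp only: step.IH[symmetric]) (simp add: algebra_simps)
  then show ?case using step.hyps by (simp add: Suc_diff_le algebra_simps)
qed

text \<open>Interlacing with \<open>l\<close> lets the parts \<open>m j\<close>,
  \<open>j < n\<close>, vary independently between \<open>l (Suc j)\<close> and \<open>l j\<close>,
  so the sum is over a product of intervals. The last part \<open>l n\<close> has no partner and
  gives the prefactor.\<close>

lemma interlacing_sum:
  fixes f :: "(nat \<Rightarrow> nat) \<Rightarrow> real"
  assumes l: "l \<in> bounded_partitions N (Suc n)"
    and f: "\<And>m m'. (\<And>j. j < n \<Longrightarrow> m j = m' j) \<Longrightarrow> f m = f m'"
  shows "(\<Sum>m\<in>bounded_partitions N n. branch x m l * f m) =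
    x ^ l n * (\<Sum>m\<in>PiE {..<n} (\<lambda>j. {l (Suc j)..l j}). (\<Prod>j<n. x ^ (l j - m j)) * f m)"
proof -
  let ?T = "PiE {..<n} (\<lambda>j. {l (Suc j)..l j})"
  let ?S = "{m \<in> bounded_partitions N n. interlaces m l}"
  let ?ext = "\<lambda>m j. if j < n then m j else (0::nat)"
  have l0: "l j = 0" if "j \<ge> Suc n" for j using l that by (auto simp: bounded_partitions_def)
  have la: "antimono l" using l by (auto simp: bounded_partitions_def)
  have "(\<Sum>m\<in>bounded_partitions N n. branch x m l * f m) = (\<Sum>m\<in>?S. x ^ (psize l - psize m) * f m)"
    by (rule sum.mono_neutral_cong_right) (auto simp: branch_def)
  also have "\<dots> = (\<Sum>m\<in>?T. x ^ l n * ((\<Prod>j<n. x ^ (l j - m j)) * f m))"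
  proof (rule sum.reindex_bij_witness[where i = ?ext and j = "\<lambda>m. restrict m {..<n}"])
    fix m assume m: "m \<in> ?S"
    then have mz: "m j = 0" if "j \<ge> n" for j using that by (auto simp: bounded_partitions_def)
    show "?ext (restrict m {..<n}) = m" using mz by (auto simp: fun_eq_iff)
    show "restrict m {..<n} \<in> ?T" using m by (auto simp: interlaces_def)
    have ml: "m j \<le> l j" for j using m by (auto simp: interlaces_def)
    have "psize l - psize m = l n + (\<Sum>j<n. l j) - (\<Sum>j<n. m j)"
      using psize_eq[OF l, of "Suc n"] psize_eq[of m N n n] m by simp
    also have "\<dots> = l n + (\<Sum>j<n. l j - m j)"
      using ml by (simp add: sum_subtractf_nat sum_mono)
    finally have "x ^ (psize l - psize m) = x ^ l n * (\<Prod>j<n. x ^ (l j - m j))"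
      by (simp add: power_add power_sum)
    moreover have "f (restrict m {..<n}) = f m" by (rule f) auto
    ultimately show "x ^ l n * ((\<Prod>j<n. x ^ (l j - restrict m {..<n} j)) * f (restrict m {..<n})) =
        x ^ (psize l - psize m) * f m" by simp
  next
    fix m assume m: "m \<in> ?T"
    show "restrict (?ext m) {..<n} = m"
      using m by (auto simp: fun_eq_iff PiE_def extensional_def)
    have b: "l (Suc j) \<le> ?ext m j \<and> ?ext m j \<le> l j" for j
      using m l0[of "Suc j"] by (auto simp: PiE_iff)
    then have il: "interlaces (?ext m) l" by (auto simp: interlaces_def)
    have "?ext m (Suc j) \<le> ?ext m j" for j using b[of j] b[of "Suc j"] by linarith
    then have "antimono (?ext m)" by (intro antimonoI) (rule lift_Suc_antimono_le)
    moreover have "?ext m 0 \<le> N"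
    proof -
      have "?ext m 0 \<le> l 0" using b[of 0] by blast
      also have "\<dots> \<le> N" using l by (simp add: bounded_partitions_def)
      finally show ?thesis .
    qed
    ultimately show "?ext m \<in> ?S" using il by (simp add: bounded_partitions_def)
  qed
  finally show ?thesis by (simp add: sum_distrib_left)
qed

text \<open>Subtracting a multiple of the next column from every column but the last makes the row
  of \<open>x n\<close> vanish outside the last column. Expanding along that row leaves a
  determinant whose entries are sums over interlacing parts, and linearity in the columns gives the
  branching rule.\<close>

lemma alternant_branch:
  assumes l: "l \<in> bounded_partitions N (Suc n)"
  shows "alternant (Suc n) x l =
    (\<Prod>i<n. x i - x n) * (\<Sum>m\<in>bounded_partitions N n. branch (x n) m l * alternant n x m)"
proof -
  define A where "A i j = x i ^ (l j + (n - j))" for i j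
  \<comment> \<open>The factor for which column \<open>j\<close> minus \<open>t j\<close> times
    column \<open>Suc j\<close> vanishes in row \<open>n\<close>. The matrix \<open>U\<close>
    performs these operations by multiplication from the right.\<close>
  define t where "t j = x n ^ Suc (l j - l (Suc j))" for j
  define U where "U i j = (if i = j then 1 else if i = Suc j then - t j else 0)" for i j
  define E where "E i j = (\<Sum>q\<in>{l (Suc j)..l j}. x n ^ (l j - q) * x i ^ (q + (n - Suc j)))" for i j
  have lS: "l (Suc j) \<le> l j" for j using l by (auto simp: bounded_partitions_def antimono_def)
  have AU: "(\<Sum>k<Suc n. A i k * U k j) = (if j < n then (x i - x n) * E i j else A i n)"
    if "j < Suc n" for i j
  proof (cases "j < n")
    case True
    have "(\<Sum>k<Suc n. A i k * U k j) = (\<Sum>k\<in>{j, Suc j}. A i k * U k j)"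
      by (rule sum.mono_neutral_right) (use True in \<open>auto simp: U_def\<close>)
    also have "\<dots> = A i j - t j * A i (Suc j)" by (simp add: U_def)
    also have "\<dots> = (x i ^ Suc (l j) - x n ^ Suc (l j - l (Suc j)) * x i ^ l (Suc j)) * x i ^ (n - Suc j)"
    proof -
      have "l j + (n - j) = Suc (l j) + (n - Suc j)" using True by simp
      then show ?thesis by (simp only: A_def t_def power_add) (simp add: algebra_simps)
    qed
    also have "\<dots> = (x i - x n) * E i j"
      unfolding geometric_telescope[OF lS, symmetric] E_def
      by (simp add: power_add sum_distrib_left sum_distrib_right mult_ac)
    finally show ?thesis using True by simp
  next
    case False
    then have j: "j = n" using that by simp
    have "(\<Sum>k<Suc n. A i k * U k j) = (\<Sum>k\<in>{n}. A i k * U k j)"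
      by (rule sum.mono_neutral_right) (use j in \<open>auto simp: U_def\<close>)
    then show ?thesis using j by (simp add: U_def)
  qed
  have "alternant (Suc n) x l = pdet {..<Suc n} A * pdet {..<Suc n} U"
    by (subst pdet_unitriangular[of U]) (auto simp: U_def alternant_def A_def[abs_def])
  also have "\<dots> = pdet {..<Suc n} (\<lambda>i j. \<Sum>k<Suc n. A i k * U k j)" by (rule pdet_mult[symmetric])
  also have "\<dots> = pdet {..<Suc n} (\<lambda>i j. if j < n then (x i - x n) * E i j else A i n)"
    by (rule pdet_cong) (simp only: AU lessThan_iff)
  also have "\<dots> = A n n * pdet {..<n} (\<lambda>i j. if j < n then (x i - x n) * E i j else A i n)"
    by (subst pdet_last_row) auto
  also have "pdet {..<n} (\<lambda>i j. if j < n then (x i - x n) * E i j else A i n) =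
      pdet {..<n} (\<lambda>i j. (x i - x n) * E i j)"
    by (rule pdet_cong) auto
  also have "\<dots> = (\<Prod>i<n. x i - x n) * pdet {..<n} E" by (rule pdet_scale_rows)
  also have "pdet {..<n} E = (\<Sum>m\<in>PiE {..<n} (\<lambda>j. {l (Suc j)..l j}).
      pdet {..<n} (\<lambda>i j. x n ^ (l j - m j) * x i ^ (m j + (n - Suc j))))"
    unfolding E_def by (rule pdet_sum_columns) auto
  also have "\<dots> = (\<Sum>m\<in>PiE {..<n} (\<lambda>j. {l (Suc j)..l j}). (\<Prod>j<n. x n ^ (l j - m j)) * alternant n x m)"
    by (simp add: pdet_scale_columns alternant_def)
  also have "A n n * ((\<Prod>i<n. x i - x n) * \<dots>) = (\<Prod>i<n. x i - x n) *
     (\<Sum>m\<in>bounded_partitions N n. branch (x n) m l * alternant n x m)"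
    by (subst interlacing_sum[OF l]) (auto simp: A_def alternant_def intro!: pdet_cong)
  finally show ?thesis .
qed

text \<open>The alternant of the empty partition; the sign of the factors fits the decreasing
  exponents in \<open>alternant\<close>.\<close>

definition vandermonde :: "nat \<Rightarrow> (nat \<Rightarrow> real) \<Rightarrow> real" where
  "vandermonde n x = (\<Prod>k<n. \<Prod>i<k. x i - x k)"

text \<open>Both sides obey the same branching recursion: the factor split off by the alternant is
  the one that the Vandermonde product gains. The product form avoids a division.\<close>

lemma schur_alternant:
  "l \<in> bounded_partitions N n \<Longrightarrow> vandermonde n x * schur N x n l = alternant n x l"
proof (induction n arbitrary: l)
  case 0 then show ?case by (simp add: vandermonde_def alternant_def lessThan_0)
next
  case (Suc n)
  show ?case
    unfolding alternant_branch[OF Suc.prems] schur.simps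
    by (simp add: Suc.IH[symmetric] vandermonde_def sum_distrib_left mult_ac)
qed

section \<open>Summation over partitions by the Cauchy-Binet formula\<close>

definition shifted :: "nat \<Rightarrow> (nat \<Rightarrow> nat) \<Rightarrow> nat \<Rightarrow> nat" where
  "shifted n l j = l j + (n - Suc j)"

lemma shifted_strict: "antimono l \<Longrightarrow> i < j \<Longrightarrow> j < n \<Longrightarrow> shifted n l j < shifted n l i"
  unfolding shifted_def using antimonoD[of l i j] by simp

lemma shifted_inj_on:
  assumes "antimono l" shows "inj_on (shifted n l) {..<n}"
proof (rule inj_onI)
  fix i j assume "i \<in> {..<n}" "j \<in> {..<n}" "shifted n l i = shifted n l j"
  then show "i = j"
    using shifted_strict[OF assms, of i j n] shifted_strict[OF assms, of j i n]
    by (cases i j rule: linorder_cases) simp_all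
qed

text \<open>The shifted parts decrease strictly, so read backwards they are the increasing
  enumeration of their set, which is unique.\<close>

lemma shifted_image_inj:
  assumes l: "l \<in> bounded_partitions N n" "l' \<in> bounded_partitions N n"
    and im: "shifted n l ` {..<n} = shifted n l' ` {..<n}"
  shows "l = l'"
proof -
  have a: "antimono l" "antimono l'" using l by (auto simp: bounded_partitions_def)
  let ?L = "\<lambda>l. map (\<lambda>i. shifted n l (n - Suc i)) [0..<n]"
  have s: "sorted_wrt (<) (?L l)" if "antimono l" for l
    using that by (auto simp: sorted_wrt_iff_nth_less intro!: shifted_strict)
  have st: "set (?L l) = shifted n l ` {..<n}" for l
  proof
    show "shifted n l ` {..<n} \<subseteq> set (?L l)"
    proof (rule image_subsetI)
      fix j assume "j \<in> {..<n}"
      then have "n - Suc j \<in> {0..<n}" "shifted n l j = shifted n l (n - Suc (n - Suc j))" by auto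
      then show "shifted n l j \<in> set (?L l)" unfolding set_map set_upt by (metis image_eqI)
    qed
  qed auto
  have "?L l = ?L l'"
    by (rule strict_sorted_equal) (use s a st im in auto)
  then have e: "shifted n l (n - Suc i) = shifted n l' (n - Suc i)" if "i < n" for i
    using that by (auto simp: list_eq_iff_nth_eq)
  have "l j = l' j" for j
  proof (cases "j < n")
    case True
    then show ?thesis using e[of "n - Suc j"] by (simp add: shifted_def)
  next
    case False then show ?thesis using l by (auto simp: bounded_partitions_def)
  qed
  then show ?thesis by auto
qed

text \<open>The parts are recovered by removing the staircase from the increasing enumeration of
  \<open>T\<close>; strict increase makes the differences nonnegative and monotone.\<close>

lemma shifted_surj:
  assumes T: "finite T" "card T = n" "T \<subseteq> {..<N + n}"
  shows "\<exists>l\<in>bounded_partitions N n. shifted n l ` {..<n} = T"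
proof -
  define xs where "xs = sorted_list_of_set T"
  have xs: "sorted_wrt (<) xs" "set xs = T" "length xs = n" using T by (auto simp: xs_def)
  have lt: "xs ! i < xs ! j" if "i < j" "j < n" for i j
    using xs that by (auto simp: sorted_wrt_iff_nth_less)
  have gr: "xs ! i + (j - i) \<le> xs ! j" if "i \<le> j" "j < n" for i j
    using that
  proof (induction rule: dec_induct)
    case (step m) then show ?case using lt[of m "Suc m"] by simp
  qed simp
  define l where "l j = (if j < n then xs ! (n - Suc j) - (n - Suc j) else 0)" for j
  have sh: "shifted n l j = xs ! (n - Suc j)" if "j < n" for j
    using gr[of 0 "n - Suc j"] that by (simp add: shifted_def l_def)
  have "l (Suc j) \<le> l j" for j
  proof (cases "Suc j < n")
    case True
    have "Suc (xs ! (n - Suc (Suc j))) \<le> xs ! (n - Suc j)"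
      by (intro Suc_leI lt) (use True in auto)
    then show ?thesis using True by (auto simp: l_def)
  qed (simp add: l_def)
  then have "antimono l" by (intro antimonoI) (rule lift_Suc_antimono_le)
  moreover have "l 0 \<le> N"
  proof (cases n)
    case (Suc k)
    then have "xs ! k \<in> T" using xs nth_mem by fastforce
    then show ?thesis using T Suc by (auto simp: l_def)
  qed (simp add: l_def)
  ultimately have "l \<in> bounded_partitions N n" by (auto simp: bounded_partitions_def l_def)
  moreover have "shifted n l ` {..<n} = T"
  proof -
    have "shifted n l ` {..<n} = (\<lambda>j. xs ! (n - Suc j)) ` {..<n}" using sh by auto
    also have "\<dots> = (!) xs ` ((\<lambda>j. n - Suc j) ` {..<n})" by auto
    also have "(\<lambda>j. n - Suc j) ` {..<n} = {..<n}"
    proof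
      show "{..<n} \<subseteq> (\<lambda>j. n - Suc j) ` {..<n}"
        by (rule subsetI, rule_tac x = "n - Suc x" in image_eqI) auto
    qed auto
    also have "(!) xs ` {..<n} = T" using xs by (auto simp: set_conv_nth)
    finally show ?thesis .
  qed
  ultimately show ?thesis by blast
qed

text \<open>Sorting: an injective tuple of exponents is a strictly decreasing one, read in the order
  of a unique permutation.\<close>

lemma shifted_permutation_bij:
  "bij_betw (\<lambda>(l, s). restrict (\<lambda>j. shifted n l (s j)) {..<n})
     (bounded_partitions N n \<times> {s. s permutes {..<n}})
     {m \<in> PiE {..<n} (\<lambda>_. {..<N + n}). inj_on m {..<n}}"
  unfolding bij_betw_def
proof
  let ?h = "\<lambda>(l, s). restrict (\<lambda>j. shifted n l (s j)) {..<n}"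
  have im: "?h (l, s) ` {..<n} = shifted n l ` {..<n}" if "s permutes {..<n}" for l s
    using permutes_image[OF that] by (simp add: image_image[symmetric])
  show "inj_on ?h (bounded_partitions N n \<times> {s. s permutes {..<n}})"
  proof (rule inj_onI, clarify)
    fix l s l' s'
    assume l: "l \<in> bounded_partitions N n" "l' \<in> bounded_partitions N n"
      and s: "s permutes {..<n}" "s' permutes {..<n}"
      and eq: "restrict (\<lambda>j. shifted n l (s j)) {..<n} = restrict (\<lambda>j. shifted n l' (s' j)) {..<n}"
    have "shifted n l ` {..<n} = shifted n l' ` {..<n}"
      using im[OF s(1), of l] im[OF s(2), of l'] eq by simp
    then have ll: "l = l'" by (rule shifted_image_inj[OF l])
    have "s j = s' j" for j
    proof (cases "j < n")
      case True
      have "shifted n l (s j) = shifted n l (s' j)" using fun_cong[OF eq, of j] True ll by auto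
      moreover have "s j < n" "s' j < n" using s True permutes_in_image by fastforce+
      ultimately show ?thesis using shifted_inj_on[of l n] l
        by (auto simp: bounded_partitions_def inj_on_def)
    next
      case False then show ?thesis using s by (auto simp: permutes_def)
    qed
    then show "l = l' \<and> s = s'" using ll by auto
  qed
  show "?h ` (bounded_partitions N n \<times> {s. s permutes {..<n}}) =
     {m \<in> PiE {..<n} (\<lambda>_. {..<N + n}). inj_on m {..<n}}"
  proof (intro equalityI subsetI)
    fix m assume "m \<in> ?h ` (bounded_partitions N n \<times> {s. s permutes {..<n}})"
    then obtain l s where l: "l \<in> bounded_partitions N n" and s: "s permutes {..<n}"
      and m: "m = restrict (\<lambda>j. shifted n l (s j)) {..<n}" by auto
    have la: "antimono l" "l 0 \<le> N" using l by (auto simp: bounded_partitions_def)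
    have sj: "s j < n" if "j < n" for j using s that permutes_in_image by fastforce
    have "l (s j) \<le> N" for j using la antimonoD[OF la(1), of 0 "s j"] by simp
    then have "shifted n l (s j) < N + n" if "j < n" for j
      unfolding shifted_def by (rule add_le_less_mono) (use sj[OF that] in simp)
    moreover have "inj_on m {..<n}"
      using comp_inj_on[OF permutes_inj_on[OF s, of "{..<n}"], of "shifted n l"] shifted_inj_on[OF la(1), of n]
        permutes_image[OF s] by (auto simp: m inj_on_def)
    ultimately show "m \<in> {m \<in> PiE {..<n} (\<lambda>_. {..<N + n}). inj_on m {..<n}}" by (auto simp: m)
  next
    fix m assume m: "m \<in> {m \<in> PiE {..<n} (\<lambda>_. {..<N + n}). inj_on m {..<n}}"
    then obtain l where l: "l \<in> bounded_partitions N n" and im: "shifted n l ` {..<n} = m ` {..<n}"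
      using shifted_surj[of "m ` {..<n}" n N] by (auto simp: card_image)
    define s where "s j = (if j < n then inv_into {..<n} (shifted n l) (m j) else j)" for j
    have la: "antimono l" using l by (auto simp: bounded_partitions_def)
    have b1: "bij_betw (inv_into {..<n} (shifted n l)) (shifted n l ` {..<n}) {..<n}"
      by (rule bij_betw_inv_into) (use shifted_inj_on[OF la] in \<open>auto simp: bij_betw_def\<close>)
    have b2: "bij_betw m {..<n} (shifted n l ` {..<n})" using m im by (auto simp: bij_betw_def)
    have "bij_betw (inv_into {..<n} (shifted n l) \<circ> m) {..<n} {..<n}"
      by (rule bij_betw_trans[OF b2 b1])
    then have "bij_betw s {..<n} {..<n}"
      by (rule bij_betw_cong[THEN iffD1, rotated]) (auto simp: s_def)
    then have s: "s permutes {..<n}" by (rule bij_imp_permutes) (auto simp: s_def)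
    have "shifted n l (s j) = m j" if "j < n" for j
      using that im by (auto simp: s_def intro!: f_inv_into_f)
    then have "m = ?h (l, s)" using m by (auto simp: fun_eq_iff PiE_def extensional_def)
    then show "m \<in> ?h ` (bounded_partitions N n \<times> {s. s permutes {..<n}})" using l s by blast
  qed
qed

text \<open>Expanding every column in powers gives a sum over tuples of exponents. A tuple with a
  repetition contributes zero; an injective one is sorted at the cost of a sign, which turns the
  monomials in \<open>y\<close> into the second alternant. First parts at most \<open>N\<close>
  correspond to exponents below \<open>N + n\<close>.\<close>

lemma alternant_cauchy_binet:
  "(\<Sum>l\<in>bounded_partitions N n. alternant n x l * alternant n y l) =
   pdet {..<n} (\<lambda>i j. \<Sum>q<N + n. (x i * y j) ^ q)"
proof -
  let ?T = "PiE {..<n} (\<lambda>_. {..<N + n})"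
  let ?term = "\<lambda>m. (\<Prod>j<n. y j ^ m j) * pdet {..<n} (\<lambda>i j. x i ^ m j)"
  have "pdet {..<n} (\<lambda>i j. \<Sum>q<N + n. (x i * y j) ^ q) =
      (\<Sum>m\<in>?T. pdet {..<n} (\<lambda>i j. (x i * y j) ^ m j))"
    by (rule pdet_sum_columns) auto
  also have "\<dots> = (\<Sum>m\<in>?T. ?term m)"
    by (simp add: power_mult_distrib mult.commute[of "_ ^ _" "y _ ^ _"] pdet_scale_columns)
  also have "\<dots> = (\<Sum>m\<in>{m \<in> ?T. inj_on m {..<n}}. ?term m)"
  proof (rule sum.mono_neutral_right)
    show "finite ?T" by (intro finite_PiE) auto
    show "\<forall>m\<in>?T - {m \<in> ?T. inj_on m {..<n}}. ?term m = 0"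
    proof
      fix m assume "m \<in> ?T - {m \<in> ?T. inj_on m {..<n}}"
      then obtain a b where "a < n" "b < n" "a \<noteq> b" "m a = m b" by (auto simp: inj_on_def)
      then show "?term m = 0" using pdet_identical_columns[of a n b "\<lambda>i j. x i ^ m j"] by simp
    qed
  qed auto
  also have "\<dots> = (\<Sum>(l, s)\<in>bounded_partitions N n \<times> {s. s permutes {..<n}}.
      ?term (restrict (\<lambda>j. shifted n l (s j)) {..<n}))"
    by (subst sum.reindex_bij_betw[OF shifted_permutation_bij, symmetric]) (simp add: case_prod_unfold)
  also have "\<dots> = (\<Sum>(l, s)\<in>bounded_partitions N n \<times> {s. s permutes {..<n}}.
      alternant n x l * (of_int (sign s) * (\<Prod>j<n. y j ^ shifted n l (s j))))"
  proof (rule sum.cong[OF refl], clarify)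
    fix l s assume s: "s permutes {..<n}"
    have "pdet {..<n} (\<lambda>i j. x i ^ restrict (\<lambda>j. shifted n l (s j)) {..<n} j) =
       pdet {..<n} (\<lambda>i j. x i ^ shifted n l (s j))" by (rule pdet_cong) auto
    also have "\<dots> = of_int (sign s) * alternant n x l"
      unfolding alternant_def shifted_def[symmetric] by (rule pdet_permute_columns[OF s])
    finally show "?term (restrict (\<lambda>j. shifted n l (s j)) {..<n}) =
      alternant n x l * (of_int (sign s) * (\<Prod>j<n. y j ^ shifted n l (s j)))" by simp
  qed
  also have "\<dots> = (\<Sum>l\<in>bounded_partitions N n. alternant n x l * alternant n y l)"
    by (simp add: sum.cartesian_product[symmetric] sum_distrib_left[symmetric])
       (simp add: alternant_def pdet_def shifted_def)
  finally show ?thesis by simp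
qed

theorem lpp_sum_determinant:
  "vandermonde n x * vandermonde n y * lpp_sum N x n y n (\<lambda>_. 1) =
     pdet {..<n} (\<lambda>i j. \<Sum>q<N + n. (x i * y j) ^ q)"
proof -
  have "vandermonde n x * vandermonde n y * lpp_sum N x n y n (\<lambda>_. 1) =
    (\<Sum>l\<in>bounded_partitions N n. (vandermonde n x * schur N x n l) * (vandermonde n y * schur N y n l))"
    unfolding lpp_sum_eq_cauchy_sum by (simp add: sum_distrib_left mult_ac)
  also have "\<dots> = (\<Sum>l\<in>bounded_partitions N n. alternant n x l * alternant n y l)"
    by (intro sum.cong refl) (simp add: schur_alternant)
  finally show ?thesis by (simp add: alternant_cauchy_binet)
qed

section \<open>The ratio of Cauchy determinants\<close>

lemma lagrange_interpolation:
  fixes p :: "'a :: field poly"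
  assumes d: "degree p < n" and x: "inj_on x {..<n}"
  shows "poly p z = (\<Sum>k<n. poly p (x k) * (\<Prod>m\<in>{..<n} - {k}. (z - x m) / (x k - x m)))"
proof -
  define q where "q = (\<Sum>k<n. Polynomial.smult (poly p (x k) / (\<Prod>m\<in>{..<n} - {k}. x k - x m)) (\<Prod>m\<in>{..<n} - {k}. [:- x m, 1:]))"
  have pq: "poly q z = (\<Sum>k<n. poly p (x k) * (\<Prod>m\<in>{..<n} - {k}. (z - x m) / (x k - x m)))" for z
    by (simp add: q_def poly_sum poly_prod prod_dividef)
  have "degree q \<le> n - 1"
    unfolding q_def
  proof (rule degree_sum_le)
    fix k assume "k \<in> {..<n}"
    then have "degree (\<Prod>m\<in>{..<n} - {k}. [:- x m, 1:]) \<le> n - 1"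
      by (intro order_trans[OF degree_prod_sum_le]) auto
    then show "degree (Polynomial.smult (poly p (x k) / (\<Prod>m\<in>{..<n} - {k}. x k - x m)) (\<Prod>m\<in>{..<n} - {k}. [:- x m, 1:])) \<le> n - 1"
      using degree_smult_le order_trans by blast
  qed auto
  then have dq: "degree q < n" using d by simp
  have "p = q"
  proof (rule poly_eqI_degree)
    fix v assume "v \<in> x ` {..<n}"
    then obtain j where j: "j < n" "v = x j" by auto
    have "(\<Sum>k<n. poly p (x k) * (\<Prod>m\<in>{..<n} - {k}. (v - x m) / (x k - x m))) =
       (\<Sum>k\<in>{j}. poly p (x k) * (\<Prod>m\<in>{..<n} - {k}. (v - x m) / (x k - x m)))"
    proof (rule sum.mono_neutral_right)
      show "\<forall>k\<in>{..<n} - {j}. poly p (x k) * (\<Prod>m\<in>{..<n} - {k}. (v - x m) / (x k - x m)) = 0"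
      proof
        fix k assume "k \<in> {..<n} - {j}"
        then have "(\<Prod>m\<in>{..<n} - {k}. (v - x m) / (x k - x m)) = 0"
          using j by (intro prod_zero) auto
        then show "poly p (x k) * (\<Prod>m\<in>{..<n} - {k}. (v - x m) / (x k - x m)) = 0" by simp
      qed
    qed (use j in auto)
    also have "\<dots> = poly p (x j)"
    proof -
      have "(\<Prod>m\<in>{..<n} - {j}. (v - x m) / (x j - x m)) = 1"
        by (rule prod.neutral) (use j x in \<open>auto simp: inj_on_def\<close>)
      then show ?thesis by simp
    qed
    finally show "poly p v = poly q v" using j by (simp add: pq)
  qed (use dq d x in \<open>auto simp: card_image\<close>)
  then have "poly p z = poly q z" by (rule arg_cong)
  then show ?thesis by (rule trans) (rule pq)
qed

text \<open>Up to the factor \<open>1 / (1 - x k * y j)\<close>, the entry of the inverse of the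
  Cauchy matrix \<open>1 / (1 - x i * y j)\<close> is a product of two such numbers, one for the row
  and one for the column, with \<open>x\<close> and \<open>y\<close> exchanged in one of
  them.\<close>

definition cauchy_coeff :: "nat \<Rightarrow> (nat \<Rightarrow> real) \<Rightarrow> (nat \<Rightarrow> real) \<Rightarrow> nat \<Rightarrow> real" where
  "cauchy_coeff n x y k = (\<Prod>m<n. 1 - x k * y m) / (\<Prod>m\<in>{..<n} - {k}. x k - x m)"

text \<open>Lagrange interpolation at the nodes \<open>x k\<close> of the product of
  \<open>1 - z * y m\<close> over all \<open>m\<close> other than \<open>l\<close>, evaluated at
  \<open>z = 1 / y j\<close>: the value is zero unless \<open>j = l\<close>.\<close>

lemma cauchy_matrix_inverse:
  assumes x: "inj_on x {..<n}" and y: "inj_on y {..<n}" and y0: "\<And>j. j < n \<Longrightarrow> y j \<noteq> 0"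
    and xy: "\<And>i j. i < n \<Longrightarrow> j < n \<Longrightarrow> x i * y j \<noteq> 1" and j: "j < n" and l: "l < n"
  shows "(\<Sum>k<n. cauchy_coeff n y x j * cauchy_coeff n x y k / (1 - x k * y j) * (1 / (1 - x k * y l))) =
    (if j = l then 1 else 0)"
proof -
  define p where "p = (\<Prod>m\<in>{..<n} - {l}. [:1, - y m:])"
  have "degree p \<le> (\<Sum>m\<in>{..<n} - {l}. degree [:1, - y m:])"
    unfolding p_def using degree_prod_sum_le[of "{..<n} - {l}" "\<lambda>m. [:1, - y m:]"] by (simp add: comp_def)
  also have "\<dots> \<le> (\<Sum>m\<in>{..<n} - {l}. 1)" by (intro sum_mono) auto
  finally have d: "degree p < n" using l by simp
  have pz: "poly p z = (\<Prod>m\<in>{..<n} - {l}. 1 - z * y m)" for z by (simp add: p_def poly_prod)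
  have c: "card ({..<n} - {k}) = n - 1" if "k < n" for k using that by simp
  \<comment> \<open>One factor \<open>y j\<close> for each of the \<open>n - 1\<close> factors of
    the product clears the denominators caused by \<open>1 / y j\<close>.\<close>
  have yn: "y j ^ (n - 1) * (\<Prod>m\<in>{..<n} - {k}. f m) = (\<Prod>m\<in>{..<n} - {k}. y j * f m)" if "k < n" for k f
    using c[OF that] by (simp add: prod.distrib)
  have yj: "y j \<noteq> 0" using y0 j by auto
  have term_eq: "y j ^ (n - 1) * (poly p (x k) * (\<Prod>m\<in>{..<n} - {k}. (1 / y j - x m) / (x k - x m))) =
      cauchy_coeff n x y k / (1 - x k * y l) * ((\<Prod>m<n. 1 - y j * x m) / (1 - x k * y j))"
    if k: "k < n" for k
  proof -
    have a: "(\<Prod>m<n. 1 - x k * y m) = (1 - x k * y l) * poly p (x k)"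
      unfolding pz using l by (subst prod.remove[of _ l]) auto
    have b: "(\<Prod>m<n. 1 - y j * x m) = (1 - x k * y j) * (\<Prod>m\<in>{..<n} - {k}. 1 - y j * x m)"
      using k by (subst prod.remove[of _ k]) (auto simp: mult.commute)
    have "y j ^ (n - 1) * (poly p (x k) * (\<Prod>m\<in>{..<n} - {k}. (1 / y j - x m) / (x k - x m))) =
       poly p (x k) * (\<Prod>m\<in>{..<n} - {k}. y j * ((1 / y j - x m) / (x k - x m)))"
      using yn[OF k] by (simp add: mult_ac)
    also have "(\<Prod>m\<in>{..<n} - {k}. y j * ((1 / y j - x m) / (x k - x m))) = 
      (\<Prod>m\<in>{..<n} - {k}. (1 - y j * x m) / (x k - x m))"
      using yj by (intro prod.cong refl) (simp add: right_diff_distrib)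
    also have "\<dots> = (\<Prod>m\<in>{..<n} - {k}. 1 - y j * x m) / (\<Prod>m\<in>{..<n} - {k}. x k - x m)"
      by (rule prod_dividef)
    finally show ?thesis using xy[OF k j] xy[OF k l]
      by (simp add: cauchy_coeff_def a b)
  qed
  have lhs: "(\<Sum>k<n. cauchy_coeff n x y k / (1 - x k * y l) * ((\<Prod>m<n. 1 - y j * x m) / (1 - x k * y j))) =
     y j ^ (n - 1) * poly p (1 / y j)"
    unfolding lagrange_interpolation[OF d x, of "1 / y j"] sum_distrib_left
    by (intro sum.cong refl term_eq[symmetric]) simp
  also have "\<dots> = (\<Prod>m\<in>{..<n} - {l}. y j - y m)"
    unfolding pz yn[OF l] using yj by (intro prod.cong refl) (simp add: field_simps)
  also have "\<dots> = (if j = l then (\<Prod>m\<in>{..<n} - {j}. y j - y m) else 0)"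
    using j by (auto intro!: prod_zero)
  finally have s: "(\<Sum>k<n. cauchy_coeff n x y k / (1 - x k * y l) * ((\<Prod>m<n. 1 - y j * x m) / (1 - x k * y j))) =
     (if j = l then (\<Prod>m\<in>{..<n} - {j}. y j - y m) else 0)" .
  have nz: "(\<Prod>m\<in>{..<n} - {j}. y j - y m) \<noteq> 0" using y j by (auto simp: inj_on_def)
  have "(\<Sum>k<n. cauchy_coeff n y x j * cauchy_coeff n x y k / (1 - x k * y j) * (1 / (1 - x k * y l))) =
    (\<Sum>k<n. cauchy_coeff n x y k / (1 - x k * y l) * ((\<Prod>m<n. 1 - y j * x m) / (1 - x k * y j))) / 
      (\<Prod>m\<in>{..<n} - {j}. y j - y m)"
    unfolding sum_divide_distrib by (intro sum.cong refl) (simp add: cauchy_coeff_def[of n y x] mult_ac)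
  also have "\<dots> = (if j = l then 1 else 0)" unfolding s
  proof (cases "j = l")
    case True
    then show "(if j = l then \<Prod>m\<in>{..<n} - {j}. y j - y m else 0) / (\<Prod>m\<in>{..<n} - {j}. y j - y m) =
      (if j = l then 1 else 0)" using nz by (simp del: prod_zero_iff)
  qed simp
  finally show ?thesis .
qed

lemma pdet_identity: "pdet {..<n} (\<lambda>i j. if i = j then 1 else 0) = 1"
  by (rule pdet_unitriangular) auto

lemma pdet_scale_columns_rows:
  assumes "finite S"
  shows "pdet S (\<lambda>i j. A i j * c j) = pdet S (\<lambda>i j. c i * A i j)"
  unfolding pdet_def
proof (rule sum.cong[OF refl])
  fix p assume "p \<in> {p. p permutes S}"
  then have "(\<Prod>i\<in>S. c (p i)) = (\<Prod>i\<in>S. c i)" using prod.permute[of p S c] by (simp add: comp_def)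
  then show "of_int (sign p) * (\<Prod>i\<in>S. A i (p i) * c (p i)) = of_int (sign p) * (\<Prod>i\<in>S. c i * A i (p i))"
    by (simp add: prod.distrib mult.commute)
qed

text \<open>Choosing the diagonal 1 in a row forces a fixed point there, so once the set
  \<open>S\<close> of the other rows is chosen exactly the permutations of \<open>S\<close>
  survive.\<close>

lemma pdet_identity_minus:
  assumes U: "finite U"
  shows "pdet U (\<lambda>i j. (if i = j then 1 else 0) - K i j) = (\<Sum>S\<in>Pow U. (-1) ^ card S * pdet S K)"
proof -
  have "pdet U (\<lambda>i j. (if i = j then 1 else 0) - K i j) =
    (\<Sum>p | p permutes U. \<Sum>S\<in>Pow U. of_int (sign p) * ((\<Prod>i\<in>S. - K i (p i)) * (\<Prod>i\<in>U - S. if i = p i then 1 else 0)))"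
    unfolding pdet_def
  proof (rule sum.cong[OF refl])
    fix p
    have "(\<Prod>i\<in>U. (if i = p i then 1 else 0) - K i (p i)) = (\<Prod>i\<in>U. - K i (p i) + (if i = p i then 1 else 0))"
      by simp
    also have "\<dots> = (\<Sum>S\<in>Pow U. (\<Prod>i\<in>S. - K i (p i)) * (\<Prod>i\<in>U - S. if i = p i then 1 else 0))"
      by (rule prod_add[OF U])
    finally show "of_int (sign p) * (\<Prod>i\<in>U. (if i = p i then 1 else 0) - K i (p i)) = (\<Sum>S\<in>Pow U.
       of_int (sign p) * ((\<Prod>i\<in>S. - K i (p i)) * (\<Prod>i\<in>U - S. if i = p i then 1 else 0)))"
      by (simp add: sum_distrib_left)
  qed
  also have "\<dots> = (\<Sum>S\<in>Pow U. \<Sum>p | p permutes U. of_int (sign p) * ((\<Prod>i\<in>S. - K i (p i)) * (\<Prod>i\<in>U - S. if i = p i then 1 else 0)))"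
    by (rule sum.swap)
  also have "\<dots> = (\<Sum>S\<in>Pow U. (-1) ^ card S * pdet S K)"
  proof (rule sum.cong[OF refl])
    fix S assume "S \<in> Pow U"
    then have S: "S \<subseteq> U" by simp
    have fS: "finite S" using S U finite_subset by blast
    have sub: "p permutes U" if "p permutes S" for p using that S by (rule permutes_subset)
    have zero: "of_int (sign p) * ((\<Prod>i\<in>S. - K i (p i)) * (\<Prod>i\<in>U - S. if i = p i then 1 else 0)) = 0"
      if p: "p permutes U" "\<not> p permutes S" for p
    proof -
      have "\<exists>i\<in>U - S. p i \<noteq> i" using permutes_superset[OF p(1), of S] p(2) by blast
      then obtain i where i: "i \<in> U - S" "i \<noteq> p i" by fastforce
      then have "(\<Prod>i\<in>U - S. if i = p i then 1 else 0 :: 'a) = 0"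
        using U by (intro prod_zero bexI[of _ i]) auto
      then show ?thesis by simp
    qed
    have "(\<Sum>p | p permutes U. of_int (sign p) * ((\<Prod>i\<in>S. - K i (p i)) * (\<Prod>i\<in>U - S. if i = p i then 1 else 0))) =
      (\<Sum>p | p permutes S. of_int (sign p) * ((\<Prod>i\<in>S. - K i (p i)) * (\<Prod>i\<in>U - S. if i = p i then 1 else 0)))"
      using sub zero by (intro sum.mono_neutral_right finite_permutations ballI U) blast+
    also have "\<dots> = (\<Sum>p | p permutes S. (-1) ^ card S * (of_int (sign p) * (\<Prod>i\<in>S. K i (p i))))"
    proof (rule sum.cong[OF refl])
      fix p assume "p \<in> {p. p permutes S}"
      then have "(\<Prod>i\<in>U - S. if i = p i then 1 else 0 :: 'a) = 1"
        by (intro prod.neutral) (auto simp: permutes_def)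
      moreover have "(\<Prod>i\<in>S. - K i (p i)) = (-1) ^ card S * (\<Prod>i\<in>S. K i (p i))"
        using prod_uminus[of "\<lambda>i. K i (p i)" S] by simp
      ultimately show "of_int (sign p) * ((\<Prod>i\<in>S. - K i (p i)) * (\<Prod>i\<in>U - S. if i = p i then 1 else 0)) =
        (-1) ^ card S * (of_int (sign p) * (\<Prod>i\<in>S. K i (p i)))" by (simp add: mult_ac)
    qed
    finally show "(\<Sum>p | p permutes U. of_int (sign p) * ((\<Prod>i\<in>S. - K i (p i)) * (\<Prod>i\<in>U - S. if i = p i then 1 else 0))) = (-1) ^ card S * pdet S K"
      by (simp add: pdet_def sum_distrib_left)
  qed
  finally show ?thesis .
qed

text \<open>Let \<open>C\<close> be the Cauchy matrix and \<open>B\<close> its inverse. The matrix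
  with entries cut off at \<open>M\<close> is \<open>C\<close> minus a copy of \<open>C\<close> with
  row \<open>i\<close> scaled by \<open>x i ^ M\<close> and column \<open>j\<close> by
  \<open>y j ^ M\<close>, so its product with \<open>B\<close> is the identity minus an explicit
  matrix. The normalisation identifies \<open>c\<close> with the determinant of
  \<open>B\<close>.\<close>

theorem cauchy_determinant_ratio:
  assumes x: "inj_on x {..<n}" and y: "inj_on y {..<n}" and y0: "\<And>j. j < n \<Longrightarrow> y j \<noteq> 0"
    and xy: "\<And>i j. i < n \<Longrightarrow> j < n \<Longrightarrow> x i * y j \<noteq> 1"
    and norm: "c * pdet {..<n} (\<lambda>i j. 1 / (1 - x i * y j)) = 1"
  shows "c * pdet {..<n} (\<lambda>i j. (1 - (x i * y j) ^ M) / (1 - x i * y j)) =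
    (\<Sum>S\<in>Pow {..<n}. (-1) ^ card S * pdet S (\<lambda>j l. \<Sum>k<n.
       (cauchy_coeff n y x j * y j ^ M) * (cauchy_coeff n x y k * x k ^ M) / ((1 - x k * y j) * (1 - x k * y l))))"
proof -
  define C where "C i j = 1 / (1 - x i * y j)" for i j
  define B where "B j k = cauchy_coeff n y x j * cauchy_coeff n x y k / (1 - x k * y j)" for j k
  define D where "D i j = (1 - (x i * y j) ^ M) / (1 - x i * y j)" for i j
  have BC: "(\<Sum>k<n. B j k * C k l) = (if j = l then 1 else 0)" if "j < n" "l < n" for j l
    unfolding B_def C_def using cauchy_matrix_inverse[OF x y y0 xy that] by simp
  have "pdet {..<n} B * pdet {..<n} C = pdet {..<n} (\<lambda>j l. \<Sum>k<n. B j k * C k l)"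
    by (rule pdet_mult[symmetric])
  also have "\<dots> = pdet {..<n} (\<lambda>i j. if i = j then 1 else 0)" by (rule pdet_cong) (simp add: BC)
  finally have "pdet {..<n} B * pdet {..<n} C = 1" by (simp only: pdet_identity)
  moreover have "c * pdet {..<n} C = 1" using norm by (simp add: C_def[abs_def])
  ultimately have cB: "c = pdet {..<n} B"
    by (metis mult.commute mult.left_commute mult.right_neutral)
  have "c * pdet {..<n} D = pdet {..<n} (\<lambda>j l. \<Sum>k<n. B j k * D k l)" unfolding cB by (rule pdet_mult[symmetric])
  also have "\<dots> = pdet {..<n} (\<lambda>j l. (if j = l then 1 else 0) - (\<Sum>k<n. B j k * x k ^ M * C k l) * y l ^ M)"
  proof (rule pdet_cong)
    fix j l assume jl: "j \<in> {..<n}" "l \<in> {..<n}"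
    have "(\<Sum>k<n. B j k * D k l) = (\<Sum>k<n. B j k * C k l - B j k * x k ^ M * C k l * y l ^ M)"
      by (intro sum.cong refl) (simp add: D_def C_def power_mult_distrib diff_divide_distrib right_diff_distrib)
    then show "(\<Sum>k<n. B j k * D k l) = (if j = l then 1 else 0) - (\<Sum>k<n. B j k * x k ^ M * C k l) * y l ^ M"
      using BC jl by (simp add: sum_subtractf sum_distrib_right)
  qed
  also have "\<dots> = (\<Sum>S\<in>Pow {..<n}. (-1) ^ card S * pdet S (\<lambda>j l. (\<Sum>k<n. B j k * x k ^ M * C k l) * y l ^ M))"
    by (rule pdet_identity_minus) simp
  \<comment> \<open>The scaling by powers of \<open>y\<close> is moved from columns to rows, so that
    an entry can be bounded through its row index alone.\<close>
  also have "\<dots> = (\<Sum>S\<in>Pow {..<n}. (-1) ^ card S * pdet S (\<lambda>j l. y j ^ M * (\<Sum>k<n. B j k * x k ^ M * C k l)))"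
    by (intro sum.cong refl arg_cong2[where f = "(*)"] pdet_scale_columns_rows) (auto intro: finite_subset)
  also have "(\<lambda>j l. y j ^ M * (\<Sum>k<n. B j k * x k ^ M * C k l)) = (\<lambda>j l. \<Sum>k<n.
       (cauchy_coeff n y x j * y j ^ M) * (cauchy_coeff n x y k * x k ^ M) / ((1 - x k * y j) * (1 - x k * y l)))"
    by (intro ext) (simp add: B_def C_def sum_distrib_left mult_ac)
  finally show ?thesis by (simp add: D_def[abs_def])
qed

text \<open>Finite sets of naturals are enumerated by their binary codes, which makes the expansion
  in principal minors an ordinary series; its first \<open>2 ^ n\<close> terms belong to the subsets
  of \<open>{..<n}\<close>.\<close>

definition discrete_fredholm :: "(nat \<Rightarrow> nat \<Rightarrow> complex) \<Rightarrow> complex" where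
  "discrete_fredholm K = (\<Sum>m. (-1) ^ card (set_decode m) * pdet (set_decode m) K)"

text \<open>Taken in increasing order, the elements of \<open>S\<close> are at least 0, 1, 2 and so
  on.\<close>

lemma fact_card_le_prod:
  "finite (S :: nat set) \<Longrightarrow> fact (card S) \<le> (\<Prod>i\<in>S. Suc i)"
proof (induction S rule: finite_linorder_max_induct)
  case (insert b A)
  have "A \<subseteq> {..<b}" using insert by auto
  then have "card A \<le> b" using card_mono[of "{..<b}" A] by simp
  moreover have "b \<notin> A" using insert by auto
  ultimately show ?case using insert by (simp del: mult_Suc add: mult_mono)
qed simp

text \<open>The number of permutations is distributed over the rows as factors \<open>Suc i\<close>.
  This crude substitute for Hadamard's inequality is the reason for the weight
  \<open>real (Suc i)\<close> in the summability conditions below.\<close>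

lemma norm_pdet_le:
  fixes K :: "nat \<Rightarrow> nat \<Rightarrow> complex"
  assumes S: "finite S" and K: "\<And>i j. norm (K i j) \<le> g i"
  shows "norm (pdet S K) \<le> (\<Prod>i\<in>S. real (Suc i) * g i)"
proof -
  have g: "0 \<le> g i" for i using K[of i 0] norm_ge_zero order_trans by blast
  have "norm (pdet S K) \<le> (\<Sum>p | p permutes S. \<Prod>i\<in>S. g i)"
    unfolding pdet_def
  proof (rule sum_norm_le)
    fix p assume "p \<in> {p. p permutes S}"
    have "norm (of_int (sign p) * (\<Prod>i\<in>S. K i (p i))) = (\<Prod>i\<in>S. norm (K i (p i)))"
      by (simp add: norm_mult prod_norm sign_def)
    also have "\<dots> \<le> (\<Prod>i\<in>S. g i)" by (intro prod_mono) (simp add: K)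
    finally show "norm (of_int (sign p) * (\<Prod>i\<in>S. K i (p i))) \<le> (\<Prod>i\<in>S. g i)" .
  qed
  also have "\<dots> = real (fact (card S)) * (\<Prod>i\<in>S. g i)" using card_permutations[OF refl S] by simp
  also have "\<dots> \<le> real (\<Prod>i\<in>S. Suc i) * (\<Prod>i\<in>S. g i)"
    using fact_card_le_prod[OF S] by (intro mult_right_mono prod_nonneg) (auto simp: g simp del: of_nat_prod of_nat_fact)
  also have "\<dots> = (\<Prod>i\<in>S. real (Suc i) * g i)" by (simp add: prod.distrib)
  finally show ?thesis .
qed

lemma set_decode_bij: "bij_betw set_decode {..<2 ^ n} (Pow {..<n})"
proof (rule bij_betw_byWitness[where f' = set_encode])
  show "\<forall>S\<in>Pow {..<n}. set_decode (set_encode S) = S"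
    using finite_subset[OF _ finite_lessThan] by (metis PowD set_encode_inverse)
  show "set_decode ` {..<2 ^ n} \<subseteq> Pow {..<n}"
  proof (intro image_subsetI PowI subsetI)
    fix m i assume m: "m \<in> {..<2 ^ n :: nat}" "i \<in> set_decode m"
    then have "m div 2 ^ i \<noteq> 0" by (auto simp: set_decode_def intro: odd_pos)
    then have "2 ^ i \<le> m" by (simp add: div_eq_0_iff)
    then have "(2::nat) ^ i < 2 ^ n" using m(1) le_less_trans unfolding lessThan_iff by blast
    then show "i \<in> {..<n}" by simp
  qed
  show "set_encode ` Pow {..<n} \<subseteq> {..<2 ^ n}"
  proof (intro image_subsetI)
    fix S assume "S \<in> Pow {..<n}"
    then have S: "S \<subseteq> {..<n}" by simp
    have "set_encode S \<le> (\<Sum>i<n. 2 ^ i)" unfolding set_encode_def using S by (auto intro: sum_mono2)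
    also have "\<dots> = 2 ^ n - 1" by (simp add: sum_power2 lessThan_atLeast0)
    also have "\<dots> < 2 ^ n" by simp
    finally show "set_encode S \<in> {..<2 ^ n}" by simp
  qed
qed simp

lemma sum_set_decode: "(\<Sum>m<2 ^ n. f (set_decode m)) = (\<Sum>S\<in>Pow {..<n}. f S)"
  by (rule sum.reindex_bij_betw[OF set_decode_bij])

text \<open>The sums over the subsets of \<open>{..<n}\<close> expand the product of the
  \<open>h i + 1\<close>, which is at most \<open>exp (suminf h)\<close>.\<close>

lemma summable_subset_products:
  assumes h: "summable h" "\<And>i. 0 \<le> h i"
  shows "summable (\<lambda>m. \<Prod>i\<in>set_decode m. h i :: real)"
proof (rule summableI_nonneg_bounded[where x = "exp (suminf h)"])
  fix n
  have "(\<Sum>m<n. \<Prod>i\<in>set_decode m. h i) \<le> (\<Sum>m<2 ^ n. \<Prod>i\<in>set_decode m. h i)"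
    by (intro sum_mono2) (auto intro: prod_nonneg h less_trans[OF _ less_exp])
  also have "\<dots> = (\<Sum>S\<in>Pow {..<n}. \<Prod>i\<in>S. h i)" by (rule sum_set_decode)
  also have "\<dots> = (\<Prod>i<n. h i + 1)" by (simp add: prod_add)
  also have "\<dots> \<le> (\<Prod>i<n. exp (h i))"
    by (intro prod_mono) (auto simp: h add.commute intro: exp_ge_add_one_self add_nonneg_nonneg)
  also have "\<dots> = exp (\<Sum>i<n. h i)" by (simp add: exp_sum)
  also have "\<dots> \<le> exp (suminf h)" using sum_le_suminf[OF h(1), of "{..<n}"] h(2) by auto
  finally show "(\<Sum>m<n. \<Prod>i\<in>set_decode m. h i) \<le> exp (suminf h)" .
qed (auto intro: prod_nonneg h)

text \<open>Each minor is a finite expression and converges; Tannery's theorem then exchanges limit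
  and series, with a majorant built from row bounds that do not involve the parameter.\<close>

lemma discrete_fredholm_tendsto:
  fixes K :: "'a \<Rightarrow> nat \<Rightarrow> nat \<Rightarrow> complex"
  assumes lim: "\<And>i j. ((\<lambda>t. K t i j) \<longlongrightarrow> K' i j) F" and F: "F \<noteq> bot"
    and bound: "eventually (\<lambda>t. \<forall>i j. norm (K t i j) \<le> g i) F"
    and sm: "summable (\<lambda>i. real (Suc i) * g i)"
  shows "((\<lambda>t. discrete_fredholm (K t)) \<longlongrightarrow> discrete_fredholm K') F"
proof -
  obtain t0 where "\<forall>i j. norm (K t0 i j) \<le> g i" using eventually_happens[OF bound] F by blast
  then have g: "0 \<le> g i" for i using norm_ge_zero order_trans by blast
  have "eventually (\<lambda>(m, t). norm ((-1) ^ card (set_decode m) * pdet (set_decode m) (K t)) \<le> 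
      (\<Prod>i\<in>set_decode m. real (Suc i) * g i)) (at_top \<times>\<^sub>F F)"
    unfolding eventually_prod_filter
  proof (intro exI conjI allI impI)
    show "eventually (\<lambda>_. True) at_top" by simp
    show "eventually (\<lambda>t. \<forall>i j. norm (K t i j) \<le> g i) F" by (rule bound)
    fix m t assume "\<forall>i j. norm (K t i j) \<le> g i"
    then show "case (m, t) of (m, t) \<Rightarrow> norm ((-1) ^ card (set_decode m) * pdet (set_decode m) (K t)) \<le> 
      (\<Prod>i\<in>set_decode m. real (Suc i) * g i)"
      using norm_pdet_le[of "set_decode m" "K t" g] by (simp add: norm_mult norm_power)
  qed
  note dom = this
  have lims: "((\<lambda>t. (-1) ^ card (set_decode m) * pdet (set_decode m) (K t)) \<longlongrightarrow>
      (-1) ^ card (set_decode m) * pdet (set_decode m) K') F" for m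
    unfolding pdet_def by (intro tendsto_intros lim)
  have "summable (\<lambda>m. \<Prod>i\<in>set_decode m. real (Suc i) * g i)"
    by (rule summable_subset_products[OF sm]) (simp add: g)
  from tannerys_theorem[OF lims dom this F] show ?thesis
    unfolding discrete_fredholm_def by blast
qed

text \<open>The sections are the partial sums of the series at the indices
  \<open>2 ^ n\<close>.\<close>

lemma discrete_fredholm_sections:
  assumes bound: "\<And>i j. norm (K i j) \<le> g i" and sm: "summable (\<lambda>i. real (Suc i) * g i)"
  shows "(\<lambda>n. \<Sum>S\<in>Pow {..<n}. (-1) ^ card S * pdet S K) \<longlonglongrightarrow> discrete_fredholm K"
proof -
  have g: "0 \<le> g i" for i using bound[of i 0] norm_ge_zero order_trans by blast
  have "summable (\<lambda>m. (-1) ^ card (set_decode m) * pdet (set_decode m) K)"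
    by (rule summable_comparison_test'[OF summable_subset_products[OF sm], of 0])
       (use norm_pdet_le[of "set_decode _" K g] bound g in \<open>auto simp: norm_mult norm_power\<close>)
  then have "(\<lambda>n. \<Sum>m<n. (-1) ^ card (set_decode m) * pdet (set_decode m) K) \<longlonglongrightarrow> discrete_fredholm K"
    unfolding discrete_fredholm_def by (rule summable_LIMSEQ)
  then have "((\<lambda>n. \<Sum>m<n. (-1) ^ card (set_decode m) * pdet (set_decode m) K) \<circ> (\<lambda>n. 2 ^ n)) \<longlonglongrightarrow> discrete_fredholm K"
    by (rule LIMSEQ_subseq_LIMSEQ) (auto simp: strict_mono_def)
  then show ?thesis
    by (simp add: comp_def sum_set_decode[of "\<lambda>S. (-1) ^ card S * pdet S K"])
qed

lemma discrete_fredholm_finite: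
  assumes "\<And>i j. n \<le> i \<Longrightarrow> K i j = 0"
  shows "discrete_fredholm K = (\<Sum>S\<in>Pow {..<n}. (-1) ^ card S * pdet S K)"
proof -
  have "pdet (set_decode m) K = 0" if m: "m \<notin> {..<2 ^ n}" for m
  proof -
    have "\<not> set_decode m \<subseteq> {..<n}"
    proof
      assume "set_decode m \<subseteq> {..<n}"
      then obtain m' where "m' \<in> {..<2 ^ n}" "set_decode m' = set_decode m"
        using bij_betw_imp_surj_on[OF set_decode_bij[of n]] by (metis PowI imageE)
      then show False using m by (metis set_decode_inverse)
    qed
    then obtain i where "i \<in> set_decode m" "n \<le> i" by (meson lessThan_iff not_le subsetI)
    then show ?thesis unfolding pdet_def
      by (intro sum.neutral ballI) (auto intro!: prod_zero bexI[of _ i] simp: assms)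
  qed
  then have "discrete_fredholm K = (\<Sum>m<2 ^ n. (-1) ^ card (set_decode m) * pdet (set_decode m) K)"
    unfolding discrete_fredholm_def by (intro suminf_finite) auto
  then show ?thesis by (simp add: sum_set_decode[of "\<lambda>S. (-1) ^ card S * pdet S K"])
qed

section \<open>The q-Gamma function\<close>

text \<open>The infinite q-Pochhammer symbol of \<open>q ^ z\<close> with
  \<open>q = exp (- h)\<close>.\<close>

definition qpoch :: "real \<Rightarrow> real \<Rightarrow> real" where
  "qpoch h z = (\<Prod>m. 1 - exp (- (h * (z + real m))))"

definition qnum :: "real \<Rightarrow> real \<Rightarrow> real" where
  "qnum h z = (1 - exp (- (h * z))) / (1 - exp (- h))"

text \<open>The reciprocal of the \<open>q\<close>-Gamma function with \<open>q = exp (- h)\<close>.\<close>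

definition rqGamma :: "real \<Rightarrow> real \<Rightarrow> real" where
  "rqGamma h z = qpoch h z / qpoch h 1 * (1 - exp (- h)) powr (z - 1)"

context
  fixes h :: real
  assumes h: "h > 0"
begin

lemma summable_exp_shift: "summable (\<lambda>m. exp (- (h * (z + real m))))"
proof -
  have "summable (\<lambda>m. exp (- (h * z)) * exp (- h) ^ m)" using h by (intro summable_mult summable_geometric) simp
  moreover have "exp (- (h * z)) * exp (- h) ^ m = exp (- (h * (z + real m)))" for m
    by (simp add: exp_of_nat_mult[symmetric] mult_exp_exp algebra_simps)
  ultimately show ?thesis by simp
qed

lemma qpoch_convergent: "convergent_prod (\<lambda>m. 1 - exp (- (h * (z + real m))))"
  by (intro abs_convergent_prod_imp_convergent_prod summable_imp_abs_convergent_prod)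
     (simp add: summable_exp_shift)

lemma qpoch_LIMSEQ: "(\<lambda>n. \<Prod>m<n. 1 - exp (- (h * (z + real m)))) \<longlonglongrightarrow> qpoch h z"
proof -
  have "(\<lambda>n. \<Prod>m\<le>n. 1 - exp (- (h * (z + real m)))) \<longlonglongrightarrow> qpoch h z"
    unfolding qpoch_def by (rule convergent_prod_LIMSEQ[OF qpoch_convergent])
  then have "(\<lambda>n. \<Prod>m<Suc n. 1 - exp (- (h * (z + real m)))) \<longlonglongrightarrow> qpoch h z"
    by (simp only: lessThan_Suc_atMost)
  then show ?thesis by (rule LIMSEQ_imp_Suc)
qed

lemma exp_factor: "z > 0 \<Longrightarrow> 0 < 1 - exp (- (h * z))" "0 < 1 - exp (- h)"
  using h by simp_all

lemma qpoch_pos: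
  assumes z: "z > 0" shows "qpoch h z > 0"
proof -
  have f: "0 < 1 - exp (- (h * (z + real m)))" for m using exp_factor(1)[of "z + real m"] z by simp
  have "qpoch h z \<ge> 0"
    by (rule LIMSEQ_le_const[OF qpoch_LIMSEQ]) (auto intro!: prod_nonneg less_imp_le[OF f])
  moreover have "qpoch h z \<noteq> 0"
    unfolding qpoch_def by (rule prodinf_nonzero[OF qpoch_convergent]) (use f in \<open>auto simp: less_imp_neq[symmetric]\<close>)
  ultimately show ?thesis by simp
qed

lemma qpoch_le_partial:
  assumes z: "z > 0" shows "qpoch h z \<le> (\<Prod>m<n. 1 - exp (- (h * (z + real m))))"
proof (rule LIMSEQ_le_const2[OF qpoch_LIMSEQ], intro exI allI impI)
  fix k assume k: "n \<le> k"
  have f: "0 < 1 - exp (- (h * (z + real m)))" for m using exp_factor(1)[of "z + real m"] z by simp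
  have "(\<Prod>m<k. 1 - exp (- (h * (z + real m)))) = (\<Prod>m<n. 1 - exp (- (h * (z + real m)))) * (\<Prod>m\<in>{n..<k}. 1 - exp (- (h * (z + real m))))"
    using k by (subst prod.union_disjoint[symmetric]) (auto intro!: prod.cong)
  also have "\<dots> \<le> (\<Prod>m<n. 1 - exp (- (h * (z + real m)))) * 1"
    using h z by (intro mult_left_mono prod_le_1 prod_nonneg) auto
  finally show "(\<Prod>m<k. 1 - exp (- (h * (z + real m)))) \<le> (\<Prod>m<n. 1 - exp (- (h * (z + real m))))" by simp
qed

lemma qpoch_rec:
  assumes z: "z > 0" shows "qpoch h z = (1 - exp (- (h * z))) * qpoch h (z + 1)"
proof -
  have "(\<lambda>n. (1 - exp (- (h * z))) * (\<Prod>m<n. 1 - exp (- (h * (z + 1 + real m))))) \<longlonglongrightarrow> (1 - exp (- (h * z))) * qpoch h (z + 1)"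
    by (intro tendsto_intros qpoch_LIMSEQ)
  moreover have "(1 - exp (- (h * z))) * (\<Prod>m<n. 1 - exp (- (h * (z + 1 + real m)))) = (\<Prod>m<Suc n. 1 - exp (- (h * (z + real m))))" for n
    by (subst prod.lessThan_Suc_shift) (simp add: add_ac)
  ultimately have "(\<lambda>n. \<Prod>m<Suc n. 1 - exp (- (h * (z + real m)))) \<longlonglongrightarrow> (1 - exp (- (h * z))) * qpoch h (z + 1)" by simp
  moreover have "(\<lambda>n. \<Prod>m<Suc n. 1 - exp (- (h * (z + real m)))) \<longlonglongrightarrow> qpoch h z"
    using qpoch_LIMSEQ by (rule LIMSEQ_Suc)
  ultimately show ?thesis using LIMSEQ_unique by blast
qed

text \<open>The function \<open>1 - exp (- h z)\<close> is log-concave in \<open>z\<close>, and for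
  a concave function the chord over \<open>a - 1\<close> and \<open>a\<close>, continued to
  \<open>a + w\<close>, stays above the graph.\<close>

lemma log_concave_factor:
  assumes a: "a > 1" and w: "w \<ge> 0"
  shows "1 - exp (- (h * (a + w))) \<le>
    (1 - exp (- (h * a))) * ((1 - exp (- (h * a))) / (1 - exp (- (h * (a - 1))))) powr w"
proof -
  have p: "0 < 1 - exp (- (h * (a + w)))" "0 < 1 - exp (- (h * a))" "0 < 1 - exp (- (h * (a - 1)))"
    using a w h by auto
  let ?A = "1 - exp (- (h * (a - 1)))" and ?B = "1 - exp (- (h * (a + w)))" and ?C = "1 - exp (- (h * a))"
  \<comment> \<open>With this weight \<open>a\<close> is the convex combination of
    \<open>a - 1\<close> and \<open>a + w\<close>.\<close>
  define t where "t = 1 / (w + 1)"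
  have t: "0 \<le> t" "t \<le> 1" using w by (auto simp: t_def)
  have tw: "1 - t = w * t" using w by (simp add: t_def field_simps)
  have mid: "(1 - t) * (a - 1) + t * (a + w) = a"
  proof -
    have "w * t * (a - 1) + t * (a + w) = t * (w + 1) * a" by (simp add: algebra_simps)
    also have "t * (w + 1) = 1" using w by (simp add: t_def)
    finally show ?thesis unfolding tw by simp
  qed
  have "exp ((1 - t) *\<^sub>R (- (h * (a - 1))) + t *\<^sub>R (- (h * (a + w)))) \<le>
     (1 - t) * exp (- (h * (a - 1))) + t * exp (- (h * (a + w)))"
    by (rule convex_onD[OF exp_convex t]) auto
  moreover have "(1 - t) *\<^sub>R (- (h * (a - 1))) + t *\<^sub>R (- (h * (a + w))) = - (h * ((1 - t) * (a - 1) + t * (a + w)))"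
    by (simp add: algebra_simps)
  ultimately have 1: "(1 - t) * ?A + t * ?B \<le> ?C" unfolding mid by (simp add: algebra_simps)
  have "(1 - t) * ln ?A + t * ln ?B \<le> ln ((1 - t) *\<^sub>R ?A + t *\<^sub>R ?B)"
    by (rule concave_onD[OF ln_concave t]) (use p in auto)
  also have "\<dots> \<le> ln ?C"
  proof -
    have "0 < (1 - t) * ?A + t * ?B"
      using p t w by (intro add_nonneg_pos mult_nonneg_nonneg mult_pos_pos) (auto simp: t_def)
    then show ?thesis using 1 by (intro ln_mono) (auto simp: p)
  qed
  finally have "w * t * ln ?A + t * ln ?B \<le> ln ?C" unfolding tw .
  then have "(w + 1) * (w * t * ln ?A + t * ln ?B) \<le> (w + 1) * ln ?C" using w by (intro mult_left_mono) auto
  moreover have "(w + 1) * (w * t * ln ?A + t * ln ?B) = w * ln ?A + ln ?B"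
  proof -
    have "(w + 1) * (w * t * ln ?A + t * ln ?B) = ((w + 1) * t) * (w * ln ?A + ln ?B)"
      by (simp add: algebra_simps)
    also have "(w + 1) * t = 1" using w by (simp add: t_def)
    finally show ?thesis by simp
  qed
  ultimately have "ln ?B \<le> ln ?C + w * (ln ?C - ln ?A)" by (simp add: algebra_simps)
  also have "\<dots> = ln (?C * (?C / ?A) powr w)"
  proof -
    have "ln C + w * (ln C - ln A) = ln (C * (C / A) powr w)" if "A > 0" "C > 0" for A C :: real
      using that by (simp add: ln_mult ln_powr ln_div)
    then show ?thesis using p by blast
  qed
  finally have "ln ?B \<le> ln (?C * (?C / ?A) powr w)" .
  moreover have "0 < ?C * (?C / ?A) powr w"
  proof -
    have "?C / ?A > 0" using p by (intro divide_pos_pos)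
    then have "(?C / ?A) powr w > 0" unfolding powr_gt_zero by linarith
    then show ?thesis by (rule mult_pos_pos[OF p(2)])
  qed
  ultimately show ?thesis using p(1) ln_le_cancel_iff by blast
qed

text \<open>The powers in the product of the log-concavity bounds telescope to one factor at each
  end, and the far end is at most 1.\<close>

lemma qpoch_shift_le:
  assumes a: "a > 1" and w: "w \<ge> 0"
  shows "qpoch h (a + w) \<le> qpoch h a * (1 - exp (- (h * (a - 1)))) powr (- w)"
proof -
  let ?e = "\<lambda>z. 1 - exp (- (h * z))"
  have pos: "0 < ?e z" if "z > 0" for z using exp_factor(1)[OF that] .
  have fin: "(\<Prod>m<n. ?e (a + w + real m)) \<le> (\<Prod>m<n. ?e (a + real m)) * ?e (a - 1) powr (- w)" for n
  proof -
    have "(\<Prod>m<n. ?e (a + w + real m)) \<le> (\<Prod>m<n. ?e (a + real m) * (?e (a + real m) / ?e (a + real m - 1)) powr w)"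
    proof (rule prod_mono, rule conjI)
      fix m
      show "0 \<le> ?e (a + w + real m)" using a w by (intro less_imp_le pos) auto
      show "?e (a + w + real m) \<le> ?e (a + real m) * (?e (a + real m) / ?e (a + real m - 1)) powr w"
        using log_concave_factor[of "a + real m" w] a w by (simp add: add_ac)
    qed
    also have "\<dots> = (\<Prod>m<n. ?e (a + real m)) * (\<Prod>m<n. (?e (a + real m) / ?e (a + real m - 1)) powr w)"
      by (rule prod.distrib)
    finally have le1: "(\<Prod>m<n. ?e (a + w + real m)) \<le>
      (\<Prod>m<n. ?e (a + real m)) * (\<Prod>m<n. (?e (a + real m) / ?e (a + real m - 1)) powr w)" .
    have "(\<Prod>m<n. (?e (a + real m) / ?e (a + real m - 1)) powr w) = (?e (a + real n - 1) / ?e (a - 1)) powr w"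
    proof (induction n)
      case 0 show ?case using pos[of "a - 1"] a h by simp
    next
      case (Suc n)
      have "?e (a + real n - 1) > 0" "?e (a - 1) > 0" "?e (a + real n) > 0" using a by (intro pos; simp)+
      then show ?case unfolding prod.lessThan_Suc Suc.IH
        by (subst powr_mult[symmetric]) (auto simp: add_ac)
    qed
    also have "\<dots> \<le> (1 / ?e (a - 1)) powr w"
      using a w pos[of "a - 1"] pos[of "a + real n - 1"] by (intro powr_mono2 divide_right_mono) auto
    also have "\<dots> = ?e (a - 1) powr (- w)"
      using pos[of "a - 1"] a by (simp add: powr_minus powr_divide field_simps)
    finally have le2: "(\<Prod>m<n. (?e (a + real m) / ?e (a + real m - 1)) powr w) \<le> ?e (a - 1) powr (- w)" .
    have "0 \<le> (\<Prod>m<n. ?e (a + real m))" using a by (intro prod_nonneg ballI less_imp_le[OF pos]) simp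
    from mult_left_mono[OF le2 this] le1 show ?thesis by linarith
  qed
  show ?thesis
    by (rule LIMSEQ_le[OF qpoch_LIMSEQ tendsto_mult_right[OF qpoch_LIMSEQ]]) (use fin in auto)
qed

lemma qnum_pos: "z > 0 \<Longrightarrow> qnum h z > 0"
  unfolding qnum_def using exp_factor by (intro divide_pos_pos) auto

lemma rqGamma_pos: "z > 0 \<Longrightarrow> rqGamma h z > 0"
  unfolding rqGamma_def using qpoch_pos[of z] qpoch_pos[of 1] exp_factor(2) by (intro mult_pos_pos divide_pos_pos) auto

lemma rqGamma_1: "rqGamma h 1 = 1"
  unfolding rqGamma_def using qpoch_pos[of 1] exp_factor(2) by simp

lemma rqGamma_rec:
  assumes z: "z > 0" shows "rqGamma h z = qnum h z * rqGamma h (z + 1)"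
proof -
  have "(1 - exp (- h)) powr z = (1 - exp (- h)) powr (z - 1) * (1 - exp (- h))"
    using exp_factor(2) powr_add[of "1 - exp (- h)" "z - 1" 1] by simp
  then show ?thesis using exp_factor(2)
    by (simp add: rqGamma_def qnum_def qpoch_rec[OF z])
qed

text \<open>The q-analogue of the inequality behind the Bohr-Mollerup theorem, that
  \<open>Gamma (a + w)\<close> is at least \<open>Gamma a * (a - 1) powr w\<close>, stated for
  reciprocals.\<close>

lemma rqGamma_shift_le:
  assumes a: "a > 1" and w: "w \<ge> 0"
  shows "rqGamma h (a + w) \<le> rqGamma h a * qnum h (a - 1) powr (- w)"
proof -
  let ?q = "1 - exp (- h)" and ?r = "1 - exp (- (h * (a - 1)))"
  have q: "?q > 0" "?r > 0" using exp_factor a by auto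
  have "qpoch h (a + w) / qpoch h 1 * ?q powr (a + w - 1) \<le>
     (qpoch h a * ?r powr (- w)) / qpoch h 1 * ?q powr (a + w - 1)"
    using qpoch_shift_le[OF a w] qpoch_pos[of 1] by (intro mult_right_mono divide_right_mono) auto
  also have "\<dots> = rqGamma h a * qnum h (a - 1) powr (- w)"
  proof -
    have "?q powr (a + w - 1) = ?q powr (a - 1) * ?q powr w" using q by (simp add: powr_add[symmetric] algebra_simps)
    moreover have "(?r / ?q) powr (- w) = ?r powr (- w) * ?q powr w"
      using q by (simp add: powr_divide powr_minus field_simps)
    ultimately show ?thesis by (simp add: rqGamma_def qnum_def mult_ac)
  qed
  finally show ?thesis by (simp add: rqGamma_def)
qed

lemma qnum_mono: "z \<le> z' \<Longrightarrow> qnum h z \<le> qnum h z'"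
  unfolding qnum_def using h exp_factor(2) by (intro divide_right_mono) auto

lemma qnum_1: "qnum h 1 = 1" using exp_factor(2) by (simp add: qnum_def)

lemma qnum_add1: "qnum h (z + 1) \<le> qnum h z + 1" if "z \<ge> 0"
proof -
  have "qnum h (z + 1) - qnum h z = exp (- (h * z))"
    using exp_factor(2) unfolding qnum_def
    by (simp add: diff_divide_distrib[symmetric] field_simps exp_add[symmetric] mult_exp_exp)
  moreover have "exp (- (h * z)) \<le> 1" using h that by simp
  ultimately show ?thesis by linarith
qed

text \<open>A bound uniform in \<open>h\<close>, needed for domination. From 2 onwards the shift
  inequality gives at most 1; below 2 two steps of the recursion cost factors of at most 2 and
  3.\<close>

lemma rqGamma_le:
  assumes z: "z > 0" shows "rqGamma h z \<le> 6"
proof -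
  have r2: "rqGamma h 2 = 1" using rqGamma_rec[of 1] by (simp add: rqGamma_1 qnum_1)
  have big: "rqGamma h z \<le> 1" if "z \<ge> 2" for z
    using rqGamma_shift_le[of 2 "z - 2"] that by (simp add: r2 qnum_1)
  show ?thesis
  proof (cases "z \<ge> 2")
    case True then show ?thesis using big[of z] by simp
  next
    case False
    have q2: "qnum h 2 \<le> 2" using qnum_add1[of 1] by (simp add: qnum_1)
    have q3: "qnum h 3 \<le> 3" using qnum_add1[of 2] q2 by simp
    have "rqGamma h z = qnum h z * (qnum h (z + 1) * rqGamma h (z + 2))"
      using rqGamma_rec[of z] rqGamma_rec[of "z + 1"] z by (simp add: add.assoc)
    also have "\<dots> \<le> 2 * (3 * 1)"
    proof (intro mult_mono mult_nonneg_nonneg)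
      show "qnum h z \<le> 2" using qnum_mono[of z 2] False q2 by linarith
      show "qnum h (z + 1) \<le> 3" using qnum_mono[of "z + 1" 3] False q3 by linarith
      show "rqGamma h (z + 2) \<le> 1" using big z by simp
    qed (use z in \<open>auto intro!: less_imp_le[OF qnum_pos] less_imp_le[OF rqGamma_pos]\<close>)
    finally show ?thesis by simp
  qed
qed

lemma rqGamma_prod:
  assumes z: "z > 0" shows "rqGamma h z = (\<Prod>i<n. qnum h (z + real i)) * rqGamma h (z + real n)"
proof (induction n)
  case (Suc n)
  then show ?case using rqGamma_rec[of "z + real n"] z by (simp add: add_ac)
qed simp

lemma rqGamma_Suc: "rqGamma h (real n + 1) = 1 / (\<Prod>i<n. qnum h (real i + 1))"
proof -
  define P where "P = (\<Prod>i<n. qnum h (real i + 1))"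
  have e: "1 = P * rqGamma h (real n + 1)"
    using rqGamma_prod[of 1 n] rqGamma_1 by (simp add: P_def add.commute)
  then have "P \<noteq> 0" by auto
  then show ?thesis using e unfolding P_def[symmetric] by (simp add: nonzero_eq_divide_eq mult.commute)
qed

lemma rqGamma_prod_Suc:
  assumes z: "z > 0"
  shows "rqGamma h z = (\<Prod>i<Suc n. qnum h (z + real i)) * rqGamma h (real n + 1 + z)"
    "0 \<le> (\<Prod>i<Suc n. qnum h (z + real i))"
proof -
  have "z + real (Suc n) = real n + 1 + z" by simp
  then show "rqGamma h z = (\<Prod>i<Suc n. qnum h (z + real i)) * rqGamma h (real n + 1 + z)"
    using rqGamma_prod[OF z, of "Suc n"] by (simp only:)
  show "0 \<le> (\<Prod>i<Suc n. qnum h (z + real i))"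
    using z by (intro prod_nonneg ballI less_imp_le[OF qnum_pos]) auto
qed

text \<open>Moving \<open>n + 1\<close> steps out and comparing with the integer point
  \<open>n + 1\<close> leaves finitely many q-numbers, whose limits as \<open>h\<close> tends to 0
  are immediate for fixed \<open>n\<close>.\<close>

lemma rqGamma_upper:
  assumes z: "z > 0" and n: "n > 0"
  shows "rqGamma h z \<le> (\<Prod>i<Suc n. qnum h (z + real i)) * (1 / (\<Prod>i<n. qnum h (real i + 1)) * qnum h (real n) powr (- z))"
proof -
  have "rqGamma h (real n + 1 + z) \<le> rqGamma h (real n + 1) * qnum h (real n) powr (- z)"
    using rqGamma_shift_le[of "real n + 1" z] z n by simp
  then show ?thesis unfolding rqGamma_prod_Suc(1)[OF z, of n] rqGamma_Suc
    by (rule mult_left_mono) (rule rqGamma_prod_Suc(2)[OF z])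
qed

text \<open>The shift inequality bounds only the larger argument, so the comparison goes from
  \<open>n + 1 + z\<close> up to the integer point \<open>n + m + 1\<close>.\<close>

lemma rqGamma_lower:
  assumes z: "z > 0" and m: "z \<le> real m"
  shows "(\<Prod>i<Suc n. qnum h (z + real i)) * (1 / (\<Prod>i<n + m. qnum h (real i + 1)) * qnum h (real n + z) powr (real m - z)) \<le> rqGamma h z"
proof -
  define Q where "Q = qnum h (real n + z)"
  have q: "Q > 0" unfolding Q_def using z by (intro qnum_pos) simp
  have "rqGamma h (real (n + m) + 1) \<le> rqGamma h (real n + 1 + z) * Q powr (- (real m - z))"
    using rqGamma_shift_le[of "real n + 1 + z" "real m - z"] z m by (simp add: add_ac Q_def)
  then have "rqGamma h (real (n + m) + 1) * Q powr (real m - z) \<le>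
      (rqGamma h (real n + 1 + z) * Q powr (- (real m - z))) * Q powr (real m - z)"
    by (rule mult_right_mono) simp
  also have "\<dots> = rqGamma h (real n + 1 + z) * (Q powr (- (real m - z)) * Q powr (real m - z))"
    by (rule mult.assoc)
  also have "Q powr (- (real m - z)) * Q powr (real m - z) = 1"
    using q by (simp add: powr_add[symmetric])
  finally have "1 / (\<Prod>i<n + m. qnum h (real i + 1)) * Q powr (real m - z) \<le> rqGamma h (real n + 1 + z)"
    unfolding rqGamma_Suc by simp
  then show ?thesis unfolding rqGamma_prod_Suc(1)[OF z, of n] Q_def
    by (rule mult_left_mono) (rule rqGamma_prod_Suc(2)[OF z])
qed

end

lemma qnum_tendsto: "((\<lambda>h. qnum h z) \<longlongrightarrow> z) (at_right 0)"
proof -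
  have d: "((\<lambda>h. (1 - exp (- (h * c))) / h) \<longlongrightarrow> c) (at_right 0)" for c :: real
  proof -
    have "((\<lambda>h. 1 - exp (- (h * c))) has_field_derivative c) (at 0)"
      by (auto intro!: derivative_eq_intros)
    then have "((\<lambda>h. (1 - exp (- (h * c))) / h) \<longlongrightarrow> c) (at 0)"
      by (simp add: has_field_derivative_iff)
    then show ?thesis by (rule filterlim_mono) (auto simp: at_le)
  qed
  have "((\<lambda>h. ((1 - exp (- (h * z))) / h) / ((1 - exp (- (h * 1))) / h)) \<longlongrightarrow> z / 1) (at_right 0)"
    by (intro tendsto_divide d) simp
  moreover have "eventually (\<lambda>h. ((1 - exp (- (h * z))) / h) / ((1 - exp (- (h * 1))) / h) = qnum h z) (at_right 0)"
    by (auto simp: eventually_at_filter qnum_def)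
  ultimately show ?thesis using Lim_transform_eventually by fastforce
qed

text \<open>For fixed \<open>n\<close> the two bounds converge as \<open>h\<close> tends to 0, the
  upper one to \<open>rGamma_series z n\<close>, the lower one to \<open>r n\<close> times it. Since
  \<open>n\<close> is chosen before \<open>h\<close> becomes small, no uniformity in
  \<open>h\<close> is involved.\<close>

lemma rqGamma_tendsto:
  assumes z: "z > 0"
  shows "((\<lambda>h. rqGamma h z) \<longlongrightarrow> rGamma z) (at_right 0)"
proof -
  define m where "m = nat \<lceil>z\<rceil>"
  have m: "z \<le> real m" unfolding m_def by linarith
  define U where "U n h = (\<Prod>i<Suc n. qnum h (z + real i)) * (1 / (\<Prod>i<n. qnum h (real i + 1)) * qnum h (real n) powr (- z))" for n h
  define L where "L n h = (\<Prod>i<Suc n. qnum h (z + real i)) * (1 / (\<Prod>i<n + m. qnum h (real i + 1)) * qnum h (real n + z) powr (real m - z))" for n h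
  have fact_eq: "(\<Prod>i<n. real i + 1) = fact n" for n by (induction n) (auto simp: add_ac)
  have Ulim: "(U n \<longlongrightarrow> rGamma_series z n) (at_right 0)" if n: "n > 0" for n
  proof -
    have "(U n \<longlongrightarrow> (\<Prod>i<Suc n. z + real i) * (1 / (\<Prod>i<n. real i + 1) * real n powr (- z))) (at_right 0)"
      unfolding U_def
      by (intro tendsto_intros qnum_tendsto tendsto_powr) (use n in \<open>auto simp: fact_eq\<close>)
    also have "(\<Prod>i<Suc n. z + real i) * (1 / (\<Prod>i<n. real i + 1) * real n powr (- z)) = rGamma_series z n"
      using n unfolding fact_eq rGamma_series_def pochhammer_prod
      by (simp add: powr_def exp_minus field_simps lessThan_atLeast0)
    finally show ?thesis .
  qed
  \<comment> \<open>The quotient of the limits of the lower and the upper bound; it tends to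
    1.\<close>
  define r where "r n = (real n powr z * (real n + z) powr (- z)) * (\<Prod>i<m. (real n + z) / (real n + real i + 1))" for n
  have Llim: "(L n \<longlongrightarrow> rGamma_series z n * r n) (at_right 0)" if n: "n > 0" for n
  proof -
    have "(L n \<longlongrightarrow> (\<Prod>i<Suc n. z + real i) * (1 / (\<Prod>i<n + m. real i + 1) * (real n + z) powr (real m - z))) (at_right 0)"
      unfolding L_def
      by (intro tendsto_intros qnum_tendsto tendsto_powr) (use n z in \<open>auto simp: fact_eq\<close>)
    also have "(\<Prod>i<n + m. real i + 1) = fact n * (\<Prod>i<m. real n + real i + 1)"
    proof (induction m)
      case 0 show ?case by (simp add: fact_eq)
    next
      case (Suc m) then show ?case by (simp add: add_ac)
    qed
    also have "(\<Prod>i<Suc n. z + real i) * (1 / (fact n * (\<Prod>i<m. real n + real i + 1)) * (real n + z) powr (real m - z)) = rGamma_series z n * r n"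
    proof -
      have "(real n + z) powr (real m - z) = (real n + z) powr (- z) * (real n + z) ^ m"
        using z by (simp add: powr_diff powr_minus powr_realpow divide_inverse)
      moreover have "rGamma_series z n * real n powr z = (\<Prod>i<Suc n. z + real i) / fact n"
        using n unfolding rGamma_series_def pochhammer_prod by (simp add: powr_def lessThan_atLeast0)
      moreover have "rGamma_series z n * r n = (rGamma_series z n * real n powr z) *
          ((real n + z) powr (- z) * (real n + z) ^ m / (\<Prod>i<m. real n + real i + 1))"
        by (simp add: r_def prod_dividef mult_ac)
      ultimately show ?thesis by simp
    qed
    finally show ?thesis .
  qed
  have rlim: "r \<longlonglongrightarrow> 1"
  proof -
    have a: "(\<lambda>n. (real n + z) / (real n + real i + 1)) \<longlonglongrightarrow> 1" for i by real_asymp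
    have b: "(\<lambda>n. real n powr z * (real n + z) powr (- z)) \<longlonglongrightarrow> 1" using z by real_asymp
    have "r \<longlonglongrightarrow> 1 * (\<Prod>i<m. 1)" unfolding r_def by (intro tendsto_intros a b)
    then show ?thesis by simp
  qed
  have ev: "eventually (\<lambda>h::real. h > 0) (at_right 0)" by (auto simp: eventually_at_filter)
  have rl: "(\<lambda>n. rGamma_series z n * r n) \<longlonglongrightarrow> rGamma z" using tendsto_mult[OF rGamma_series_LIMSEQ rlim, of z] by simp
  show ?thesis
  proof (rule order_tendstoI)
    fix a assume "a < rGamma z"
    then have "eventually (\<lambda>n. a < rGamma_series z n * r n) sequentially" by (rule order_tendstoD(1)[OF rl])
    then obtain n where n: "n > 0" "a < rGamma_series z n * r n"
      using eventually_happens'[OF sequentially_bot eventually_conj[OF eventually_gt_at_top[of "0::nat"]]] by blast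
    have "eventually (\<lambda>h. a < L n h) (at_right 0)" by (rule order_tendstoD(1)[OF Llim[OF n(1)] n(2)])
    with ev show "eventually (\<lambda>h. a < rqGamma h z) (at_right 0)"
      by eventually_elim (use rqGamma_lower[OF _ z m] in \<open>auto simp: L_def intro: less_le_trans\<close>)
  next
    fix a assume "a > rGamma z"
    then have "eventually (\<lambda>n. a > rGamma_series z n) sequentially" by (rule order_tendstoD(2)[OF rGamma_series_LIMSEQ])
    then obtain n where n: "n > 0" "a > rGamma_series z n"
      using eventually_happens'[OF sequentially_bot eventually_conj[OF eventually_gt_at_top[of "0::nat"]]] by blast
    have "eventually (\<lambda>h. a > U n h) (at_right 0)" by (rule order_tendstoD(2)[OF Ulim[OF n(1)] n(2)])
    with ev show "eventually (\<lambda>h. a > rqGamma h z) (at_right 0)"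
      by eventually_elim (use rqGamma_upper[OF _ z n(1)] in \<open>auto simp: U_def intro: le_less_trans\<close>)
  qed
qed

section \<open>Residue expansion of the kernel\<close>

text \<open>Beyond real part 2 the relation \<open>rGamma (z - 1) = (z - 1) * rGamma z\<close> has a
  factor of norm at least 1, so a bound on a compact rectangle propagates to the right.\<close>

lemma rGamma_bounded_half_strip:
  "\<exists>C>0. \<forall>z::complex. 0 \<le> Re z \<longrightarrow> \<bar>Im z\<bar> \<le> h \<longrightarrow> norm (rGamma z) \<le> C"
proof -
  have "compact (rGamma ` cbox (Complex 0 (-h)) (Complex 2 h))"
    by (intro compact_continuous_image continuous_intros compact_cbox)
  then obtain C where C: "C > 0" "\<And>z. z \<in> cbox (Complex 0 (-h)) (Complex 2 h) \<Longrightarrow> norm (rGamma z) \<le> C"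
    using compact_imp_bounded bounded_pos by (metis imageI)
  have "norm (rGamma z) \<le> C" if "0 \<le> Re z" "Re z \<le> 2 + real n" "\<bar>Im z\<bar> \<le> h" for n and z :: complex
    using that
  proof (induction n arbitrary: z)
    case 0 then show ?case by (intro C(2)) (auto simp: in_cbox_complex_iff)
  next
    case (Suc n)
    show ?case
    proof (cases "Re z \<le> 2")
      case True with Suc.prems show ?thesis by (intro C(2)) (auto simp: in_cbox_complex_iff)
    next
      case False
      have "norm (rGamma (z - 1)) \<le> C" by (rule Suc.IH) (use Suc.prems False in auto)
      moreover have "(z - 1) * rGamma z = rGamma (z - 1)" using rGamma_plus1[of "z - 1"] by simp
      moreover have "1 \<le> norm (z - 1)" using complex_Re_le_cmod[of "z - 1"] False by simp
      moreover have "1 * norm (rGamma z) \<le> norm (z - 1) * norm (rGamma z)"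
        by (rule mult_right_mono) (use calculation(3) in auto)
      ultimately show ?thesis by (metis mult_1 norm_mult order_trans)
    qed
  qed
  moreover have "Re z \<le> 2 + real (nat \<lceil>Re z\<rceil>)" for z by linarith
  ultimately show ?thesis using C(1) by blast
qed

text \<open>A grid that avoids the poles 0, 1, 2, ... of \<open>Gamma (- u)\<close>: two horizontal
  half-lines and the vertical segments through the half-integers.\<close>

definition between_poles :: "real \<Rightarrow> complex set" where
  "between_poles h = {u. 0 \<le> Re u \<and> \<bar>Im u\<bar> \<le> h \<and> (\<bar>Im u\<bar> = h \<or> (\<exists>n::nat. Re u = real n + 1/2))}"

lemma between_poles_not_pole:
  assumes "h > 0" "u \<in> between_poles h" shows "- u \<notin> \<int>\<^sub>\<le>\<^sub>0"
proof
  assume "- u \<in> \<int>\<^sub>\<le>\<^sub>0"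
  then obtain n where "- u = - of_nat n" by (auto elim: nonpos_Ints_cases')
  then have n: "Re u = real n" "Im u = 0" by auto
  then obtain k :: nat where "real n = real k + 1/2" using assms by (auto simp: between_poles_def)
  then have "2 * real n = 2 * real k + 1" by simp
  then have "2 * n = 2 * k + 1" by (metis of_nat_eq_iff of_nat_add of_nat_mult of_nat_numeral of_nat_1)
  then show False by presburger
qed

text \<open>By \<open>Gamma (1 - u) = - u * Gamma (- u)\<close> each unit step to the right divides
  by a number of norm at least the next integer, and a step back to the left stays in the grid. The
  base is a compact piece of the grid.\<close>

lemma Gamma_bound_between_poles:
  assumes h: "h > 0"
  shows "\<exists>M>0. \<forall>m u. u \<in> between_poles h \<longrightarrow> real m \<le> Re u \<longrightarrow> Re u \<le> real m + 1 \<longrightarrow> norm (Gamma (- u)) \<le> M / fact m"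
proof -
  define K where "K = cbox (Complex 0 (-h)) (Complex 1 h) \<inter> ({u. Im u = h} \<union> {u. Im u = - h} \<union> {u. Re u = 1/2})"
  have Kb: "u \<in> between_poles h" if "u \<in> K" for u
    using that h by (auto simp: K_def between_poles_def in_cbox_complex_iff intro!: exI[of _ 0])
  have "compact K" unfolding K_def
    by (intro compact_Int_closed compact_cbox closed_Un closed_Collect_eq continuous_intros)
  moreover have "continuous_on K (\<lambda>u. Gamma (- u))"
    using between_poles_not_pole[OF h Kb]
    by (intro continuous_on_compose2[OF continuous_on_Gamma[of "uminus ` K"]] continuous_intros) auto
  ultimately have "compact ((\<lambda>u. Gamma (- u)) ` K)" by (rule compact_continuous_image[rotated])
  then obtain M where M: "M > 0" "\<And>u. u \<in> K \<Longrightarrow> norm (Gamma (- u)) \<le> M"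
    using compact_imp_bounded bounded_pos by (metis (no_types, lifting) imageI)
  have "norm (Gamma (- u)) \<le> M / fact m" if "u \<in> between_poles h" "real m \<le> Re u" "Re u \<le> real m + 1" for m u
    using that
  proof (induction m arbitrary: u)
    case 0
    have "Re u = 1/2" if "Re u = real n + 1/2" for n using that 0 by (cases n) auto
    then have "u \<in> K" using 0 by (auto simp: K_def between_poles_def in_cbox_complex_iff)
    then show ?case using M(2) by simp
  next
    case (Suc m)
    have b: "u - 1 \<in> between_poles h"
    proof -
      have "\<exists>k::nat. Re u - 1 = real k + 1/2" if "Re u = real n + 1/2" for n
        using that Suc.prems by (cases n) auto
      then show ?thesis using Suc.prems by (auto simp: between_poles_def)
    qed
    have IH: "norm (Gamma (- (u - 1))) \<le> M / fact m" by (rule Suc.IH[OF b]) (use Suc.prems in auto)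
    have "Gamma (- (u - 1)) = - u * Gamma (- u)"
      using Gamma_plus1[OF between_poles_not_pole[OF h Suc.prems(1)]] by (simp add: algebra_simps)
    then have e: "norm u * norm (Gamma (- u)) \<le> M / fact m" using IH by (simp add: norm_mult)
    have "real (Suc m) \<le> norm u" using complex_Re_le_cmod[of u] Suc.prems by linarith
    then have "real (Suc m) * norm (Gamma (- u)) \<le> M / fact m"
      using mult_right_mono[of "real (Suc m)" "norm u" "norm (Gamma (- u))"] e by simp
    then have "real (Suc m) * norm (Gamma (- u)) * fact m \<le> M" by (simp only: pos_le_divide_eq fact_gt_zero)
    moreover have "norm (Gamma (- u)) * fact (Suc m) = real (Suc m) * norm (Gamma (- u)) * fact m"
      by (simp only: fact_Suc mult_ac)
    ultimately show ?case by (simp only: pos_le_divide_eq fact_gt_zero)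
  qed
  then show ?thesis using M(1) by blast
qed

text \<open>Factorial decay beats every exponential rate: \<open>exp (L m) / fact m\<close> is one
  term of the series of \<open>exp (exp L)\<close>.\<close>

lemma Gamma_exp_bound_between_poles:
  assumes h: "h > 0" and L: "L \<ge> 0"
  shows "\<exists>C>0. \<forall>u\<in>between_poles h. norm (Gamma (- u)) \<le> C * exp (- (L * Re u))"
proof -
  obtain M where M: "M > 0" "\<And>m u. u \<in> between_poles h \<Longrightarrow> real m \<le> Re u \<Longrightarrow> Re u \<le> real m + 1 \<Longrightarrow> norm (Gamma (- u)) \<le> M / fact m"
    using Gamma_bound_between_poles[OF h] by blast
  define C where "C = M * exp L * exp (exp L)"
  have "norm (Gamma (- u)) \<le> C * exp (- (L * Re u))" if u: "u \<in> between_poles h" for u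
  proof -
    define m where "m = nat \<lfloor>Re u\<rfloor>"
    have m: "real m \<le> Re u" "Re u \<le> real m + 1"
      using u by (auto simp: m_def between_poles_def; linarith)+
    have "exp L ^ m / fact m \<le> (\<Sum>k. exp L ^ k /\<^sub>R fact k)"
      using sum_le_suminf[OF summable_exp_generic[of "exp L"], of "{m}"] by (simp add: divide_inverse mult.commute)
    then have "exp L ^ m / fact m \<le> exp (exp L)" by (simp add: exp_def)
    then have em: "exp (L * real m) / fact m \<le> exp (exp L)" by (simp add: exp_of_nat_mult[symmetric] mult.commute)
    have "norm (Gamma (- u)) \<le> M / fact m" using M(2)[OF u m] .
    also have "\<dots> = M * (exp (L * real m) / fact m) * exp (- (L * real m))" by (simp add: exp_minus)
    also have "\<dots> \<le> M * exp (exp L) * exp (- (L * real m))"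
      using em M(1) by (intro mult_right_mono mult_left_mono) auto
    also have "\<dots> \<le> M * exp (exp L) * (exp L * exp (- (L * Re u)))"
    proof -
      have "- (L * real m) \<le> L + - (L * Re u)" using mult_left_mono[OF m(2) L] by (simp add: algebra_simps)
      then show ?thesis using M(1) by (intro mult_left_mono) (auto simp: mult_exp_exp)
    qed
    finally show ?thesis by (simp add: C_def mult_ac)
  qed
  then show ?thesis using M(1) by (intro exI[of _ C]) (auto simp: C_def)
qed

text \<open>Multiplication by \<open>\<i>\<close> carries the horizontal segment to a vertical one,
  where the parametrisation by the imaginary part is at hand.\<close>

lemma horizontal_contour_integral:
  assumes "Im z = c" "Im z' = c" "Re z = a" "Re z' = b" "a < b"
  shows "(f has_contour_integral I) (linepath z z') \<longleftrightarrow> ((\<lambda>x. f (Complex x c)) has_integral I) {a..b}"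
proof -
  have "(f has_contour_integral I) (linepath z z') \<longleftrightarrow>
     ((\<lambda>x. f (linepath z z' x) * (z' - z)) has_integral I) {0..1}"
    by (rule has_contour_integral_linepath)
  also have "\<dots> \<longleftrightarrow> ((\<lambda>x. \<i> * (f (linepath z z' x) * (z' - z))) has_integral (\<i> * I)) {0..1}"
    by (subst has_integral_mult_right_iff) auto
  also have "\<dots> \<longleftrightarrow> ((\<lambda>x. f (- \<i> * linepath (\<i> * z) (\<i> * z') x) * (\<i> * z' - \<i> * z)) has_integral (\<i> * I)) {0..1}"
    by (intro has_integral_cong) (simp add: linepath_def algebra_simps scaleR_conv_of_real)
  also have "\<dots> \<longleftrightarrow> ((\<lambda>w. f (- \<i> * w)) has_contour_integral (\<i> * I)) (linepath (\<i> * z) (\<i> * z'))"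
    by (rule has_contour_integral_linepath[symmetric])
  also have "\<dots> \<longleftrightarrow> ((\<lambda>x. f (- \<i> * Complex (- c) x)) has_integral (- \<i> * (\<i> * I))) {a..b}"
    by (rule has_contour_integral_linepath_same_Re_iff) (use assms in auto)
  also have "(\<lambda>x. f (- \<i> * Complex (- c) x)) = (\<lambda>x. f (Complex x c))"
    by (intro ext arg_cong[where f = f]) (simp add: complex_eq_iff)
  finally show ?thesis by (simp add: mult.assoc[symmetric])
qed

lemma vertical_contour_integral:
  assumes "Re z = c" "Re z' = c" "Im z = a" "Im z' = b" "a < b"
  shows "(f has_contour_integral I) (linepath z z') \<longleftrightarrow> ((\<lambda>x. \<i> * f (Complex c x)) has_integral I) {a..b}"
proof -
  have "(f has_contour_integral I) (linepath z z') \<longleftrightarrow> ((\<lambda>x. f (Complex c x)) has_integral (- \<i> * I)) {a..b}"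
    by (rule has_contour_integral_linepath_same_Re_iff[OF assms])
  also have "\<dots> \<longleftrightarrow> ((\<lambda>x. \<i> * f (Complex c x)) has_integral \<i> * (- \<i> * I)) {a..b}"
    by (subst has_integral_mult_right_iff) auto
  finally show ?thesis by (simp add: mult.assoc[symmetric])
qed

text \<open>The left boundary of the rectangle from \<open>Complex \<delta> (-\<delta>)\<close> to \<open>Complex R \<delta>\<close> is the part
  \<open>\<bar>t\<bar> \<le> R\<close> of the contour, run backwards.\<close>

lemma gamma_plus_truncated:
  assumes d: "0 < \<delta>" "\<delta> < R"
    and cont: "continuous_on (path_image (rectpath (Complex \<delta> (-\<delta>)) (Complex R \<delta>))) f"
  shows "((\<lambda>t. gamma_plus' \<delta> t * f (gamma_plus \<delta> t)) has_integral
     (contour_integral (linepath (Complex R (-\<delta>)) (Complex R \<delta>)) f -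
      contour_integral (rectpath (Complex \<delta> (-\<delta>)) (Complex R \<delta>)) f)) {-R..R}"
proof -
  define a1 a2 a3 a4 where a: "a1 = Complex \<delta> (-\<delta>)" "a2 = Complex R (-\<delta>)" "a3 = Complex R \<delta>" "a4 = Complex \<delta> \<delta>"
  have im: "path_image (rectpath a1 a3) = closed_segment a1 a2 \<union> closed_segment a2 a3 \<union> closed_segment a3 a4 \<union> closed_segment a4 a1"
    by (simp add: rectpath_def Let_def path_image_join a Un_assoc)
  have ci: "f contour_integrable_on (linepath a1 a2)" "f contour_integrable_on (linepath a2 a3)"
    "f contour_integrable_on (linepath a3 a4)" "f contour_integrable_on (linepath a4 a1)"
    "f contour_integrable_on (linepath a4 a3)" "f contour_integrable_on (linepath a1 a4)"
    using cont unfolding a(1)[symmetric] a(3)[symmetric] im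
    by (auto intro!: contour_integrable_continuous_linepath elim!: continuous_on_subset simp: closed_segment_commute)
  define I1 I2 I3 I4 where I: "I1 = contour_integral (linepath a1 a2) f" "I2 = contour_integral (linepath a2 a3) f"
    "I3 = contour_integral (linepath a4 a3) f" "I4 = contour_integral (linepath a1 a4) f"
  have "contour_integral (rectpath a1 a3) f = contour_integral (linepath a1 a2) f + (contour_integral (linepath a2 a3) f +
     (contour_integral (linepath a3 a4) f + contour_integral (linepath a4 a1) f))"
    using ci by (simp add: rectpath_def Let_def a)
  also have "contour_integral (linepath a3 a4) f = - I3"
    unfolding I using contour_integral_reversepath[of "linepath a4 a3" f] by simp
  also have "contour_integral (linepath a4 a1) f = - I4"
    unfolding I using contour_integral_reversepath[of "linepath a1 a4" f] by simp
  finally have rect: "contour_integral (rectpath a1 a3) f = I1 + I2 - I3 - I4" by (simp add: I)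
  have "(f has_contour_integral I1) (linepath a1 a2)" using ci I has_contour_integral_integral by blast
  then have h1: "((\<lambda>x. f (Complex x (-\<delta>))) has_integral I1) {\<delta>..R}"
    by (subst (asm) horizontal_contour_integral[of _ "-\<delta>" _ \<delta> R]) (use d in \<open>auto simp: a\<close>)
  have "(f has_contour_integral I3) (linepath a4 a3)" using ci I has_contour_integral_integral by blast
  then have h3: "((\<lambda>x. f (Complex x \<delta>)) has_integral I3) {\<delta>..R}"
    by (subst (asm) horizontal_contour_integral[of _ \<delta> _ \<delta> R]) (use d in \<open>auto simp: a\<close>)
  have "(f has_contour_integral I4) (linepath a1 a4)" using ci I has_contour_integral_integral by blast
  then have h4: "((\<lambda>x. \<i> * f (Complex \<delta> x)) has_integral I4) {-\<delta>..\<delta>}"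
    by (subst (asm) vertical_contour_integral[of _ \<delta> _ "-\<delta>" \<delta>]) (use d in \<open>auto simp: a\<close>)
  let ?g = "\<lambda>t. gamma_plus' \<delta> t * f (gamma_plus \<delta> t)"
  have "((\<lambda>x. - f (Complex (- x) (-\<delta>))) has_integral - I1) {-R..-\<delta>}"
    by (rule has_integral_neg)
       (use has_integral_reflect_real[where f = "\<lambda>x. f (Complex x (-\<delta>))" and a = \<delta> and b = R] h1 in simp)
  then have g1: "(?g has_integral - I1) {-R..-\<delta>}"
    by (rule has_integral_eq[rotated]) (auto simp: gamma_plus_def gamma_plus'_def)
  have g2: "(?g has_integral I4) {-\<delta>..\<delta>}"
    by (rule has_integral_spike[OF _ _ h4, of "{-\<delta>}"]) (auto simp: gamma_plus_def gamma_plus'_def)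
  have g3: "(?g has_integral I3) {\<delta>..R}"
    by (rule has_integral_spike[OF _ _ h3, of "{\<delta>}"]) (use d in \<open>auto simp: gamma_plus_def gamma_plus'_def\<close>)
  have "(?g has_integral (- I1 + I4)) {-R..\<delta>}"
    by (rule has_integral_combine[OF _ _ g1 g2]) (use d in auto)
  then have "(?g has_integral (- I1 + I4 + I3)) {-R..R}"
    by (rule has_integral_combine[rotated 2]) (use d g3 in auto)
  moreover have "- I1 + I4 + I3 = I2 - contour_integral (rectpath a1 a3) f" by (simp add: rect)
  ultimately show ?thesis by (simp only: a[symmetric] I(2)[symmetric])
qed

text \<open>The poles of the numerator of \<open>F_he\<close>, where its Gamma function is taken at
  \<open>- k\<close>. With \<open>\<theta>\<close> in place of \<open>\<eta>\<close> these are, up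
  to sign, the poles of the reciprocal of \<open>F_he\<close>.\<close>

definition pole :: "real \<Rightarrow> real \<Rightarrow> nat \<Rightarrow> real" where
  "pole \<alpha> \<eta> k = \<alpha> / 2 + \<eta> * (real k + 1/2)"

text \<open>Minus the residue of \<open>F_he\<close> at the pole, because the contour runs clockwise
  around the poles.\<close>

definition residue_coeff :: "real \<Rightarrow> real \<Rightarrow> real \<Rightarrow> nat \<Rightarrow> real" where
  "residue_coeff \<alpha> \<eta> \<theta> k = \<eta> * (-1) ^ k / fact k * rGamma ((\<alpha> / 2 + pole \<alpha> \<eta> k) / \<theta> + 1/2)"

lemma F_he_rGamma:
  "F_he \<alpha> \<eta> \<theta> \<zeta> = Gamma (- (\<zeta> / of_real \<eta> - of_real (\<alpha> / (2 * \<eta>) + 1/2))) *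
     rGamma (of_real (\<alpha> / (2 * \<theta>) + 1/2) + \<zeta> / of_real \<theta>)"
proof -
  have e1: "- (\<zeta> / of_real \<eta> - of_real (\<alpha> / (2 * \<eta>) + 1/2)) = of_real (\<alpha> / (2 * \<eta>)) - \<zeta> / of_real \<eta> + 1/2"
    by simp
  have e2: "of_real (\<alpha> / (2 * \<theta>) + 1/2) + \<zeta> / of_real \<theta> = of_real (\<alpha> / (2 * \<theta>)) + \<zeta> / of_real \<theta> + 1/2"
    by simp
  show ?thesis unfolding F_he_def e1 e2 rGamma_inverse_Gamma by (rule divide_inverse)
qed

lemma F_he_measurable [measurable]: "F_he \<alpha> \<eta> \<theta> \<in> borel_measurable borel"
proof -
  have [measurable]: "(rGamma :: complex \<Rightarrow> complex) \<in> borel_measurable borel"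
    by (intro borel_measurable_continuous_onI continuous_intros)
  have "F_he \<alpha> \<eta> \<theta> = (\<lambda>\<zeta>. inverse (rGamma (of_real (\<alpha> / (2 * \<eta>)) - \<zeta> / of_real \<eta> + 1/2)) *
     rGamma (of_real (\<alpha> / (2 * \<theta>)) + \<zeta> / of_real \<theta> + 1/2))"
    by (intro ext, unfold F_he_def rGamma_inverse_Gamma inverse_inverse_eq, rule divide_inverse)
  then show ?thesis by simp
qed

lemma gamma_plus_measurable [measurable]:
  "gamma_plus \<delta> \<in> borel_measurable borel" "gamma_plus' \<delta> \<in> borel_measurable borel"
  unfolding gamma_plus_def[abs_def] gamma_plus'_def[abs_def] Complex_eq by measurable

lemma integrable_exp_minus_abs: "integrable lborel (\<lambda>t::real. exp (- \<bar>t\<bar>))"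
proof -
  have 1: "integrable lborel (\<lambda>x::real. indicator {0<..} x *\<^sub>R exp (- x))"
    using integrable_I0i_exp_mscale[of 1] by (simp add: set_integrable_def)
  have 2: "integrable lborel (\<lambda>x::real. indicator {0<..} (- x) *\<^sub>R exp x)"
    using lborel_integrable_real_affine[OF 1, of "-1" 0] by simp
  have "integrable lborel (\<lambda>x::real. indicator {0<..} x *\<^sub>R exp (- x) + indicator {0<..} (- x) *\<^sub>R exp x)"
    by (rule Bochner_Integration.integrable_add[OF 1 2])
  then show ?thesis
    by (rule integrable_cong_AE_imp) (auto intro!: AE_I[where N = "{0}"] simp: indicator_def abs_if split: if_splits)
qed

context
  fixes \<alpha> \<eta> \<theta> \<delta> :: real
  assumes eta: "\<eta> > 0" and theta: "\<theta> > 0" and alpha: "\<alpha> \<ge> 0" and delta: "0 < \<delta>" "\<delta> < (\<alpha> + \<eta>) / 2"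
begin

text \<open>All points at which the integrand has to be bounded: the contour and the vertical
  segments halfway between consecutive poles, along which the truncated contour is closed.\<close>

definition contour_set :: "complex set" where
  "contour_set = {\<zeta>. \<delta> \<le> Re \<zeta> \<and> \<bar>Im \<zeta>\<bar> \<le> \<delta> \<and>
     (\<bar>Im \<zeta>\<bar> = \<delta> \<or> Re \<zeta> = \<delta> \<or> (\<exists>n. Re \<zeta> = pole \<alpha> \<eta> n + \<eta> / 2))}"

lemma pole_ge: "(\<alpha> + \<eta>) / 2 \<le> pole \<alpha> \<eta> k" "\<delta> < pole \<alpha> \<eta> k" "0 < pole \<alpha> \<eta> k"
proof -
  have "0 \<le> \<eta> * real k" using eta by simp
  then show "(\<alpha> + \<eta>) / 2 \<le> pole \<alpha> \<eta> k" unfolding pole_def by (simp add: algebra_simps)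
  then show "\<delta> < pole \<alpha> \<eta> k" "0 < pole \<alpha> \<eta> k" using delta by linarith+
qed

lemma pole_diff: "pole \<alpha> \<eta> j - pole \<alpha> \<eta> k = \<eta> * (real j - real k)"
  by (simp add: pole_def algebra_simps)

lemma F_he_holomorphic:
  assumes "\<And>k. complex_of_real (pole \<alpha> \<eta> k) \<notin> A"
  shows "F_he \<alpha> \<eta> \<theta> holomorphic_on A"
proof -
  have "- (\<zeta> / of_real \<eta> - of_real (\<alpha> / (2 * \<eta>) + 1/2)) \<notin> \<int>\<^sub>\<le>\<^sub>0" if "\<zeta> \<in> A" for \<zeta>
  proof
    assume "- (\<zeta> / of_real \<eta> - of_real (\<alpha> / (2 * \<eta>) + 1/2)) \<in> \<int>\<^sub>\<le>\<^sub>0"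
    then obtain n where "- (\<zeta> / of_real \<eta> - of_real (\<alpha> / (2 * \<eta>) + 1/2)) = - of_nat n" by (auto elim: nonpos_Ints_cases')
    then have "\<zeta> / of_real \<eta> = of_real (real n + (\<alpha> / (2 * \<eta>) + 1/2))" by (simp add: algebra_simps)
    then have "\<zeta> = of_real (real n + (\<alpha> / (2 * \<eta>) + 1/2)) * of_real \<eta>"
      using eta by (subst (asm) nonzero_divide_eq_eq) auto
    also have "\<dots> = of_real (pole \<alpha> \<eta> n)" unfolding of_real_mult[symmetric] using eta by (simp add: pole_def field_simps)
    finally show False using assms that by auto
  qed
  then show ?thesis unfolding F_he_rGamma[abs_def] using eta theta
    by (intro holomorphic_intros) auto
qed

lemma contour_set_not_pole: "complex_of_real (pole \<alpha> \<eta> k) \<notin> contour_set"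
proof
  assume "complex_of_real (pole \<alpha> \<eta> k) \<in> contour_set"
  then obtain n where "pole \<alpha> \<eta> k = pole \<alpha> \<eta> n + \<eta> / 2"
    using pole_ge(2)[of k] delta by (auto simp: contour_set_def)
  then have "\<eta> * (real k - real n) = \<eta> * (1 / 2)" using pole_diff[of k n] by simp
  then have "2 * real k = 2 * real n + 1" using eta by simp
  then have "2 * k = 2 * n + 1" by (metis of_nat_eq_iff of_nat_add of_nat_mult of_nat_numeral of_nat_1)
  then show False by presburger
qed

lemma gamma_plus_contour: "gamma_plus \<delta> t \<in> contour_set" "\<bar>t\<bar> \<le> Re (gamma_plus \<delta> t)"
  using delta by (auto simp: gamma_plus_def contour_set_def)

lemma norm_gamma_plus' [simp]: "norm (gamma_plus' \<delta> t) = 1"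
  by (simp add: gamma_plus'_def)

text \<open>Up to the first pole \<open>c\<close> the points lie in a compact set free of poles;
  beyond it \<open>u = (\<zeta> - c) / \<eta>\<close> stays on the grid
  \<open>between_poles\<close>. The rate \<open>L\<close> is arbitrary, so every exponential weight
  can be absorbed.\<close>

lemma F_he_bound:
  assumes L: "L \<ge> 0"
  shows "\<exists>C>0. \<forall>\<zeta>\<in>contour_set. norm (F_he \<alpha> \<eta> \<theta> \<zeta>) \<le> C * exp (- (L * Re \<zeta>))"
proof -
  define c where "c = (\<alpha> + \<eta>) / 2"
  have ce: "\<eta> * (\<alpha> / (2 * \<eta>) + 1/2) = c" using eta by (simp add: c_def field_simps)
  obtain C1 where C1: "C1 > 0" "\<And>z::complex. 0 \<le> Re z \<Longrightarrow> \<bar>Im z\<bar> \<le> \<delta> / \<theta> \<Longrightarrow> norm (rGamma z) \<le> C1"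
    using rGamma_bounded_half_strip[of "\<delta> / \<theta>"] by blast
  obtain C2 where C2: "C2 > 0" "\<And>u. u \<in> between_poles (\<delta> / \<eta>) \<Longrightarrow> norm (Gamma (- u)) \<le> C2 * exp (- (L * \<eta> * Re u))"
    using Gamma_exp_bound_between_poles[of "\<delta> / \<eta>" "L * \<eta>"] delta eta L by auto
  define K where "K = cbox (Complex \<delta> (-\<delta>)) (Complex c \<delta>) \<inter> ({u. Im u = \<delta>} \<union> {u. Im u = - \<delta>} \<union> {u. Re u = \<delta>})"
  have "compact K" unfolding K_def
    by (intro compact_Int_closed compact_cbox closed_Un closed_Collect_eq continuous_intros)
  moreover have "continuous_on K (F_he \<alpha> \<eta> \<theta>)"
    by (rule holomorphic_on_imp_continuous_on[OF F_he_holomorphic])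
       (use pole_ge(2) delta in \<open>auto simp: K_def less_imp_neq[symmetric]\<close>)
  ultimately have "compact (F_he \<alpha> \<eta> \<theta> ` K)" by (rule compact_continuous_image[rotated])
  then obtain C3 where C3: "C3 > 0" "\<And>u. u \<in> K \<Longrightarrow> norm (F_he \<alpha> \<eta> \<theta> u) \<le> C3"
    using compact_imp_bounded bounded_pos by (metis (no_types, lifting) imageI)
  have "norm (F_he \<alpha> \<eta> \<theta> \<zeta>) \<le> (C1 * C2 + C3) * exp (L * c) * exp (- (L * Re \<zeta>))" if z: "\<zeta> \<in> contour_set" for \<zeta>
  proof (cases "Re \<zeta> \<le> c")
    case True
    have "Re \<zeta> \<noteq> pole \<alpha> \<eta> n + \<eta> / 2" for n using pole_ge(1)[of n] True eta unfolding c_def by linarith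
    then have "\<bar>Im \<zeta>\<bar> = \<delta> \<or> Re \<zeta> = \<delta>" using z unfolding contour_set_def by blast
    then have "\<zeta> \<in> K" using z True by (auto simp: K_def contour_set_def in_cbox_complex_iff abs_if split: if_splits)
    then have "norm (F_he \<alpha> \<eta> \<theta> \<zeta>) \<le> C3" by (rule C3)
    also have "\<dots> \<le> (C1 * C2 + C3) * 1" using C1 C2 by simp
    also have "\<dots> \<le> (C1 * C2 + C3) * exp (L * c + - (L * Re \<zeta>))"
      using C1 C2 C3 mult_left_mono[OF True L] by (intro mult_left_mono) auto
    finally show ?thesis by (simp only: exp_add mult.assoc)
  next
    case False
    define u where "u = \<zeta> / of_real \<eta> - of_real (\<alpha> / (2 * \<eta>) + 1/2)"
    have Re_u: "\<eta> * Re u = Re \<zeta> - c" using eta ce by (simp add: u_def algebra_simps)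
    have Im_u: "\<bar>Im u\<bar> = \<bar>Im \<zeta>\<bar> / \<eta>" using eta by (simp add: u_def)
    have "0 < \<eta> * Re u" using False Re_u by simp
    then have u0: "0 \<le> Re u" using eta by (simp add: zero_less_mult_iff)
    have "Re u = real n + 1/2" if "Re \<zeta> = pole \<alpha> \<eta> n + \<eta> / 2" for n
    proof -
      have "\<eta> * Re u = \<eta> * (real n + 1/2)" unfolding Re_u that c_def pole_def by (simp add: algebra_simps add_divide_distrib)
      then show ?thesis using eta by simp
    qed
    then have "u \<in> between_poles (\<delta> / \<eta>)"
      using z u0 False delta eta by (auto simp: between_poles_def contour_set_def Im_u divide_right_mono c_def)
    then have g: "norm (Gamma (- u)) \<le> C2 * exp (L * c + - (L * Re \<zeta>))"
      using C2(2)[of u] Re_u by (simp add: mult.assoc algebra_simps)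
    have r: "norm (rGamma (of_real (\<alpha> / (2 * \<theta>) + 1/2) + \<zeta> / of_real \<theta>)) \<le> C1"
      using z delta theta alpha by (intro C1) (auto simp: contour_set_def divide_right_mono)
    have "norm (F_he \<alpha> \<eta> \<theta> \<zeta>) \<le> (C2 * exp (L * c + - (L * Re \<zeta>))) * C1"
      unfolding F_he_rGamma u_def[symmetric] norm_mult using C2(1) by (intro mult_mono g r) auto
    also have "\<dots> \<le> (C1 * C2 + C3) * exp (L * c + - (L * Re \<zeta>))"
      using C3(1) by (simp add: algebra_simps)
    finally show ?thesis by (simp only: exp_add mult.assoc)
  qed
  then show ?thesis using C1(1) C2(1) C3(1)
    by (intro exI[of _ "(C1 * C2 + C3) * exp (L * c)"]) (auto intro!: mult_pos_pos add_pos_pos)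
qed

context
  fixes w :: "complex \<Rightarrow> complex" and B L :: real
  assumes w_holo: "w holomorphic_on {\<zeta>. 0 < Re \<zeta>}" and w_meas: "w \<in> borel_measurable borel"
    and w_bound: "\<And>\<zeta>. \<delta> \<le> Re \<zeta> \<Longrightarrow> norm (w \<zeta>) \<le> B * exp (L * Re \<zeta>)" and L: "L \<ge> 0" and B: "B \<ge> 0"
begin

text \<open>Other poles are at distance at least \<open>\<eta>\<close>, so the pole is isolated in
  the disc. The local behaviour is that of Gamma at \<open>- k\<close>, transported by the affine
  argument \<open>s\<close>, whose slope gives the factor \<open>\<eta>\<close> and the
  sign.\<close>

lemma residue_F_he:
  "residue (\<lambda>\<zeta>. F_he \<alpha> \<eta> \<theta> \<zeta> * w \<zeta>) (of_real (pole \<alpha> \<eta> k)) =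
     - (of_real (residue_coeff \<alpha> \<eta> \<theta> k) * w (of_real (pole \<alpha> \<eta> k)))"
proof (rule residue_simple')
  let ?p = "complex_of_real (pole \<alpha> \<eta> k)"
  let ?s = "{\<zeta>. 0 < Re \<zeta>} \<inter> ball ?p \<eta>"
  show "open ?s" by (intro open_Int open_halfspace_Re_gt open_ball)
  show "?p \<in> ?s" using pole_ge(3) eta by simp
  show "(\<lambda>\<zeta>. F_he \<alpha> \<eta> \<theta> \<zeta> * w \<zeta>) holomorphic_on ?s - {?p}"
  proof (intro holomorphic_on_mult F_he_holomorphic)
    fix j
    have "\<eta> \<le> dist ?p (complex_of_real (pole \<alpha> \<eta> j))" if "j \<noteq> k"
    proof -
      have "1 \<le> \<bar>real k - real j\<bar>" using that by linarith
      then have "\<eta> \<le> \<bar>\<eta> * (real k - real j)\<bar>" using eta by (simp add: abs_mult)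
      then show ?thesis by (simp add: dist_complex_def pole_diff norm_mult abs_mult flip: of_real_diff)
    qed
    then show "complex_of_real (pole \<alpha> \<eta> j) \<notin> ?s - {?p}" by (cases "j = k") auto
    show "w holomorphic_on ?s - {?p}" using w_holo by (rule holomorphic_on_subset) auto
  qed
  define s where "s = (\<lambda>\<zeta> :: complex. - (\<zeta> / of_real \<eta> - of_real (\<alpha> / (2 * \<eta>) + 1/2)))"
  have sp: "s \<zeta> + of_nat k = - (\<zeta> - ?p) / of_real \<eta>" for \<zeta>
    using eta by (simp add: s_def pole_def field_simps)
  have "filterlim s (at (- of_nat k)) (at ?p)"
    unfolding filterlim_at
  proof
    have "(s \<longlongrightarrow> s ?p) (at ?p)" unfolding s_def by (intro tendsto_intros) (use eta in auto)
    moreover have "s ?p = - of_nat k" using sp[of ?p] by (simp add: eq_neg_iff_add_eq_0)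
    ultimately show "(s \<longlongrightarrow> - of_nat k) (at ?p)" by simp
    show "eventually (\<lambda>x. s x \<in> UNIV \<and> s x \<noteq> - of_nat k) (at ?p)"
      unfolding eventually_at_filter
    proof (rule always_eventually, intro allI impI conjI UNIV_I)
      fix x assume "x \<noteq> ?p"
      then have "s x + of_nat k \<noteq> 0" unfolding sp using eta by simp
      then show "s x \<noteq> - of_nat k" by (simp add: eq_neg_iff_add_eq_0)
    qed
  qed
  from filterlim_compose[OF Gamma_residues this]
  have "((\<lambda>\<zeta>. Gamma (s \<zeta>) * (s \<zeta> + of_nat k)) \<longlongrightarrow> (-1) ^ k / fact k) (at ?p)" .
  moreover have "w \<midarrow>?p\<rightarrow> w ?p"
    using holomorphic_on_imp_continuous_on[OF w_holo] pole_ge(3)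
    by (simp add: continuous_on_eq_continuous_at open_halfspace_Re_gt isCont_def)
  moreover have "((\<lambda>\<zeta>. rGamma (of_real (\<alpha> / (2 * \<theta>) + 1/2) + \<zeta> / of_real \<theta>)) \<longlongrightarrow>
      rGamma (of_real (\<alpha> / (2 * \<theta>) + 1/2) + ?p / of_real \<theta>)) (at ?p)"
  proof -
    have "continuous_on UNIV (\<lambda>\<zeta>. rGamma (of_real (\<alpha> / (2 * \<theta>) + 1/2) + \<zeta> / of_real \<theta>) :: complex)"
      by (intro continuous_on_compose2[OF continuous_on_rGamma[of UNIV]] continuous_intros) (use theta in auto)
    then show ?thesis by (simp add: continuous_on_eq_continuous_at isCont_def)
  qed
  ultimately have "((\<lambda>\<zeta>. Gamma (s \<zeta>) * (s \<zeta> + of_nat k) * (- of_real \<eta>) *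
      rGamma (of_real (\<alpha> / (2 * \<theta>) + 1/2) + \<zeta> / of_real \<theta>) * w \<zeta>) \<longlongrightarrow>
      (-1) ^ k / fact k * (- of_real \<eta>) * rGamma (of_real (\<alpha> / (2 * \<theta>) + 1/2) + ?p / of_real \<theta>) * w ?p) (at ?p)"
    by (intro tendsto_mult tendsto_const)
  moreover have "Gamma (s \<zeta>) * (s \<zeta> + of_nat k) * (- of_real \<eta>) *
      rGamma (of_real (\<alpha> / (2 * \<theta>) + 1/2) + \<zeta> / of_real \<theta>) * w \<zeta> = F_he \<alpha> \<eta> \<theta> \<zeta> * w \<zeta> * (\<zeta> - ?p)" for \<zeta>
  proof -
    have e: "(s \<zeta> + of_nat k) * (- of_real \<eta>) = \<zeta> - ?p" unfolding sp using eta by simp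
    have "F_he \<alpha> \<eta> \<theta> \<zeta> = Gamma (s \<zeta>) * rGamma (of_real (\<alpha> / (2 * \<theta>) + 1/2) + \<zeta> / of_real \<theta>)"
      by (simp only: F_he_rGamma s_def)
    then show ?thesis by (simp only: e[symmetric] mult_ac)
  qed
  moreover have "(-1) ^ k / fact k * (- of_real \<eta>) * rGamma (of_real (\<alpha> / (2 * \<theta>) + 1/2) + ?p / of_real \<theta>) * w ?p =
     - (of_real (residue_coeff \<alpha> \<eta> \<theta> k) * w ?p)"
  proof -
    have "of_real (\<alpha> / (2 * \<theta>) + 1/2) + ?p / of_real \<theta> = complex_of_real ((\<alpha> / 2 + pole \<alpha> \<eta> k) / \<theta> + 1/2)"
      by (simp add: add_divide_distrib)
    then show ?thesis by (simp only: residue_coeff_def rGamma_complex_of_real) simp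
  qed
  ultimately show "((\<lambda>\<zeta>. F_he \<alpha> \<eta> \<theta> \<zeta> * w \<zeta> * (\<zeta> - ?p)) \<longlongrightarrow> - (of_real (residue_coeff \<alpha> \<eta> \<theta> k) * w ?p)) (at ?p)"
    by simp
qed

lemma integrand_bound:
  "\<exists>C>0. \<forall>\<zeta>\<in>contour_set. norm (F_he \<alpha> \<eta> \<theta> \<zeta> * w \<zeta>) \<le> C * B * exp (- Re \<zeta>)"
proof -
  \<comment> \<open>The rate \<open>L + 1\<close> absorbs the growth of \<open>w\<close> and leaves
    one unit of decay for integrability.\<close>
  obtain C where C: "C > 0" "\<And>\<zeta>. \<zeta> \<in> contour_set \<Longrightarrow> norm (F_he \<alpha> \<eta> \<theta> \<zeta>) \<le> C * exp (- ((L + 1) * Re \<zeta>))"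
    using F_he_bound[of "L + 1"] L by auto
  have "norm (F_he \<alpha> \<eta> \<theta> \<zeta> * w \<zeta>) \<le> C * B * exp (- Re \<zeta>)" if "\<zeta> \<in> contour_set" for \<zeta>
  proof -
    have "norm (F_he \<alpha> \<eta> \<theta> \<zeta> * w \<zeta>) \<le> (C * exp (- ((L + 1) * Re \<zeta>))) * (B * exp (L * Re \<zeta>))"
      unfolding norm_mult using C(1) C(2)[OF that] that
      by (intro mult_mono w_bound) (auto simp: contour_set_def)
    also have "\<dots> = C * B * exp (- ((L + 1) * Re \<zeta>) + L * Re \<zeta>)" by (simp only: exp_add mult_ac)
    finally show ?thesis by (simp add: algebra_simps)
  qed
  then show ?thesis using C(1) by blast
qed

lemma contour_integrable:
  "integrable lborel (\<lambda>t. gamma_plus' \<delta> t * (F_he \<alpha> \<eta> \<theta> (gamma_plus \<delta> t) * w (gamma_plus \<delta> t)))"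
proof -
  obtain C where C: "C > 0" "\<And>\<zeta>. \<zeta> \<in> contour_set \<Longrightarrow> norm (F_he \<alpha> \<eta> \<theta> \<zeta> * w \<zeta>) \<le> C * B * exp (- Re \<zeta>)"
    using integrand_bound by blast
  note w_meas[measurable]
  show ?thesis
  proof (rule Bochner_Integration.integrable_bound[where f = "\<lambda>t. C * B * exp (- \<bar>t\<bar>)"])
    show "integrable lborel (\<lambda>t. C * B * exp (- \<bar>t\<bar>))" using integrable_exp_minus_abs by simp
    show "AE t in lborel. norm (gamma_plus' \<delta> t * (F_he \<alpha> \<eta> \<theta> (gamma_plus \<delta> t) * w (gamma_plus \<delta> t))) \<le> norm (C * B * exp (- \<bar>t\<bar>))"
    proof (rule AE_I2)
      fix t
      have "norm (gamma_plus' \<delta> t * (F_he \<alpha> \<eta> \<theta> (gamma_plus \<delta> t) * w (gamma_plus \<delta> t))) \<le> C * B * exp (- Re (gamma_plus \<delta> t))"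
        using C(2)[OF gamma_plus_contour(1)[of t]] by (simp add: norm_mult)
      also have "\<dots> \<le> C * B * exp (- \<bar>t\<bar>)" using gamma_plus_contour(2)[of t] C(1) B by (intro mult_left_mono) auto
      finally show "norm (gamma_plus' \<delta> t * (F_he \<alpha> \<eta> \<theta> (gamma_plus \<delta> t) * w (gamma_plus \<delta> t))) \<le> norm (C * B * exp (- \<bar>t\<bar>))"
        by simp
    qed
  qed measurable
qed

text \<open>The truncated contour is closed by a vertical segment between two poles, and the residue
  theorem is applied to the rectangle. The rectangle runs against the contour and the residues carry
  a minus sign, so the series appears with a plus. On the closing segment the integrand is of order
  \<open>exp (- R n)\<close>.\<close>

theorem contour_residue_series:
  "(\<lambda>k. of_real (residue_coeff \<alpha> \<eta> \<theta> k) * w (of_real (pole \<alpha> \<eta> k))) sums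
     (1 / (2 * pi * \<i>) * (LINT t|lborel. gamma_plus' \<delta> t * (F_he \<alpha> \<eta> \<theta> (gamma_plus \<delta> t) * w (gamma_plus \<delta> t))))"
proof -
  let ?f = "\<lambda>\<zeta>. F_he \<alpha> \<eta> \<theta> \<zeta> * w \<zeta>"
  let ?G = "\<lambda>t. gamma_plus' \<delta> t * ?f (gamma_plus \<delta> t)"
  define R where "R n = pole \<alpha> \<eta> n + \<eta> / 2" for n
  define a1 a3 where a: "a1 = Complex \<delta> (-\<delta>)" "a3 = (\<lambda>n. Complex (R n) \<delta>)"
  obtain C where C: "C > 0" "\<And>\<zeta>. \<zeta> \<in> contour_set \<Longrightarrow> norm (?f \<zeta>) \<le> C * B * exp (- Re \<zeta>)"
    using integrand_bound by blast
  have R: "\<delta> < R n" for n using pole_ge(2)[of n] eta by (simp add: R_def)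
  have path: "path_image (rectpath a1 (a3 n)) \<subseteq> contour_set" for n
  proof -
    have "path_image (rectpath a1 (a3 n)) = {z. Re z \<in> {\<delta>, R n} \<and> Im z \<in> {-\<delta>..\<delta>}} \<union> {z. Im z \<in> {-\<delta>, \<delta>} \<and> Re z \<in> {\<delta>..R n}}"
      using delta R[of n] by (subst path_image_rectpath) (auto simp: a)
    then show ?thesis using R[of n] delta by (auto simp: contour_set_def R_def abs_if)
  qed
  have cont: "continuous_on (path_image (rectpath a1 (a3 n))) ?f" for n
  proof (intro continuous_intros)
    show "continuous_on (path_image (rectpath a1 (a3 n))) (F_he \<alpha> \<eta> \<theta>)"
      by (rule holomorphic_on_imp_continuous_on[OF F_he_holomorphic]) (use contour_set_not_pole path in blast)
    show "continuous_on (path_image (rectpath a1 (a3 n))) w"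
      by (rule continuous_on_subset[OF holomorphic_on_imp_continuous_on[OF w_holo]])
         (use path[of n] delta in \<open>force simp: contour_set_def\<close>)
  qed
  have rect: "contour_integral (rectpath a1 (a3 n)) ?f = - (2 * pi * \<i>) * (\<Sum>k\<le>n. of_real (residue_coeff \<alpha> \<eta> \<theta> k) * w (of_real (pole \<alpha> \<eta> k)))" for n
  proof -
    \<comment> \<open>A strip around the rectangle that contains exactly the poles with index at
      most \<open>n\<close>.\<close>
    let ?S = "{\<zeta>. 0 < Re \<zeta> \<and> Re \<zeta> < pole \<alpha> \<eta> (Suc n)}"
    let ?p = "\<lambda>k. complex_of_real (pole \<alpha> \<eta> k)"
    have S: "?S = {\<zeta>. 0 < Re \<zeta>} \<inter> {\<zeta>. Re \<zeta> < pole \<alpha> \<eta> (Suc n)}" by auto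
    have oS: "open ?S" unfolding S by (intro open_Int open_halfspace_Re_gt open_halfspace_Re_lt)
    have cS: "convex ?S" unfolding S by (intro convex_Int convex_halfspace_Re_gt convex_halfspace_Re_lt)
    have Rn: "R n < pole \<alpha> \<eta> (Suc n)" using pole_diff[of "Suc n" n] eta by (simp add: R_def)
    have pS: "path_image (rectpath a1 (a3 n)) \<subseteq> ?S"
    proof
      fix z assume "z \<in> path_image (rectpath a1 (a3 n))"
      then have "z \<in> cbox a1 (a3 n)" using path_image_rectpath_subset_cbox[of a1 "a3 n"] R[of n] delta by (auto simp: a)
      then show "z \<in> ?S" using Rn delta by (auto simp: in_cbox_complex_iff a)
    qed
    have inj: "inj_on ?p {..n}"
    proof (rule inj_onI)
      fix j k assume "?p j = ?p k"
      then have "\<eta> * (real j - real k) = 0" using pole_diff[of j k] by simp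
      then show "j = k" using eta by simp
    qed
    have "contour_integral (rectpath a1 (a3 n)) ?f =
       2 * pi * \<i> * (\<Sum>p\<in>?p ` {..n}. winding_number (rectpath a1 (a3 n)) p * residue ?f p)"
    proof (rule Residue_theorem[of ?S])
      show "connected ?S" using cS by (rule convex_connected)
      show "?f holomorphic_on ?S - ?p ` {..n}"
      proof (intro holomorphic_on_mult F_he_holomorphic)
        fix k show "?p k \<notin> ?S - ?p ` {..n}"
        proof
          assume k: "?p k \<in> ?S - ?p ` {..n}"
          then have "\<eta> * (real k - real (Suc n)) < 0" using pole_diff[of k "Suc n"] by simp
          then have "k < Suc n" using eta by (simp add: mult_less_0_iff)
          then show False using k by auto
        qed
        show "w holomorphic_on ?S - ?p ` {..n}" using w_holo by (rule holomorphic_on_subset) auto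
      qed
      show "path_image (rectpath a1 (a3 n)) \<subseteq> ?S - ?p ` {..n}" using pS path[of n] contour_set_not_pole by blast
      show "\<forall>z. z \<notin> ?S \<longrightarrow> winding_number (rectpath a1 (a3 n)) z = 0"
        using winding_number_zero_outside[OF _ cS _ _ pS] by simp
    qed (use oS in auto)
    also have "(\<Sum>p\<in>?p ` {..n}. winding_number (rectpath a1 (a3 n)) p * residue ?f p) =
       (\<Sum>k\<le>n. winding_number (rectpath a1 (a3 n)) (?p k) * residue ?f (?p k))"
      using inj by (simp add: sum.reindex)
    also have "\<dots> = (\<Sum>k\<le>n. - (of_real (residue_coeff \<alpha> \<eta> \<theta> k) * w (?p k)))"
    proof (intro sum.cong refl)
      fix k assume "k \<in> {..n}"
      then have "\<eta> * (real k - real n) \<le> 0" using eta by (simp add: mult_le_0_iff)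
      then have "pole \<alpha> \<eta> k < R n" using pole_diff[of k n] eta by (simp add: R_def)
      then have "?p k \<in> box a1 (a3 n)" using pole_ge(2)[of k] delta by (simp add: in_box_complex_iff a)
      then show "winding_number (rectpath a1 (a3 n)) (?p k) * residue ?f (?p k) = - (of_real (residue_coeff \<alpha> \<eta> \<theta> k) * w (?p k))"
        by (simp add: winding_number_rectpath residue_F_he)
    qed
    finally show ?thesis by (simp add: sum_negf)
  qed
  define V where "V n = contour_integral (linepath (Complex (R n) (-\<delta>)) (Complex (R n) \<delta>)) ?f" for n
  have "norm (V n) \<le> C * B * exp (- R n) * norm (Complex (R n) \<delta> - Complex (R n) (-\<delta>))" for n
    unfolding V_def
  proof (rule contour_integral_bound_linepath)
    have seg: "closed_segment (Complex (R n) (-\<delta>)) (Complex (R n) \<delta>) \<subseteq> path_image (rectpath a1 (a3 n))"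
      by (auto simp: rectpath_def Let_def path_image_join a)
    show "?f contour_integrable_on linepath (Complex (R n) (-\<delta>)) (Complex (R n) \<delta>)"
      by (rule contour_integrable_continuous_linepath) (rule continuous_on_subset[OF cont seg])
    show "0 \<le> C * B * exp (- R n)" using C(1) B by simp
    fix x assume x: "x \<in> closed_segment (Complex (R n) (-\<delta>)) (Complex (R n) \<delta>)"
    then have "Re x = R n" by (auto simp: closed_segment_same_Re)
    then show "norm (?f x) \<le> C * B * exp (- R n)" using C(2)[of x] seg path[of n] x by auto
  qed
  moreover have "(\<lambda>n. C * B * exp (- R n) * norm (Complex (R n) \<delta> - Complex (R n) (-\<delta>))) \<longlonglongrightarrow> 0"
  proof -
    have "norm (Complex (R n) \<delta> - Complex (R n) (-\<delta>)) = 2 * \<delta>" for n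
    proof -
      have "Complex (R n) \<delta> - Complex (R n) (-\<delta>) = of_real (2 * \<delta>) * \<i>" by (simp add: complex_eq_iff)
      then show ?thesis using delta by (simp add: norm_mult)
    qed
    moreover have "(\<lambda>n. C * B * exp (- R n) * (2 * \<delta>)) \<longlonglongrightarrow> C * B * 0 * (2 * \<delta>)"
    proof (intro tendsto_intros)
      have "filterlim (\<lambda>n. (\<alpha> / 2 + \<eta>) + \<eta> * real n) at_top sequentially"
        by (intro filterlim_tendsto_add_at_top[OF tendsto_const] filterlim_tendsto_pos_mult_at_top[OF tendsto_const eta] filterlim_real_sequentially)
      moreover have "R = (\<lambda>n. (\<alpha> / 2 + \<eta>) + \<eta> * real n)" by (simp add: fun_eq_iff R_def pole_def algebra_simps)
      ultimately have "filterlim R at_top sequentially" by simp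
      then show "(\<lambda>n. exp (- R n)) \<longlonglongrightarrow> 0"
        by (intro filterlim_compose[OF exp_at_bot] filterlim_compose[OF filterlim_uminus_at_bot_at_top])
    qed
    ultimately show ?thesis by simp
  qed
  ultimately have V0: "V \<longlonglongrightarrow> 0" by (rule Lim_null_comparison[OF always_eventually, rule_format])
  have fin: "(LINT t|lborel. indicator {- R n..R n} t *\<^sub>R ?G t) =
     V n + 2 * pi * \<i> * (\<Sum>k\<le>n. of_real (residue_coeff \<alpha> \<eta> \<theta> k) * w (of_real (pole \<alpha> \<eta> k)))" for n
  proof -
    have "set_integrable lborel {- R n..R n} ?G"
      unfolding set_integrable_def by (rule integrable_mult_indicator[OF _ contour_integrable]) simp
    then have "(LINT t|lborel. indicator {- R n..R n} t *\<^sub>R ?G t) = integral {- R n..R n} ?G"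
      using set_borel_integral_eq_integral(2) by (simp add: set_lebesgue_integral_def)
    also have "\<dots> = V n - contour_integral (rectpath a1 (a3 n)) ?f"
      unfolding V_def a using gamma_plus_truncated[OF delta(1) R[of n], of ?f] cont[of n] by (intro integral_unique) (simp add: a)
    finally show ?thesis by (simp add: rect)
  qed
  have "(\<lambda>n. LINT t|lborel. indicator {- R n..R n} t *\<^sub>R ?G t) \<longlonglongrightarrow> (LINT t|lborel. ?G t)"
  proof (rule integral_dominated_convergence[where w = "\<lambda>t. norm (?G t)"])
    show "AE t in lborel. (\<lambda>n. indicator {- R n..R n} t *\<^sub>R ?G t) \<longlonglongrightarrow> ?G t"
    proof (rule AE_I2, rule tendsto_eventually)
      fix t :: real
      obtain n0 where n0: "\<bar>t\<bar> \<le> \<eta> * real n0" using reals_Archimedean3[OF eta, rule_format, of "\<bar>t\<bar>"] by (auto simp: mult.commute intro: less_imp_le)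
      show "eventually (\<lambda>n. indicator {- R n..R n} t *\<^sub>R ?G t = ?G t) sequentially"
        using eventually_ge_at_top[of n0]
      proof eventually_elim
        case (elim n)
        have "\<eta> * real n0 \<le> \<eta> * real n" using elim eta by simp
        moreover have "R n = \<eta> * real n + \<eta> + \<alpha> / 2" by (simp add: R_def pole_def algebra_simps)
        ultimately have "\<bar>t\<bar> \<le> R n" using n0 alpha eta by linarith
        then have "t \<in> {- R n..R n}" by auto
        then show ?case by simp
      qed
    qed
    show "AE t in lborel. norm (indicator {- R n..R n} t *\<^sub>R ?G t) \<le> norm (?G t)" for n
      by (auto simp: indicator_def)
  qed (use contour_integrable in \<open>auto intro: borel_measurable_integrable integrable_norm\<close>)
  from tendsto_diff[OF this V0]
  have "(\<lambda>n. 2 * pi * \<i> * (\<Sum>k\<le>n. of_real (residue_coeff \<alpha> \<eta> \<theta> k) * w (of_real (pole \<alpha> \<eta> k)))) \<longlonglongrightarrow> (LINT t|lborel. ?G t)"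
    unfolding fin by simp
  then have "(\<lambda>n. 1 / (2 * pi * \<i>) * (2 * pi * \<i> * (\<Sum>k\<le>n. of_real (residue_coeff \<alpha> \<eta> \<theta> k) * w (of_real (pole \<alpha> \<eta> k))))) \<longlonglongrightarrow> 1 / (2 * pi * \<i>) * (LINT t|lborel. ?G t)"
    by (intro tendsto_intros)
  then show ?thesis unfolding sums_def_le by simp
qed

end

end

text \<open>The argument of \<open>rGamma\<close> is nonnegative, where \<open>rGamma\<close> is
  bounded, so only the factorial from the residue of Gamma is left.\<close>

lemma residue_coeff_bound:
  assumes "\<eta> > 0" "\<theta> > 0" "\<alpha> \<ge> 0"
  shows "\<exists>C>0. \<forall>k. \<bar>residue_coeff \<alpha> \<eta> \<theta> k\<bar> \<le> C / fact k"
proof -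
  obtain C where C: "C > 0" "\<And>z::complex. 0 \<le> Re z \<Longrightarrow> \<bar>Im z\<bar> \<le> 0 \<Longrightarrow> norm (rGamma z) \<le> C"
    using rGamma_bounded_half_strip[of 0] by blast
  have "\<bar>residue_coeff \<alpha> \<eta> \<theta> k\<bar> \<le> \<eta> * C / fact k" for k
  proof -
    define z where "z = (\<alpha> / 2 + pole \<alpha> \<eta> k) / \<theta> + 1/2"
    have z: "z \<ge> 0" using assms by (simp add: z_def pole_def)
    have "norm (rGamma (complex_of_real z)) \<le> C" using z by (intro C) auto
    then have "\<bar>rGamma z\<bar> \<le> C" by (simp add: rGamma_complex_of_real)
    then show ?thesis using assms
      by (simp add: residue_coeff_def z_def[symmetric] abs_mult power_abs divide_right_mono mult_left_mono)
  qed
  then show ?thesis using C assms by (intro exI[of _ "\<eta> * C"]) auto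
qed

lemma exp_pole: "exp (- (s * pole \<alpha> \<eta> k)) = exp (- (s * (\<alpha> / 2 + \<eta> / 2))) * exp (- (s * \<eta>)) ^ k"
  by (simp add: pole_def exp_of_nat_mult[symmetric] mult_exp_exp algebra_simps)

lemma summable_residue_coeff:
  assumes "\<eta> > 0" "\<theta> > 0" "\<alpha> \<ge> 0"
  shows "summable (\<lambda>k. \<bar>residue_coeff \<alpha> \<eta> \<theta> k\<bar> * exp (- (s * pole \<alpha> \<eta> k)))"
proof -
  obtain C where C: "C > 0" "\<And>k. \<bar>residue_coeff \<alpha> \<eta> \<theta> k\<bar> \<le> C / fact k" using residue_coeff_bound[OF assms] by blast
  define D where "D = exp (- (s * \<eta>))"
  have D0: "0 \<le> D" by (simp add: D_def)
  have "summable (\<lambda>k. C * exp (- (s * (\<alpha> / 2 + \<eta> / 2))) * (D ^ k /\<^sub>R fact k))"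
    by (intro summable_mult summable_exp_generic)
  then show ?thesis
  proof (rule summable_comparison_test'[of _ 0])
    fix k :: nat
    have "\<bar>residue_coeff \<alpha> \<eta> \<theta> k\<bar> * exp (- (s * pole \<alpha> \<eta> k)) \<le> C / fact k * exp (- (s * pole \<alpha> \<eta> k))"
      by (intro mult_right_mono C) auto
    then show "norm (\<bar>residue_coeff \<alpha> \<eta> \<theta> k\<bar> * exp (- (s * pole \<alpha> \<eta> k))) \<le> C * exp (- (s * (\<alpha> / 2 + \<eta> / 2))) * (D ^ k /\<^sub>R fact k)"
      unfolding exp_pole D_def[symmetric] real_scaleR_def by (simp add: field_simps abs_mult D0)
  qed
qed

section \<open>Expansion of the kernel by residues in both variables\<close>

lemma gamma_minus_reflect: "gamma_minus \<delta> u = - gamma_plus \<delta> (- u)" if "\<delta> > 0"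
  using that by (auto simp: gamma_minus_def gamma_plus_def complex_eq_iff)

lemma gamma_minus'_reflect: "\<delta> > 0 \<Longrightarrow> u \<noteq> \<delta> \<Longrightarrow> u \<noteq> - \<delta> \<Longrightarrow> gamma_minus' \<delta> u = gamma_plus' \<delta> (- u)"
  by (auto simp: gamma_minus'_def gamma_plus'_def)

lemma gamma_minus'_measurable [measurable]: "gamma_minus' \<delta> \<in> borel_measurable borel"
  unfolding gamma_minus'_def[abs_def] by measurable

text \<open>Changing the sign of the variable interchanges the two Gamma functions. The integral
  over the left contour thus becomes one over the right contour with \<open>\<eta>\<close> and
  \<open>\<theta>\<close> exchanged, and the residue series proved there serves for both.\<close>

lemma F_he_reflect: "1 / F_he \<alpha> \<eta> \<theta> (- \<omega>) = F_he \<alpha> \<theta> \<eta> \<omega>"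
  unfolding F_he_def by simp

lemma exp_powr: "complex_of_real (exp (- x)) powr z = exp (- (of_real x * z))"
proof -
  have "complex_of_real (exp (- x)) powr z = exp (z * Ln (exp (- complex_of_real x)))"
    by (simp add: powr_def exp_of_real[symmetric])
  also have "Ln (exp (- complex_of_real x)) = - of_real x" by (rule Ln_exp) auto
  finally show ?thesis by (simp add: mult.commute)
qed

text \<open>The residue series in \<open>\<zeta>\<close> after \<open>\<omega>\<close> has been
  placed at the pole \<open>- pole \<alpha> \<theta> l\<close>; the denominator is the value of
  \<open>\<zeta> - \<omega>\<close>.\<close>

definition limit_series :: "real \<Rightarrow> real \<Rightarrow> real \<Rightarrow> nat \<Rightarrow> real \<Rightarrow> real" where
  "limit_series \<alpha> \<eta> \<theta> l x = (\<Sum>k. residue_coeff \<alpha> \<eta> \<theta> k * exp (- (x * pole \<alpha> \<eta> k)) / (pole \<alpha> \<eta> k + pole \<alpha> \<theta> l))"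

context
  fixes \<alpha> \<eta> \<theta> \<delta> :: real
  assumes eta: "\<eta> > 0" and theta: "\<theta> > 0" and alpha: "\<alpha> \<ge> 0" and delta: "0 < \<delta>" "\<delta> < (\<alpha> + min \<eta> \<theta>) / 2"
begin

lemma Re_gamma_plus: "\<delta> \<le> Re (gamma_plus \<delta> t)"
  using delta by (auto simp: gamma_plus_def)

lemma weight_props:
  fixes a :: complex and x :: real
  assumes a: "0 \<le> Re a"
  defines "w \<equiv> \<lambda>\<zeta>. exp (- (of_real x * \<zeta>)) / (a + \<zeta>)"
  shows "w holomorphic_on {\<zeta>. 0 < Re \<zeta>}" "w \<in> borel_measurable borel"
    "\<And>\<zeta>. \<delta> \<le> Re \<zeta> \<Longrightarrow> norm (w \<zeta>) \<le> (1 / \<delta>) * exp (\<bar>x\<bar> * Re \<zeta>)"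
proof -
  have "a + \<zeta> \<noteq> 0" if "0 < Re \<zeta>" for \<zeta>
  proof
    assume "a + \<zeta> = 0"
    then have "Re a + Re \<zeta> = 0" by (metis plus_complex.simps(1) zero_complex.simps(1))
    then show False using a that by simp
  qed
  then show "w holomorphic_on {\<zeta>. 0 < Re \<zeta>}" unfolding w_def by (intro holomorphic_intros) auto
  show "w \<in> borel_measurable borel" unfolding w_def by measurable
  fix \<zeta> :: complex assume z: "\<delta> \<le> Re \<zeta>"
  have "- (x * Re \<zeta>) \<le> \<bar>x\<bar> * Re \<zeta>"
    using z delta by (metis abs_ge_minus_self less_eq_real_def minus_mult_left mult_right_mono order_trans)
  moreover have "\<delta> \<le> norm (a + \<zeta>)" using complex_Re_le_cmod[of "a + \<zeta>"] a z by simp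
  ultimately have "exp (- (x * Re \<zeta>)) / norm (a + \<zeta>) \<le> exp (\<bar>x\<bar> * Re \<zeta>) / \<delta>"
    using delta by (intro frac_le) auto
  then show "norm (w \<zeta>) \<le> (1 / \<delta>) * exp (\<bar>x\<bar> * Re \<zeta>)" by (simp add: w_def norm_divide)
qed

text \<open>Serves both contours: for the integral over \<open>\<omega>\<close> the number
  \<open>a\<close> is a point of the other contour, for the integral over \<open>\<zeta>\<close> it
  is a pole. Hence \<open>p\<close> and \<open>r\<close> stand for \<open>\<eta>\<close> and
  \<open>\<theta>\<close> in either order.\<close>

lemma weighted_contour:
  fixes a :: complex and x :: real
  assumes a: "0 \<le> Re a" and p: "p > 0" "r > 0" "\<delta> < (\<alpha> + p) / 2"
  shows "integrable lborel (\<lambda>t. gamma_plus' \<delta> t * (F_he \<alpha> p r (gamma_plus \<delta> t) *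
       (exp (- (of_real x * gamma_plus \<delta> t)) / (a + gamma_plus \<delta> t))))"
    "(\<lambda>k. of_real (residue_coeff \<alpha> p r k) * (exp (- (of_real x * of_real (pole \<alpha> p k))) / (a + of_real (pole \<alpha> p k)))) sums
       (1 / (2 * pi * \<i>) * (LINT t|lborel. gamma_plus' \<delta> t * (F_he \<alpha> p r (gamma_plus \<delta> t) *
         (exp (- (of_real x * gamma_plus \<delta> t)) / (a + gamma_plus \<delta> t)))))"
proof -
  note w = weight_props[OF a, where x = x]
  show "integrable lborel (\<lambda>t. gamma_plus' \<delta> t * (F_he \<alpha> p r (gamma_plus \<delta> t) *
       (exp (- (of_real x * gamma_plus \<delta> t)) / (a + gamma_plus \<delta> t))))"
    by (rule contour_integrable[where w = "\<lambda>\<zeta>. exp (- (of_real x * \<zeta>)) / (a + \<zeta>)" and B = "1 / \<delta>" and L = "\<bar>x\<bar>"])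
       (use p alpha delta w in auto)
  show "(\<lambda>k. of_real (residue_coeff \<alpha> p r k) * (exp (- (of_real x * of_real (pole \<alpha> p k))) / (a + of_real (pole \<alpha> p k)))) sums
       (1 / (2 * pi * \<i>) * (LINT t|lborel. gamma_plus' \<delta> t * (F_he \<alpha> p r (gamma_plus \<delta> t) *
         (exp (- (of_real x * gamma_plus \<delta> t)) / (a + gamma_plus \<delta> t)))))"
    by (rule contour_residue_series[where w = "\<lambda>\<zeta>. exp (- (of_real x * \<zeta>)) / (a + \<zeta>)" and B = "1 / \<delta>" and L = "\<bar>x\<bar>"])
       (use p alpha delta w in auto)
qed

lemma plain_contour_integrable:
  assumes p: "p > 0" "r > 0" "\<delta> < (\<alpha> + p) / 2"
  shows "integrable lborel (\<lambda>t. gamma_plus' \<delta> t * (F_he \<alpha> p r (gamma_plus \<delta> t) * exp (- (of_real x * gamma_plus \<delta> t))))"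
proof (rule contour_integrable[where w = "\<lambda>\<zeta>. exp (- (of_real x * \<zeta>))" and B = 1 and L = "\<bar>x\<bar>"])
  fix \<zeta> :: complex assume z: "\<delta> \<le> Re \<zeta>"
  have "- (x * Re \<zeta>) \<le> \<bar>x\<bar> * Re \<zeta>"
    using z delta by (metis abs_ge_minus_self less_eq_real_def minus_mult_left mult_right_mono order_trans)
  then show "norm (exp (- (of_real x * \<zeta>))) \<le> 1 * exp (\<bar>x\<bar> * Re \<zeta>)" by simp
qed (use p alpha delta in \<open>auto intro!: holomorphic_intros\<close>)

text \<open>After a change of sign in \<open>\<omega>\<close> both contours are
  \<open>gamma_plus\<close>. Fubini separates them; residues are taken first in
  \<open>\<omega>\<close>, the series is integrated term by term, and then residues are taken in
  \<open>\<zeta>\<close>. The prefactor of \<open>K_he_tilde\<close> cancels the square root in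
  \<open>K_he\<close>.\<close>

theorem K_he_tilde_series:
  "K_he_tilde \<alpha> \<eta> \<theta> \<delta> x y =
     (\<Sum>l. of_real (residue_coeff \<alpha> \<theta> \<eta> l * exp (- (y * pole \<alpha> \<theta> l)) * limit_series \<alpha> \<eta> \<theta> l x))"
proof -
  have d1: "\<delta> < (\<alpha> + \<eta>) / 2" and d2: "\<delta> < (\<alpha> + \<theta>) / 2" using delta by (auto simp: min_def split: if_splits)
  define g where "g = gamma_plus \<delta>"
  define P where "P t = gamma_plus' \<delta> t / (2 * pi * \<i>) * (F_he \<alpha> \<eta> \<theta> (g t) * exp (- (of_real x * g t)))" for t
  define Q where "Q t = F_he \<alpha> \<theta> \<eta> (g t) * exp (- (of_real y * g t))" for t
  define E where "E = (\<lambda>(t, u). P t * (gamma_minus' \<delta> u / (2 * pi * \<i>)) * Q (- u) * (1 / (g t + g (- u))))"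
  have [measurable]: "g \<in> borel_measurable borel" by (simp add: g_def)
  have [measurable]: "P \<in> borel_measurable borel" "Q \<in> borel_measurable borel"
    unfolding P_def[abs_def] Q_def[abs_def] by measurable
  have g: "\<delta> \<le> Re (g t)" for t unfolding g_def by (rule Re_gamma_plus)
  have norm_gp: "norm (gamma_plus' \<delta> t) = 1" "norm (gamma_minus' \<delta> t) = 1" for t
    by (auto simp: gamma_plus'_def gamma_minus'_def)
  have P_int: "integrable lborel P"
  proof -
    have "P = (\<lambda>t. 1 / (2 * pi * \<i>) * (gamma_plus' \<delta> t * (F_he \<alpha> \<eta> \<theta> (g t) * exp (- (of_real x * g t)))))"
      by (auto simp: P_def fun_eq_iff)
    then show ?thesis using plain_contour_integrable[OF eta theta d1, of x]
      by (simp only: g_def) (rule integrable_mult_right)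
  qed
  have Q_int: "integrable lborel (\<lambda>u. norm (Q (- u)))"
  proof -
    have "integrable lborel (\<lambda>t. norm (Q t))"
      using integrable_norm[OF plain_contour_integrable[OF theta eta d2, of y]]
      by (simp add: norm_mult norm_gp Q_def g_def)
    from lborel_integrable_real_affine[OF this, of "-1" 0] show ?thesis by simp
  qed
  have E_int: "integrable (lborel \<Otimes>\<^sub>M lborel) E"
  proof (rule Bochner_Integration.integrable_bound)
    show "integrable (lborel \<Otimes>\<^sub>M lborel) (\<lambda>(t, u). norm (P t) * (norm (Q (- u)) / \<delta>))"
    proof (rule lborel_pair.Fubini_integrable)
      show "(\<lambda>(t, u). norm (P t) * (norm (Q (- u)) / \<delta>)) \<in> borel_measurable (lborel \<Otimes>\<^sub>M lborel)" by measurable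
      show "integrable lborel (\<lambda>t. LINT u|lborel. norm (case (t, u) of (t, u) \<Rightarrow> norm (P t) * (norm (Q (- u)) / \<delta>)))"
        using P_int delta by (simp add: abs_mult)
      show "AE t in lborel. integrable lborel (\<lambda>u. case (t, u) of (t, u) \<Rightarrow> norm (P t) * (norm (Q (- u)) / \<delta>))"
        using Q_int by simp
    qed
    show "E \<in> borel_measurable (lborel \<Otimes>\<^sub>M lborel)" unfolding E_def by measurable
    show "AE z in lborel \<Otimes>\<^sub>M lborel. norm (E z) \<le> norm (case z of (t, u) \<Rightarrow> norm (P t) * (norm (Q (- u)) / \<delta>))"
    proof (rule AE_I2, clarify)
      fix t u
      have "norm (1 / (g t + g (- u))) \<le> 1 / \<delta>"
      proof -
        \<comment> \<open>Both points have real part at least \<open>\<delta>\<close>, so the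
          contours stay apart and \<open>1 / (\<zeta> - \<omega>)\<close> is bounded.\<close>
        have "\<delta> \<le> norm (g t + g (- u))"
          using complex_Re_le_cmod[of "g t + g (- u)"] g[of t] g[of "- u"] delta by simp
        then show ?thesis using delta by (simp add: norm_divide frac_le)
      qed
      moreover have "norm (gamma_minus' \<delta> u / (2 * pi * \<i>)) \<le> 1"
        using pi_ge_two by (simp add: norm_divide norm_mult norm_gp)
      ultimately have "norm (P t) * norm (gamma_minus' \<delta> u / (2 * pi * \<i>)) * norm (Q (- u)) * norm (1 / (g t + g (- u)))
         \<le> norm (P t) * 1 * norm (Q (- u)) * (1 / \<delta>)"
        by (intro mult_mono) auto
      then show "norm (E (t, u)) \<le> norm (norm (P t) * (norm (Q (- u)) / \<delta>))"
        unfolding E_def prod.case norm_mult using delta by (simp add: abs_mult)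
    qed
  qed
  have exp_eq: "(\<lambda>(t, u). let \<zeta> = gamma_plus \<delta> t; \<omega> = gamma_minus \<delta> u in
          (gamma_plus' \<delta> t / (2 * pi * \<i>)) * (gamma_minus' \<delta> u / (2 * pi * \<i>)) *
          (F_he \<alpha> \<eta> \<theta> \<zeta> / F_he \<alpha> \<eta> \<theta> \<omega>) *
          (of_real (exp (-x)) powr \<zeta> / of_real (exp (-y)) powr \<omega>) * (1 / (\<zeta> - \<omega>))) = E"
  proof (intro ext, clarify)
    fix t u
    have "F_he \<alpha> \<eta> \<theta> (g t) / F_he \<alpha> \<eta> \<theta> (- g (- u)) = F_he \<alpha> \<eta> \<theta> (g t) * F_he \<alpha> \<theta> \<eta> (g (- u))"
      using F_he_reflect[of \<alpha> \<eta> \<theta> "g (- u)"] by (simp add: divide_inverse)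
    moreover have "of_real (exp (-x)) powr g t / of_real (exp (-y)) powr (- g (- u)) =
        exp (- (of_real x * g t)) * exp (- (of_real y * g (- u)))"
      unfolding exp_powr by (simp add: exp_minus divide_inverse)
    ultimately show "(let \<zeta> = gamma_plus \<delta> t; \<omega> = gamma_minus \<delta> u in
          (gamma_plus' \<delta> t / (2 * pi * \<i>)) * (gamma_minus' \<delta> u / (2 * pi * \<i>)) *
          (F_he \<alpha> \<eta> \<theta> \<zeta> / F_he \<alpha> \<eta> \<theta> \<omega>) *
          (of_real (exp (-x)) powr \<zeta> / of_real (exp (-y)) powr \<omega>) * (1 / (\<zeta> - \<omega>))) = E (t, u)"
      unfolding Let_def gamma_minus_reflect[OF delta(1)] g_def[symmetric] E_def P_def Q_def by simp
  qed
  define c where "c l = residue_coeff \<alpha> \<theta> \<eta> l * exp (- (y * pole \<alpha> \<theta> l))" for l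
  have pole_pos: "0 < pole \<alpha> \<eta> k" "0 < pole \<alpha> \<theta> k" for k
    using eta theta alpha by (auto simp: pole_def intro!: add_nonneg_pos mult_pos_pos)
  have inner: "(LINT u|lborel. E (t, u)) = (\<Sum>l. P t * (of_real (c l) / (g t + of_real (pole \<alpha> \<theta> l))))" for t
  proof -
    let ?h = "\<lambda>s. P t * (gamma_plus' \<delta> s / (2 * pi * \<i>)) * Q s * (1 / (g t + g s))"
    have "(LINT u|lborel. E (t, u)) = (LINT u|lborel. ?h (- u))"
    proof (rule integral_cong_AE)
      show "AE u in lborel. E (t, u) = ?h (- u)"
      \<comment> \<open>At the two corners the chosen one-sided derivatives do not match under
        reflection; they form a null set.\<close>
      proof (rule AE_I[where N = "{\<delta>, - \<delta>}"])
        show "{u \<in> space lborel. E (t, u) \<noteq> ?h (- u)} \<subseteq> {\<delta>, - \<delta>}"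
          using gamma_minus'_reflect[OF delta(1)] by (auto simp: E_def)
      qed (auto intro!: emeasure_lborel_countable)
    qed (simp_all add: E_def)
    also have "\<dots> = (LINT s|lborel. ?h s)" using lborel_integral_real_affine[of "-1" ?h 0] by simp
    also have "?h = (\<lambda>s. P t * (1 / (2 * pi * \<i>)) * (gamma_plus' \<delta> s * (F_he \<alpha> \<theta> \<eta> (gamma_plus \<delta> s) *
         (exp (- (of_real y * gamma_plus \<delta> s)) / (g t + gamma_plus \<delta> s)))))"
      by (auto simp: Q_def g_def fun_eq_iff)
    also have "(LINT s|lborel. \<dots> s) = P t * (1 / (2 * pi * \<i>) * (LINT s|lborel. gamma_plus' \<delta> s * (F_he \<alpha> \<theta> \<eta> (gamma_plus \<delta> s) *
         (exp (- (of_real y * gamma_plus \<delta> s)) / (g t + gamma_plus \<delta> s)))))"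
      unfolding integral_mult_right_zero by (rule mult.assoc)
    also have "\<dots> = (\<Sum>l. P t * (of_real (c l) / (g t + of_real (pole \<alpha> \<theta> l))))"
    proof -
      have "0 \<le> Re (g t)" using g[of t] delta by linarith
      from weighted_contour(2)[OF this theta eta d2, of y]
      have "(\<lambda>l. of_real (c l) / (g t + of_real (pole \<alpha> \<theta> l))) sums (1 / (2 * pi * \<i>) * (LINT s|lborel. gamma_plus' \<delta> s * (F_he \<alpha> \<theta> \<eta> (gamma_plus \<delta> s) *
         (exp (- (of_real y * gamma_plus \<delta> s)) / (g t + gamma_plus \<delta> s)))))"
        by (simp add: c_def exp_of_real[symmetric])
      from sums_unique[OF sums_mult[OF this, of "P t"]] show ?thesis by simp
    qed
    finally show ?thesis .
  qed
  have csum: "summable (\<lambda>l. \<bar>c l\<bar>)"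
    using summable_residue_coeff[OF theta eta alpha, of y] by (simp add: c_def abs_mult)
  have f_eq: "P t * (of_real (c l) / (g t + of_real (pole \<alpha> \<theta> l))) =
     (of_real (c l) * (1 / (2 * pi * \<i>))) * (gamma_plus' \<delta> t * (F_he \<alpha> \<eta> \<theta> (gamma_plus \<delta> t) *
       (exp (- (of_real x * gamma_plus \<delta> t)) / (of_real (pole \<alpha> \<theta> l) + gamma_plus \<delta> t))))" for t l
    by (simp add: P_def g_def add.commute)
  have f_bound: "norm (P t * (of_real (c l) / (g t + of_real (pole \<alpha> \<theta> l)))) \<le> norm (P t) * (\<bar>c l\<bar> / \<delta>)" for t l
  proof -
    have "\<delta> \<le> norm (g t + of_real (pole \<alpha> \<theta> l))"
      using complex_Re_le_cmod[of "g t + of_real (pole \<alpha> \<theta> l)"] g[of t] pole_pos(2)[of l] by simp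
    then have "\<bar>c l\<bar> / norm (g t + of_real (pole \<alpha> \<theta> l)) \<le> \<bar>c l\<bar> / \<delta>" using delta by (intro frac_le) auto
    then show ?thesis unfolding norm_mult norm_divide by (intro mult_left_mono) auto
  qed
  have f_int: "integrable lborel (\<lambda>t. P t * (of_real (c l) / (g t + of_real (pole \<alpha> \<theta> l))))" for l
    unfolding f_eq by (intro integrable_mult_right weighted_contour(1) eta theta d1) (use pole_pos(2)[of l] in simp)
  have "K_he_tilde \<alpha> \<eta> \<theta> \<delta> x y = (LINT z|lborel. E z)"
  proof -
    have "exp (- x / 2 - y / 2) * (1 / sqrt (exp (- x) * exp (- y))) = 1"
    proof -
      have "exp (- x) * exp (- y) = (exp (- x / 2 - y / 2))\<^sup>2" by (simp add: power2_eq_square mult_exp_exp)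
      then show ?thesis by (simp add: real_sqrt_abs)
    qed
    then have "complex_of_real (exp (- x / 2 - y / 2)) * of_real (1 / sqrt (exp (- x) * exp (- y))) = 1"
      by (metis of_real_1 of_real_mult)
    then show ?thesis unfolding K_he_tilde_def K_he_def exp_eq mult.assoc[symmetric] by simp
  qed
  also have "\<dots> = (LINT t|lborel. LINT u|lborel. E (t, u))"
    unfolding lborel_prod[symmetric] by (rule lborel_pair.integral_fst'[OF E_int, symmetric])
  also have "\<dots> = (LINT t|lborel. (\<Sum>l. P t * (of_real (c l) / (g t + of_real (pole \<alpha> \<theta> l)))))" by (simp only: inner)
  also have "\<dots> = (\<Sum>l. (LINT t|lborel. P t * (of_real (c l) / (g t + of_real (pole \<alpha> \<theta> l)))))"
  proof (rule integral_suminf[OF f_int])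
    have s: "summable (\<lambda>l. norm (P t) * (\<bar>c l\<bar> / \<delta>))" for t by (intro summable_mult summable_divide csum)
    show "AE t in lborel. summable (\<lambda>l. norm (P t * (of_real (c l) / (g t + of_real (pole \<alpha> \<theta> l)))))"
      by (intro AE_I2 summable_comparison_test'[OF s, of 0]) (use f_bound in simp)
    have "summable (\<lambda>l. (LINT t|lborel. norm (P t)) * (\<bar>c l\<bar> / \<delta>))" by (intro summable_mult summable_divide csum)
    then show "summable (\<lambda>l. LINT t|lborel. norm (P t * (of_real (c l) / (g t + of_real (pole \<alpha> \<theta> l)))))"
    proof (rule summable_comparison_test'[of _ 0])
      fix l :: nat
      have "(LINT t|lborel. norm (P t * (of_real (c l) / (g t + of_real (pole \<alpha> \<theta> l))))) \<le> (LINT t|lborel. norm (P t) * (\<bar>c l\<bar> / \<delta>))"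
        by (intro integral_mono integrable_norm f_int f_bound integrable_mult_left P_int)
      then show "norm (LINT t|lborel. norm (P t * (of_real (c l) / (g t + of_real (pole \<alpha> \<theta> l))))) \<le> (LINT t|lborel. norm (P t)) * (\<bar>c l\<bar> / \<delta>)"
        by simp
    qed
  qed
  also have "\<dots> = (\<Sum>l. of_real (c l * limit_series \<alpha> \<eta> \<theta> l x))"
  proof (rule suminf_cong)
    fix l
    have "(LINT t|lborel. P t * (of_real (c l) / (g t + of_real (pole \<alpha> \<theta> l)))) = of_real (c l) * (1 / (2 * pi * \<i>) *
       (LINT t|lborel. gamma_plus' \<delta> t * (F_he \<alpha> \<eta> \<theta> (gamma_plus \<delta> t) *
       (exp (- (of_real x * gamma_plus \<delta> t)) / (of_real (pole \<alpha> \<theta> l) + gamma_plus \<delta> t)))))"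
      unfolding f_eq integral_mult_right_zero by (rule mult.assoc)
    also have "\<dots> = of_real (c l) * (\<Sum>k. of_real (residue_coeff \<alpha> \<eta> \<theta> k) * (exp (- (of_real x * of_real (pole \<alpha> \<eta> k))) / (of_real (pole \<alpha> \<theta> l) + of_real (pole \<alpha> \<eta> k))))"
      using sums_unique[OF weighted_contour(2)[OF _ eta theta d1, of "of_real (pole \<alpha> \<theta> l)" x]] pole_pos(2)[of l] by simp
    also have "\<dots> = of_real (c l) * (\<Sum>k. of_real (residue_coeff \<alpha> \<eta> \<theta> k * exp (- (x * pole \<alpha> \<eta> k)) / (pole \<alpha> \<eta> k + pole \<alpha> \<theta> l)))"
      by (simp add: exp_of_real[symmetric] add.commute)
    also have "\<dots> = of_real (c l * limit_series \<alpha> \<eta> \<theta> l x)"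
    proof -
      have "summable (\<lambda>k. complex_of_real (residue_coeff \<alpha> \<eta> \<theta> k * exp (- (x * pole \<alpha> \<eta> k)) / (pole \<alpha> \<eta> k + pole \<alpha> \<theta> l)))"
        using sums_summable[OF weighted_contour(2)[OF _ eta theta d1, of "of_real (pole \<alpha> \<theta> l)" x]] pole_pos(2)[of l]
        by (simp add: exp_of_real[symmetric] add.commute)
      then have "summable (\<lambda>k. residue_coeff \<alpha> \<eta> \<theta> k * exp (- (x * pole \<alpha> \<eta> k)) / (pole \<alpha> \<eta> k + pole \<alpha> \<theta> l))"
        by (simp only: summable_complex_of_real)
      from suminf_of_real[OF this, where ?'a = complex] show ?thesis by (simp only: limit_series_def of_real_mult)
    qed
    finally show "(LINT t|lborel. P t * (of_real (c l) / (g t + of_real (pole \<alpha> \<theta> l)))) = of_real (c l * limit_series \<alpha> \<eta> \<theta> l x)" .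
  qed
  finally show ?thesis by (simp add: c_def)
qed

end

section \<open>Fredholm determinants of kernels with discrete expansion\<close>

lemma pdet_bij:
  assumes f: "bij_betw f {..<r} S"
  shows "pdet {..<r} (\<lambda>a b. M (f a) (f b)) = pdet S M"
proof -
  let ?h = "\<lambda>p x. if x \<in> S then f (p (inv_into {..<r} f x)) else x"
  have bij: "bij_betw ?h {p. p permutes {..<r}} {p. p permutes S}" by (rule bij_betw_permutations[OF f])
  have inv: "inv_into {..<r} f (f x) = x" if "x < r" for x using f that by (auto simp: bij_betw_def inv_into_f_f)
  have fS: "f x \<in> S" if "x < r" for x using f that by (auto simp: bij_betw_def)
  have "pdet S M = (\<Sum>p | p permutes {..<r}. of_int (sign (?h p)) * (\<Prod>i\<in>S. M i (?h p i)))"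
    unfolding pdet_def by (rule sum.reindex_bij_betw[OF bij, symmetric])
  also have "\<dots> = (\<Sum>p | p permutes {..<r}. of_int (sign p) * (\<Prod>i<r. M (f i) (f (p i))))"
  proof (rule sum.cong[OF refl])
    fix p assume "p \<in> {p. p permutes {..<r}}"
    then interpret permutes_bij_finite p "{..<r}" S f "inv_into {..<r} f" "?h p"
      by unfold_locales (use f inv in auto)
    have "(\<Prod>i\<in>S. M i (?h p i)) = (\<Prod>i<r. M (f i) (?h p (f i)))"
      by (rule prod.reindex_bij_betw[OF f, symmetric])
    also have "\<dots> = (\<Prod>i<r. M (f i) (f (p i)))" by (intro prod.cong refl) (auto simp: inv fS)
    finally show "of_int (sign (?h p)) * (\<Prod>i\<in>S. M i (?h p i)) = of_int (sign p) * (\<Prod>i<r. M (f i) (f (p i)))"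
      by (simp only: sign_p')
  qed
  finally show ?thesis by (simp add: pdet_def)
qed

text \<open>Every such tuple is one fixed enumeration of \<open>S\<close> followed by a permutation
  of \<open>S\<close>.\<close>

lemma card_bijections_PiE:
  assumes S: "finite S" "card S = r"
  shows "card {l \<in> PiE {..<r} (\<lambda>_. S). inj_on l {..<r}} = fact r"
proof -
  obtain f where f: "bij_betw f {..<r} S"
    using ex_bij_betw_nat_finite[OF S(1)] S(2) by (auto simp: lessThan_atLeast0)
  have "bij_betw (\<lambda>s. restrict (s \<circ> f) {..<r}) {s. s permutes S} {l \<in> PiE {..<r} (\<lambda>_. S). inj_on l {..<r}}"
    unfolding bij_betw_def
  proof
    show "inj_on (\<lambda>s. restrict (s \<circ> f) {..<r}) {s. s permutes S}"
    proof (rule inj_onI, clarify)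
      fix s s' assume s: "s permutes S" "s' permutes S" and e: "restrict (s \<circ> f) {..<r} = restrict (s' \<circ> f) {..<r}"
      show "s = s'"
      proof
        fix x show "s x = s' x"
        proof (cases "x \<in> S")
          case True
          then obtain i where i: "i < r" "f i = x" using f by (auto simp: bij_betw_def)
          then show ?thesis using fun_cong[OF e, of i] by simp
        qed (use s in \<open>auto simp: permutes_def\<close>)
      qed
    qed
    show "(\<lambda>s. restrict (s \<circ> f) {..<r}) ` {s. s permutes S} = {l \<in> PiE {..<r} (\<lambda>_. S). inj_on l {..<r}}"
    proof (intro equalityI subsetI)
      fix l assume "l \<in> (\<lambda>s. restrict (s \<circ> f) {..<r}) ` {s. s permutes S}"
      then obtain s where s: "s permutes S" "l = restrict (s \<circ> f) {..<r}" by auto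
      have "bij_betw (s \<circ> f) {..<r} S" by (rule bij_betw_trans[OF f permutes_imp_bij[OF s(1)]])
      then show "l \<in> {l \<in> PiE {..<r} (\<lambda>_. S). inj_on l {..<r}}"
        unfolding s(2) by (auto simp: bij_betw_def inj_on_def)
    next
      fix l assume l: "l \<in> {l \<in> PiE {..<r} (\<lambda>_. S). inj_on l {..<r}}"
      define s where "s x = (if x \<in> S then l (inv_into {..<r} f x) else x)" for x
      have "l ` {..<r} = S" using l S by (intro card_subset_eq) (auto simp: card_image)
      then have bl: "bij_betw l {..<r} S" using l by (auto simp: bij_betw_def)
      have "bij_betw (l \<circ> inv_into {..<r} f) S S" by (rule bij_betw_trans[OF bij_betw_inv_into[OF f] bl])
      then have "bij_betw s S S" by (rule bij_betw_cong[THEN iffD1, rotated]) (auto simp: s_def)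
      then have "s permutes S" by (rule bij_imp_permutes) (auto simp: s_def)
      moreover have "l = restrict (s \<circ> f) {..<r}"
      proof
        fix i show "l i = restrict (s \<circ> f) {..<r} i"
          using l f by (cases "i < r") (auto simp: s_def bij_betw_def inv_into_f_f PiE_def extensional_def)
      qed
      ultimately show "l \<in> (\<lambda>s. restrict (s \<circ> f) {..<r}) ` {s. s permutes S}" by blast
    qed
  qed
  from bij_betw_same_card[OF this] card_permutations[OF S(2,1)] show ?thesis by simp
qed

text \<open>A tuple with a repeated index has two equal columns; each index set of size
  \<open>r\<close> is reached by \<open>fact r\<close> injective tuples, all with the same
  minor.\<close>

lemma sum_tuples_pdet:
  fixes M :: "nat \<Rightarrow> nat \<Rightarrow> complex"
  shows "(\<Sum>l\<in>PiE {..<r} (\<lambda>_. {..<n}). pdet {..<r} (\<lambda>a b. M (l a) (l b))) =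
    fact r * (\<Sum>S | S \<subseteq> {..<n} \<and> card S = r. pdet S M)"
proof -
  let ?T = "PiE {..<r} (\<lambda>_. {..<n})"
  let ?I = "{l \<in> ?T. inj_on l {..<r}}"
  let ?C = "{S. S \<subseteq> {..<n} \<and> card S = r}"
  have fT: "finite ?T" by (intro finite_PiE) auto
  have fC: "finite ?C" by (rule finite_subset[of _ "Pow {..<n}"]) auto
  have "(\<Sum>l\<in>?T. pdet {..<r} (\<lambda>a b. M (l a) (l b))) = (\<Sum>l\<in>?I. pdet {..<r} (\<lambda>a b. M (l a) (l b)))"
  proof (rule sum.mono_neutral_right[OF fT])
    show "\<forall>l\<in>?T - ?I. pdet {..<r} (\<lambda>a b. M (l a) (l b)) = 0"
    proof
      fix l assume "l \<in> ?T - ?I"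
      then obtain a b where "a < r" "b < r" "a \<noteq> b" "l a = l b" by (auto simp: inj_on_def)
      then show "pdet {..<r} (\<lambda>a b. M (l a) (l b)) = 0" by (intro pdet_identical_columns[of a r b]) auto
    qed
  qed auto
  also have "\<dots> = (\<Sum>S\<in>?C. \<Sum>l\<in>{l \<in> ?I. l ` {..<r} = S}. pdet {..<r} (\<lambda>a b. M (l a) (l b)))"
  proof (rule sum.group[symmetric, OF _ fC])
    show "finite ?I" using fT by simp
    show "(\<lambda>l. l ` {..<r}) ` ?I \<subseteq> ?C"
    proof (rule image_subsetI)
      fix l assume l: "l \<in> ?I"
      then have "l ` {..<r} \<subseteq> {..<n}" by (auto simp: PiE_iff)
      moreover have "card (l ` {..<r}) = r" using l by (simp add: card_image)
      ultimately show "l ` {..<r} \<in> ?C" by blast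
    qed
  qed
  also have "\<dots> = (\<Sum>S\<in>?C. fact r * pdet S M)"
  proof (rule sum.cong[OF refl])
    fix S assume S: "S \<in> ?C"
    then have fS: "finite S" using finite_subset by blast
    have eq: "{l \<in> ?I. l ` {..<r} = S} = {l \<in> PiE {..<r} (\<lambda>_. S). inj_on l {..<r}}"
    proof (intro equalityI subsetI)
      fix l assume l: "l \<in> {l \<in> PiE {..<r} (\<lambda>_. S). inj_on l {..<r}}"
      have "l ` {..<r} = S" using l S fS by (intro card_subset_eq) (auto simp: card_image)
      then show "l \<in> {l \<in> ?I. l ` {..<r} = S}" using l S by auto
    qed auto
    have "(\<Sum>l\<in>{l \<in> ?I. l ` {..<r} = S}. pdet {..<r} (\<lambda>a b. M (l a) (l b))) = (\<Sum>l\<in>{l \<in> ?I. l ` {..<r} = S}. pdet S M)"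
      by (intro sum.cong refl pdet_bij) (auto simp: bij_betw_def)
    also have "\<dots> = fact r * pdet S M" unfolding eq using card_bijections_PiE[OF fS] S by simp
    finally show "(\<Sum>l\<in>{l \<in> ?I. l ` {..<r} = S}. pdet {..<r} (\<lambda>a b. M (l a) (l b))) = fact r * pdet S M" .
  qed
  finally show ?thesis by (simp add: sum_distrib_left)
qed

context
  fixes \<phi> \<psi> :: "nat \<Rightarrow> real \<Rightarrow> complex" and \<Phi> :: "real \<Rightarrow> real" and \<Psi> :: "nat \<Rightarrow> real \<Rightarrow> real" and s :: real
    and \<nu> :: "real measure" and M :: "nat \<Rightarrow> nat \<Rightarrow> complex" and K :: "real \<Rightarrow> real \<Rightarrow> complex"
  defines "\<nu> \<equiv> restrict_space lborel {s<..}"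
  defines "M \<equiv> \<lambda>j l. LINT x|\<nu>. \<psi> j x * \<phi> l x"
  assumes meas: "\<And>l. \<phi> l \<in> borel_measurable borel" "\<And>l. \<psi> l \<in> borel_measurable borel"
    and phi: "\<And>l x. s < x \<Longrightarrow> norm (\<phi> l x) \<le> \<Phi> x"
    and psi: "\<And>l x. s < x \<Longrightarrow> norm (\<psi> l x) \<le> \<Psi> l x"
    and psum: "\<And>x. s < x \<Longrightarrow> summable (\<lambda>l. \<Psi> l x)"
    and int: "integrable \<nu> (\<lambda>x. \<Phi> x * (\<Sum>l. \<Psi> l x))"
    and int_l: "\<And>l. integrable \<nu> (\<lambda>x. \<Phi> x * \<Psi> l x)"
    and gsum: "summable (\<lambda>l. real (Suc l) * (LINT x|\<nu>. \<Phi> x * \<Psi> l x))"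
    and K: "\<And>x y. s < x \<Longrightarrow> s < y \<Longrightarrow> K x y = (\<Sum>l. \<phi> l x * \<psi> l y)"
begin

interpretation nu: product_sigma_finite "\<lambda>_::nat. \<nu>"
  unfolding product_sigma_finite_def \<nu>_def
  by (intro allI sigma_finite_measure_restrict_space sigma_finite_lborel) auto

lemma meas_nu [measurable]: "\<phi> l \<in> borel_measurable \<nu>" "\<psi> l \<in> borel_measurable \<nu>"
  unfolding \<nu>_def using meas by (auto intro!: measurable_restrict_space1)

lemma space_nu: "space \<nu> = {s<..}" by (simp add: \<nu>_def space_restrict_space)

lemma psi_phi_bound: "s < x \<Longrightarrow> norm (\<psi> j x * \<phi> l x) \<le> \<Phi> x * \<Psi> j x"
  using mult_mono[OF phi[of x l] psi[of x j]] order_trans[OF norm_ge_zero phi[of x l]]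
  by (simp add: norm_mult mult.commute)

lemma psi_phi_integrable: "integrable \<nu> (\<lambda>x. \<psi> j x * \<phi> l x)"
  by (rule Bochner_Integration.integrable_bound[OF int_l[of j]])
     (auto intro!: AE_I2 order_trans[OF psi_phi_bound] simp: space_nu)

lemma M_bound: "norm (M j l) \<le> (LINT x|\<nu>. \<Phi> x * \<Psi> j x)"
proof -
  have "norm (M j l) \<le> (LINT x|\<nu>. norm (\<psi> j x * \<phi> l x))" unfolding M_def by (rule integral_norm_bound)
  also have "\<dots> \<le> (LINT x|\<nu>. \<Phi> x * \<Psi> j x)"
    by (intro integral_mono integrable_norm psi_phi_integrable int_l psi_phi_bound) (simp add: space_nu)
  finally show ?thesis .
qed

text \<open>Andreief's identity for a kernel of finite rank. Expanding the product and renaming by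
  the inverse permutation gathers one \<open>\<psi>\<close> and one \<open>\<phi>\<close> at each
  variable, so the integral factors into entries of \<open>M\<close>.\<close>

lemma integral_kernel_det_truncated:
  "(LINT x|Pi\<^sub>M {..<r} (\<lambda>_. \<nu>). kernel_det (\<lambda>x y. \<Sum>l<n. \<phi> l x * \<psi> l y) r x) =
     fact r * (\<Sum>S | S \<subseteq> {..<n} \<and> card S = r. pdet S M)"
proof -
  let ?T = "PiE {..<r} (\<lambda>_. {..<n})"
  let ?P = "{p. p permutes {..<r}}"
  have ke: "kernel_det (\<lambda>x y. \<Sum>l<n. \<phi> l x * \<psi> l y) r x =
    (\<Sum>p\<in>?P. \<Sum>l\<in>?T. of_int (sign p) * (\<Prod>i<r. \<psi> (l (inv_into UNIV p i)) (x i) * \<phi> (l i) (x i)))" for x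
    unfolding kernel_det_def
  proof (rule sum.cong[OF refl])
    fix p assume "p \<in> ?P"
    then have p: "p permutes {..<r}" by simp
    have "(\<Prod>i<r. \<Sum>l<n. \<phi> l (x i) * \<psi> l (x (p i))) = (\<Sum>l\<in>?T. \<Prod>i<r. \<phi> (l i) (x i) * \<psi> (l i) (x (p i)))"
      by (rule prod_sum_PiE) auto
    also have "\<dots> = (\<Sum>l\<in>?T. \<Prod>i<r. \<psi> (l (inv_into UNIV p i)) (x i) * \<phi> (l i) (x i))"
    proof (rule sum.cong[OF refl])
      fix l
      have "(\<Prod>i<r. \<psi> (l i) (x (p i))) = (\<Prod>i<r. \<psi> (l (inv_into UNIV p i)) (x i))"
        using prod.permute[OF p, of "\<lambda>i. \<psi> (l (inv_into UNIV p i)) (x i)"] permutes_inverses(2)[OF p] by (simp add: comp_def)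
      then show "(\<Prod>i<r. \<phi> (l i) (x i) * \<psi> (l i) (x (p i))) = (\<Prod>i<r. \<psi> (l (inv_into UNIV p i)) (x i) * \<phi> (l i) (x i))"
        by (simp add: prod.distrib mult.commute)
    qed
    finally show "of_int (sign p) * (\<Prod>i<r. \<Sum>l<n. \<phi> l (x i) * \<psi> l (x (p i))) =
      (\<Sum>l\<in>?T. of_int (sign p) * (\<Prod>i<r. \<psi> (l (inv_into UNIV p i)) (x i) * \<phi> (l i) (x i)))" by (simp add: sum_distrib_left)
  qed
  have pi: "integrable (Pi\<^sub>M {..<r} (\<lambda>_. \<nu>)) (\<lambda>x. \<Prod>i<r. \<psi> (l (inv_into UNIV p i)) (x i) * \<phi> (l i) (x i))" for p l
    by (rule nu.product_integrable_prod) (auto intro: psi_phi_integrable)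
  have pe: "(LINT x|Pi\<^sub>M {..<r} (\<lambda>_. \<nu>). (\<Prod>i<r. \<psi> (l (inv_into UNIV p i)) (x i) * \<phi> (l i) (x i))) = (\<Prod>i<r. M (l (inv_into UNIV p i)) (l i))" for p l
    unfolding M_def by (rule nu.product_integral_prod) (auto intro: psi_phi_integrable)
  have "(LINT x|Pi\<^sub>M {..<r} (\<lambda>_. \<nu>). kernel_det (\<lambda>x y. \<Sum>l<n. \<phi> l x * \<psi> l y) r x) =
    (\<Sum>p\<in>?P. \<Sum>l\<in>?T. of_int (sign p) * (\<Prod>i<r. M (l (inv_into UNIV p i)) (l i)))"
    unfolding ke by (simp add: Bochner_Integration.integral_sum pi pe)
  also have "\<dots> = (\<Sum>p\<in>?P. \<Sum>l\<in>?T. of_int (sign p) * (\<Prod>i<r. M (l (p i)) (l i)))"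
  proof -
    have "(\<Sum>p\<in>?P. \<Sum>l\<in>?T. of_int (sign p) * (\<Prod>i<r. M (l (inv_into UNIV p i)) (l i))) =
      (\<Sum>p\<in>?P. \<Sum>l\<in>?T. of_int (sign (inv_into UNIV p)) * (\<Prod>i<r. M (l (inv_into UNIV (inv_into UNIV p) i)) (l i)))"
      by (rule sum_permutations_inverse)
    also have "\<dots> = (\<Sum>p\<in>?P. \<Sum>l\<in>?T. of_int (sign p) * (\<Prod>i<r. M (l (p i)) (l i)))"
    proof (rule sum.cong[OF refl])
      fix p assume "p \<in> ?P"
      then have p: "p permutes {..<r}" by simp
      have "sign (inv_into UNIV p) = sign p" by (rule sign_inverse) (use p in \<open>auto intro: permutes_imp_permutation[of "{..<r}"]\<close>)
      moreover have "inv_into UNIV (inv_into UNIV p) = p" by (rule inv_inv_eq) (rule permutes_bij[OF p])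
      ultimately show "(\<Sum>l\<in>?T. of_int (sign (inv_into UNIV p)) * (\<Prod>i<r. M (l (inv_into UNIV (inv_into UNIV p) i)) (l i))) =
        (\<Sum>l\<in>?T. of_int (sign p) * (\<Prod>i<r. M (l (p i)) (l i)))" by simp
    qed
    finally show ?thesis .
  qed
  also have "\<dots> = (\<Sum>l\<in>?T. \<Sum>p\<in>?P. of_int (sign p) * (\<Prod>i<r. M (l (p i)) (l i)))" by (rule sum.swap)
  also have "\<dots> = (\<Sum>l\<in>?T. pdet {..<r} (\<lambda>a b. M (l a) (l b)))" by (simp add: pdet_columns)
  finally show ?thesis by (simp add: sum_tuples_pdet)
qed

lemma Psi_nonneg: "s < x \<Longrightarrow> 0 \<le> \<Psi> l x" and Phi_nonneg: "s < x \<Longrightarrow> 0 \<le> \<Phi> x"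
  using order_trans[OF norm_ge_zero psi] order_trans[OF norm_ge_zero phi] by blast+

text \<open>The bound separates into a function of \<open>x\<close> and one of \<open>y\<close>. In
  a product along a permutation these regroup into the same integrable function of each
  variable.\<close>

lemma kernel_truncated_bound:
  assumes "s < x" "s < y"
  shows "norm (\<Sum>l<n. \<phi> l x * \<psi> l y) \<le> \<Phi> x * (\<Sum>l. \<Psi> l y)"
proof -
  have "norm (\<Sum>l<n. \<phi> l x * \<psi> l y) \<le> (\<Sum>l<n. \<Phi> x * \<Psi> l y)"
    using assms by (intro sum_norm_le) (auto simp: norm_mult intro!: mult_mono phi psi Phi_nonneg)
  also have "\<dots> = \<Phi> x * (\<Sum>l<n. \<Psi> l y)" by (simp add: sum_distrib_left)
  also have "\<dots> \<le> \<Phi> x * (\<Sum>l. \<Psi> l y)"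
    using assms by (intro mult_left_mono sum_le_suminf psum Phi_nonneg) (auto intro: Psi_nonneg)
  finally show ?thesis .
qed

lemma kernel_truncated_tendsto:
  assumes "s < x" "s < y"
  shows "(\<lambda>n. \<Sum>l<n. \<phi> l x * \<psi> l y) \<longlonglongrightarrow> K x y"
proof -
  have "summable (\<lambda>l. \<phi> l x * \<psi> l y)"
  proof (rule summable_comparison_test'[of _ 0])
    show "summable (\<lambda>l. \<Phi> x * \<Psi> l y)" using assms by (intro summable_mult psum)
    show "norm (\<phi> l x * \<psi> l y) \<le> \<Phi> x * \<Psi> l y" for l
      using assms by (auto simp: norm_mult intro!: mult_mono phi psi Phi_nonneg)
  qed
  then show ?thesis using K[OF assms] by (simp add: summable_LIMSEQ)
qed

text \<open>Dominated convergence as the rank of the truncated kernel grows; the factorial from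
  counting tuples cancels the one in \<open>fredholm_term\<close>.\<close>

lemma fredholm_term_tendsto:
  "(\<lambda>n. (-1) ^ r * (\<Sum>S | S \<subseteq> {..<n} \<and> card S = r. pdet S M)) \<longlonglongrightarrow> fredholm_term K s r"
proof -
  let ?N = "Pi\<^sub>M {..<r} (\<lambda>_. \<nu>)"
  have sp: "s < x i" if "x \<in> space ?N" "i < r" for x i using that by (auto simp: space_PiM space_nu PiE_iff)
  have "(\<lambda>n. LINT x|?N. kernel_det (\<lambda>x y. \<Sum>l<n. \<phi> l x * \<psi> l y) r x) \<longlonglongrightarrow> (LINT x|?N. kernel_det K r x)"
  proof (rule integral_dominated_convergence[where w = "\<lambda>x. fact r * (\<Prod>i<r. \<Phi> (x i) * (\<Sum>l. \<Psi> l (x i)))"])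
    have lim: "(\<lambda>n. kernel_det (\<lambda>x y. \<Sum>l<n. \<phi> l x * \<psi> l y) r x) \<longlonglongrightarrow> kernel_det K r x" if x: "x \<in> space ?N" for x
      unfolding kernel_det_def
    proof (intro tendsto_sum tendsto_mult tendsto_const tendsto_prod)
      fix p i assume p: "p \<in> {p. p permutes {..<r}}" and i: "i \<in> {..<r}"
      then have "p i < r" using permutes_in_image[of p "{..<r}" i] by auto
      then show "(\<lambda>n. \<Sum>l<n. \<phi> l (x i) * \<psi> l (x (p i))) \<longlonglongrightarrow> K (x i) (x (p i))"
        using i by (intro kernel_truncated_tendsto sp[OF x]) auto
    qed
    show meas_n: "(\<lambda>x. kernel_det (\<lambda>x y. \<Sum>l<n. \<phi> l x * \<psi> l y) r x) \<in> borel_measurable ?N" for n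
    proof -
      have F: "(\<lambda>x. \<Sum>l<n. \<phi> l (x i) * \<psi> l (x (p i))) \<in> borel_measurable ?N" if "i < r" "p permutes {..<r}" for i p
      proof -
        have "p i < r" using permutes_in_image[OF that(2), of i] that(1) by simp
        then have [measurable]: "(\<lambda>x. x i) \<in> measurable ?N \<nu>" "(\<lambda>x. x (p i)) \<in> measurable ?N \<nu>"
          using that by (auto intro!: measurable_component_singleton)
        show ?thesis by measurable
      qed
      show ?thesis unfolding kernel_det_def
        by (rule borel_measurable_sum, rule borel_measurable_times, rule borel_measurable_const, rule borel_measurable_prod, rule F) auto
    qed
    show "kernel_det K r \<in> borel_measurable ?N"
      by (rule borel_measurable_LIMSEQ_metric[OF meas_n lim])
    show "integrable ?N (\<lambda>x. fact r * (\<Prod>i<r. \<Phi> (x i) * (\<Sum>l. \<Psi> l (x i))))"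
      by (intro integrable_mult_right nu.product_integrable_prod) (auto intro: int)
    show "AE x in ?N. (\<lambda>n. kernel_det (\<lambda>x y. \<Sum>l<n. \<phi> l x * \<psi> l y) r x) \<longlonglongrightarrow> kernel_det K r x"
      using lim by (intro AE_I2)
    show "AE x in ?N. norm (kernel_det (\<lambda>x y. \<Sum>l<n. \<phi> l x * \<psi> l y) r x) \<le> fact r * (\<Prod>i<r. \<Phi> (x i) * (\<Sum>l. \<Psi> l (x i)))" for n
    proof (rule AE_I2)
      fix x assume x: "x \<in> space ?N"
      have "norm (kernel_det (\<lambda>x y. \<Sum>l<n. \<phi> l x * \<psi> l y) r x) \<le> (\<Sum>p | p permutes {..<r}. \<Prod>i<r. \<Phi> (x i) * (\<Sum>l. \<Psi> l (x i)))"
        unfolding kernel_det_def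
      proof (rule sum_norm_le)
        fix p assume "p \<in> {p. p permutes {..<r}}"
        then have p: "p permutes {..<r}" by simp
        have pi: "p i < r" if "i < r" for i using permutes_in_image[OF p, of i] that by simp
        have "norm (of_int (sign p) * (\<Prod>i<r. \<Sum>l<n. \<phi> l (x i) * \<psi> l (x (p i)))) = (\<Prod>i<r. norm (\<Sum>l<n. \<phi> l (x i) * \<psi> l (x (p i))))"
          by (simp add: norm_mult prod_norm sign_def)
        also have "\<dots> \<le> (\<Prod>i<r. \<Phi> (x i) * (\<Sum>l. \<Psi> l (x (p i))))"
          by (intro prod_mono) (auto intro!: kernel_truncated_bound sp[OF x] pi)
        also have "\<dots> = (\<Prod>i<r. \<Phi> (x i)) * (\<Prod>i<r. \<Sum>l. \<Psi> l (x (p i)))" by (rule prod.distrib)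
        also have "(\<Prod>i<r. \<Sum>l. \<Psi> l (x (p i))) = (\<Prod>i<r. \<Sum>l. \<Psi> l (x i))"
          using prod.permute[OF p, of "\<lambda>i. \<Sum>l. \<Psi> l (x i)"] by (simp add: comp_def)
        finally show "norm (of_int (sign p) * (\<Prod>i<r. \<Sum>l<n. \<phi> l (x i) * \<psi> l (x (p i)))) \<le> (\<Prod>i<r. \<Phi> (x i) * (\<Sum>l. \<Psi> l (x i)))"
          by (simp add: prod.distrib)
      qed
      also have "\<dots> = fact r * (\<Prod>i<r. \<Phi> (x i) * (\<Sum>l. \<Psi> l (x i)))"
        using card_permutations[of "{..<r}" r] by simp
      finally show "norm (kernel_det (\<lambda>x y. \<Sum>l<n. \<phi> l x * \<psi> l y) r x) \<le> fact r * (\<Prod>i<r. \<Phi> (x i) * (\<Sum>l. \<Psi> l (x i)))" .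
    qed
  qed
  then have "(\<lambda>n. fact r * (\<Sum>S | S \<subseteq> {..<n} \<and> card S = r. pdet S M)) \<longlonglongrightarrow> (LINT x|?N. kernel_det K r x)"
    unfolding integral_kernel_det_truncated .
  from tendsto_mult_left[OF this, of "(-1) ^ r / of_nat (fact r)"]
  show ?thesis unfolding fredholm_term_def \<nu>_def[symmetric] by simp
qed

text \<open>The kernel is a product of two operators through the index set, and \<open>M\<close> is
  their product in the other order: this is \<open>det (1 - A B) = det (1 - B A)\<close>. It is
  obtained by sorting the minors of the sections of \<open>M\<close> by size and letting the section
  grow.\<close>

theorem fredholm_det_discrete: "fredholm_det K s = discrete_fredholm M"
proof -
  define g where "g l = (LINT x|\<nu>. \<Phi> x * \<Psi> l x)" for l
  define h where "h l = real (Suc l) * g l" for l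
  define a where "a r n = (-1) ^ r * (\<Sum>S | S \<subseteq> {..<n} \<and> card S = r. pdet S M)" for r n
  have g: "norm (M j l) \<le> g j" for j l unfolding g_def by (rule M_bound)
  have g0: "0 \<le> g j" for j using order_trans[OF norm_ge_zero g[of j 0]] .
  have h0: "0 \<le> h l" for l using g0 by (simp add: h_def)
  have hs: "summable h" using gsum unfolding h_def[abs_def] g_def .
  have fin: "finite {S. S \<subseteq> {..<n} \<and> card S = r}" for n r :: nat by (rule finite_subset[of _ "Pow {..<n}"]) auto
  have pd: "norm (pdet S M) \<le> (\<Prod>i\<in>S. h i)" if "S \<subseteq> {..<n}" for S and n :: nat
    unfolding h_def by (rule norm_pdet_le) (use finite_subset[OF that] g in auto)
  \<comment> \<open>On sets of size \<open>r\<close>, doubling every \<open>h i\<close> gains a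
    factor \<open>2 ^ r\<close>. Paying with \<open>(1/2) ^ r\<close> gives a bound that is summable
    in \<open>r\<close> and free of \<open>n\<close>.\<close>
  have bound: "norm (a r n) \<le> (1/2) ^ r * exp (2 * suminf h)" for r n
  proof -
    have "norm (a r n) \<le> (\<Sum>S | S \<subseteq> {..<n} \<and> card S = r. \<Prod>i\<in>S. h i)"
      by (auto simp: a_def norm_mult norm_power intro!: sum_norm_le pd)
    also have "\<dots> = (\<Sum>S | S \<subseteq> {..<n} \<and> card S = r. (1/2) ^ r * (\<Prod>i\<in>S. 2 * h i))"
      by (intro sum.cong refl) (auto simp: prod.distrib power_divide)
    also have "\<dots> = (1/2) ^ r * (\<Sum>S | S \<subseteq> {..<n} \<and> card S = r. \<Prod>i\<in>S. 2 * h i)" by (simp add: sum_distrib_left)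
    also have "\<dots> \<le> (1/2) ^ r * (\<Sum>S\<in>Pow {..<n}. \<Prod>i\<in>S. 2 * h i)"
      using h0 by (intro mult_left_mono sum_mono2) (auto intro!: prod_nonneg)
    also have "(\<Sum>S\<in>Pow {..<n}. \<Prod>i\<in>S. 2 * h i) = (\<Prod>i<n. 2 * h i + 1)" by (simp add: prod_add)
    also have "(1/2) ^ r * (\<Prod>i<n. 2 * h i + 1) \<le> (1/2) ^ r * exp (2 * suminf h)"
    proof (rule mult_left_mono)
      have "(\<Prod>i<n. 2 * h i + 1) \<le> (\<Prod>i<n. exp (2 * h i))"
        using h0 exp_ge_add_one_self by (intro prod_mono) (auto simp: add.commute)
      also have "\<dots> = exp (2 * (\<Sum>i<n. h i))" by (simp add: exp_sum sum_distrib_left)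
      also have "\<dots> \<le> exp (2 * suminf h)" using sum_le_suminf[OF hs, of "{..<n}"] h0 by auto
      finally show "(\<Prod>i<n. 2 * h i + 1) \<le> exp (2 * suminf h)" .
    qed simp
    finally show ?thesis .
  qed
  have "(\<lambda>n. \<Sum>r. a r n) \<longlonglongrightarrow> (\<Sum>r. fredholm_term K s r)"
  proof -
    have dom: "eventually (\<lambda>(r, n). norm (a r n) \<le> (1/2) ^ r * exp (2 * suminf h)) (at_top \<times>\<^sub>F sequentially)"
      using bound by (intro always_eventually) auto
    have sm: "summable (\<lambda>r. (1/2) ^ r * exp (2 * suminf h))" by (intro summable_mult2 summable_geometric) simp
    have lims: "a r \<longlonglongrightarrow> fredholm_term K s r" for r unfolding a_def[abs_def] by (rule fredholm_term_tendsto)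
    from tannerys_theorem[OF lims dom sm trivial_limit_sequentially] show ?thesis by blast
  qed
  moreover have "(\<Sum>r. a r n) = (\<Sum>S\<in>Pow {..<n}. (-1) ^ card S * pdet S M)" for n
  proof -
    have card_le: "card S \<le> n" if "S \<subseteq> {..<n}" for S using card_mono[OF finite_lessThan that] by simp
    have "(\<Sum>r. a r n) = (\<Sum>r\<le>n. a r n)"
    proof (rule suminf_finite)
      fix r assume "r \<notin> {..n}"
      then have "{S. S \<subseteq> {..<n} \<and> card S = r} = {}" using card_le by auto
      then show "a r n = 0" by (simp only: a_def) simp
    qed simp
    also have "\<dots> = (\<Sum>r\<le>n. \<Sum>S\<in>{S \<in> Pow {..<n}. card S = r}. (-1) ^ card S * pdet S M)"
      by (simp add: a_def sum_distrib_left)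
    also have "\<dots> = (\<Sum>S\<in>Pow {..<n}. (-1) ^ card S * pdet S M)"
      by (rule sum.group) (use card_le in auto)
    finally show ?thesis .
  qed
  moreover have "(\<lambda>n. \<Sum>S\<in>Pow {..<n}. (-1) ^ card S * pdet S M) \<longlonglongrightarrow> discrete_fredholm M"
    by (rule discrete_fredholm_sections[OF g]) (use hs in \<open>simp add: h_def[abs_def]\<close>)
  ultimately show ?thesis unfolding fredholm_det_def by (simp only: LIMSEQ_unique)
qed

end

section \<open>The Fredholm determinant of the limiting kernel\<close>

lemma pole_pos: "\<eta> > 0 \<Longrightarrow> \<alpha> \<ge> 0 \<Longrightarrow> 0 < pole \<alpha> \<eta> k"
  by (auto simp: pole_def intro!: add_nonneg_pos mult_pos_pos)

lemma pole_mono: "\<eta> > 0 \<Longrightarrow> pole \<alpha> \<eta> 0 \<le> pole \<alpha> \<eta> k"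
  by (simp add: pole_def)

lemma summable_exp_pole: "summable (\<lambda>k. exp (- (s * pole \<alpha> \<eta> k)) / fact k)"
proof -
  have "summable (\<lambda>k. exp (- (s * (\<alpha> / 2 + \<eta> / 2))) * (exp (- (s * \<eta>)) ^ k /\<^sub>R fact k))"
    by (intro summable_mult summable_exp_generic)
  then show ?thesis unfolding exp_pole real_scaleR_def by (simp add: field_simps)
qed

text \<open>The weight is at most \<open>exp (real k)\<close>, hence at most
  \<open>exp (pole \<alpha> \<eta> k / \<eta>)\<close>, and this merely lowers \<open>s\<close> by
  \<open>1 / \<eta>\<close> in a series that converges for every \<open>s\<close>.\<close>

lemma summable_Suc_exp_pole:
  assumes "\<eta> > 0" "\<alpha> \<ge> 0"
  shows "summable (\<lambda>k. real (Suc k) * (exp (- (s * pole \<alpha> \<eta> k)) / fact k))"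
proof (rule summable_comparison_test'[OF summable_exp_pole[of "s - 1 / \<eta>" \<alpha> \<eta>], of 0])
  fix k :: nat
  have "real k \<le> pole \<alpha> \<eta> k / \<eta>" using assms by (simp add: pole_def field_simps)
  then have "exp (real k) \<le> exp (pole \<alpha> \<eta> k / \<eta>)" by (simp only: exp_le_cancel_iff)
  moreover have "real (Suc k) \<le> exp (real k)" using exp_ge_add_one_self[of "real k"] by simp
  ultimately have "real (Suc k) \<le> exp (pole \<alpha> \<eta> k / \<eta>)" by linarith
  then have "real (Suc k) * (exp (- (s * pole \<alpha> \<eta> k)) / fact k) \<le> exp (pole \<alpha> \<eta> k / \<eta>) * (exp (- (s * pole \<alpha> \<eta> k)) / fact k)"
    by (intro mult_right_mono) auto
  also have "\<dots> = exp (- ((s - 1 / \<eta>) * pole \<alpha> \<eta> k)) / fact k"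
    by (simp add: mult_exp_exp algebra_simps)
  finally show "norm (real (Suc k) * (exp (- (s * pole \<alpha> \<eta> k)) / fact k)) \<le> exp (- ((s - 1 / \<eta>) * pole \<alpha> \<eta> k)) / fact k"
    by simp
qed

lemma half_line_exp:
  assumes c: "c > 0"
  shows "integrable (restrict_space lborel {s<..}) (\<lambda>x::real. exp (- (x * c)))"
    "(LINT x|restrict_space lborel {s<..}. exp (- (x * c))) = exp (- (s * c)) / c"
proof -
  let ?f = "\<lambda>x::real. indicator {s<..} x *\<^sub>R exp (- (x * c))"
  have sh: "?f (s + 1 * x) = exp (- (s * c)) * (indicator {0<..} x *\<^sub>R exp (- (x * c)))" for x
    by (simp add: indicator_def mult_exp_exp algebra_simps)
  have i0: "integrable lborel (\<lambda>x. indicator {0<..} x *\<^sub>R exp (- (x * c)))"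
    using integrable_I0i_exp_mscale[OF c] by (simp add: set_integrable_def)
  have "integrable lborel (\<lambda>x. ?f (s + 1 * x))" unfolding sh by (intro integrable_mult_right i0)
  then have fi: "integrable lborel ?f" by (subst (asm) lborel_integrable_real_affine_iff) auto
  then show "integrable (restrict_space lborel {s<..}) (\<lambda>x::real. exp (- (x * c)))"
    by (subst integrable_restrict_space) auto
  have "(LINT x|lborel. indicator {0<..} x *\<^sub>R exp (- (x * c))) = 1 / c"
    using LBINT_I0i_exp_mscale[OF c] by (simp add: interval_lebesgue_integral_0_infty set_lebesgue_integral_def)
  moreover have "(LINT x|lborel. ?f x) = (LINT x|lborel. ?f (s + 1 * x))"
    using lborel_integral_real_affine[of 1 ?f s] by simp
  ultimately have "(LINT x|lborel. ?f x) = exp (- (s * c)) / c" unfolding sh by simp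
  then show "(LINT x|restrict_space lborel {s<..}. exp (- (x * c))) = exp (- (s * c)) / c"
    by (subst integral_restrict_space) auto
qed

text \<open>The denominator with index \<open>j\<close> comes from integrating two exponentials over
  the half-line above \<open>s\<close>, the one with index \<open>l\<close> from
  \<open>limit_series\<close>.\<close>

definition limit_kernel :: "real \<Rightarrow> real \<Rightarrow> real \<Rightarrow> real \<Rightarrow> nat \<Rightarrow> nat \<Rightarrow> real" where
  "limit_kernel \<alpha> \<eta> \<theta> s j l = (\<Sum>k. (residue_coeff \<alpha> \<theta> \<eta> j * exp (- (s * pole \<alpha> \<theta> j))) *
      (residue_coeff \<alpha> \<eta> \<theta> k * exp (- (s * pole \<alpha> \<eta> k))) /
      ((pole \<alpha> \<eta> k + pole \<alpha> \<theta> j) * (pole \<alpha> \<eta> k + pole \<alpha> \<theta> l)))"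

context
  fixes \<alpha> \<eta> \<theta> \<delta> s :: real
  assumes eta: "\<eta> > 0" and theta: "\<theta> > 0" and alpha: "\<alpha> \<ge> 0" and delta: "0 < \<delta>" "\<delta> < (\<alpha> + min \<eta> \<theta>) / 2"
begin

lemma poles_pos: "0 < pole \<alpha> \<eta> k" "0 < pole \<alpha> \<theta> k"
  using pole_pos eta theta alpha by auto

lemma pole_sum_ge: "pole \<alpha> \<eta> 0 \<le> pole \<alpha> \<eta> k + pole \<alpha> \<theta> l"
  using pole_mono[OF eta, of \<alpha> k] poles_pos(2)[of l] by linarith

lemma summable_A: "summable (\<lambda>k. \<bar>residue_coeff \<alpha> \<eta> \<theta> k\<bar> * exp (- (s * pole \<alpha> \<eta> k)))"
  by (rule summable_residue_coeff[OF eta theta alpha])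

lemma summable_Suc_B: "summable (\<lambda>k. real (Suc k) * (\<bar>residue_coeff \<alpha> \<theta> \<eta> k\<bar> * exp (- (s * pole \<alpha> \<theta> k))))"
proof -
  obtain C where C: "C > 0" "\<And>k. \<bar>residue_coeff \<alpha> \<theta> \<eta> k\<bar> \<le> C / fact k" using residue_coeff_bound[OF theta eta alpha] by blast
  have "summable (\<lambda>k. C * (real (Suc k) * (exp (- (s * pole \<alpha> \<theta> k)) / fact k)))"
    by (intro summable_mult summable_Suc_exp_pole theta alpha)
  then show ?thesis
  proof (rule summable_comparison_test'[of _ 0])
    fix k :: nat
    have "real (Suc k) * (\<bar>residue_coeff \<alpha> \<theta> \<eta> k\<bar> * exp (- (s * pole \<alpha> \<theta> k))) \<le> real (Suc k) * (C / fact k * exp (- (s * pole \<alpha> \<theta> k)))"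
      by (intro mult_left_mono mult_right_mono C) auto
    then show "norm (real (Suc k) * (\<bar>residue_coeff \<alpha> \<theta> \<eta> k\<bar> * exp (- (s * pole \<alpha> \<theta> k)))) \<le> C * (real (Suc k) * (exp (- (s * pole \<alpha> \<theta> k)) / fact k))"
      by (simp add: abs_mult mult_ac)
  qed
qed

lemma summable_B: "summable (\<lambda>k. \<bar>residue_coeff \<alpha> \<theta> \<eta> k\<bar> * exp (- (s * pole \<alpha> \<theta> k)))"
  by (rule summable_residue_coeff[OF theta eta alpha])

lemma limit_series_term_bound:
  assumes x: "s < x"
  shows "\<bar>residue_coeff \<alpha> \<eta> \<theta> k * exp (- (x * pole \<alpha> \<eta> k)) / (pole \<alpha> \<eta> k + pole \<alpha> \<theta> l)\<bar> \<le>
    \<bar>residue_coeff \<alpha> \<eta> \<theta> k\<bar> * exp (- (s * pole \<alpha> \<eta> k)) / pole \<alpha> \<eta> 0"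
proof -
  have "exp (- (x * pole \<alpha> \<eta> k)) \<le> exp (- (s * pole \<alpha> \<eta> k))" using x poles_pos(1)[of k] by simp
  then have "\<bar>residue_coeff \<alpha> \<eta> \<theta> k\<bar> * exp (- (x * pole \<alpha> \<eta> k)) / (pole \<alpha> \<eta> k + pole \<alpha> \<theta> l) \<le>
     \<bar>residue_coeff \<alpha> \<eta> \<theta> k\<bar> * exp (- (s * pole \<alpha> \<eta> k)) / pole \<alpha> \<eta> 0"
    using pole_sum_ge[of k l] poles_pos(1)[of 0] by (intro frac_le mult_left_mono mult_nonneg_nonneg) auto
  moreover have "0 < pole \<alpha> \<eta> k + pole \<alpha> \<theta> l" using poles_pos by (simp add: add_pos_pos)
  ultimately show ?thesis by (simp add: abs_mult)
qed

text \<open>The first family is bounded on the half-line uniformly in its index. The second carries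
  the factorial decay in the index and all decay in \<open>x\<close>, at the slowest rate
  \<open>pole \<alpha> \<theta> 0\<close>; a bound in product form therefore suffices.\<close>

theorem fredholm_det_limit_kernel:
  "fredholm_det (K_he_tilde \<alpha> \<eta> \<theta> \<delta>) s = discrete_fredholm (\<lambda>j l. of_real (limit_kernel \<alpha> \<eta> \<theta> s j l))"
proof -
  define \<nu> where "\<nu> = restrict_space lborel {s<..}"
  define CA where "CA = (\<Sum>k. \<bar>residue_coeff \<alpha> \<eta> \<theta> k\<bar> * exp (- (s * pole \<alpha> \<eta> k)) / pole \<alpha> \<eta> 0)"
  define b where "b l = \<bar>residue_coeff \<alpha> \<theta> \<eta> l\<bar> * exp (- (s * pole \<alpha> \<theta> l))" for l
  define e where "e x = exp (- ((x - s) * pole \<alpha> \<theta> 0))" for x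
  define \<phi> where "\<phi> l x = complex_of_real (limit_series \<alpha> \<eta> \<theta> l x)" for l x
  define \<psi> where "\<psi> l x = complex_of_real (residue_coeff \<alpha> \<theta> \<eta> l * exp (- (x * pole \<alpha> \<theta> l)))" for l x
  have sA: "summable (\<lambda>k. \<bar>residue_coeff \<alpha> \<eta> \<theta> k\<bar> * exp (- (s * pole \<alpha> \<eta> k)) / pole \<alpha> \<eta> 0)"
    by (intro summable_divide summable_A)
  have e_eq: "e x = exp (s * pole \<alpha> \<theta> 0) * exp (- (x * pole \<alpha> \<theta> 0))" for x
    by (simp add: e_def mult_exp_exp algebra_simps)
  have e_int: "integrable \<nu> e" unfolding e_eq[abs_def] \<nu>_def by (intro integrable_mult_right half_line_exp poles_pos)
  have bs: "summable b" unfolding b_def by (rule summable_B)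
  have main: "fredholm_det (K_he_tilde \<alpha> \<eta> \<theta> \<delta>) s = discrete_fredholm (\<lambda>j l. LINT x|restrict_space lborel {s<..}. \<psi> j x * \<phi> l x)"
  proof (rule fredholm_det_discrete[where \<Phi> = "\<lambda>_. CA" and \<Psi> = "\<lambda>l x. b l * e x"])
    show "\<phi> l \<in> borel_measurable borel" for l unfolding \<phi>_def limit_series_def by measurable
    show "\<psi> l \<in> borel_measurable borel" for l unfolding \<psi>_def by measurable
    show "norm (\<phi> l x) \<le> CA" if x: "s < x" for l x
    proof -
      have "norm (\<phi> l x) = \<bar>limit_series \<alpha> \<eta> \<theta> l x\<bar>" by (simp add: \<phi>_def)
      also have "\<dots> \<le> (\<Sum>k. \<bar>residue_coeff \<alpha> \<eta> \<theta> k * exp (- (x * pole \<alpha> \<eta> k)) / (pole \<alpha> \<eta> k + pole \<alpha> \<theta> l)\<bar>)"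
        unfolding limit_series_def
        by (rule summable_rabs, rule summable_comparison_test'[OF sA, of 0]) (use limit_series_term_bound[OF x] in simp)
      also have "\<dots> \<le> CA" unfolding CA_def
        by (rule suminf_le[OF limit_series_term_bound[OF x] _ sA], rule summable_comparison_test'[OF sA, of 0])
           (use limit_series_term_bound[OF x] in simp)
      finally show ?thesis .
    qed
    show "norm (\<psi> l x) \<le> b l * e x" if x: "s < x" for l x
    proof -
      have "(x - s) * pole \<alpha> \<theta> 0 \<le> (x - s) * pole \<alpha> \<theta> l" using x pole_mono[OF theta, of \<alpha> l] by (intro mult_left_mono) auto
      then have "- (x * pole \<alpha> \<theta> l) \<le> - (s * pole \<alpha> \<theta> l) + - ((x - s) * pole \<alpha> \<theta> 0)" by (simp add: algebra_simps)
      then have "exp (- (x * pole \<alpha> \<theta> l)) \<le> exp (- (s * pole \<alpha> \<theta> l)) * e x"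
        unfolding e_def exp_add[symmetric] by (simp only: exp_le_cancel_iff)
      then have "\<bar>residue_coeff \<alpha> \<theta> \<eta> l\<bar> * exp (- (x * pole \<alpha> \<theta> l)) \<le> \<bar>residue_coeff \<alpha> \<theta> \<eta> l\<bar> * (exp (- (s * pole \<alpha> \<theta> l)) * e x)"
        by (rule mult_left_mono) simp
      then show ?thesis by (simp add: \<psi>_def b_def norm_mult mult.assoc)
    qed
    show "summable (\<lambda>l. b l * e x)" for x by (intro summable_mult2 bs)
    have "(\<Sum>l. b l * e x) = (\<Sum>l. b l) * e x" for x by (rule suminf_mult2[symmetric, OF bs])
    then show "integrable (restrict_space lborel {s<..}) (\<lambda>x. CA * (\<Sum>l. b l * e x))"
      using e_int by (simp add: \<nu>_def)
    show "integrable (restrict_space lborel {s<..}) (\<lambda>x. CA * (b l * e x))" for l using e_int by (simp add: \<nu>_def)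
    have "summable (\<lambda>l. (real (Suc l) * b l) * (CA * (LINT x|\<nu>. e x)))"
      unfolding b_def by (intro summable_mult2 summable_Suc_B)
    then show "summable (\<lambda>l. real (Suc l) * (LINT x|restrict_space lborel {s<..}. CA * (b l * e x)))"
      by (simp add: \<nu>_def mult_ac)
    show "K_he_tilde \<alpha> \<eta> \<theta> \<delta> x y = (\<Sum>l. \<phi> l x * \<psi> l y)" for x y
      unfolding K_he_tilde_series[OF eta theta alpha delta] \<phi>_def \<psi>_def of_real_mult[symmetric] by (simp only: mult_ac)
  qed
  have "(LINT x|\<nu>. \<psi> j x * \<phi> l x) = of_real (limit_kernel \<alpha> \<eta> \<theta> s j l)" for j l
  proof -
    define Bj where "Bj = residue_coeff \<alpha> \<theta> \<eta> j"
    define c where "c k = pole \<alpha> \<eta> k + pole \<alpha> \<theta> j" for k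
    define f where "f k x = (Bj * residue_coeff \<alpha> \<eta> \<theta> k / (pole \<alpha> \<eta> k + pole \<alpha> \<theta> l)) * exp (- (x * c k))" for k x
    have c: "c k > 0" for k using poles_pos by (simp add: c_def add_pos_pos)
    have f_int: "integrable \<nu> (f k)" for k unfolding f_def \<nu>_def by (intro integrable_mult_right half_line_exp c)
    have f_val: "(LINT x|\<nu>. f k x) = (Bj * residue_coeff \<alpha> \<eta> \<theta> k / (pole \<alpha> \<eta> k + pole \<alpha> \<theta> l)) * (exp (- (s * c k)) / c k)" for k
      unfolding f_def \<nu>_def using half_line_exp(2)[OF c[of k], of s] by simp
    have f_eq: "f k x = (Bj * exp (- (x * pole \<alpha> \<theta> j))) * (residue_coeff \<alpha> \<eta> \<theta> k * exp (- (x * pole \<alpha> \<eta> k)) / (pole \<alpha> \<eta> k + pole \<alpha> \<theta> l))" for k x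
    proof -
      have "exp (- (x * c k)) = exp (- (x * pole \<alpha> \<theta> j)) * exp (- (x * pole \<alpha> \<eta> k))" by (simp add: c_def mult_exp_exp algebra_simps)
      then show ?thesis by (simp add: f_def)
    qed
    have sx: "summable (\<lambda>k. \<bar>residue_coeff \<alpha> \<eta> \<theta> k * exp (- (x * pole \<alpha> \<eta> k)) / (pole \<alpha> \<eta> k + pole \<alpha> \<theta> l)\<bar>)" if "s < x" for x
      by (rule summable_comparison_test'[OF sA, of 0]) (use limit_series_term_bound[OF that] in simp)
    have "(LINT x|\<nu>. \<psi> j x * \<phi> l x) = (LINT x|\<nu>. complex_of_real (\<Sum>k. f k x))"
    proof (rule Bochner_Integration.integral_cong[OF refl])
      fix x assume "x \<in> space \<nu>"
      then have x: "s < x" by (simp add: \<nu>_def space_restrict_space)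
      have "(\<Sum>k. f k x) = Bj * exp (- (x * pole \<alpha> \<theta> j)) * limit_series \<alpha> \<eta> \<theta> l x"
        unfolding f_eq limit_series_def by (rule suminf_mult[OF summable_rabs_cancel[OF sx[OF x]]])
      then show "\<psi> j x * \<phi> l x = complex_of_real (\<Sum>k. f k x)" by (simp add: \<psi>_def \<phi>_def Bj_def)
    qed
    also have "\<dots> = complex_of_real (LINT x|\<nu>. (\<Sum>k. f k x))" by (rule integral_complex_of_real)
    also have "(LINT x|\<nu>. (\<Sum>k. f k x)) = (\<Sum>k. (LINT x|\<nu>. f k x))"
    proof (rule integral_suminf[OF f_int])
      show "AE x in \<nu>. summable (\<lambda>k. norm (f k x))"
      proof (rule AE_I2)
        fix x assume "x \<in> space \<nu>"
        then have x: "s < x" by (simp add: \<nu>_def space_restrict_space)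
        show "summable (\<lambda>k. norm (f k x))" unfolding f_eq real_norm_def abs_mult[of "Bj * exp (- (x * pole \<alpha> \<theta> j))"]
          by (intro summable_mult sx[OF x])
      qed
      have nf: "(LINT x|\<nu>. norm (f k x)) = \<bar>Bj * residue_coeff \<alpha> \<eta> \<theta> k / (pole \<alpha> \<eta> k + pole \<alpha> \<theta> l)\<bar> * (exp (- (s * c k)) / c k)" for k
        unfolding f_def real_norm_def abs_mult abs_exp_cancel \<nu>_def using half_line_exp(2)[OF c[of k], of s] by simp
      have "summable (\<lambda>k. (\<bar>Bj\<bar> * exp (- (s * pole \<alpha> \<theta> j)) / pole \<alpha> \<eta> 0) * (\<bar>residue_coeff \<alpha> \<eta> \<theta> k\<bar> * exp (- (s * pole \<alpha> \<eta> k)) / pole \<alpha> \<eta> 0))"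
        by (intro summable_mult sA)
      then show "summable (\<lambda>k. LINT x|\<nu>. norm (f k x))"
      proof (rule summable_comparison_test'[of _ 0])
        fix k :: nat
        have m: "0 < pole \<alpha> \<eta> 0" "pole \<alpha> \<eta> 0 \<le> c k" "pole \<alpha> \<eta> 0 \<le> pole \<alpha> \<eta> k + pole \<alpha> \<theta> l"
          using poles_pos(1) pole_sum_ge[of k j] pole_sum_ge[of k l] by (auto simp: c_def)
        have "exp (- (s * c k)) = exp (- (s * pole \<alpha> \<theta> j)) * exp (- (s * pole \<alpha> \<eta> k))" by (simp add: c_def mult_exp_exp algebra_simps)
        then have "(LINT x|\<nu>. norm (f k x)) = (\<bar>Bj\<bar> * exp (- (s * pole \<alpha> \<theta> j)) / c k) * (\<bar>residue_coeff \<alpha> \<eta> \<theta> k\<bar> * exp (- (s * pole \<alpha> \<eta> k)) / (pole \<alpha> \<eta> k + pole \<alpha> \<theta> l))"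
          unfolding nf using m by (simp add: abs_mult mult_ac)
        also have "\<dots> \<le> (\<bar>Bj\<bar> * exp (- (s * pole \<alpha> \<theta> j)) / pole \<alpha> \<eta> 0) * (\<bar>residue_coeff \<alpha> \<eta> \<theta> k\<bar> * exp (- (s * pole \<alpha> \<eta> k)) / pole \<alpha> \<eta> 0)"
          using m by (intro mult_mono frac_le divide_nonneg_nonneg mult_nonneg_nonneg) auto
        finally show "norm (LINT x|\<nu>. norm (f k x)) \<le> (\<bar>Bj\<bar> * exp (- (s * pole \<alpha> \<theta> j)) / pole \<alpha> \<eta> 0) * (\<bar>residue_coeff \<alpha> \<eta> \<theta> k\<bar> * exp (- (s * pole \<alpha> \<eta> k)) / pole \<alpha> \<eta> 0)"
          by simp
      qed
    qed
    also have "\<dots> = limit_kernel \<alpha> \<eta> \<theta> s j l"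
      unfolding limit_kernel_def f_val
    proof (rule suminf_cong)
      fix k
      have "exp (- (s * c k)) = exp (- (s * pole \<alpha> \<theta> j)) * exp (- (s * pole \<alpha> \<eta> k))" by (simp add: c_def mult_exp_exp algebra_simps)
      then show "Bj * residue_coeff \<alpha> \<eta> \<theta> k / (pole \<alpha> \<eta> k + pole \<alpha> \<theta> l) * (exp (- (s * c k)) / c k) =
         residue_coeff \<alpha> \<theta> \<eta> j * exp (- (s * pole \<alpha> \<theta> j)) * (residue_coeff \<alpha> \<eta> \<theta> k * exp (- (s * pole \<alpha> \<eta> k))) /
         ((pole \<alpha> \<eta> k + pole \<alpha> \<theta> j) * (pole \<alpha> \<eta> k + pole \<alpha> \<theta> l))"
        by (simp add: Bj_def c_def mult_ac)
    qed
    finally show ?thesis .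
  qed
  then show ?thesis using main by (simp add: \<nu>_def)
qed

end

section \<open>The expansion before the limit\<close>

text \<open>Splitting \<open>a\<close> evenly between rows and columns makes each weight parameter a
  product of a row factor and a column factor, and the exponents of these factors are exactly the
  poles of the limiting kernel.\<close>

definition geo_x :: "real \<Rightarrow> real \<Rightarrow> real \<Rightarrow> nat \<Rightarrow> real" where
  "geo_x \<alpha> \<eta> \<epsilon> i = exp (- (\<epsilon> * pole \<alpha> \<eta> i))"

definition gamma_arg :: "real \<Rightarrow> real \<Rightarrow> real \<Rightarrow> nat \<Rightarrow> real" where
  "gamma_arg \<alpha> \<eta> \<theta> k = (\<alpha> / 2 + pole \<alpha> \<eta> k) / \<theta> + 1/2"

text \<open>Comes from the differences \<open>x k - x m\<close> with \<open>m < k\<close>; it is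
  asymptotic to \<open>h ^ k * fact k\<close> for small \<open>h\<close> and so produces the
  factorial of the residues.\<close>

definition exp_prod :: "real \<Rightarrow> nat \<Rightarrow> real" where
  "exp_prod h k = (\<Prod>i<k. exp (h * real (Suc i)) - 1)"

text \<open>The limit, as the box grows, of the coefficient
  \<open>cauchy_coeff n x y k * x k ^ (N + n)\<close> for the row parameters \<open>x\<close> and
  column parameters \<open>y\<close>.\<close>

definition prelimit_coeff :: "real \<Rightarrow> real \<Rightarrow> real \<Rightarrow> real \<Rightarrow> nat \<Rightarrow> nat \<Rightarrow> real" where
  "prelimit_coeff \<alpha> \<eta> \<theta> \<epsilon> N k = (-1) ^ k * geo_x \<alpha> \<eta> \<epsilon> k ^ Suc N * qpoch (\<epsilon> * \<theta>) (gamma_arg \<alpha> \<eta> \<theta> k) /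
     (exp_prod (\<epsilon> * \<eta>) k * qpoch (\<epsilon> * \<eta>) 1)"

definition prelimit_kernel :: "real \<Rightarrow> real \<Rightarrow> real \<Rightarrow> real \<Rightarrow> nat \<Rightarrow> nat \<Rightarrow> nat \<Rightarrow> real" where
  "prelimit_kernel \<alpha> \<eta> \<theta> \<epsilon> N j l = (\<Sum>k. prelimit_coeff \<alpha> \<theta> \<eta> \<epsilon> N j * prelimit_coeff \<alpha> \<eta> \<theta> \<epsilon> N k /
     ((1 - geo_x \<alpha> \<eta> \<epsilon> k * geo_x \<alpha> \<theta> \<epsilon> j) * (1 - geo_x \<alpha> \<eta> \<epsilon> k * geo_x \<alpha> \<theta> \<epsilon> l)))"

lemma exp_prod_ge: "h > 0 \<Longrightarrow> h ^ k * fact k \<le> exp_prod h k"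
proof (induction k)
  case (Suc k)
  have "h * real (Suc k) \<le> exp (h * real (Suc k)) - 1" using exp_ge_add_one_self[of "h * real (Suc k)"] by linarith
  then have "(h ^ k * fact k) * (h * real (Suc k)) \<le> exp_prod h k * (exp (h * real (Suc k)) - 1)"
    using Suc by (intro mult_mono) (auto intro: order_trans[OF _ Suc.IH])
  then show ?case by (simp add: exp_prod_def mult_ac)
qed (simp add: exp_prod_def)

lemma exp_prod_pos: "h > 0 \<Longrightarrow> 0 < exp_prod h k"
  by (rule less_le_trans[OF _ exp_prod_ge]) auto

lemma summable_coeff_bound: "summable (\<lambda>k. real (Suc k) * (1 / (h ^ k * fact k * c)))" for h c :: real
proof -
  define D where "D = 1 / h"
  have "summable (\<lambda>k. (2 * \<bar>D\<bar>) ^ k /\<^sub>R fact k)" by (rule summable_exp_generic)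
  then have "summable (\<lambda>k. real (Suc k) * (D ^ k / fact k))"
  proof (rule summable_comparison_test'[of _ 0])
    fix k :: nat
    have "real (Suc k) \<le> 2 ^ k" by (induction k) auto
    then have "real (Suc k) * (\<bar>D\<bar> ^ k / fact k) \<le> 2 ^ k * (\<bar>D\<bar> ^ k / fact k)" by (intro mult_right_mono) auto
    moreover have "norm (real (Suc k) * (D ^ k / fact k)) = real (Suc k) * (\<bar>D\<bar> ^ k / fact k)"
      by (simp add: abs_mult power_abs del: of_nat_Suc)
    moreover have "(2 * \<bar>D\<bar>) ^ k /\<^sub>R fact k = 2 ^ k * (\<bar>D\<bar> ^ k / fact k)"
      by (simp add: power_mult_distrib divide_inverse)
    ultimately show "norm (real (Suc k) * (D ^ k / fact k)) \<le> (2 * \<bar>D\<bar>) ^ k /\<^sub>R fact k" by (simp only:)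
  qed
  then have "summable (\<lambda>k. real (Suc k) * (D ^ k / fact k) * (1 / c))" by (rule summable_mult2)
  moreover have "real (Suc k) * (D ^ k / fact k) * (1 / c) = real (Suc k) * (1 / (h ^ k * fact k * c))" for k
    by (simp add: D_def power_divide mult_ac)
  ultimately show ?thesis by (simp only:)
qed

text \<open>Makes the product of \<open>1 - x k * y m\<close> over \<open>m\<close> a partial
  q-Pochhammer symbol with \<open>q = exp (- \<epsilon> \<theta>)\<close>.\<close>

lemma geo_x_mult:
  assumes "\<theta> > 0"
  shows "geo_x \<alpha> \<eta> \<epsilon> k * geo_x \<alpha> \<theta> \<epsilon> m = exp (- (\<epsilon> * \<theta> * (gamma_arg \<alpha> \<eta> \<theta> k + real m)))"
  using assms by (simp add: geo_x_def gamma_arg_def pole_def mult_exp_exp field_simps)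

context
  fixes \<alpha> \<eta> \<theta> \<epsilon> :: real and N :: nat
  assumes eta: "\<eta> > 0" and theta: "\<theta> > 0" and alpha: "\<alpha> \<ge> 0" and eps: "\<epsilon> > 0"
begin

lemma gamma_arg_pos: "0 < gamma_arg \<alpha> \<eta> \<theta> k"
  unfolding gamma_arg_def using pole_pos[OF eta alpha, of k] alpha theta by (intro add_nonneg_pos divide_nonneg_pos) auto

text \<open>Taking \<open>x k\<close> out of the \<open>n - 1\<close> differences cancels all but
  \<open>Suc N\<close> of the \<open>N + n\<close> powers. The differences with \<open>m < k\<close>
  give \<open>exp_prod\<close> and the sign. The size of the box is then visible only in two partial
  q-Pochhammer products, one above and one below.\<close>

lemma cauchy_coeff_prelimit:
  assumes k: "k < n"
  shows "cauchy_coeff n (geo_x \<alpha> \<eta> \<epsilon>) (geo_x \<alpha> \<theta> \<epsilon>) k * geo_x \<alpha> \<eta> \<epsilon> k ^ (N + n) =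
    (-1) ^ k * geo_x \<alpha> \<eta> \<epsilon> k ^ Suc N * (\<Prod>m<n. 1 - exp (- (\<epsilon> * \<theta> * (gamma_arg \<alpha> \<eta> \<theta> k + real m)))) /
     (exp_prod (\<epsilon> * \<eta>) k * (\<Prod>i<n - Suc k. 1 - exp (- (\<epsilon> * \<eta> * (1 + real i)))))"
proof -
  let ?x = "geo_x \<alpha> \<eta> \<epsilon>"
  have x0: "?x k \<noteq> 0" by (simp add: geo_x_def)
  have ratio: "?x m / ?x k = exp (\<epsilon> * \<eta> * (real k - real m))" for m
    by (simp add: geo_x_def pole_def exp_diff[symmetric] algebra_simps)
  have split: "{..<n} - {k} = {..<k} \<union> {Suc k..<n}" using k by auto
  have "(\<Prod>m\<in>{..<n} - {k}. ?x k - ?x m) = (\<Prod>m\<in>{..<n} - {k}. ?x k * (1 - ?x m / ?x k))"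
    using x0 by (intro prod.cong refl) (simp add: right_diff_distrib)
  also have "\<dots> = ?x k ^ (n - 1) * (\<Prod>m\<in>{..<n} - {k}. 1 - exp (\<epsilon> * \<eta> * (real k - real m)))"
    using k by (simp add: prod.distrib ratio)
  also have "(\<Prod>m\<in>{..<n} - {k}. 1 - exp (\<epsilon> * \<eta> * (real k - real m))) =
     (\<Prod>m<k. 1 - exp (\<epsilon> * \<eta> * (real k - real m))) * (\<Prod>m\<in>{Suc k..<n}. 1 - exp (\<epsilon> * \<eta> * (real k - real m)))"
    unfolding split by (rule prod.union_disjoint) auto
  also have "(\<Prod>m<k. 1 - exp (\<epsilon> * \<eta> * (real k - real m))) = (\<Prod>i<k. 1 - exp (\<epsilon> * \<eta> * real (Suc i)))"
    by (rule prod.reindex_bij_witness[where i = "\<lambda>i. k - Suc i" and j = "\<lambda>i. k - Suc i"]) (auto simp: of_nat_diff)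
  also have "\<dots> = (\<Prod>i<k. - (exp (\<epsilon> * \<eta> * real (Suc i)) - 1))" by simp
  also have "\<dots> = (-1) ^ k * exp_prod (\<epsilon> * \<eta>) k" unfolding exp_prod_def prod_uminus by simp
  also have "(\<Prod>m\<in>{Suc k..<n}. 1 - exp (\<epsilon> * \<eta> * (real k - real m))) = (\<Prod>i<n - Suc k. 1 - exp (- (\<epsilon> * \<eta> * (1 + real i))))"
    by (rule prod.reindex_bij_witness[where i = "\<lambda>i. i + Suc k" and j = "\<lambda>i. i - Suc k"])
       (auto simp: of_nat_diff algebra_simps)
  finally have den: "(\<Prod>m\<in>{..<n} - {k}. ?x k - ?x m) = ?x k ^ (n - 1) * ((-1) ^ k * exp_prod (\<epsilon> * \<eta>) k *
     (\<Prod>i<n - Suc k. 1 - exp (- (\<epsilon> * \<eta> * (1 + real i)))))" by simp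
  have "N + n = Suc N + (n - 1)" using k by simp
  then have pw: "?x k ^ (N + n) = ?x k ^ Suc N * ?x k ^ (n - 1)" by (simp only: power_add)
  have "1 / (-1 :: real) ^ k = (-1) ^ k" by (cases "even k") auto
  then have sg: "a / ((-1) ^ k * b) = (-1) ^ k * a / b" for a b :: real
    by (metis (no_types, opaque_lifting) divide_divide_eq_left mult.commute mult_1 times_divide_eq_left)
  show ?thesis unfolding cauchy_coeff_def den pw geo_x_mult[OF theta] using x0
    by (simp add: sg mult.assoc)
qed

lemma partial_prod_bounds:
  assumes "h > 0" "z > 0"
  shows "0 \<le> (\<Prod>m<n. 1 - exp (- (h * (z + real m))))" "(\<Prod>m<n. 1 - exp (- (h * (z + real m)))) \<le> 1"
  using assms by (auto intro!: prod_nonneg prod_le_1)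

text \<open>Uniform in \<open>n\<close>: the numerator is at most 1, and in the denominator a
  partial product of factors below 1 is at least the infinite one.\<close>

lemma cauchy_coeff_bound:
  assumes k: "k < n"
  shows "\<bar>cauchy_coeff n (geo_x \<alpha> \<eta> \<epsilon>) (geo_x \<alpha> \<theta> \<epsilon>) k * geo_x \<alpha> \<eta> \<epsilon> k ^ (N + n)\<bar> \<le>
    1 / ((\<epsilon> * \<eta>) ^ k * fact k * qpoch (\<epsilon> * \<eta>) 1)"
proof -
  have h: "\<epsilon> * \<eta> > 0" "\<epsilon> * \<theta> > 0" using eps eta theta by auto
  have x: "0 \<le> geo_x \<alpha> \<eta> \<epsilon> k" "geo_x \<alpha> \<eta> \<epsilon> k \<le> 1" using pole_pos[OF eta alpha, of k] eps by (auto simp: geo_x_def)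
  have "(\<epsilon> * \<eta>) ^ k * fact k * qpoch (\<epsilon> * \<eta>) 1 \<le> exp_prod (\<epsilon> * \<eta>) k * (\<Prod>i<n - Suc k. 1 - exp (- (\<epsilon> * \<eta> * (1 + real i))))"
    using exp_prod_ge[OF h(1), of k] qpoch_le_partial[OF h(1), of 1 "n - Suc k"] qpoch_pos[OF h(1), of 1] exp_prod_pos[OF h(1), of k]
    by (intro mult_mono) auto
  moreover have "geo_x \<alpha> \<eta> \<epsilon> k ^ Suc N * (\<Prod>m<n. 1 - exp (- (\<epsilon> * \<theta> * (gamma_arg \<alpha> \<eta> \<theta> k + real m)))) \<le> 1 * 1"
    using x partial_prod_bounds[OF h(2) gamma_arg_pos[of k], of n] by (intro mult_mono power_le_one) auto
  moreover have "0 < (\<epsilon> * \<eta>) ^ k * fact k * qpoch (\<epsilon> * \<eta>) 1" using h qpoch_pos[OF h(1), of 1] by (intro mult_pos_pos) auto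
  moreover have "0 \<le> geo_x \<alpha> \<eta> \<epsilon> k ^ Suc N * (\<Prod>m<n. 1 - exp (- (\<epsilon> * \<theta> * (gamma_arg \<alpha> \<eta> \<theta> k + real m))))"
    using x partial_prod_bounds[OF h(2) gamma_arg_pos[of k], of n] by (intro mult_nonneg_nonneg) auto
  ultimately have "geo_x \<alpha> \<eta> \<epsilon> k ^ Suc N * (\<Prod>m<n. 1 - exp (- (\<epsilon> * \<theta> * (gamma_arg \<alpha> \<eta> \<theta> k + real m)))) /
     (exp_prod (\<epsilon> * \<eta>) k * (\<Prod>i<n - Suc k. 1 - exp (- (\<epsilon> * \<eta> * (1 + real i))))) \<le> 1 / ((\<epsilon> * \<eta>) ^ k * fact k * qpoch (\<epsilon> * \<eta>) 1)"
    by (intro frac_le) auto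
  moreover have "\<bar>(-1) ^ k * a * b / c\<bar> = a * b / c" if "0 \<le> a * b" "0 \<le> c" for a b c :: real
  proof -
    have "\<bar>(-1) ^ k * a * b / c\<bar> = \<bar>a * b\<bar> / \<bar>c\<bar>" by (simp add: abs_mult power_abs)
    then show ?thesis using that by (simp only: abs_of_nonneg)
  qed
  moreover have "0 \<le> exp_prod (\<epsilon> * \<eta>) k * (\<Prod>i<n - Suc k. 1 - exp (- (\<epsilon> * \<eta> * (1 + real i))))"
    using exp_prod_pos[OF h(1), of k] partial_prod_bounds(1)[OF h(1), of 1 "n - Suc k"] by simp
  moreover note \<open>0 \<le> geo_x \<alpha> \<eta> \<epsilon> k ^ Suc N * _\<close>
  ultimately show ?thesis unfolding cauchy_coeff_prelimit[OF k] by (simp only:)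
qed

lemma cauchy_coeff_tendsto:
  "(\<lambda>n. cauchy_coeff n (geo_x \<alpha> \<eta> \<epsilon>) (geo_x \<alpha> \<theta> \<epsilon>) k * geo_x \<alpha> \<eta> \<epsilon> k ^ (N + n)) \<longlonglongrightarrow> prelimit_coeff \<alpha> \<eta> \<theta> \<epsilon> N k"
proof -
  have h: "\<epsilon> * \<eta> > 0" "\<epsilon> * \<theta> > 0" using eps eta theta by auto
  have "filterlim (\<lambda>n. n - Suc k) sequentially sequentially" by (rule filterlim_minus_const_nat_at_top)
  from filterlim_compose[OF qpoch_LIMSEQ[OF h(1), of 1] this]
  have "(\<lambda>n. (-1) ^ k * geo_x \<alpha> \<eta> \<epsilon> k ^ Suc N * (\<Prod>m<n. 1 - exp (- (\<epsilon> * \<theta> * (gamma_arg \<alpha> \<eta> \<theta> k + real m)))) /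
     (exp_prod (\<epsilon> * \<eta>) k * (\<Prod>i<n - Suc k. 1 - exp (- (\<epsilon> * \<eta> * (1 + real i)))))) \<longlonglongrightarrow> prelimit_coeff \<alpha> \<eta> \<theta> \<epsilon> N k"
    unfolding prelimit_coeff_def
    using qpoch_pos[OF h(1), of 1] exp_prod_pos[OF h(1), of k]
    by (intro tendsto_divide tendsto_mult tendsto_const qpoch_LIMSEQ h) auto
  then show ?thesis
    by (rule Lim_transform_eventually)
       (rule eventually_mono[OF eventually_gt_at_top[of k]], rule cauchy_coeff_prelimit[symmetric])
qed

end

context
  fixes \<alpha> \<eta> \<theta> \<epsilon> :: real and N :: nat
  assumes eta: "\<eta> > 0" and theta: "\<theta> > 0" and alpha: "\<alpha> \<ge> 0" and eps: "\<epsilon> > 0"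
begin

abbreviation (input) "xx \<equiv> geo_x \<alpha> \<eta> \<epsilon>"
abbreviation (input) "yy \<equiv> geo_x \<alpha> \<theta> \<epsilon>"

lemma one_minus_xy: "0 < 1 - xx 0 * yy 0" "1 - xx 0 * yy 0 \<le> 1 - xx k * yy j"
proof -
  have e: "xx k * yy j = exp (- (\<epsilon> * (pole \<alpha> \<eta> k + pole \<alpha> \<theta> j)))" for k j
    by (simp add: geo_x_def mult_exp_exp algebra_simps)
  have "0 < \<epsilon> * (pole \<alpha> \<eta> 0 + pole \<alpha> \<theta> 0)" using eps pole_pos eta theta alpha by (intro mult_pos_pos add_pos_pos) auto
  then show "0 < 1 - xx 0 * yy 0" unfolding e by simp
  have "\<epsilon> * (pole \<alpha> \<eta> 0 + pole \<alpha> \<theta> 0) \<le> \<epsilon> * (pole \<alpha> \<eta> k + pole \<alpha> \<theta> j)"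
    using eps pole_mono[OF eta, of \<alpha> k] pole_mono[OF theta, of \<alpha> j] by (intro mult_left_mono) auto
  then show "1 - xx 0 * yy 0 \<le> 1 - xx k * yy j" unfolding e by simp
qed

text \<open>Coefficients outside the box are set to zero, so the finite expansion is the Fredholm
  sum of an infinite matrix. Tannery's theorem is applied to the inner sum over \<open>k\<close> and
  then to the sum over index sets; all denominators are bounded below by the one at indices
  0.\<close>

theorem prelimit_fredholm:
  "(\<lambda>n. complex_of_real (\<Sum>S\<in>Pow {..<n}. (-1) ^ card S * pdet S (\<lambda>j l. \<Sum>k<n.
       (cauchy_coeff n yy xx j * yy j ^ (N + n)) * (cauchy_coeff n xx yy k * xx k ^ (N + n)) /
       ((1 - xx k * yy j) * (1 - xx k * yy l))))) \<longlonglongrightarrow>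
   discrete_fredholm (\<lambda>j l. of_real (prelimit_kernel \<alpha> \<eta> \<theta> \<epsilon> N j l))"
proof -
  define a where "a n k = (if k < n then cauchy_coeff n xx yy k * xx k ^ (N + n) else 0)" for n k
  define b where "b n k = (if k < n then cauchy_coeff n yy xx k * yy k ^ (N + n) else 0)" for n k
  define A where "A k = 1 / ((\<epsilon> * \<eta>) ^ k * fact k * qpoch (\<epsilon> * \<eta>) 1)" for k
  define B where "B k = 1 / ((\<epsilon> * \<theta>) ^ k * fact k * qpoch (\<epsilon> * \<theta>) 1)" for k
  have h: "\<epsilon> * \<eta> > 0" "\<epsilon> * \<theta> > 0" using eps eta theta by auto
  have A0: "0 \<le> A k" and B0: "0 \<le> B k" for k
    using h qpoch_pos[OF h(1), of 1] qpoch_pos[OF h(2), of 1] by (auto simp: A_def B_def)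
  have aA: "\<bar>a n k\<bar> \<le> A k" for n k
    using cauchy_coeff_bound[OF eta theta alpha eps, of k n N] A0 by (auto simp: a_def A_def)
  have bB: "\<bar>b n k\<bar> \<le> B k" for n k
    using cauchy_coeff_bound[OF theta eta alpha eps, of k n N] B0 by (auto simp: b_def B_def)
  have alim: "(\<lambda>n. a n k) \<longlonglongrightarrow> prelimit_coeff \<alpha> \<eta> \<theta> \<epsilon> N k" for k
    by (rule Lim_transform_eventually[OF cauchy_coeff_tendsto[OF eta theta alpha eps]])
       (rule eventually_mono[OF eventually_gt_at_top[of k]], simp add: a_def)
  have blim: "(\<lambda>n. b n k) \<longlonglongrightarrow> prelimit_coeff \<alpha> \<theta> \<eta> \<epsilon> N k" for k
    by (rule Lim_transform_eventually[OF cauchy_coeff_tendsto[OF theta eta alpha eps]])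
       (rule eventually_mono[OF eventually_gt_at_top[of k]], simp add: b_def)
  have As: "summable (\<lambda>k. real (Suc k) * A k)" and Bs: "summable (\<lambda>k. real (Suc k) * B k)"
    unfolding A_def B_def by (rule summable_coeff_bound)+
  have As1: "summable A"
    by (rule summable_comparison_test'[OF As, of 0]) (use A0 in \<open>auto simp: distrib_right\<close>)
  define m where "m = 1 - xx 0 * yy 0"
  have m: "0 < m" "m \<le> 1 - xx k * yy j" for k j unfolding m_def using one_minus_xy by auto
  define T where "T n j l k = b n j * a n k / ((1 - xx k * yy j) * (1 - xx k * yy l))" for n j l k
  define K where "K n j l = complex_of_real (\<Sum>k. T n j l k)" for n j l
  have Tb: "\<bar>T n j l k\<bar> \<le> B j * A k / (m * m)" for n j l k
  proof -
    have d: "0 < 1 - xx k * yy j" "0 < 1 - xx k * yy l" using m(1) m(2)[of k j] m(2)[of k l] by linarith+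
    have "\<bar>T n j l k\<bar> = \<bar>b n j\<bar> * \<bar>a n k\<bar> / ((1 - xx k * yy j) * (1 - xx k * yy l))"
      unfolding T_def using d by (simp add: abs_mult)
    also have "\<dots> \<le> B j * A k / (m * m)"
      using d m(1) m(2)[of k j] m(2)[of k l] A0 B0 by (intro frac_le mult_mono aA bB mult_nonneg_nonneg) auto
    finally show ?thesis .
  qed
  have Ts: "summable (\<lambda>k. B j * A k / (m * m))" for j by (intro summable_divide summable_mult As1)
  have Klim: "(\<lambda>n. K n j l) \<longlonglongrightarrow> of_real (prelimit_kernel \<alpha> \<eta> \<theta> \<epsilon> N j l)" for j l
  proof -
    have lims: "(\<lambda>n. T n j l k) \<longlonglongrightarrow> prelimit_coeff \<alpha> \<theta> \<eta> \<epsilon> N j * prelimit_coeff \<alpha> \<eta> \<theta> \<epsilon> N k / ((1 - xx k * yy j) * (1 - xx k * yy l))" for k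
      unfolding T_def using m(1) m(2)[of k j] m(2)[of k l] by (intro tendsto_intros alim blim) auto
    have dom: "eventually (\<lambda>(k, n). norm (T n j l k) \<le> B j * A k / (m * m)) (at_top \<times>\<^sub>F sequentially)"
      using Tb by (intro always_eventually) auto
    from tannerys_theorem[OF lims dom Ts[of j] trivial_limit_sequentially]
    have "(\<lambda>n. \<Sum>k. T n j l k) \<longlonglongrightarrow> prelimit_kernel \<alpha> \<eta> \<theta> \<epsilon> N j l"
      unfolding prelimit_kernel_def by blast
    then show ?thesis unfolding K_def by (rule tendsto_of_real)
  qed
  have Kb: "norm (K n j l) \<le> B j * (suminf A / (m * m))" for n j l
  proof -
    have s: "summable (\<lambda>k. \<bar>T n j l k\<bar>)" by (rule summable_comparison_test'[OF Ts[of j], of 0]) (use Tb in simp)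
    have "norm (K n j l) \<le> (\<Sum>k. \<bar>T n j l k\<bar>)" unfolding K_def norm_of_real by (rule summable_rabs[OF s])
    also have "\<dots> \<le> (\<Sum>k. B j * A k / (m * m))" by (rule suminf_le[OF Tb s Ts])
    also have "\<dots> = B j * (suminf A / (m * m))"
      using suminf_divide[OF summable_mult[OF As1, of "B j"], of "m * m"] suminf_mult[OF As1, of "B j"] by simp
    finally show ?thesis .
  qed
  have "(\<lambda>n. discrete_fredholm (K n)) \<longlonglongrightarrow> discrete_fredholm (\<lambda>j l. of_real (prelimit_kernel \<alpha> \<eta> \<theta> \<epsilon> N j l))"
  proof (rule discrete_fredholm_tendsto[OF Klim trivial_limit_sequentially, where g = "\<lambda>j. B j * (suminf A / (m * m))"])
    show "eventually (\<lambda>n. \<forall>j l. norm (K n j l) \<le> B j * (suminf A / (m * m))) sequentially"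
      using Kb by (intro always_eventually) auto
    show "summable (\<lambda>j. real (Suc j) * (B j * (suminf A / (m * m))))"
      using summable_mult2[OF Bs, of "suminf A / (m * m)"] by (simp add: mult.assoc)
  qed
  moreover have "discrete_fredholm (K n) = complex_of_real (\<Sum>S\<in>Pow {..<n}. (-1) ^ card S * pdet S (\<lambda>j l. \<Sum>k<n.
       (cauchy_coeff n yy xx j * yy j ^ (N + n)) * (cauchy_coeff n xx yy k * xx k ^ (N + n)) /
       ((1 - xx k * yy j) * (1 - xx k * yy l))))" for n
  proof -
    have pd: "pdet S (\<lambda>i j. complex_of_real (R i j)) = complex_of_real (pdet S R)" for S R
      by (simp add: pdet_def)
    have Ke: "K n j l = of_real (\<Sum>k<n. T n j l k)" for j l
      unfolding K_def by (subst suminf_finite[of "{..<n}"]) (auto simp: T_def a_def)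
    have "discrete_fredholm (K n) = (\<Sum>S\<in>Pow {..<n}. (-1) ^ card S * pdet S (K n))"
      by (rule discrete_fredholm_finite) (simp add: K_def T_def b_def)
    also have "\<dots> = complex_of_real (\<Sum>S\<in>Pow {..<n}. (-1) ^ card S * pdet S (\<lambda>j l. \<Sum>k<n. T n j l k))"
      unfolding Ke[abs_def] pd by simp
    also have "(\<Sum>S\<in>Pow {..<n}. (-1) ^ card S * pdet S (\<lambda>j l. \<Sum>k<n. T n j l k)) =
      (\<Sum>S\<in>Pow {..<n}. (-1) ^ card S * pdet S (\<lambda>j l. \<Sum>k<n.
       (cauchy_coeff n yy xx j * yy j ^ (N + n)) * (cauchy_coeff n xx yy k * xx k ^ (N + n)) /
       ((1 - xx k * yy j) * (1 - xx k * yy l))))"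
      by (intro sum.cong arg_cong2[where f = "(*)"] refl pdet_cong) (auto simp: T_def a_def b_def)
    finally show ?thesis .
  qed
  ultimately show ?thesis by simp
qed

end

section \<open>The scaling limit of coefficients and kernel\<close>

definition exp_quot :: "real \<Rightarrow> real" where "exp_quot h = (1 - exp (- h)) / h"

text \<open>The part of \<open>prelimit_coeff\<close> that converges as \<open>\<epsilon>\<close>
  tends to 0, with \<open>t\<close> for the rescaled cutoff; every factor that is absent from the
  residue coefficient and the exponential tends to 1.\<close>

definition norm_coeff :: "real \<Rightarrow> real \<Rightarrow> real \<Rightarrow> real \<Rightarrow> real \<Rightarrow> nat \<Rightarrow> real" where
  "norm_coeff \<alpha> \<eta> \<theta> \<epsilon> t k = \<eta> * (-1) ^ k / fact k * rqGamma (\<epsilon> * \<theta>) (gamma_arg \<alpha> \<eta> \<theta> k) *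
     exp_quot (\<epsilon> * \<theta>) powr (1 - gamma_arg \<alpha> \<eta> \<theta> k) *
     ((\<epsilon> * \<eta>) ^ k * fact k / exp_prod (\<epsilon> * \<eta>) k) * exp (- (t * pole \<alpha> \<eta> k))"

definition coeff_scale :: "real \<Rightarrow> real \<Rightarrow> real \<Rightarrow> real \<Rightarrow> real" where
  "coeff_scale \<alpha> \<eta> \<theta> \<epsilon> = exp ((1/2 - \<alpha> / (2 * \<theta>)) * ln (\<epsilon> * \<theta>) + (\<alpha> / (2 * \<eta>) + 1/2) * ln (\<epsilon> * \<eta>)) *
     qpoch (\<epsilon> * \<theta>) 1 / qpoch (\<epsilon> * \<eta>) 1 / \<eta>"

definition rescaled :: "real \<Rightarrow> real \<Rightarrow> real \<Rightarrow> nat \<Rightarrow> real" where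
  "rescaled \<eta> \<theta> \<epsilon> N = \<epsilon> * real N + ln (\<epsilon> * \<eta>) / \<eta> + ln (\<epsilon> * \<theta>) / \<theta>"

lemma rescaled_commute: "rescaled \<eta> \<theta> \<epsilon> N = rescaled \<theta> \<eta> \<epsilon> N"
  by (simp add: rescaled_def)

text \<open>The power \<open>1 - z\<close> of \<open>1 - exp (- \<epsilon> \<theta>)\<close> and the
  power \<open>- k\<close> of \<open>\<epsilon> \<eta>\<close> have exponents affine in the pole, so
  their logarithms join \<open>\<epsilon> (N + 1)\<close> in the rate of one exponential. This is
  the origin of the logarithmic centring; the extra \<open>\<epsilon>\<close> in the rate comes from
  the exponent \<open>Suc N\<close>.\<close>

lemma prelimit_coeff_norm:
  assumes eta: "\<eta> > 0" and theta: "\<theta> > 0" and alpha: "\<alpha> \<ge> 0" and eps: "\<epsilon> > 0"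
  shows "prelimit_coeff \<alpha> \<eta> \<theta> \<epsilon> N k = coeff_scale \<alpha> \<eta> \<theta> \<epsilon> * norm_coeff \<alpha> \<eta> \<theta> \<epsilon> (rescaled \<eta> \<theta> \<epsilon> N + \<epsilon>) k"
proof -
  define z where "z = gamma_arg \<alpha> \<eta> \<theta> k"
  define p where "p = pole \<alpha> \<eta> k"
  have h: "\<epsilon> * \<eta> > 0" "\<epsilon> * \<theta> > 0" using eps eta theta by auto
  have q: "qpoch (\<epsilon> * \<theta>) 1 > 0" "qpoch (\<epsilon> * \<eta>) 1 > 0" using qpoch_pos h by auto
  have e: "0 < 1 - exp (- (\<epsilon> * \<theta>))" using h by simp
  have "rqGamma (\<epsilon> * \<theta>) z * qpoch (\<epsilon> * \<theta>) 1 * (1 - exp (- (\<epsilon> * \<theta>))) powr (1 - z) =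
      qpoch (\<epsilon> * \<theta>) z * ((1 - exp (- (\<epsilon> * \<theta>))) powr (z - 1) * (1 - exp (- (\<epsilon> * \<theta>))) powr (1 - z))"
    using q by (simp add: rqGamma_def)
  also have "(1 - exp (- (\<epsilon> * \<theta>))) powr (z - 1) * (1 - exp (- (\<epsilon> * \<theta>))) powr (1 - z) = 1"
    using e eps theta by (simp add: powr_add[symmetric])
  finally have qz: "qpoch (\<epsilon> * \<theta>) z = rqGamma (\<epsilon> * \<theta>) z * qpoch (\<epsilon> * \<theta>) 1 * (1 - exp (- (\<epsilon> * \<theta>))) powr (1 - z)" by simp
  have "(1 - exp (- (\<epsilon> * \<theta>))) powr (1 - z) = (exp_quot (\<epsilon> * \<theta>) * (\<epsilon> * \<theta>)) powr (1 - z)"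
    using eps theta by (simp add: exp_quot_def)
  also have "\<dots> = exp_quot (\<epsilon> * \<theta>) powr (1 - z) * (\<epsilon> * \<theta>) powr (1 - z)"
    by (rule powr_mult)
  also have "(\<epsilon> * \<theta>) powr (1 - z) = exp ((1 - z) * ln (\<epsilon> * \<theta>))" using eps theta by (simp add: powr_def)
  finally have pw: "(1 - exp (- (\<epsilon> * \<theta>))) powr (1 - z) = exp_quot (\<epsilon> * \<theta>) powr (1 - z) * exp ((1 - z) * ln (\<epsilon> * \<theta>))" .
  have ke: "1 / (\<epsilon> * \<eta>) ^ k = exp (- (real k * ln (\<epsilon> * \<eta>)))"
    using h eps by (simp add: exp_minus exp_of_nat_mult divide_inverse)
  have x: "geo_x \<alpha> \<eta> \<epsilon> k ^ Suc N = exp (- (\<epsilon> * real (Suc N) * p))"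
    unfolding geo_x_def p_def by (subst exp_of_nat_mult[symmetric]) (simp add: algebra_simps)
  have z1: "1 - z = (1/2 - \<alpha> / (2 * \<theta>)) - p / \<theta>" using theta by (simp add: z_def gamma_arg_def p_def field_simps)
  have k1: "real k = p / \<eta> - (\<alpha> / (2 * \<eta>) + 1/2)" using eta by (simp add: p_def pole_def field_simps)
  have ex: "exp (- (\<epsilon> * real (Suc N) * p)) * exp ((1 - z) * ln (\<epsilon> * \<theta>)) * exp (- (real k * ln (\<epsilon> * \<eta>))) =
     exp ((1/2 - \<alpha> / (2 * \<theta>)) * ln (\<epsilon> * \<theta>) + (\<alpha> / (2 * \<eta>) + 1/2) * ln (\<epsilon> * \<eta>)) * exp (- ((rescaled \<eta> \<theta> \<epsilon> N + \<epsilon>) * p))"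
    unfolding mult_exp_exp exp_inj_iff z1 k1 rescaled_def by (simp add: algebra_simps)
  have ep: "exp_prod (\<epsilon> * \<eta>) k > 0" by (rule exp_prod_pos[OF h(1)])
  have inv: "1 / exp_prod (\<epsilon> * \<eta>) k = ((\<epsilon> * \<eta>) ^ k * fact k / exp_prod (\<epsilon> * \<eta>) k) * (1 / fact k) * (1 / (\<epsilon> * \<eta>) ^ k)"
    using eps eta by simp
  have "prelimit_coeff \<alpha> \<eta> \<theta> \<epsilon> N k = (-1) ^ k * geo_x \<alpha> \<eta> \<epsilon> k ^ Suc N * qpoch (\<epsilon> * \<theta>) z * (1 / exp_prod (\<epsilon> * \<eta>) k) / qpoch (\<epsilon> * \<eta>) 1"
    by (simp add: prelimit_coeff_def z_def)
  also have "\<dots> = (-1) ^ k * (rqGamma (\<epsilon> * \<theta>) z * exp_quot (\<epsilon> * \<theta>) powr (1 - z)) *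
      ((\<epsilon> * \<eta>) ^ k * fact k / exp_prod (\<epsilon> * \<eta>) k) * (1 / fact k) *
      (exp (- (\<epsilon> * real (Suc N) * p)) * exp ((1 - z) * ln (\<epsilon> * \<theta>)) * exp (- (real k * ln (\<epsilon> * \<eta>)))) *
      (qpoch (\<epsilon> * \<theta>) 1 / qpoch (\<epsilon> * \<eta>) 1)"
    unfolding inv qz pw x ke by (simp add: mult_ac)
  also have "\<dots> = coeff_scale \<alpha> \<eta> \<theta> \<epsilon> * norm_coeff \<alpha> \<eta> \<theta> \<epsilon> (rescaled \<eta> \<theta> \<epsilon> N + \<epsilon>) k"
    unfolding ex coeff_scale_def norm_coeff_def z_def[symmetric] p_def[symmetric] using eta by (simp add: mult_ac)
  finally show ?thesis .
qed

text \<open>What survives the cancellation is one factor \<open>\<epsilon>\<close> for each of the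
  two denominators \<open>1 - x k * y j\<close>, which vanish to first order.\<close>

lemma coeff_scale_mult:
  assumes eta: "\<eta> > 0" and theta: "\<theta> > 0" and eps: "\<epsilon> > 0"
  shows "coeff_scale \<alpha> \<theta> \<eta> \<epsilon> * coeff_scale \<alpha> \<eta> \<theta> \<epsilon> = \<epsilon> * \<epsilon>"
proof -
  have h: "\<epsilon> * \<eta> > 0" "\<epsilon> * \<theta> > 0" using eps eta theta by auto
  have q: "qpoch (\<epsilon> * \<theta>) 1 > 0" "qpoch (\<epsilon> * \<eta>) 1 > 0" using qpoch_pos h by auto
  have "coeff_scale \<alpha> \<theta> \<eta> \<epsilon> * coeff_scale \<alpha> \<eta> \<theta> \<epsilon> =
     exp ((1/2 - \<alpha> / (2 * \<eta>)) * ln (\<epsilon> * \<eta>) + (\<alpha> / (2 * \<theta>) + 1/2) * ln (\<epsilon> * \<theta>)) *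
     exp ((1/2 - \<alpha> / (2 * \<theta>)) * ln (\<epsilon> * \<theta>) + (\<alpha> / (2 * \<eta>) + 1/2) * ln (\<epsilon> * \<eta>)) / (\<eta> * \<theta>)"
    unfolding coeff_scale_def using q by simp
  also have "exp ((1/2 - \<alpha> / (2 * \<eta>)) * ln (\<epsilon> * \<eta>) + (\<alpha> / (2 * \<theta>) + 1/2) * ln (\<epsilon> * \<theta>)) *
     exp ((1/2 - \<alpha> / (2 * \<theta>)) * ln (\<epsilon> * \<theta>) + (\<alpha> / (2 * \<eta>) + 1/2) * ln (\<epsilon> * \<eta>)) = exp (ln (\<epsilon> * \<eta>)) * exp (ln (\<epsilon> * \<theta>))"
    unfolding mult_exp_exp exp_inj_iff by (simp add: algebra_simps)
  also have "\<dots> = (\<epsilon> * \<eta>) * (\<epsilon> * \<theta>)" using h by simp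
  finally show ?thesis using eta theta by simp
qed

lemma prelimit_kernel_norm:
  assumes "\<eta> > 0" "\<theta> > 0" "\<alpha> \<ge> 0" "\<epsilon> > 0"
  shows "prelimit_kernel \<alpha> \<eta> \<theta> \<epsilon> N j l = (\<Sum>k. norm_coeff \<alpha> \<theta> \<eta> \<epsilon> (rescaled \<eta> \<theta> \<epsilon> N + \<epsilon>) j *
     norm_coeff \<alpha> \<eta> \<theta> \<epsilon> (rescaled \<eta> \<theta> \<epsilon> N + \<epsilon>) k *
     (\<epsilon> / (1 - geo_x \<alpha> \<eta> \<epsilon> k * geo_x \<alpha> \<theta> \<epsilon> j)) * (\<epsilon> / (1 - geo_x \<alpha> \<eta> \<epsilon> k * geo_x \<alpha> \<theta> \<epsilon> l)))"
  unfolding prelimit_kernel_def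
proof (rule suminf_cong)
  fix k
  define a b where "a = norm_coeff \<alpha> \<theta> \<eta> \<epsilon> (rescaled \<eta> \<theta> \<epsilon> N + \<epsilon>) j" and "b = norm_coeff \<alpha> \<eta> \<theta> \<epsilon> (rescaled \<eta> \<theta> \<epsilon> N + \<epsilon>) k"
  have "prelimit_coeff \<alpha> \<theta> \<eta> \<epsilon> N j * prelimit_coeff \<alpha> \<eta> \<theta> \<epsilon> N k = (coeff_scale \<alpha> \<theta> \<eta> \<epsilon> * coeff_scale \<alpha> \<eta> \<theta> \<epsilon>) * (a * b)"
    unfolding a_def b_def using prelimit_coeff_norm[of \<theta> \<eta> \<alpha> \<epsilon> N j] prelimit_coeff_norm[of \<eta> \<theta> \<alpha> \<epsilon> N k] assms
    by (simp add: rescaled_commute[of \<theta>] mult_ac)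
  also have "\<dots> = \<epsilon> * \<epsilon> * (a * b)" unfolding coeff_scale_mult[OF assms(1,2,4)] ..
  finally show "prelimit_coeff \<alpha> \<theta> \<eta> \<epsilon> N j * prelimit_coeff \<alpha> \<eta> \<theta> \<epsilon> N k /
     ((1 - geo_x \<alpha> \<eta> \<epsilon> k * geo_x \<alpha> \<theta> \<epsilon> j) * (1 - geo_x \<alpha> \<eta> \<epsilon> k * geo_x \<alpha> \<theta> \<epsilon> l)) =
     a * b * (\<epsilon> / (1 - geo_x \<alpha> \<eta> \<epsilon> k * geo_x \<alpha> \<theta> \<epsilon> j)) * (\<epsilon> / (1 - geo_x \<alpha> \<eta> \<epsilon> k * geo_x \<alpha> \<theta> \<epsilon> l))"
    by simp
qed

lemma filterlim_scale_at_right: "c > 0 \<Longrightarrow> filterlim (\<lambda>\<epsilon>::real. \<epsilon> * c) (at_right 0) (at_right 0)"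
  unfolding filterlim_at by (auto intro!: tendsto_eq_intros simp: eventually_at_filter)

lemma exp_quot_tendsto: "((\<lambda>h. (1 - exp (- (h * c))) / h) \<longlongrightarrow> c) (at_right (0::real))"
proof -
  have "((\<lambda>h. 1 - exp (- (h * c))) has_field_derivative c) (at 0)" by (auto intro!: derivative_eq_intros)
  then have "((\<lambda>h. (1 - exp (- (h * c))) / h) \<longlongrightarrow> c) (at 0)" by (simp add: has_field_derivative_iff)
  then show ?thesis by (rule filterlim_mono) (auto simp: at_le)
qed

lemma exp_prod_tendsto: "((\<lambda>h. h ^ k * fact k / exp_prod h k) \<longlongrightarrow> 1) (at_right 0)"
proof -
  have d: "((\<lambda>h. (exp (h * c) - 1) / h) \<longlongrightarrow> c) (at_right (0::real))" for c :: real
  proof -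
    have "((\<lambda>h. exp (h * c) - 1) has_field_derivative c) (at 0)" by (auto intro!: derivative_eq_intros)
    then have "((\<lambda>h. (exp (h * c) - 1) / h) \<longlongrightarrow> c) (at 0)" by (simp add: has_field_derivative_iff)
    then show ?thesis by (rule filterlim_mono) (auto simp: at_le)
  qed
  have f: "(\<Prod>i<k. real (Suc i)) = fact k" by (induction k) (auto simp: mult.commute)
  have "((\<lambda>h. fact k / (\<Prod>i<k. (exp (h * real (Suc i)) - 1) / h)) \<longlongrightarrow> fact k / (\<Prod>i<k. real (Suc i))) (at_right 0)"
    by (intro tendsto_divide tendsto_const tendsto_prod d) (simp add: f del: of_nat_Suc)
  then have "((\<lambda>h. fact k / (\<Prod>i<k. (exp (h * real (Suc i)) - 1) / h)) \<longlongrightarrow> 1) (at_right 0)" by (simp add: f del: of_nat_Suc)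
  moreover have "fact k / (\<Prod>i<k. (exp (h * real (Suc i)) - 1) / h) = h ^ k * fact k / exp_prod h k" for h
    by (simp add: exp_prod_def prod_dividef mult.commute)
  ultimately show ?thesis by simp
qed

lemma norm_coeff_tendsto:
  assumes eta: "\<eta> > 0" and theta: "\<theta> > 0" and alpha: "\<alpha> \<ge> 0" and t: "(t \<longlongrightarrow> s) (at_right 0)"
  shows "((\<lambda>\<epsilon>. norm_coeff \<alpha> \<eta> \<theta> \<epsilon> (t \<epsilon>) k) \<longlongrightarrow> residue_coeff \<alpha> \<eta> \<theta> k * exp (- (s * pole \<alpha> \<eta> k))) (at_right 0)"
proof -
  have z: "0 < gamma_arg \<alpha> \<eta> \<theta> k" unfolding gamma_arg_def using pole_pos[OF eta alpha, of k] alpha theta by (intro add_nonneg_pos divide_nonneg_pos) auto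
  have 1: "((\<lambda>\<epsilon>. rqGamma (\<epsilon> * \<theta>) (gamma_arg \<alpha> \<eta> \<theta> k)) \<longlongrightarrow> rGamma (gamma_arg \<alpha> \<eta> \<theta> k)) (at_right 0)"
    by (rule filterlim_compose[OF rqGamma_tendsto[OF z] filterlim_scale_at_right[OF theta]])
  have "((\<lambda>h. exp_quot h) \<longlongrightarrow> 1) (at_right 0)" using exp_quot_tendsto[of 1] by (simp add: exp_quot_def[abs_def])
  from filterlim_compose[OF this filterlim_scale_at_right[OF theta]]
  have 2: "((\<lambda>\<epsilon>. exp_quot (\<epsilon> * \<theta>)) \<longlongrightarrow> 1) (at_right 0)" .
  have 3: "((\<lambda>\<epsilon>. (\<epsilon> * \<eta>) ^ k * fact k / exp_prod (\<epsilon> * \<eta>) k) \<longlongrightarrow> 1) (at_right 0)"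
    by (rule filterlim_compose[OF exp_prod_tendsto filterlim_scale_at_right[OF eta]])
  have "((\<lambda>\<epsilon>. norm_coeff \<alpha> \<eta> \<theta> \<epsilon> (t \<epsilon>) k) \<longlongrightarrow> \<eta> * (-1) ^ k / fact k * rGamma (gamma_arg \<alpha> \<eta> \<theta> k) *
     1 powr (1 - gamma_arg \<alpha> \<eta> \<theta> k) * 1 * exp (- (s * pole \<alpha> \<eta> k))) (at_right 0)"
    unfolding norm_coeff_def by (intro tendsto_mult tendsto_const 1 3 tendsto_exp tendsto_minus t tendsto_powr[OF 2]) auto
  then show ?thesis by (simp add: residue_coeff_def gamma_arg_def)
qed

text \<open>The 6 is the uniform bound on \<open>rqGamma\<close>, and \<open>exp_quot\<close> of at
  least 1/2 costs at most \<open>2 powr z\<close>. Since \<open>z\<close> is affine in the pole,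
  this amounts to lowering \<open>s\<close> by \<open>ln 2 / \<theta>\<close> together with a
  constant factor, which the factorial tolerates.\<close>

lemma norm_coeff_bound:
  assumes eta: "\<eta> > 0" and theta: "\<theta> > 0" and alpha: "\<alpha> \<ge> 0" and eps: "\<epsilon> > 0"
    and q: "1/2 \<le> exp_quot (\<epsilon> * \<theta>)" and t: "s \<le> t"
  shows "\<bar>norm_coeff \<alpha> \<eta> \<theta> \<epsilon> t k\<bar> \<le> 6 * \<eta> * exp (ln 2 * (\<alpha> / (2 * \<theta>) + 1/2)) * (exp (- ((s - ln 2 / \<theta>) * pole \<alpha> \<eta> k)) / fact k)"
proof -
  define z where "z = gamma_arg \<alpha> \<eta> \<theta> k"
  have h: "\<epsilon> * \<eta> > 0" "\<epsilon> * \<theta> > 0" using eps eta theta by auto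
  have z: "0 < z" unfolding z_def gamma_arg_def using pole_pos[OF eta alpha, of k] alpha theta by (intro add_nonneg_pos divide_nonneg_pos) auto
  have q1: "exp_quot (\<epsilon> * \<theta>) \<le> 1" using h exp_ge_add_one_self[of "- (\<epsilon> * \<theta>)"] by (simp add: exp_quot_def)
  have pw: "exp_quot (\<epsilon> * \<theta>) powr (1 - z) \<le> exp (ln 2 * z)"
  proof -
    have "ln (1/2) \<le> ln (exp_quot (\<epsilon> * \<theta>))" using q by (subst ln_le_cancel_iff) auto
    then have l: "- ln 2 \<le> ln (exp_quot (\<epsilon> * \<theta>))" "ln (exp_quot (\<epsilon> * \<theta>)) \<le> 0" using q q1 by (auto simp: ln_div)
    have "(1 - z) * ln (exp_quot (\<epsilon> * \<theta>)) = ln (exp_quot (\<epsilon> * \<theta>)) + z * (- ln (exp_quot (\<epsilon> * \<theta>)))" by (simp add: algebra_simps)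
    also have "\<dots> \<le> 0 + z * ln 2" using l z by (intro add_mono mult_left_mono) auto
    finally show ?thesis using q by (simp add: powr_def mult.commute)
  qed
  have rq: "0 < rqGamma (\<epsilon> * \<theta>) z" "rqGamma (\<epsilon> * \<theta>) z \<le> 6" using rqGamma_pos[OF h(2) z] rqGamma_le[OF h(2) z] by auto
  have ep: "0 < exp_prod (\<epsilon> * \<eta>) k" by (rule exp_prod_pos[OF h(1)])
  have tau: "0 \<le> (\<epsilon> * \<eta>) ^ k * fact k / exp_prod (\<epsilon> * \<eta>) k" "(\<epsilon> * \<eta>) ^ k * fact k / exp_prod (\<epsilon> * \<eta>) k \<le> 1"
    using ep exp_prod_ge[OF h(1), of k] h by auto
  have ex: "exp (- (t * pole \<alpha> \<eta> k)) \<le> exp (- (s * pole \<alpha> \<eta> k))" using t pole_pos[OF eta alpha, of k] by simp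
  have "\<bar>norm_coeff \<alpha> \<eta> \<theta> \<epsilon> t k\<bar> = \<eta> / fact k * rqGamma (\<epsilon> * \<theta>) z * exp_quot (\<epsilon> * \<theta>) powr (1 - z) *
     ((\<epsilon> * \<eta>) ^ k * fact k / exp_prod (\<epsilon> * \<eta>) k) * exp (- (t * pole \<alpha> \<eta> k))"
    using eta rq tau(1) ep eps by (simp add: norm_coeff_def z_def[symmetric] abs_mult power_abs)
  also have "\<dots> \<le> \<eta> / fact k * 6 * exp (ln 2 * z) * 1 * exp (- (s * pole \<alpha> \<eta> k))"
    using eta rq tau pw ex by (intro mult_mono mult_nonneg_nonneg) auto
  also have "\<dots> = 6 * \<eta> / fact k * (exp (ln 2 * z) * exp (- (s * pole \<alpha> \<eta> k)))" by simp
  also have "exp (ln 2 * z) * exp (- (s * pole \<alpha> \<eta> k)) = exp (ln 2 * (\<alpha> / (2 * \<theta>) + 1/2)) * exp (- ((s - ln 2 / \<theta>) * pole \<alpha> \<eta> k))"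
    unfolding mult_exp_exp exp_inj_iff z_def gamma_arg_def using theta by (simp add: field_simps)
  finally show ?thesis by (simp add: mult_ac)
qed

text \<open>The assumption \<open>ge\<close> keeps the exponentials below those at \<open>s\<close>
  and so gives a majorant free of \<open>\<epsilon>\<close>; Tannery's theorem then applies to the
  inner series and to the sum over index sets.\<close>

theorem prelimit_kernel_tendsto:
  assumes eta: "\<eta> > 0" and theta: "\<theta> > 0" and alpha: "\<alpha> \<ge> 0"
    and lim: "((\<lambda>\<epsilon>. rescaled \<eta> \<theta> \<epsilon> (N \<epsilon>)) \<longlongrightarrow> s) (at_right 0)"
    and ge: "eventually (\<lambda>\<epsilon>. s \<le> rescaled \<eta> \<theta> \<epsilon> (N \<epsilon>) + \<epsilon>) (at_right 0)"
  shows "((\<lambda>\<epsilon>. discrete_fredholm (\<lambda>j l. of_real (prelimit_kernel \<alpha> \<eta> \<theta> \<epsilon> (N \<epsilon>) j l))) \<longlongrightarrow>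
     discrete_fredholm (\<lambda>j l. of_real (limit_kernel \<alpha> \<eta> \<theta> s j l))) (at_right 0)"
proof -
  define t where "t \<epsilon> = rescaled \<eta> \<theta> \<epsilon> (N \<epsilon>) + \<epsilon>" for \<epsilon>
  define A where "A k = 6 * \<eta> * exp (ln 2 * (\<alpha> / (2 * \<theta>) + 1/2)) * (exp (- ((s - ln 2 / \<theta>) * pole \<alpha> \<eta> k)) / fact k)" for k
  define B where "B k = 6 * \<theta> * exp (ln 2 * (\<alpha> / (2 * \<eta>) + 1/2)) * (exp (- ((s - ln 2 / \<eta>) * pole \<alpha> \<theta> k)) / fact k)" for k
  have AB0: "0 \<le> A k" "0 \<le> B k" for k using eta theta by (auto simp: A_def B_def)
  have As: "summable A" unfolding A_def by (intro summable_mult summable_exp_pole)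
  have "summable (\<lambda>k. 6 * \<theta> * exp (ln 2 * (\<alpha> / (2 * \<eta>) + 1/2)) * (real (Suc k) * (exp (- ((s - ln 2 / \<eta>) * pole \<alpha> \<theta> k)) / fact k)))"
    by (intro summable_mult summable_Suc_exp_pole theta alpha)
  then have Bs: "summable (\<lambda>k. real (Suc k) * B k)" by (simp add: B_def mult_ac)
  define c where "c k j = pole \<alpha> \<eta> k + pole \<alpha> \<theta> j" for k j
  have c0: "0 < c k j" for k j using pole_pos eta theta alpha by (auto simp: c_def intro!: add_pos_pos)
  have cge: "c 0 0 \<le> c k j" for k j unfolding c_def by (intro add_mono pole_mono eta theta)
  define r where "r \<epsilon> k j = \<epsilon> / (1 - geo_x \<alpha> \<eta> \<epsilon> k * geo_x \<alpha> \<theta> \<epsilon> j)" for \<epsilon> k j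
  have r_eq: "r \<epsilon> k j = 1 / ((1 - exp (- (\<epsilon> * c k j))) / \<epsilon>)" for \<epsilon> k j
    by (simp add: r_def geo_x_def c_def mult_exp_exp algebra_simps)
  have r_lim: "((\<lambda>\<epsilon>. r \<epsilon> k j) \<longlongrightarrow> 1 / c k j) (at_right 0)" for k j
    unfolding r_eq using c0[of k j] by (intro tendsto_divide tendsto_const exp_quot_tendsto) auto
  have pos: "eventually (\<lambda>\<epsilon>::real. 0 < \<epsilon>) (at_right 0)" by (auto simp: eventually_at_filter)
  have r0: "0 \<le> r \<epsilon> k j" if "\<epsilon> > 0" for \<epsilon> k j unfolding r_eq using that c0[of k j] by (auto intro!: divide_nonneg_nonneg)
  have r_mono: "r \<epsilon> k j \<le> r \<epsilon> 0 0" if "\<epsilon> > 0" for \<epsilon> k j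
  proof -
    have "\<epsilon> * c 0 0 \<le> \<epsilon> * c k j" using that cge by (intro mult_left_mono) auto
    then have "1 - exp (- (\<epsilon> * c 0 0)) \<le> 1 - exp (- (\<epsilon> * c k j))" by simp
    moreover have "0 < 1 - exp (- (\<epsilon> * c 0 0))" using that c0[of 0 0] by simp
    ultimately have "\<epsilon> / (1 - exp (- (\<epsilon> * c k j))) \<le> \<epsilon> / (1 - exp (- (\<epsilon> * c 0 0)))" using that c0[of k j] c0[of 0 0] by (intro divide_left_mono) (auto intro!: mult_pos_pos)
    then show ?thesis unfolding r_eq by simp
  qed
  have "eventually (\<lambda>\<epsilon>. r \<epsilon> 0 0 < 2 / c 0 0) (at_right 0)"
    by (rule order_tendstoD(2)[OF r_lim]) (use c0[of 0 0] in \<open>simp add: divide_strict_right_mono\<close>)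
  \<comment> \<open>Twice the limit of \<open>r \<epsilon> 0 0\<close>, the largest of the quotients
    \<open>r \<epsilon> k j\<close>.\<close>
  define R where "R = 2 / c 0 0"
  have t_lim: "(t \<longlongrightarrow> s) (at_right 0)"
  proof -
    have "((\<lambda>\<epsilon>. rescaled \<eta> \<theta> \<epsilon> (N \<epsilon>) + \<epsilon>) \<longlongrightarrow> s + 0) (at_right 0)" by (intro tendsto_add lim tendsto_ident_at)
    then show ?thesis by (simp add: t_def[abs_def])
  qed
  have eq1: "((\<lambda>h. exp_quot h) \<longlongrightarrow> 1) (at_right 0)" using exp_quot_tendsto[of 1] by (simp add: exp_quot_def[abs_def])
  have half: "eventually (\<lambda>\<epsilon>. 1/2 < exp_quot (\<epsilon> * c)) (at_right 0)" if "c > 0" for c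
    by (rule order_tendstoD(1)[OF filterlim_compose[OF eq1 filterlim_scale_at_right[OF that]]]) simp
  define T where "T \<epsilon> j l k = norm_coeff \<alpha> \<theta> \<eta> \<epsilon> (t \<epsilon>) j * norm_coeff \<alpha> \<eta> \<theta> \<epsilon> (t \<epsilon>) k * r \<epsilon> k j * r \<epsilon> k l" for \<epsilon> j l k
  have good: "eventually (\<lambda>\<epsilon>. 0 < \<epsilon> \<and> (\<forall>j l k. \<bar>T \<epsilon> j l k\<bar> \<le> B j * A k * R * R)) (at_right 0)"
    using pos half[OF eta] half[OF theta] ge \<open>eventually (\<lambda>\<epsilon>. r \<epsilon> 0 0 < 2 / c 0 0) (at_right 0)\<close>
  proof eventually_elim
    case (elim \<epsilon>)
    have a: "\<bar>norm_coeff \<alpha> \<eta> \<theta> \<epsilon> (t \<epsilon>) k\<bar> \<le> A k" for k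
      unfolding A_def by (rule norm_coeff_bound) (use elim eta theta alpha in \<open>auto simp: t_def\<close>)
    have b: "\<bar>norm_coeff \<alpha> \<theta> \<eta> \<epsilon> (t \<epsilon>) k\<bar> \<le> B k" for k
      unfolding B_def by (rule norm_coeff_bound) (use elim eta theta alpha in \<open>auto simp: t_def\<close>)
    have rR: "\<bar>r \<epsilon> k j\<bar> \<le> R" for k j using r_mono[of \<epsilon> k j] r0[of \<epsilon> k j] elim by (simp add: R_def)
    have "\<bar>T \<epsilon> j l k\<bar> \<le> B j * A k * R * R" for j l k
      unfolding T_def abs_mult using AB0 order_trans[OF abs_ge_zero rR]
      by (intro mult_mono a b rR mult_nonneg_nonneg) auto
    then show ?case using elim by blast
  qed
  have K_eq: "prelimit_kernel \<alpha> \<eta> \<theta> \<epsilon> (N \<epsilon>) j l = (\<Sum>k. T \<epsilon> j l k)" if "\<epsilon> > 0" for \<epsilon> j l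
    unfolding prelimit_kernel_norm[OF eta theta alpha that] T_def t_def r_def ..
  have Ts: "summable (\<lambda>k. B j * A k * R * R)" for j by (intro summable_mult summable_mult2 As)
  show ?thesis
  proof (rule discrete_fredholm_tendsto[where g = "\<lambda>j. B j * (suminf A * R * R)"])
    fix j l
    have Tl: "((\<lambda>\<epsilon>. T \<epsilon> j l k) \<longlongrightarrow> (residue_coeff \<alpha> \<theta> \<eta> j * exp (- (s * pole \<alpha> \<theta> j))) *
        (residue_coeff \<alpha> \<eta> \<theta> k * exp (- (s * pole \<alpha> \<eta> k))) * (1 / c k j) * (1 / c k l)) (at_right 0)" for k
      unfolding T_def by (intro tendsto_mult norm_coeff_tendsto eta theta alpha t_lim r_lim)
    have dom: "eventually (\<lambda>(k, \<epsilon>). norm (T \<epsilon> j l k) \<le> B j * A k * R * R) (at_top \<times>\<^sub>F at_right 0)"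
      unfolding eventually_prod_filter
      by (rule exI[of _ "\<lambda>_. True"], rule exI, intro conjI, simp, rule good) auto
    have nb: "at_right (0::real) \<noteq> bot" by simp
    from tannerys_theorem[OF Tl dom Ts nb]
    have "((\<lambda>\<epsilon>. \<Sum>k. T \<epsilon> j l k) \<longlongrightarrow> limit_kernel \<alpha> \<eta> \<theta> s j l) (at_right 0)"
      by (simp add: limit_kernel_def c_def)
    then have "((\<lambda>\<epsilon>. prelimit_kernel \<alpha> \<eta> \<theta> \<epsilon> (N \<epsilon>) j l) \<longlongrightarrow> limit_kernel \<alpha> \<eta> \<theta> s j l) (at_right 0)"
      by (rule Lim_transform_eventually) (use pos in \<open>auto elim!: eventually_mono simp: K_eq\<close>)
    then show "((\<lambda>\<epsilon>. complex_of_real (prelimit_kernel \<alpha> \<eta> \<theta> \<epsilon> (N \<epsilon>) j l)) \<longlongrightarrow> of_real (limit_kernel \<alpha> \<eta> \<theta> s j l)) (at_right 0)"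
      by (rule tendsto_of_real)
  next
    show "eventually (\<lambda>\<epsilon>. \<forall>j l. norm (complex_of_real (prelimit_kernel \<alpha> \<eta> \<theta> \<epsilon> (N \<epsilon>) j l)) \<le> B j * (suminf A * R * R)) (at_right 0)"
      using good
    proof eventually_elim
      case (elim \<epsilon>)
      show ?case
      proof (intro allI)
        fix j l
        have Tb: "\<bar>T \<epsilon> j l k\<bar> \<le> B j * A k * R * R" for k using elim by blast
        have sm: "summable (\<lambda>k. \<bar>T \<epsilon> j l k\<bar>)" by (rule summable_comparison_test'[OF Ts[of j], of 0]) (use Tb in simp)
        have "\<bar>\<Sum>k. T \<epsilon> j l k\<bar> \<le> (\<Sum>k. \<bar>T \<epsilon> j l k\<bar>)" by (rule summable_rabs[OF sm])
        also have "\<dots> \<le> (\<Sum>k. B j * A k * R * R)" by (rule suminf_le[OF Tb sm Ts])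
        also have "\<dots> = (\<Sum>k. (B j * R * R) * A k)" by (simp add: mult_ac)
        also have "\<dots> = (B j * R * R) * suminf A" by (rule suminf_mult[OF As])
        finally show "norm (complex_of_real (prelimit_kernel \<alpha> \<eta> \<theta> \<epsilon> (N \<epsilon>) j l)) \<le> B j * (suminf A * R * R)"
          using elim by (simp add: K_eq mult_ac)
      qed
    qed
    show "summable (\<lambda>j. real (Suc j) * (B j * (suminf A * R * R)))"
      using summable_mult2[OF Bs, of "suminf A * R * R"] by (simp add: mult_ac)
  qed simp
qed

section \<open>Last passage times\<close>

text \<open>Cells are numbered from 1; row and column 0 form a border of zeros that makes one
  recursion serve the edges as well.\<close>

fun lpt :: "(nat \<times> nat \<Rightarrow> nat) \<Rightarrow> nat \<Rightarrow> nat \<Rightarrow> nat" where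
  "lpt w 0 j = 0"
| "lpt w (Suc i) 0 = 0"
| "lpt w (Suc i) (Suc j) = max (lpt w i (Suc j)) (lpt w (Suc i) j) + w (Suc i, Suc j)"

lemma lpt_0_right [simp]: "lpt w i 0 = 0" by (cases i) auto

lemma lpt_step: "lpt w i j \<le> lpt w (Suc i) j" "lpt w i j \<le> lpt w i (Suc j)"
  by (cases j; simp) (cases i; simp)

lemma lpt_mono: "i \<le> i' \<Longrightarrow> j \<le> j' \<Longrightarrow> lpt w i j \<le> lpt w i' j'"
proof -
  assume "i \<le> i'" "j \<le> j'"
  have "lpt w i j \<le> lpt w i' j" by (rule lift_Suc_mono_le[OF _ \<open>i \<le> i'\<close>]) (rule lpt_step)
  also have "\<dots> \<le> lpt w i' j'" by (rule lift_Suc_mono_le[OF _ \<open>j \<le> j'\<close>]) (rule lpt_step)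
  finally show ?thesis .
qed

lemma lpt_cong:
  "(\<And>a b. 1 \<le> a \<Longrightarrow> a \<le> i \<Longrightarrow> 1 \<le> b \<Longrightarrow> b \<le> j \<Longrightarrow> w (a, b) = w' (a, b)) \<Longrightarrow> lpt w i j = lpt w' i j"
proof (induction w i j rule: lpt.induct)
  case (3 w i j)
  have "lpt w i (Suc j) = lpt w' i (Suc j)" by (rule 3(1)) (use 3(3) in auto)
  moreover have "lpt w (Suc i) j = lpt w' (Suc i) j" by (rule 3(2)) (use 3(3) in auto)
  ultimately show ?case using 3(3)[of "Suc i" "Suc j"] by simp
qed auto

lemma weight_le_lpt: "1 \<le> i \<Longrightarrow> 1 \<le> j \<Longrightarrow> w (i, j) \<le> lpt w i j"
  by (cases i; cases j) auto

lemmas lpt_rec = lpt.simps(3)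

declare lpt.simps(3) [simp del]

section \<open>Paths and passage times on boxes\<close>

definition ur_step :: "nat \<times> nat \<Rightarrow> nat \<times> nat \<Rightarrow> bool" where
  "ur_step p q \<longleftrightarrow> q = (fst p + 1, snd p) \<or> q = (fst p, snd p + 1)"

definition lu_step :: "nat \<times> nat \<Rightarrow> nat \<times> nat \<Rightarrow> bool" where
  "lu_step p q \<longleftrightarrow> (fst q + 1 = fst p \<and> snd q = snd p) \<or> q = (fst p, snd p + 1)"

lemma up_right_path_iff: "up_right_path xs \<longleftrightarrow> xs \<noteq> [] \<and> hd xs = (1, 1) \<and> successively ur_step xs"
  by (simp add: up_right_path_def ur_step_def successively_conv_nth)

lemma left_up_path_iff: "left_up_path xs \<longleftrightarrow> xs \<noteq> [] \<and> fst (hd xs) \<ge> 1 \<and> snd (hd xs) = 1 \<and>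
    fst (last xs) = 1 \<and> snd (last xs) \<ge> 1 \<and> successively lu_step xs"
  by (simp add: left_up_path_def lu_step_def successively_conv_nth)

lemma path_weight_eq: "path_weight w xs = enat (sum_list (map w xs))"
  unfolding path_weight_def by (induction xs) (auto simp: zero_enat_def)

lemma ur_path_bounds:
  assumes "xs \<noteq> []" "successively ur_step xs" "p \<in> set xs"
  shows "fst (hd xs) \<le> fst p" "snd (hd xs) \<le> snd p" "fst p \<le> fst (last xs)" "snd p \<le> snd (last xs)"
proof -
  have "\<forall>p\<in>set xs. fst (hd xs) \<le> fst p \<and> snd (hd xs) \<le> snd p \<and> fst p \<le> fst (last xs) \<and> snd p \<le> snd (last xs)"
    using assms(1,2)
  proof (induction xs rule: rev_induct)
    case (snoc q xs)
    show ?case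
    proof (cases "xs = []")
      case False
      have st: "ur_step (last xs) q" and su: "successively ur_step xs"
        using snoc.prems False by (auto simp: successively_append_iff)
      note IH = snoc.IH[OF False su]
      have q: "fst (last xs) \<le> fst q" "snd (last xs) \<le> snd q" using st by (auto simp: ur_step_def)
      have "fst (hd xs) \<le> fst (last xs)" "snd (hd xs) \<le> snd (last xs)" using IH last_in_set[OF False] by auto
      then show ?thesis using IH q False by (auto intro: order_trans)
    qed simp
  qed simp
  then show "fst (hd xs) \<le> fst p" "snd (hd xs) \<le> snd p" "fst p \<le> fst (last xs)" "snd p \<le> snd (last xs)" using assms(3) by auto
qed

text \<open>The start is any cell with positive coordinates: reflected paths of the second model
  need not begin at \<open>(1, 1)\<close>.\<close>

lemma ur_path_weight_le:
  "xs \<noteq> [] \<Longrightarrow> successively ur_step xs \<Longrightarrow> 1 \<le> fst (hd xs) \<Longrightarrow> 1 \<le> snd (hd xs) \<Longrightarrow>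
     sum_list (map w xs) \<le> lpt w (fst (last xs)) (snd (last xs))"
proof (induction xs rule: rev_induct)
  case (snoc q xs)
  show ?case
  proof (cases "xs = []")
    case True
    then show ?thesis using weight_le_lpt[of "fst q" "snd q" w] snoc.prems by simp
  next
    case False
    have st: "ur_step (last xs) q" and su: "successively ur_step xs" and h: "1 \<le> fst (hd xs)" "1 \<le> snd (hd xs)"
      using snoc.prems False by (auto simp: successively_append_iff)
    obtain a b where l: "last xs = (a, b)" by force
    have ab: "1 \<le> a" "1 \<le> b" using ur_path_bounds[OF False su last_in_set[OF False]] h l by auto
    have IH: "sum_list (map w xs) \<le> lpt w a b" using snoc.IH[OF False su h] l by simp
    obtain a' b' where a': "a = Suc a'" "b = Suc b'" using ab by (cases a; cases b) auto
    from st l consider "q = (Suc a, b)" | "q = (a, Suc b)" by (auto simp: ur_step_def)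
    then show ?thesis
    proof cases
      case 1
      then have "lpt w (fst q) (snd q) = max (lpt w a b) (lpt w (Suc a) b') + w q" by (simp add: a' lpt_rec)
      then show ?thesis using IH by simp
    next
      case 2
      then have "lpt w (fst q) (snd q) = max (lpt w a' (Suc b)) (lpt w a b) + w q" by (simp add: a' lpt_rec)
      then show ?thesis using IH by simp
    qed
  qed
qed simp

lemma lpt_attained:
  "\<exists>xs. up_right_path xs \<and> last xs = (Suc i, Suc j) \<and> sum_list (map w xs) = lpt w (Suc i) (Suc j)"
proof (induction "i + j" arbitrary: i j rule: less_induct)
  case less
  have ext: "\<exists>xs. up_right_path xs \<and> last xs = (Suc i, Suc j) \<and> sum_list (map w xs) = lpt w (Suc i) (Suc j)"
    if xs: "up_right_path xs" "ur_step (last xs) (Suc i, Suc j)"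
      and v: "sum_list (map w xs) = max (lpt w i (Suc j)) (lpt w (Suc i) j)" for xs
    using xs v by (intro exI[of _ "xs @ [(Suc i, Suc j)]"]) (auto simp: up_right_path_iff successively_append_iff lpt_rec)
  show ?case
  proof (cases "i = 0 \<and> j = 0")
    case True
    then show ?thesis by (intro exI[of _ "[(1, 1)]"]) (auto simp: up_right_path_iff lpt_rec)
  next
    case False
    show ?thesis
    proof (cases "lpt w i (Suc j) \<ge> lpt w (Suc i) j \<and> i \<noteq> 0")
      case True
      then obtain i' where i': "i = Suc i'" by (cases i) auto
      obtain xs where "up_right_path xs" "last xs = (i, Suc j)" "sum_list (map w xs) = lpt w i (Suc j)"
        using less[of i' j] i' by auto
      then show ?thesis using True by (intro ext[of xs]) (auto simp: ur_step_def)
    next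
      case F: False
      have "j \<noteq> 0"
      proof
        assume "j = 0"
        then have "i = 0" using F by simp
        then show False using False \<open>j = 0\<close> by simp
      qed
      then obtain j' where j': "j = Suc j'" by (cases j) auto
      have le: "lpt w i (Suc j) \<le> lpt w (Suc i) j" using F by (cases i) auto
      obtain xs where "up_right_path xs" "last xs = (Suc i, j)" "sum_list (map w xs) = lpt w (Suc i) j"
        using less[of i j'] j' by auto
      then show ?thesis using le by (intro ext[of xs]) (auto simp: ur_step_def)
    qed
  qed
qed

text \<open>Passage times increase in both indices, so every path is controlled by a corner
  \<open>(n, n)\<close>. The event for the infinite array becomes a decreasing intersection of
  events on finite boxes.\<close>

theorem Lgeo1_le_iff: "Lgeo1 w \<le> enat N \<longleftrightarrow> (\<forall>n. lpt w n n \<le> N)"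
proof
  assume L: "Lgeo1 w \<le> enat N"
  show "\<forall>n. lpt w n n \<le> N"
  proof
    fix n show "lpt w n n \<le> N"
    proof (cases n)
      case (Suc m)
      obtain xs where xs: "up_right_path xs" "sum_list (map w xs) = lpt w n n" using lpt_attained[of m m w] Suc by auto
      have "path_weight w xs \<le> Lgeo1 w" unfolding Lgeo1_def by (rule SUP_upper) (use xs in simp)
      then have "path_weight w xs \<le> enat N" using L by (rule order_trans)
      then show ?thesis using xs by (simp add: path_weight_eq)
    qed simp
  qed
next
  assume all: "\<forall>n. lpt w n n \<le> N"
  show "Lgeo1 w \<le> enat N" unfolding Lgeo1_def
  proof (rule SUP_least)
    fix xs assume "xs \<in> {xs. up_right_path xs}"
    then have xs: "xs \<noteq> []" "hd xs = (1, 1)" "successively ur_step xs" by (auto simp: up_right_path_iff)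
    define m where "m = max (fst (last xs)) (snd (last xs))"
    have "sum_list (map w xs) \<le> lpt w (fst (last xs)) (snd (last xs))" using ur_path_weight_le[OF xs(1,3)] xs(2) by simp
    also have "\<dots> \<le> lpt w m m" by (rule lpt_mono) (auto simp: m_def)
    also have "\<dots> \<le> N" using all by blast
    finally show "path_weight w xs \<le> enat N" by (simp add: path_weight_eq)
  qed
qed

text \<open>Reverses the indices 1 to \<open>n\<close> of the first coordinate, which turns steps to
  the left into steps to the right.\<close>

definition reflect :: "nat \<Rightarrow> (nat \<times> nat \<Rightarrow> nat) \<Rightarrow> nat \<times> nat \<Rightarrow> nat" where
  "reflect n w = (\<lambda>(i, j). w (Suc n - i, j))"

lemma lu_path_bounds:
  assumes "xs \<noteq> []" "successively lu_step xs" "p \<in> set xs"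
  shows "fst p \<le> fst (hd xs)" "fst (last xs) \<le> fst p"
proof -
  have "\<forall>p\<in>set xs. fst p \<le> fst (hd xs) \<and> fst (last xs) \<le> fst p"
    using assms(1,2)
  proof (induction xs rule: rev_induct)
    case (snoc q xs)
    show ?case
    proof (cases "xs = []")
      case False
      have st: "lu_step (last xs) q" and su: "successively lu_step xs"
        using snoc.prems False by (auto simp: successively_append_iff)
      note IH = snoc.IH[OF False su]
      have q: "fst q \<le> fst (last xs)" using st by (auto simp: lu_step_def)
      then show ?thesis using IH False last_in_set[OF False] by (auto intro: order_trans)
    qed simp
  qed simp
  then show "fst p \<le> fst (hd xs)" "fst (last xs) \<le> fst p" using assms(3) by auto
qed

lemma successively_map_cong:
  assumes "successively P xs" "\<And>x y. x \<in> set xs \<Longrightarrow> y \<in> set xs \<Longrightarrow> P x y \<Longrightarrow> Q (f x) (f y)"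
  shows "successively Q (map f xs)"
  using assms by (auto simp: successively_conv_nth)

text \<open>Reflection exchanges up-right paths from \<open>(1, 1)\<close> to \<open>(n, n)\<close>
  with left-up paths from \<open>(n, 1)\<close> to \<open>(1, n)\<close>. A general left-up path is
  placed in a box large enough for both of its ends, and its reflection is compared with the corner
  passage time.\<close>

theorem Lgeo2_le_iff: "Lgeo2 w \<le> enat N \<longleftrightarrow> (\<forall>n. lpt (reflect n w) n n \<le> N)"
proof
  assume L: "Lgeo2 w \<le> enat N"
  show "\<forall>n. lpt (reflect n w) n n \<le> N"
  proof
    fix n show "lpt (reflect n w) n n \<le> N"
    proof (cases n)
      case (Suc m)
      obtain xs where "up_right_path xs" and xs: "last xs = (n, n)" "sum_list (map (reflect n w) xs) = lpt (reflect n w) n n"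
        using lpt_attained[of m m "reflect n w"] Suc by auto
      then have x: "xs \<noteq> []" "hd xs = (1, 1)" "successively ur_step xs" by (auto simp: up_right_path_iff)
      have b: "1 \<le> fst p" "fst p \<le> n" if "p \<in> set xs" for p using ur_path_bounds[OF x(1,3) that] x(2) xs(1) by auto
      define f where "f = (\<lambda>(i :: nat, j :: nat). (Suc n - i, j))"
      have "successively lu_step (map f xs)"
      proof (rule successively_map_cong[OF x(3)])
        fix p q assume "p \<in> set xs" "q \<in> set xs" "ur_step p q"
        then show "lu_step (f p) (f q)" using b[of p] b[of q] by (cases p rule: prod.exhaust; cases q rule: prod.exhaust) (auto simp: ur_step_def lu_step_def f_def)
      qed
      then have "left_up_path (map f xs)"
        using x xs(1) Suc by (auto simp: left_up_path_iff hd_map last_map f_def)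
      then have "path_weight w (map f xs) \<le> Lgeo2 w" unfolding Lgeo2_def by (intro SUP_upper) simp
      then have "path_weight w (map f xs) \<le> enat N" using L by (rule order_trans)
      moreover have "map w (map f xs) = map (reflect n w) xs" by (auto simp: f_def reflect_def)
      ultimately show ?thesis using xs by (simp only: path_weight_eq) simp
    qed simp
  qed
next
  assume all: "\<forall>n. lpt (reflect n w) n n \<le> N"
  show "Lgeo2 w \<le> enat N" unfolding Lgeo2_def
  proof (rule SUP_least)
    fix xs assume "xs \<in> {xs. left_up_path xs}"
    then have x: "xs \<noteq> []" "fst (hd xs) \<ge> 1" "snd (hd xs) = 1" "fst (last xs) = 1" "snd (last xs) \<ge> 1" "successively lu_step xs"
      by (auto simp: left_up_path_iff)
    define n where "n = max (fst (hd xs)) (snd (last xs))"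
    define f where "f = (\<lambda>(i :: nat, j :: nat). (Suc n - i, j))"
    have b: "1 \<le> fst p" "fst p \<le> n" if "p \<in> set xs" for p using lu_path_bounds[OF x(1,6) that] x(4) by (auto simp: n_def)
    have su: "successively ur_step (map f xs)"
    proof (rule successively_map_cong[OF x(6)])
      fix p q assume "p \<in> set xs" "q \<in> set xs" "lu_step p q"
      then show "ur_step (f p) (f q)" using b[of p] b[of q] by (cases p rule: prod.exhaust; cases q rule: prod.exhaust) (auto simp: ur_step_def lu_step_def f_def)
    qed
    have h: "1 \<le> fst (hd (map f xs))" "1 \<le> snd (hd (map f xs))"
      using x b[of "hd xs"] by (auto simp: hd_map f_def split: prod.splits)
    have l: "last (map f xs) = (n, snd (last xs))" using x by (cases "last xs") (auto simp: last_map f_def)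
    have "map w xs = map (reflect n w) (map f xs)" unfolding map_map
    proof (rule map_cong[OF refl], unfold comp_def)
      fix p assume "p \<in> set xs"
      then show "w p = reflect n w (f p)" using b[of p] by (cases p rule: prod.exhaust) (auto simp: f_def reflect_def)
    qed
    then have "sum_list (map w xs) = sum_list (map (reflect n w) (map f xs))" by (rule arg_cong)
    also have "\<dots> \<le> lpt (reflect n w) n (snd (last xs))" using ur_path_weight_le[OF _ su h, of "reflect n w"] x(1) l by simp
    also have "\<dots> \<le> lpt (reflect n w) n n" by (rule lpt_mono) (auto simp: n_def)
    also have "\<dots> \<le> N" using all by blast
    finally show "path_weight w xs \<le> enat N" by (simp add: path_weight_eq)
  qed
qed

text \<open>Enlarging the box adds cells on the side of the reflected origin: the old box sits in
  the new one with its first index raised by one.\<close>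

lemma lpt_reflect_mono: "lpt (reflect n w) n n \<le> lpt (reflect (Suc n) w) (Suc n) (Suc n)"
proof -
  have "lpt (reflect n w) i j \<le> lpt (reflect (Suc n) w) (Suc i) j" for i j
  proof (induction "reflect n w" i j rule: lpt.induct)
    case (3 i j)
    have "reflect n w (Suc i, Suc j) = reflect (Suc n) w (Suc (Suc i), Suc j)" by (simp add: reflect_def)
    then have "lpt (reflect n w) (Suc i) (Suc j) \<le>
        max (lpt (reflect (Suc n) w) (Suc i) (Suc j)) (lpt (reflect (Suc n) w) (Suc (Suc i)) j) + reflect (Suc n) w (Suc (Suc i), Suc j)"
      using 3 by (simp add: lpt_rec[of "reflect n w"] max.coboundedI1 max.coboundedI2)
    also have "\<dots> = lpt (reflect (Suc n) w) (Suc (Suc i)) (Suc j)" by (rule lpt_rec[symmetric])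
    finally show ?case .
  qed auto
  also have "lpt (reflect (Suc n) w) (Suc n) n \<le> lpt (reflect (Suc n) w) (Suc n) (Suc n)" by (rule lpt_mono) auto
  finally show ?thesis .
qed

section \<open>From iterated sums to sums over weight configurations\<close>

fun isum :: "nat \<Rightarrow> (nat \<times> nat) list \<Rightarrow> ((nat \<times> nat \<Rightarrow> nat) \<Rightarrow> real) \<Rightarrow> (nat \<times> nat \<Rightarrow> nat) \<Rightarrow> real" where
  "isum N [] h w = h w"
| "isum N (p # ps) h w = (\<Sum>u\<le>N. isum N ps h (w(p := u)))"

lemma isum_append: "isum N (ps @ qs) h w = isum N ps (isum N qs h) w"
  by (induction ps arbitrary: w) auto

lemma isum_cong:
  "(\<And>w'. (\<And>p. p \<notin> set ps \<Longrightarrow> w' p = w p) \<Longrightarrow> h w' = h' w') \<Longrightarrow> isum N ps h w = isum N ps h' w"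
proof (induction ps arbitrary: w)
  case (Cons p ps)
  show ?case unfolding isum.simps
  proof (rule sum.cong[OF refl], rule Cons.IH)
    fix u w' assume "\<And>q. q \<notin> set ps \<Longrightarrow> w' q = (w(p := u)) q"
    then show "h w' = h' w'" by (intro Cons.prems) auto
  qed
qed auto

lemma isum_mult: "isum N ps (\<lambda>w. c * h w) w = c * isum N ps h w"
  by (induction ps arbitrary: w) (auto simp: sum_distrib_left)

lemma isum_PiE:
  assumes "distinct ps"
  shows "isum N ps h w = (\<Sum>v\<in>PiE (set ps) (\<lambda>_. {..N}). h (override_on w v (set ps)))"
  using assms
proof (induction ps arbitrary: w)
  case (Cons p ps)
  let ?P = "PiE (set ps) (\<lambda>_. {..N})"
  have p: "p \<notin> set ps" using Cons.prems by simp
  have "(\<Sum>v\<in>PiE (set (p # ps)) (\<lambda>_. {..N}). h (override_on w v (set (p # ps)))) =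
     (\<Sum>(u, v)\<in>{..N} \<times> ?P. h (override_on w (v(p := u)) (insert p (set ps))))"
    unfolding list.set PiE_insert_eq
    by (subst sum.reindex[OF inj_combinator[OF p, of "\<lambda>_. {..N}"]]) (simp add: case_prod_unfold comp_def)
  also have "\<dots> = (\<Sum>(u, v)\<in>{..N} \<times> ?P. h (override_on (w(p := u)) v (set ps)))"
  proof (rule sum.cong[OF refl], clarify)
    fix u v
    have "override_on w (v(p := u)) (insert p (set ps)) = override_on (w(p := u)) v (set ps)"
      using p by (auto simp: override_on_def fun_eq_iff)
    then show "h (override_on w (v(p := u)) (insert p (set ps))) = h (override_on (w(p := u)) v (set ps))" by simp
  qed
  also have "\<dots> = (\<Sum>u\<le>N. \<Sum>v\<in>?P. h (override_on (w(p := u)) v (set ps)))" by (simp add: sum.cartesian_product)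
  finally show ?case using Cons by simp
qed simp

text \<open>The last row stands in front, in the order in which \<open>column_sum\<close> consumes
  the list.\<close>

definition lpt_column :: "nat \<Rightarrow> (nat \<times> nat \<Rightarrow> nat) \<Rightarrow> nat \<Rightarrow> nat list" where
  "lpt_column n w m = map (\<lambda>i. lpt w (Suc i) m) (rev [0..<n])"

lemma lpt_column_simps [simp]:
  "lpt_column 0 w m = []" "lpt_column (Suc n) w m = lpt w (Suc n) m # lpt_column n w m"
  by (auto simp: lpt_column_def)

lemma hd0_lpt_column [simp]: "hd0 (lpt_column n w m) = lpt w n m"
  by (cases n) auto

lemma length_lpt_column [simp]: "length (lpt_column n w m) = n"
  by (simp add: lpt_column_def)

text \<open>The list recursion is the recursion of passage times: the head of the new list is the
  time in the previous row of the current column, and the entry removed from the old list is the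
  time in the same row of the previous column.\<close>

lemma column_sum_isum:
  "column_sum N x y (lpt_column n w m) f = isum N (map (\<lambda>i. (Suc i, Suc m)) [0..<n])
     (\<lambda>w'. (\<Prod>i<n. (x i * y) ^ w' (Suc i, Suc m)) *
        (if \<forall>i<n. lpt w' (Suc i) (Suc m) \<le> N then f (lpt_column n w' (Suc m)) else 0)) w"
proof (induction n arbitrary: f)
  case (Suc n)
  define p where "p = (Suc n, Suc m)"
  let ?ps = "map (\<lambda>i. (Suc i, Suc m)) [0..<n]"
  let ?H = "\<lambda>n f w'. (\<Prod>i<n. (x i * y) ^ w' (Suc i, Suc m)) *
        (if \<forall>i<n. lpt w' (Suc i) (Suc m) \<le> N then f (lpt_column n w' (Suc m)) else 0)"
  let ?f = "\<lambda>h. \<Sum>u\<le>N. (x n * y) ^ u * (if max (hd0 h) (lpt w (Suc n) m) + u \<le> N then f ((max (hd0 h) (lpt w (Suc n) m) + u) # h) else 0)"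
  have gen: "(\<Sum>u\<le>N. A * (B u * (if C \<and> D u then F u else 0))) = A * (if C then \<Sum>u\<le>N. B u * (if D u then F u else 0) else 0)"
    for A :: real and B C D F by (cases C) (simp_all add: sum_distrib_left)
  have "column_sum N x y (lpt_column (Suc n) w m) f = isum N ?ps (?H n ?f) w"
    by (simp add: Suc.IH)
  also have "\<dots> = isum N ?ps (\<lambda>w'. \<Sum>u\<le>N. ?H (Suc n) f (w'(p := u))) w"
  proof (rule isum_cong)
    \<comment> \<open>Only the current column has been changed so far, and \<open>p\<close> is its
      last cell; hence earlier columns and lower rows keep their passage times when \<open>p\<close>
      is set.\<close>
    fix w' assume w': "\<And>q. q \<notin> set ?ps \<Longrightarrow> w' q = w q"
    have l1: "lpt w' (Suc n) m = lpt w (Suc n) m" by (rule lpt_cong) (auto intro!: w')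
    have l2: "lpt (w'(p := u)) i (Suc m) = lpt w' i (Suc m)" if "i \<le> n" for i u
      by (rule lpt_cong) (use that in \<open>auto simp: p_def\<close>)
    have l3: "lpt (w'(p := u)) (Suc n) m = lpt w (Suc n) m" for u
      using lpt_cong[of "Suc n" m "w'(p := u)" w'] l1 by (auto simp: p_def)
    have l4: "lpt_column n (w'(p := u)) (Suc m) = lpt_column n w' (Suc m)" for u
      unfolding lpt_column_def by (rule map_cong[OF refl]) (rule l2, simp add: Suc_le_eq)
    have top: "lpt (w'(p := u)) (Suc n) (Suc m) = max (lpt w' n (Suc m)) (lpt w (Suc n) m) + u" for u
      using l2[of n u] l3[of u] by (simp add: p_def lpt_rec)
    have pr: "(\<Prod>i<Suc n. (x i * y) ^ (w'(p := u)) (Suc i, Suc m)) = (\<Prod>i<n. (x i * y) ^ w' (Suc i, Suc m)) * (x n * y) ^ u" for u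
      by (simp add: p_def)
    have cond: "(\<forall>i<Suc n. lpt (w'(p := u)) (Suc i) (Suc m) \<le> N) \<longleftrightarrow>
       (\<forall>i<n. lpt w' (Suc i) (Suc m) \<le> N) \<and> max (lpt w' n (Suc m)) (lpt w (Suc n) m) + u \<le> N" for u
      unfolding All_less_Suc top using l2[of "Suc _" u] by (auto simp: Suc_le_eq)
    have "?H (Suc n) f (w'(p := u)) = (\<Prod>i<n. (x i * y) ^ w' (Suc i, Suc m)) * ((x n * y) ^ u *
       (if (\<forall>i<n. lpt w' (Suc i) (Suc m) \<le> N) \<and> max (lpt w' n (Suc m)) (lpt w (Suc n) m) + u \<le> N
        then f ((max (lpt w' n (Suc m)) (lpt w (Suc n) m) + u) # lpt_column n w' (Suc m)) else 0))" for u
      unfolding cond pr lpt_column_simps top l4 by (simp only: mult.assoc)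
    then have "(\<Sum>u\<le>N. ?H (Suc n) f (w'(p := u))) = (\<Sum>u\<le>N. (\<Prod>i<n. (x i * y) ^ w' (Suc i, Suc m)) * ((x n * y) ^ u *
       (if (\<forall>i<n. lpt w' (Suc i) (Suc m) \<le> N) \<and> max (lpt w' n (Suc m)) (lpt w (Suc n) m) + u \<le> N
        then f ((max (lpt w' n (Suc m)) (lpt w (Suc n) m) + u) # lpt_column n w' (Suc m)) else 0)))"
      by (rule sum.cong[OF refl])
    also have "\<dots> = ?H n ?f w'"
      unfolding hd0_lpt_column by (rule gen)
    finally show "?H n ?f w' = (\<Sum>u\<le>N. ?H (Suc n) f (w'(p := u)))" by (rule sym)
  qed
  also have "\<dots> = isum N (?ps @ [p]) (?H (Suc n) f) w" unfolding isum_append isum.simps(1,2)[abs_def] by (rule refl)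
  finally show ?case by (simp add: p_def)
qed simp

definition box_list :: "nat \<Rightarrow> nat \<Rightarrow> (nat \<times> nat) list" where
  "box_list n m = concat (map (\<lambda>j. map (\<lambda>i. (Suc i, Suc j)) [0..<n]) [0..<m])"

lemma set_box_list: "set (box_list n m) = {1..n} \<times> {1..m}"
proof -
  have "set (box_list n m) = (Suc ` {0..<n}) \<times> (Suc ` {0..<m})"
    unfolding box_list_def set_concat set_map set_upt image_image by blast
  then show ?thesis by (simp add: image_Suc_atLeastLessThan atLeastLessThanSuc_atLeastAtMost)
qed

lemma distinct_box_list: "distinct (box_list n m)"
proof (induction m)
  case (Suc m)
  have "distinct (map (\<lambda>i. (Suc i, Suc m)) [0..<n])" by (auto simp: distinct_map inj_on_def)
  moreover have "box_list n (Suc m) = box_list n m @ map (\<lambda>i. (Suc i, Suc m)) [0..<n]" by (simp add: box_list_def)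
  ultimately show ?case using Suc set_box_list[of n m] by auto
qed (simp add: box_list_def)

text \<open>The base configuration \<open>w0\<close> is arbitrary, because every cell that is read
  has been overwritten by the iterated sum.\<close>

lemma lpp_sum_isum:
  "lpp_sum N x n y m f = isum N (box_list n m)
     (\<lambda>w. (\<Prod>j<m. \<Prod>i<n. (x i * y j) ^ w (Suc i, Suc j)) *
        (if \<forall>j<m. \<forall>i<n. lpt w (Suc i) (Suc j) \<le> N then f (lpt_column n w m) else 0)) w0"
proof (induction m arbitrary: f)
  case 0
  have "lpt_column n w0 0 = replicate n 0" by (induction n) auto
  then show ?case by (simp add: box_list_def)
next
  case (Suc m)
  let ?P = "\<lambda>m w. \<Prod>j<m. \<Prod>i<n. (x i * y j) ^ w (Suc i, Suc j)"
  let ?C = "\<lambda>m w. \<forall>j<m. \<forall>i<n. lpt w (Suc i) (Suc j) \<le> N"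
  let ?ps = "map (\<lambda>i. (Suc i, Suc m)) [0..<n]"
  let ?G = "\<lambda>w. ?P (Suc m) w * (if ?C (Suc m) w then f (lpt_column n w (Suc m)) else 0)"
  have "lpp_sum N x n y (Suc m) f = isum N (box_list n m) (\<lambda>w. ?P m w * (if ?C m w then column_sum N x (y m) (lpt_column n w m) f else 0)) w0"
    by (simp add: Suc.IH)
  also have "\<dots> = isum N (box_list n m) (isum N ?ps ?G) w0"
  proof (rule isum_cong)
    fix w
    have gen: "A * (if C then S else 0) = A * (if C then 1 else 0) * S" for A S :: real and C by simp
    have gen2: "A * (if C then 1 else 0) * (B * (if D then S else 0)) = A * B * (if C \<and> D then S else 0)"
      for A B S :: real and C D by simp
    define c where "c = ?P m w * (if ?C m w then 1 else 0)"
    have "?P m w * (if ?C m w then column_sum N x (y m) (lpt_column n w m) f else 0) =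
       isum N ?ps (\<lambda>w'. c * ((\<Prod>i<n. (x i * y m) ^ w' (Suc i, Suc m)) *
        (if \<forall>i<n. lpt w' (Suc i) (Suc m) \<le> N then f (lpt_column n w' (Suc m)) else 0))) w"
      unfolding isum_mult column_sum_isum[symmetric] c_def by (rule gen)
    also have "\<dots> = isum N ?ps ?G w"
    proof (rule isum_cong)
      fix w' assume w': "\<And>q. q \<notin> set ?ps \<Longrightarrow> w' q = w q"
      have "?P m w' = ?P m w" by (intro prod.cong refl arg_cong2[where f = "(^)"]) (auto intro!: w')
      moreover have "?C m w' = ?C m w"
      proof -
        have "lpt w' (Suc i) (Suc j) = lpt w (Suc i) (Suc j)" if "j < m" for i j
          by (rule lpt_cong) (use that in \<open>auto intro!: w'\<close>)
        then show ?thesis by simp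
      qed
      ultimately show "c * ((\<Prod>i<n. (x i * y m) ^ w' (Suc i, Suc m)) *
        (if \<forall>i<n. lpt w' (Suc i) (Suc m) \<le> N then f (lpt_column n w' (Suc m)) else 0)) = ?G w'"
        unfolding c_def All_less_Suc prod.lessThan_Suc conj_commute[of _ "?C m w'"]
        by (simp only: gen2)
    qed
    finally show "?P m w * (if ?C m w then column_sum N x (y m) (lpt_column n w m) f else 0) = isum N ?ps ?G w" .
  qed
  also have "\<dots> = isum N (box_list n (Suc m)) ?G w0"
    by (simp add: isum_append[symmetric] box_list_def)
  finally show ?case .
qed

theorem lpp_sum_PiE:
  "lpp_sum N x n y n (\<lambda>_. 1) =
    (\<Sum>v\<in>{v \<in> PiE ({1..n} \<times> {1..n}) (\<lambda>_. {..N}). lpt v n n \<le> N}. \<Prod>(i, j)\<in>{1..n} \<times> {1..n}. (x (i - 1) * y (j - 1)) ^ v (i, j))"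
proof -
  let ?B = "{1..n} \<times> {1..n}"
  let ?T = "PiE ?B (\<lambda>_. {..N})"
  have pr: "(\<Prod>j<n. \<Prod>i<n. (x i * y j) ^ w (Suc i, Suc j)) = (\<Prod>(i, j)\<in>?B. (x (i - 1) * y (j - 1)) ^ w (i, j))" for w
  proof -
    have "(\<Prod>j<n. \<Prod>i<n. (x i * y j) ^ w (Suc i, Suc j)) = (\<Prod>i<n. \<Prod>j<n. (x i * y j) ^ w (Suc i, Suc j))" by (rule prod.swap)
    also have "\<dots> = (\<Prod>(i, j)\<in>{..<n} \<times> {..<n}. (x i * y j) ^ w (Suc i, Suc j))" by (rule prod.cartesian_product)
    also have "\<dots> = (\<Prod>(i, j)\<in>?B. (x (i - 1) * y (j - 1)) ^ w (i, j))"
      by (rule prod.reindex_bij_witness[where i = "\<lambda>(i, j). (i - 1, j - 1)" and j = "\<lambda>(i, j). (Suc i, Suc j)"]) auto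
    finally show ?thesis .
  qed
  \<comment> \<open>By monotonicity the cutoff at every cell of the box reduces to the cutoff at the
    corner.\<close>
  have co: "(\<forall>j<n. \<forall>i<n. lpt w (Suc i) (Suc j) \<le> N) \<longleftrightarrow> lpt w n n \<le> N" for w
  proof
    assume a: "\<forall>j<n. \<forall>i<n. lpt w (Suc i) (Suc j) \<le> N"
    then show "lpt w n n \<le> N" by (cases n) auto
  next
    assume "lpt w n n \<le> N"
    then show "\<forall>j<n. \<forall>i<n. lpt w (Suc i) (Suc j) \<le> N" by (meson Suc_leI lpt_mono order_trans)
  qed
  have "lpp_sum N x n y n (\<lambda>_. 1) = (\<Sum>v\<in>?T. (\<Prod>(i, j)\<in>?B. (x (i - 1) * y (j - 1)) ^ override_on (\<lambda>_. 0) v ?B (i, j)) *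
     (if lpt (override_on (\<lambda>_. 0) v ?B) n n \<le> N then 1 else 0))"
    unfolding lpp_sum_isum[where ?w0.0 = "\<lambda>_. 0"] pr co isum_PiE[OF distinct_box_list] set_box_list by simp
  also have "\<dots> = (\<Sum>v\<in>?T. (\<Prod>(i, j)\<in>?B. (x (i - 1) * y (j - 1)) ^ v (i, j)) * (if lpt v n n \<le> N then 1 else 0))"
  proof (rule sum.cong[OF refl])
    fix v
    have "lpt (override_on (\<lambda>_. 0) v ?B) n n = lpt v n n" by (rule lpt_cong) auto
    moreover have "(\<Prod>(i, j)\<in>?B. (x (i - 1) * y (j - 1)) ^ override_on (\<lambda>_. 0) v ?B (i, j)) = (\<Prod>(i, j)\<in>?B. (x (i - 1) * y (j - 1)) ^ v (i, j))"
      by (rule prod.cong) auto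
    ultimately show "(\<Prod>(i, j)\<in>?B. (x (i - 1) * y (j - 1)) ^ override_on (\<lambda>_. 0) v ?B (i, j)) * (if lpt (override_on (\<lambda>_. 0) v ?B) n n \<le> N then 1 else 0) =
      (\<Prod>(i, j)\<in>?B. (x (i - 1) * y (j - 1)) ^ v (i, j)) * (if lpt v n n \<le> N then 1 else 0)" by simp
  qed
  also have "\<dots> = (\<Sum>v\<in>{v \<in> ?T. lpt v n n \<le> N}. \<Prod>(i, j)\<in>?B. (x (i - 1) * y (j - 1)) ^ v (i, j))"
    by (rule sum.mono_neutral_cong_right) (auto intro!: finite_PiE)
  finally show ?thesis .
qed

section \<open>The law of the last passage times\<close>

context prob_space
begin

text \<open>The injection \<open>g\<close> renames cells, so that one joint law covers a box with
  permuted rows.\<close>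

lemma indep_joint_law:
  fixes \<omega> :: "'a \<Rightarrow> 'b \<Rightarrow> nat"
  assumes ind: "indep_vars (\<lambda>_. count_space UNIV) (\<lambda>p x. \<omega> x p) J"
    and I: "finite I" "inj_on g I" "g ` I \<subseteq> J"
  shows "prob {x \<in> space M. \<forall>p\<in>I. \<omega> x (g p) = v p} = (\<Prod>p\<in>I. prob {x \<in> space M. \<omega> x (g p) = v p})"
proof (cases "I = {}")
  case False
  define u where "u q = v (inv_into I g q)" for q
  have "prob (\<Inter>q\<in>g ` I. (\<lambda>x. \<omega> x q) -` {u q} \<inter> space M) = (\<Prod>q\<in>g ` I. prob ((\<lambda>x. \<omega> x q) -` {u q} \<inter> space M))"
    by (rule indep_varsD[OF ind]) (use I False in auto)
  also have "(\<Inter>q\<in>g ` I. (\<lambda>x. \<omega> x q) -` {u q} \<inter> space M) = {x \<in> space M. \<forall>p\<in>I. \<omega> x (g p) = v p}"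
    using False I(2) by (auto simp: u_def)
  also have "(\<Prod>q\<in>g ` I. prob ((\<lambda>x. \<omega> x q) -` {u q} \<inter> space M)) = (\<Prod>p\<in>I. prob {x \<in> space M. \<omega> x (g p) = v p})"
    unfolding prod.reindex[OF I(2)]
    by (rule prod.cong[OF refl], simp add: u_def I(2), rule arg_cong[where f = prob]) auto
  finally show ?thesis .
qed (simp add: prob_space)

lemma lpt_event_measurable:
  fixes W :: "'a \<Rightarrow> nat \<times> nat \<Rightarrow> nat"
  assumes "\<And>i j. 1 \<le> i \<Longrightarrow> i \<le> n \<Longrightarrow> 1 \<le> j \<Longrightarrow> j \<le> m \<Longrightarrow> (\<lambda>x. W x (i, j)) \<in> measurable M (count_space UNIV)"
  shows "(\<lambda>x. lpt (W x) n m) \<in> measurable M (count_space UNIV)"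
  using assms
proof (induction "\<lambda>_::nat \<times> nat. 0 :: nat" n m rule: lpt.induct)
  case (3 i j)
  have [measurable]: "(\<lambda>x. lpt (W x) i (Suc j)) \<in> measurable M (count_space UNIV)"
    "(\<lambda>x. lpt (W x) (Suc i) j) \<in> measurable M (count_space UNIV)"
    "(\<lambda>x. W x (Suc i, Suc j)) \<in> measurable M (count_space UNIV)"
    using 3 by auto
  show ?case unfolding lpt_rec by measurable
qed auto

text \<open>On the event every weight in the box is at most \<open>N\<close>, being dominated by the
  corner passage time. The event is therefore a finite disjoint union over configurations, and the
  normalising factors of the geometric laws come out of the sum.\<close>

lemma prob_lpt_le_lpp_sum:
  fixes W :: "'a \<Rightarrow> nat \<times> nat \<Rightarrow> nat" and x y :: "nat \<Rightarrow> real" and n :: nat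
  defines "I \<equiv> {1..n} \<times> {1..n}"
  assumes meas: "\<And>p. p \<in> I \<Longrightarrow> (\<lambda>x. W x p) \<in> measurable M (count_space UNIV)"
    and law: "\<And>v. prob {z \<in> space M. \<forall>p\<in>I. W z p = v p} =
       (\<Prod>(i, j)\<in>I. (1 - x (i - 1) * y (j - 1)) * (x (i - 1) * y (j - 1)) ^ v (i, j))"
  shows "prob {z \<in> space M. lpt (W z) n n \<le> N} =
    (\<Prod>(i, j)\<in>I. 1 - x (i - 1) * y (j - 1)) * lpp_sum N x n y n (\<lambda>_. 1)"
proof -
  define V where "V = {v \<in> PiE I (\<lambda>_. {..N}). lpt v n n \<le> N}"
  define E where "E v = {z \<in> space M. \<forall>p\<in>I. W z p = v p}" for v
  have fI: "finite I" by (simp add: I_def)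
  have fV: "finite V" unfolding V_def by (rule finite_subset[of _ "PiE I (\<lambda>_. {..N})"]) (auto intro!: finite_PiE fI)
  have Em: "E v \<in> sets M" for v
  proof -
    have "E v = space M \<inter> (\<Inter>p\<in>I. {z \<in> space M. W z p = v p})" by (auto simp: E_def)
    moreover have "{z \<in> space M. W z p = v p} \<in> sets M" if "p \<in> I" for p
      using meas[OF that] by measurable
    ultimately show ?thesis using fI by (cases "I = {}") (auto intro!: sets.Int sets.finite_INT)
  qed
  have cl: "lpt w n n = lpt w' n n" if "\<And>p. p \<in> I \<Longrightarrow> w p = w' p" for w w'
    by (rule lpt_cong) (use that in \<open>auto simp: I_def\<close>)
  have "{z \<in> space M. lpt (W z) n n \<le> N} = (\<Union>v\<in>V. E v)"
  proof (intro equalityI subsetI)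
    fix z assume z: "z \<in> {z \<in> space M. lpt (W z) n n \<le> N}"
    have "W z (i, j) \<le> N" if "(i, j) \<in> I" for i j
    proof -
      have "W z (i, j) \<le> lpt (W z) i j" using that by (intro weight_le_lpt) (auto simp: I_def)
      also have "\<dots> \<le> lpt (W z) n n" using that by (intro lpt_mono) (auto simp: I_def)
      also have "\<dots> \<le> N" using z by simp
      finally show ?thesis .
    qed
    moreover have "lpt (restrict (W z) I) n n = lpt (W z) n n" by (rule cl) simp
    ultimately have "restrict (W z) I \<in> V" using z by (auto simp: V_def)
    moreover have "z \<in> E (restrict (W z) I)" using z by (auto simp: E_def)
    ultimately show "z \<in> (\<Union>v\<in>V. E v)" by blast
  next
    fix z assume "z \<in> (\<Union>v\<in>V. E v)"
    then obtain v where v: "v \<in> V" "z \<in> E v" by blast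
    then have "lpt (W z) n n = lpt v n n" by (intro cl) (auto simp: E_def)
    then show "z \<in> {z \<in> space M. lpt (W z) n n \<le> N}" using v by (auto simp: V_def E_def)
  qed
  moreover have "disjoint_family_on E V"
    unfolding disjoint_family_on_def
  proof (intro ballI impI)
    fix v v' assume v: "v \<in> V" "v' \<in> V" "v \<noteq> v'"
    show "E v \<inter> E v' = {}"
    proof (rule ccontr)
      assume "E v \<inter> E v' \<noteq> {}"
      then have "v p = v' p" if "p \<in> I" for p using that by (auto simp: E_def)
      then have "v = v'" using v by (intro PiE_ext[of v I _ v']) (auto simp: V_def)
      then show False using v by simp
    qed
  qed
  ultimately have "prob {z \<in> space M. lpt (W z) n n \<le> N} = (\<Sum>v\<in>V. prob (E v))"
    using finite_measure_finite_Union[OF fV, of E] Em by auto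
  also have "\<dots> = (\<Sum>v\<in>V. (\<Prod>(i, j)\<in>I. 1 - x (i - 1) * y (j - 1)) * (\<Prod>(i, j)\<in>I. (x (i - 1) * y (j - 1)) ^ v (i, j)))"
    unfolding E_def law by (simp add: case_prod_unfold prod.distrib)
  also have "\<dots> = (\<Prod>(i, j)\<in>I. 1 - x (i - 1) * y (j - 1)) * lpp_sum N x n y n (\<lambda>_. 1)"
    unfolding lpp_sum_PiE V_def I_def by (rule sum_distrib_left[symmetric])
  finally show ?thesis .
qed

text \<open>As \<open>N\<close> grows the probabilities tend to 1 and the determinants to the Cauchy
  determinant. This identifies \<open>c\<close> as its reciprocal without evaluating it.\<close>

lemma prob_lpt_le_determinant:
  fixes W :: "'a \<Rightarrow> nat \<times> nat \<Rightarrow> nat" and x y :: "nat \<Rightarrow> real" and n :: nat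
  defines "I \<equiv> {1..n} \<times> {1..n}"
  assumes meas: "\<And>p. p \<in> I \<Longrightarrow> (\<lambda>x. W x p) \<in> measurable M (count_space UNIV)"
    and law: "\<And>v. prob {z \<in> space M. \<forall>p\<in>I. W z p = v p} =
       (\<Prod>(i, j)\<in>I. (1 - x (i - 1) * y (j - 1)) * (x (i - 1) * y (j - 1)) ^ v (i, j))"
    and inj: "inj_on x {..<n}" "inj_on y {..<n}"
    and xy: "\<And>i j. i < n \<Longrightarrow> j < n \<Longrightarrow> \<bar>x i * y j\<bar> < 1"
  obtains c where "c * pdet {..<n} (\<lambda>i j. 1 / (1 - x i * y j)) = 1"
    "\<And>N. prob {z \<in> space M. lpt (W z) n n \<le> N} = c * pdet {..<n} (\<lambda>i j. (1 - (x i * y j) ^ (N + n)) / (1 - x i * y j))"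
proof -
  define c where "c = (\<Prod>(i, j)\<in>I. 1 - x (i - 1) * y (j - 1)) / (vandermonde n x * vandermonde n y)"
  have vd: "vandermonde n z \<noteq> 0" if "inj_on z {..<n}" for z :: "nat \<Rightarrow> real"
    using that by (auto simp: vandermonde_def inj_on_def)
  have P: "prob {z \<in> space M. lpt (W z) n n \<le> N} = c * pdet {..<n} (\<lambda>i j. (1 - (x i * y j) ^ (N + n)) / (1 - x i * y j))" for N
  proof -
    have "pdet {..<n} (\<lambda>i j. (1 - (x i * y j) ^ (N + n)) / (1 - x i * y j)) = pdet {..<n} (\<lambda>i j. \<Sum>q<N + n. (x i * y j) ^ q)"
    proof (rule pdet_cong)
      fix i j assume "i \<in> {..<n}" "j \<in> {..<n}"
      then have "x i * y j \<noteq> 1" using xy[of i j] by auto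
      then show "(1 - (x i * y j) ^ (N + n)) / (1 - x i * y j) = (\<Sum>q<N + n. (x i * y j) ^ q)"
        by (simp only: sum_gp_strict if_False)
    qed
    then show ?thesis
      using vd[OF inj(1)] vd[OF inj(2)] prob_lpt_le_lpp_sum[of n W x y N, folded I_def, OF meas law] lpp_sum_determinant[of n x y N]
      by (simp add: c_def field_simps)
  qed
  have "(\<lambda>x. lpt (W x) n n) \<in> measurable M (count_space UNIV)"
    by (rule lpt_event_measurable) (auto intro!: meas simp: I_def)
  then have mm [measurable]: "{z \<in> space M. lpt (W z) n n \<le> N} \<in> sets M" for N by measurable
  have "(\<lambda>N. prob {z \<in> space M. lpt (W z) n n \<le> N}) \<longlonglongrightarrow> prob (\<Union>N. {z \<in> space M. lpt (W z) n n \<le> N})"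
    by (rule finite_Lim_measure_incseq) (use mm in \<open>auto simp: incseq_def\<close>)
  moreover have "(\<Union>N. {z \<in> space M. lpt (W z) n n \<le> N}) = space M" by auto
  ultimately have l1: "(\<lambda>N. prob {z \<in> space M. lpt (W z) n n \<le> N}) \<longlonglongrightarrow> 1" by (simp add: prob_space)
  have "(\<lambda>N. c * pdet {..<n} (\<lambda>i j. (1 - (x i * y j) ^ (N + n)) / (1 - x i * y j))) \<longlonglongrightarrow> c * pdet {..<n} (\<lambda>i j. (1 - 0) / (1 - x i * y j))"
    unfolding pdet_def
  proof (intro tendsto_mult tendsto_const tendsto_sum tendsto_prod)
    fix p i assume "p \<in> {p. p permutes {..<n}}" "i \<in> {..<n}"
    then have "i < n" "p i < n" using permutes_in_image[of p "{..<n}" i] by auto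
    then have "\<bar>x i * y (p i)\<bar> < 1" by (rule xy)
    then have "(\<lambda>N. (x i * y (p i)) ^ (N + n)) \<longlonglongrightarrow> 0" "1 - x i * y (p i) \<noteq> 0"
      by (auto intro!: LIMSEQ_ignore_initial_segment LIMSEQ_abs_realpow_zero2)
    then show "(\<lambda>N. (1 - (x i * y (p i)) ^ (N + n)) / (1 - x i * y (p i))) \<longlonglongrightarrow> (1 - 0) / (1 - x i * y (p i))"
      by (intro tendsto_divide tendsto_diff tendsto_const)
  qed
  then have "c * pdet {..<n} (\<lambda>i j. (1 - 0) / (1 - x i * y j)) = 1"
    using l1 unfolding P by (rule LIMSEQ_unique)
  then show ?thesis using P by (intro that[of c]) simp_all
qed

text \<open>Permuting the row parameters changes both determinants by the same sign, so the law of the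
  last passage time is symmetric in the rows; this is what identifies the two directed models.\<close>
lemma prob_lpt_le_expansion:
  fixes W :: "'a \<Rightarrow> nat \<times> nat \<Rightarrow> nat" and x y :: "nat \<Rightarrow> real" and n :: nat
  defines "I \<equiv> {1..n} \<times> {1..n}"
  assumes s: "s permutes {..<n}"
    and meas: "\<And>p. p \<in> I \<Longrightarrow> (\<lambda>x. W x p) \<in> measurable M (count_space UNIV)"
    and law: "\<And>v. prob {z \<in> space M. \<forall>p\<in>I. W z p = v p} =
       (\<Prod>(i, j)\<in>I. (1 - x (s (i - 1)) * y (j - 1)) * (x (s (i - 1)) * y (j - 1)) ^ v (i, j))"
    and inj: "inj_on x {..<n}" "inj_on y {..<n}"
    and y0: "\<And>j. j < n \<Longrightarrow> y j \<noteq> 0"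
    and xy: "\<And>i j. i < n \<Longrightarrow> j < n \<Longrightarrow> \<bar>x i * y j\<bar> < 1"
  shows "prob {z \<in> space M. lpt (W z) n n \<le> N} =
    (\<Sum>S\<in>Pow {..<n}. (-1) ^ card S * pdet S (\<lambda>j l. \<Sum>k<n.
       (cauchy_coeff n y x j * y j ^ (N + n)) * (cauchy_coeff n x y k * x k ^ (N + n)) / ((1 - x k * y j) * (1 - x k * y l))))"
proof -
  have sl: "s i < n" if "i < n" for i using permutes_in_image[OF s, of i] that by auto
  have "inj_on (\<lambda>i. x (s i)) {..<n}"
    using comp_inj_on[of s "{..<n}" x] inj(1) permutes_inj_on[OF s] unfolding permutes_image[OF s] comp_def by blast
  note inj' = this
  have xs: "\<bar>x (s i) * y j\<bar> < 1" if "i < n" "j < n" for i j using xy[OF sl] that by blast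
  obtain c where c: "c * pdet {..<n} (\<lambda>i j. 1 / (1 - x (s i) * y j)) = 1"
    and P: "\<And>N. prob {z \<in> space M. lpt (W z) n n \<le> N} = c * pdet {..<n} (\<lambda>i j. (1 - (x (s i) * y j) ^ (N + n)) / (1 - x (s i) * y j))"
    by (rule prob_lpt_le_determinant[of n W "\<lambda>i. x (s i)" y, folded I_def, OF meas law inj' inj(2) xs]) (assumption | rule that)+
  have perm: "pdet {..<n} (\<lambda>i j. A (s i) j) = of_int (sign s) * pdet {..<n} A" for A :: "nat \<Rightarrow> nat \<Rightarrow> real"
  proof -
    have "pdet {..<n} (\<lambda>i j. A (s i) j) = pdet {..<n} (\<lambda>j i. A (s i) j)" by (rule pdet_transpose[symmetric])
    also have "\<dots> = of_int (sign s) * pdet {..<n} (\<lambda>j i. A i j)" by (rule pdet_permute_columns[OF s])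
    also have "pdet {..<n} (\<lambda>j i. A i j) = pdet {..<n} A" by (rule pdet_transpose)
    finally show ?thesis .
  qed
  have c': "(c * of_int (sign s)) * pdet {..<n} (\<lambda>i j. 1 / (1 - x i * y j)) = 1"
    using c unfolding perm[of "\<lambda>i j. 1 / (1 - x i * y j)"] by (simp only: mult.assoc)
  have xy1: "x i * y j \<noteq> 1" if "i < n" "j < n" for i j using xy[OF that] by auto
  have "prob {z \<in> space M. lpt (W z) n n \<le> N} =
      (c * of_int (sign s)) * pdet {..<n} (\<lambda>i j. (1 - (x i * y j) ^ (N + n)) / (1 - x i * y j))"
    unfolding P perm[of "\<lambda>i j. (1 - (x i * y j) ^ (N + n)) / (1 - x i * y j)"] by (simp only: mult.assoc)
  also note cauchy_determinant_ratio[OF inj y0 xy1 c']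
  finally show ?thesis .
qed

end

lemma geo_param_eq:
  "geo_param \<alpha> \<eta> \<theta> \<epsilon> (Suc i) (Suc j) = geo_x \<alpha> \<eta> \<epsilon> i * geo_x \<alpha> \<theta> \<epsilon> j"
  by (simp add: geo_param_def geo_x_def pole_def powr_def mult_exp_exp Let_def algebra_simps)

lemma geo_x_bounds:
  assumes "\<eta> > 0" "\<alpha> \<ge> 0" "\<epsilon> > 0"
  shows "0 < geo_x \<alpha> \<eta> \<epsilon> k" "geo_x \<alpha> \<eta> \<epsilon> k < 1"
  using pole_pos[OF assms(1,2), of k] assms(3) by (auto simp: geo_x_def)

lemma inj_geo_x: "\<eta> > 0 \<Longrightarrow> \<epsilon> > 0 \<Longrightarrow> inj_on (geo_x \<alpha> \<eta> \<epsilon>) A"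
  by (auto simp: geo_x_def pole_def inj_on_def)

context
  fixes \<alpha> \<eta> \<theta> \<epsilon> :: real
  assumes eta: "\<eta> > 0" and theta: "\<theta> > 0" and alpha: "\<alpha> \<ge> 0" and eps: "\<epsilon> > 0"
begin

text \<open>The bound for \<open>N = 0\<close> survives the limit in the box size, and the remaining
  power of \<open>geo_x \<alpha> \<eta> \<epsilon> k\<close> is largest at
  \<open>k = 0\<close>.\<close>

lemma prelimit_coeff_decay:
  "\<bar>prelimit_coeff \<alpha> \<eta> \<theta> \<epsilon> N k\<bar> \<le> geo_x \<alpha> \<eta> \<epsilon> 0 ^ N * (1 / ((\<epsilon> * \<eta>) ^ k * fact k * qpoch (\<epsilon> * \<eta>) 1))"
proof -
  let ?A = "1 / ((\<epsilon> * \<eta>) ^ k * fact k * qpoch (\<epsilon> * \<eta>) 1)"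
  have "(\<lambda>n. \<bar>cauchy_coeff n (geo_x \<alpha> \<eta> \<epsilon>) (geo_x \<alpha> \<theta> \<epsilon>) k * geo_x \<alpha> \<eta> \<epsilon> k ^ (0 + n)\<bar>) \<longlonglongrightarrow> \<bar>prelimit_coeff \<alpha> \<eta> \<theta> \<epsilon> 0 k\<bar>"
    by (rule tendsto_rabs[OF cauchy_coeff_tendsto[OF eta theta alpha eps]])
  then have c0: "\<bar>prelimit_coeff \<alpha> \<eta> \<theta> \<epsilon> 0 k\<bar> \<le> ?A"
    by (rule LIMSEQ_le_const2) (intro exI[of _ "Suc k"] allI impI cauchy_coeff_bound[OF eta theta alpha eps], simp)
  have "0 \<le> geo_x \<alpha> \<eta> \<epsilon> k" "geo_x \<alpha> \<eta> \<epsilon> k \<le> geo_x \<alpha> \<eta> \<epsilon> 0"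
    using pole_mono[OF eta, of \<alpha> k] eps by (auto simp: geo_x_def)
  then have "\<bar>geo_x \<alpha> \<eta> \<epsilon> k ^ N\<bar> \<le> geo_x \<alpha> \<eta> \<epsilon> 0 ^ N" by (simp add: power_mono)
  then have "\<bar>geo_x \<alpha> \<eta> \<epsilon> k ^ N\<bar> * \<bar>prelimit_coeff \<alpha> \<eta> \<theta> \<epsilon> 0 k\<bar> \<le> geo_x \<alpha> \<eta> \<epsilon> 0 ^ N * ?A"
    using c0 by (intro mult_mono) (auto simp: geo_x_def)
  moreover have "prelimit_coeff \<alpha> \<eta> \<theta> \<epsilon> N k = geo_x \<alpha> \<eta> \<epsilon> k ^ N * prelimit_coeff \<alpha> \<eta> \<theta> \<epsilon> 0 k"
    by (simp add: prelimit_coeff_def mult_ac)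
  ultimately show ?thesis by (simp only: abs_mult)
qed

end

lemma discrete_fredholm_zero: "discrete_fredholm (\<lambda>_ _. 0) = 1"
  by (subst discrete_fredholm_finite[of 0]) (auto simp: pdet_def)

text \<open>The kernel decays geometrically in \<open>N\<close>, with row factors that stay
  summable. For the passage times this means that the distribution functions tend to 1, that is,
  almost sure finiteness.\<close>

lemma prelimit_fredholm_tendsto_1:
  assumes eta: "\<eta> > 0" and theta: "\<theta> > 0" and alpha: "\<alpha> \<ge> 0" and eps: "\<epsilon> > 0"
  shows "(\<lambda>N. discrete_fredholm (\<lambda>j l. of_real (prelimit_kernel \<alpha> \<eta> \<theta> \<epsilon> N j l))) \<longlonglongrightarrow> 1"
proof -
  define A where "A k = 1 / ((\<epsilon> * \<eta>) ^ k * fact k * qpoch (\<epsilon> * \<eta>) 1)" for k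
  define B where "B k = 1 / ((\<epsilon> * \<theta>) ^ k * fact k * qpoch (\<epsilon> * \<theta>) 1)" for k
  define m where "m = 1 - geo_x \<alpha> \<eta> \<epsilon> 0 * geo_x \<alpha> \<theta> \<epsilon> 0"
  define r where "r = geo_x \<alpha> \<theta> \<epsilon> 0"
  have h: "\<epsilon> * \<eta> > 0" "\<epsilon> * \<theta> > 0" using eps eta theta by auto
  have A0: "0 \<le> A k" and B0: "0 \<le> B k" for k
    using h qpoch_pos[OF h(1), of 1] qpoch_pos[OF h(2), of 1] by (auto simp: A_def B_def)
  have m: "0 < m" "m \<le> 1 - geo_x \<alpha> \<eta> \<epsilon> k * geo_x \<alpha> \<theta> \<epsilon> j" for k j
    unfolding m_def using one_minus_xy[OF eta theta alpha eps] by auto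
  have r: "0 \<le> r" "r < 1" using geo_x_bounds[OF theta alpha eps, of 0] by (auto simp: r_def)
  have As: "summable A"
    by (rule summable_comparison_test'[OF summable_coeff_bound[of "\<epsilon> * \<eta>" "qpoch (\<epsilon> * \<eta>) 1"], of 0])
       (use A0 in \<open>auto simp: A_def[symmetric] distrib_right\<close>)
  have Bs: "summable (\<lambda>k. real (Suc k) * B k)" unfolding B_def by (rule summable_coeff_bound)
  have tb: "norm (prelimit_coeff \<alpha> \<theta> \<eta> \<epsilon> N j * prelimit_coeff \<alpha> \<eta> \<theta> \<epsilon> N k /
     ((1 - geo_x \<alpha> \<eta> \<epsilon> k * geo_x \<alpha> \<theta> \<epsilon> j) * (1 - geo_x \<alpha> \<eta> \<epsilon> k * geo_x \<alpha> \<theta> \<epsilon> l))) \<le> r ^ N * B j / (m * m) * A k" for N j k l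
  proof -
    have a: "\<bar>prelimit_coeff \<alpha> \<eta> \<theta> \<epsilon> N k\<bar> \<le> A k"
    proof -
      have "geo_x \<alpha> \<eta> \<epsilon> 0 ^ N * A k \<le> 1 * A k"
        using geo_x_bounds[OF eta alpha eps, of 0] A0 by (intro mult_right_mono power_le_one) auto
      then show ?thesis using prelimit_coeff_decay[OF eta theta alpha eps, of N k] by (simp add: A_def)
    qed
    have b: "\<bar>prelimit_coeff \<alpha> \<theta> \<eta> \<epsilon> N j\<bar> \<le> r ^ N * B j"
      using prelimit_coeff_decay[OF theta eta alpha eps, of N j] by (simp add: B_def r_def)
    have d: "0 < 1 - geo_x \<alpha> \<eta> \<epsilon> k * geo_x \<alpha> \<theta> \<epsilon> j" "0 < 1 - geo_x \<alpha> \<eta> \<epsilon> k * geo_x \<alpha> \<theta> \<epsilon> l"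
      using m(1) m(2)[of k j] m(2)[of k l] by linarith+
    have "norm (prelimit_coeff \<alpha> \<theta> \<eta> \<epsilon> N j * prelimit_coeff \<alpha> \<eta> \<theta> \<epsilon> N k /
     ((1 - geo_x \<alpha> \<eta> \<epsilon> k * geo_x \<alpha> \<theta> \<epsilon> j) * (1 - geo_x \<alpha> \<eta> \<epsilon> k * geo_x \<alpha> \<theta> \<epsilon> l))) =
      \<bar>prelimit_coeff \<alpha> \<theta> \<eta> \<epsilon> N j\<bar> * \<bar>prelimit_coeff \<alpha> \<eta> \<theta> \<epsilon> N k\<bar> /
     ((1 - geo_x \<alpha> \<eta> \<epsilon> k * geo_x \<alpha> \<theta> \<epsilon> j) * (1 - geo_x \<alpha> \<eta> \<epsilon> k * geo_x \<alpha> \<theta> \<epsilon> l))"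
      using d by (simp add: abs_mult)
    also have "\<dots> \<le> r ^ N * B j * A k / (m * m)"
      using d m(1) m(2)[of k j] m(2)[of k l] A0 B0 r by (intro frac_le mult_mono a b mult_nonneg_nonneg) auto
    finally show ?thesis by simp
  qed
  have Kb: "\<bar>prelimit_kernel \<alpha> \<eta> \<theta> \<epsilon> N j l\<bar> \<le> r ^ N * (B j * (suminf A / (m * m)))" for N j l
  proof -
    have "norm (prelimit_kernel \<alpha> \<eta> \<theta> \<epsilon> N j l) \<le> (\<Sum>k. r ^ N * B j / (m * m) * A k)"
      unfolding prelimit_kernel_def by (rule norm_suminf_le[OF tb summable_mult[OF As]])
    also have "\<dots> = r ^ N * B j / (m * m) * suminf A" by (rule suminf_mult[OF As])
    finally show ?thesis by simp
  qed
  have S0: "0 \<le> B j * (suminf A / (m * m))" for j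
    using suminf_nonneg[OF As A0] B0 m(1) by (intro mult_nonneg_nonneg divide_nonneg_pos) auto
  have "(\<lambda>N. discrete_fredholm (\<lambda>j l. complex_of_real (prelimit_kernel \<alpha> \<eta> \<theta> \<epsilon> N j l))) \<longlonglongrightarrow> discrete_fredholm (\<lambda>_ _. 0)"
  proof (rule discrete_fredholm_tendsto)
    fix j l
    have "(\<lambda>N. r ^ N * (B j * (suminf A / (m * m)))) \<longlonglongrightarrow> 0"
      by (intro tendsto_mult_left_zero LIMSEQ_power_zero) (use r in simp)
    then have "(\<lambda>N. prelimit_kernel \<alpha> \<eta> \<theta> \<epsilon> N j l) \<longlonglongrightarrow> 0"
      by (rule Lim_null_comparison[rotated]) (use Kb in simp)
    then show "(\<lambda>N. complex_of_real (prelimit_kernel \<alpha> \<eta> \<theta> \<epsilon> N j l)) \<longlonglongrightarrow> 0"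
      using tendsto_of_real[of _ 0] by fastforce
  next
    show "eventually (\<lambda>N. \<forall>j l. norm (complex_of_real (prelimit_kernel \<alpha> \<eta> \<theta> \<epsilon> N j l)) \<le> B j * (suminf A / (m * m))) sequentially"
    proof (intro always_eventually allI)
      fix N j l
      have "r ^ N * (B j * (suminf A / (m * m))) \<le> 1 * (B j * (suminf A / (m * m)))"
        using r by (intro mult_right_mono S0 power_le_one) auto
      then show "norm (complex_of_real (prelimit_kernel \<alpha> \<eta> \<theta> \<epsilon> N j l)) \<le> B j * (suminf A / (m * m))"
        using Kb[of N j l] by simp
    qed
    show "summable (\<lambda>j. real (Suc j) * (B j * (suminf A / (m * m))))"
      using summable_mult2[OF Bs, of "suminf A / (m * m)"] by (simp add: mult.assoc)
  qed simp
  then show ?thesis by (simp only: discrete_fredholm_zero)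
qed

lemma Union_le_enat: "(\<Union>N. {x \<in> A. X x \<le> enat N}) = {x \<in> A. X x < \<infinity>}"
proof (intro equalityI subsetI)
  fix x assume "x \<in> {x \<in> A. X x < \<infinity>}"
  then show "x \<in> (\<Union>N. {x \<in> A. X x \<le> enat N})" by (cases "X x") auto
next
  fix x assume "x \<in> (\<Union>N. {x \<in> A. X x \<le> enat N})"
  then obtain N where "x \<in> A" "X x \<le> enat N" by blast
  then show "x \<in> {x \<in> A. X x < \<infinity>}" by (cases "X x") auto
qed

context prob_space
begin

text \<open>Treats both models at once: \<open>W n\<close> rearranges the rows of the box by the
  permutation \<open>s n\<close>. The expansion of the box probability is the same for every
  \<open>s n\<close>, and by \<open>mono\<close> the box events decrease, so the limit depends on
  neither \<open>W\<close> nor \<open>L\<close>.\<close>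

lemma prob_passage_le:
  fixes \<omega> :: "'a \<Rightarrow> nat \<times> nat \<Rightarrow> nat" and L :: "(nat \<times> nat \<Rightarrow> nat) \<Rightarrow> enat"
    and W :: "nat \<Rightarrow> (nat \<times> nat \<Rightarrow> nat) \<Rightarrow> nat \<times> nat \<Rightarrow> nat"
  assumes eta: "\<eta> > 0" and theta: "\<theta> > 0" and alpha: "\<alpha> \<ge> 0" and eps: "\<epsilon> > 0"
    and ind: "indep_vars (\<lambda>_. count_space UNIV) (\<lambda>ij x. \<omega> x ij) {(i, j). i \<ge> 1 \<and> j \<ge> 1}"
    and law: "\<And>i j k. i \<ge> 1 \<Longrightarrow> j \<ge> 1 \<Longrightarrow> prob {x \<in> space M. \<omega> x (i, j) = k} =
       (1 - geo_param \<alpha> \<eta> \<theta> \<epsilon> i j) * geo_param \<alpha> \<eta> \<theta> \<epsilon> i j ^ k"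
    and W: "\<And>n w i j. 1 \<le> i \<Longrightarrow> i \<le> n \<Longrightarrow> W n w (i, j) = w (Suc (s n (i - 1)), j)"
    and s: "\<And>n. s n permutes {..<n}"
    and L: "\<And>w N. L w \<le> enat N \<longleftrightarrow> (\<forall>n. lpt (W n w) n n \<le> N)"
    and mono: "\<And>n w. lpt (W n w) n n \<le> lpt (W (Suc n) w) (Suc n) (Suc n)"
  shows "{x \<in> space M. L (\<omega> x) \<le> enat N} \<in> sets M"
    and "complex_of_real (prob {x \<in> space M. L (\<omega> x) \<le> enat N}) =
      discrete_fredholm (\<lambda>j l. of_real (prelimit_kernel \<alpha> \<eta> \<theta> \<epsilon> N j l))"
proof -
  define E where "E n = {x \<in> space M. lpt (W n (\<omega> x)) n n \<le> N}" for n
  have E: "{x \<in> space M. L (\<omega> x) \<le> enat N} = (\<Inter>n. E n)" by (auto simp: E_def L)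
  have \<omega>m: "(\<lambda>x. \<omega> x (i, j)) \<in> measurable M (count_space UNIV)" if "1 \<le> i" "1 \<le> j" for i j
  proof -
    have "\<forall>p\<in>{(i, j). i \<ge> 1 \<and> j \<ge> 1}. (\<lambda>x. \<omega> x p) \<in> measurable M (count_space UNIV)"
      using ind unfolding indep_vars_def by (rule conjunct1)
    then show ?thesis by (rule bspec) (use that in simp)
  qed
  have Wm: "(\<lambda>x. W n (\<omega> x) p) \<in> measurable M (count_space UNIV)" if "p \<in> {1..n} \<times> {1..n}" for n p
    using that \<omega>m by (auto simp: W)
  have Em: "E n \<in> sets M" for n
  proof -
    have "(\<lambda>x. lpt (W n (\<omega> x)) n n) \<in> measurable M (count_space UNIV)"
      by (rule lpt_event_measurable) (auto intro!: Wm)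
    then show ?thesis unfolding E_def by measurable
  qed
  then show "{x \<in> space M. L (\<omega> x) \<le> enat N} \<in> sets M" unfolding E by auto
  have joint: "prob {z \<in> space M. \<forall>p\<in>{1..n} \<times> {1..n}. W n (\<omega> z) p = v p} =
     (\<Prod>(i, j)\<in>{1..n} \<times> {1..n}. (1 - geo_x \<alpha> \<eta> \<epsilon> (s n (i - 1)) * geo_x \<alpha> \<theta> \<epsilon> (j - 1)) *
        (geo_x \<alpha> \<eta> \<epsilon> (s n (i - 1)) * geo_x \<alpha> \<theta> \<epsilon> (j - 1)) ^ v (i, j))" for n v
  proof -
    define g where "g = (\<lambda>(i, j). (Suc (s n (i - 1)), j :: nat))"
    have "inj_on g ({1..n} \<times> {1..n})"
    proof (rule inj_onI, clarify)
      fix i j i' j' assume a: "g (i, j) = g (i', j')" "i \<in> {1..n}" "i' \<in> {1..n}"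
      then have "s n (i - 1) = s n (i' - 1)" "j = j'" by (auto simp: g_def)
      then show "i = i' \<and> j = j'" using injD[OF permutes_inj[OF s], of n "i - 1" "i' - 1"] a by auto
    qed
    then have "prob {z \<in> space M. \<forall>p\<in>{1..n} \<times> {1..n}. \<omega> z (g p) = v p} = (\<Prod>p\<in>{1..n} \<times> {1..n}. prob {z \<in> space M. \<omega> z (g p) = v p})"
      by (intro indep_joint_law[OF ind]) (auto simp: g_def)
    moreover have "{z \<in> space M. \<forall>p\<in>{1..n} \<times> {1..n}. W n (\<omega> z) p = v p} = {z \<in> space M. \<forall>p\<in>{1..n} \<times> {1..n}. \<omega> z (g p) = v p}"
      by (auto simp: g_def W)
    moreover have "prob {z \<in> space M. \<omega> z (g (i, j)) = v (i, j)} = (1 - geo_x \<alpha> \<eta> \<epsilon> (s n (i - 1)) * geo_x \<alpha> \<theta> \<epsilon> (j - 1)) *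
        (geo_x \<alpha> \<eta> \<epsilon> (s n (i - 1)) * geo_x \<alpha> \<theta> \<epsilon> (j - 1)) ^ v (i, j)" if "j \<ge> 1" for i j
      using law[of "Suc (s n (i - 1))" j "v (i, j)"] geo_param_eq[of \<alpha> \<eta> \<theta> \<epsilon> "s n (i - 1)" "j - 1"] that by (simp add: g_def)
    ultimately show ?thesis by (auto intro!: prod.cong)
  qed
  have xy: "\<bar>geo_x \<alpha> \<eta> \<epsilon> i * geo_x \<alpha> \<theta> \<epsilon> j\<bar> < 1" for i j
    using one_minus_xy(1)[OF eta theta alpha eps] one_minus_xy(2)[OF eta theta alpha eps, of i j]
      geo_x_bounds(1)[OF eta alpha eps, of i] geo_x_bounds(1)[OF theta alpha eps, of j] by simp
  have y0: "geo_x \<alpha> \<theta> \<epsilon> j \<noteq> 0" for j by (simp add: geo_x_def)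
  have expansion: "prob (E n) = (\<Sum>S\<in>Pow {..<n}. (-1) ^ card S * pdet S (\<lambda>j l. \<Sum>k<n.
       (cauchy_coeff n (geo_x \<alpha> \<theta> \<epsilon>) (geo_x \<alpha> \<eta> \<epsilon>) j * geo_x \<alpha> \<theta> \<epsilon> j ^ (N + n)) *
       (cauchy_coeff n (geo_x \<alpha> \<eta> \<epsilon>) (geo_x \<alpha> \<theta> \<epsilon>) k * geo_x \<alpha> \<eta> \<epsilon> k ^ (N + n)) /
       ((1 - geo_x \<alpha> \<eta> \<epsilon> k * geo_x \<alpha> \<theta> \<epsilon> j) * (1 - geo_x \<alpha> \<eta> \<epsilon> k * geo_x \<alpha> \<theta> \<epsilon> l))))" for n
    unfolding E_def
    by (rule prob_lpt_le_expansion[OF s Wm joint inj_geo_x[OF eta eps] inj_geo_x[OF theta eps] y0 xy]) assumption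
  have "decseq E" unfolding decseq_Suc_iff E_def using mono by (auto intro: order_trans)
  then have "(\<lambda>n. prob (E n)) \<longlonglongrightarrow> prob (\<Inter>n. E n)" using Em by (intro finite_Lim_measure_decseq) auto
  then have "(\<lambda>n. complex_of_real (prob (E n))) \<longlonglongrightarrow> complex_of_real (prob (\<Inter>n. E n))" by (rule tendsto_of_real)
  moreover have "(\<lambda>n. complex_of_real (prob (E n))) \<longlonglongrightarrow> discrete_fredholm (\<lambda>j l. of_real (prelimit_kernel \<alpha> \<eta> \<theta> \<epsilon> N j l))"
    unfolding expansion by (rule prelimit_fredholm[OF eta theta alpha eps])
  ultimately show "complex_of_real (prob {x \<in> space M. L (\<omega> x) \<le> enat N}) =
      discrete_fredholm (\<lambda>j l. of_real (prelimit_kernel \<alpha> \<eta> \<theta> \<epsilon> N j l))"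
    unfolding E by (rule LIMSEQ_unique)
qed

lemma prob_le_enat_tendsto:
  fixes X :: "'a \<Rightarrow> enat"
  assumes "\<And>N. {x \<in> space M. X x \<le> enat N} \<in> sets M"
  shows "(\<lambda>N. prob {x \<in> space M. X x \<le> enat N}) \<longlonglongrightarrow> prob {x \<in> space M. X x < \<infinity>}"
proof -
  have "(\<lambda>N. prob {x \<in> space M. X x \<le> enat N}) \<longlonglongrightarrow> prob (\<Union>N. {x \<in> space M. X x \<le> enat N})"
    using assms by (intro finite_Lim_measure_incseq) (auto simp: incseq_def intro: order_trans)
  also have "(\<Union>N. {x \<in> space M. X x \<le> enat N}) = {x \<in> space M. X x < \<infinity>}"
    by (rule Union_le_enat)
  finally show ?thesis .
qed

lemma prob_enat_eq:
  fixes X :: "'a \<Rightarrow> enat"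
  assumes m: "\<And>N. {x \<in> space M. X x \<le> enat N} \<in> sets M"
  shows "{x \<in> space M. X x = a} \<in> sets M"
    and "prob {x \<in> space M. X x = a} = (case a of
      enat n \<Rightarrow> prob {x \<in> space M. X x \<le> enat n} - (if n = 0 then 0 else prob {x \<in> space M. X x \<le> enat (n - 1)})
    | \<infinity> \<Rightarrow> 1 - prob {x \<in> space M. X x < \<infinity>})"
proof -
  have "{x \<in> space M. X x = a} \<in> sets M \<and> prob {x \<in> space M. X x = a} = (case a of
      enat n \<Rightarrow> prob {x \<in> space M. X x \<le> enat n} - (if n = 0 then 0 else prob {x \<in> space M. X x \<le> enat (n - 1)})
    | \<infinity> \<Rightarrow> 1 - prob {x \<in> space M. X x < \<infinity>})"
  proof (cases a)
    case (enat n)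
    show ?thesis
    proof (cases n)
      case 0
      then have "{x \<in> space M. X x = a} = {x \<in> space M. X x \<le> enat n}" using enat by (auto simp: zero_enat_def[symmetric])
      then show ?thesis using m[of n] 0 enat by simp
    next
      case (Suc k)
      have e: "{x \<in> space M. X x = a} = {x \<in> space M. X x \<le> enat n} - {x \<in> space M. X x \<le> enat k}"
      proof (intro equalityI subsetI)
        fix x assume "x \<in> {x \<in> space M. X x \<le> enat n} - {x \<in> space M. X x \<le> enat k}"
        then show "x \<in> {x \<in> space M. X x = a}" using enat Suc by (cases "X x") auto
      qed (use enat Suc in auto)
      have "{x \<in> space M. X x \<le> enat k} \<subseteq> {x \<in> space M. X x \<le> enat n}" using Suc by (auto intro: order_trans)
      then show ?thesis unfolding e using m enat Suc by (auto simp: finite_measure_Diff)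
    qed
  next
    case infinity
    have f: "{x \<in> space M. X x < \<infinity>} \<in> sets M"
    proof -
      have "(\<Union>N. {x \<in> space M. X x \<le> enat N}) \<in> sets M" using m by auto
      then show ?thesis by (simp only: Union_le_enat)
    qed
    have e: "{x \<in> space M. X x = a} = space M - {x \<in> space M. X x < \<infinity>}" using infinity by auto
    show ?thesis unfolding e using f infinity by (auto simp: prob_compl)
  qed
  then show "{x \<in> space M. X x = a} \<in> sets M"
    and "prob {x \<in> space M. X x = a} = (case a of
      enat n \<Rightarrow> prob {x \<in> space M. X x \<le> enat n} - (if n = 0 then 0 else prob {x \<in> space M. X x \<le> enat (n - 1)})
    | \<infinity> \<Rightarrow> 1 - prob {x \<in> space M. X x < \<infinity>})" by auto
qed

text \<open>The values at finite levels determine the law: finite points by differences, the point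
  at infinity by the missing mass.\<close>

lemma distr_enat_eqI:
  fixes X Y :: "'a \<Rightarrow> enat"
  assumes X: "\<And>N. {x \<in> space M. X x \<le> enat N} \<in> sets M" and Y: "\<And>N. {x \<in> space M. Y x \<le> enat N} \<in> sets M"
    and eq: "\<And>N. prob {x \<in> space M. X x \<le> enat N} = prob {x \<in> space M. Y x \<le> enat N}"
  shows "distr M (count_space UNIV) X = distr M (count_space UNIV) Y"
proof -
  have meas: "Z \<in> measurable M (count_space UNIV)" if "\<And>N. {x \<in> space M. Z x \<le> enat N} \<in> sets M" for Z :: "'a \<Rightarrow> enat"
  proof -
    have "Z -` {a} \<inter> space M = {x \<in> space M. Z x = a}" for a by auto
    then show ?thesis using prob_enat_eq(1)[OF that] by (simp add: measurable_count_space_eq_countable)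
  qed
  have fin: "prob {x \<in> space M. X x < \<infinity>} = prob {x \<in> space M. Y x < \<infinity>}"
    using prob_le_enat_tendsto[OF X] prob_le_enat_tendsto[OF Y] unfolding eq by (rule LIMSEQ_unique)
  show ?thesis
  proof (rule measure_eqI_countable[of _ UNIV])
    fix a
    have v: "Z -` {a} \<inter> space M = {x \<in> space M. Z x = a}" for Z :: "'a \<Rightarrow> enat" by auto
    have "prob {x \<in> space M. X x = a} = prob {x \<in> space M. Y x = a}"
      unfolding prob_enat_eq(2)[OF X] prob_enat_eq(2)[OF Y] eq fin ..
    then show "emeasure (distr M (count_space UNIV) X) {a} = emeasure (distr M (count_space UNIV) Y) {a}"
      by (simp add: emeasure_distr meas X Y v emeasure_eq_measure)
  qed auto
qed

end

text \<open>The strict inequality for the rescaled integer variable is a cutoff at an integer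
  \<open>N \<epsilon>\<close>, whose rescaled value tends to \<open>s\<close> because the lattice
  spacing is \<open>\<epsilon>\<close>.\<close>

lemma passage_limit:
  fixes L :: "(nat \<times> nat \<Rightarrow> nat) \<Rightarrow> enat" and M :: "real \<Rightarrow> 'a measure" and \<omega> :: "real \<Rightarrow> 'a \<Rightarrow> nat \<times> nat \<Rightarrow> nat"
  assumes eta: "\<eta> > 0" and theta: "\<theta> > 0" and alpha: "\<alpha> \<ge> 0" and delta: "0 < \<delta>" "\<delta> < (\<alpha> + min \<eta> \<theta>) / 2"
    and P: "\<And>\<epsilon> N. \<epsilon> > 0 \<Longrightarrow> complex_of_real (measure (M \<epsilon>) {x \<in> space (M \<epsilon>). L (\<omega> \<epsilon> x) \<le> enat N}) =
      discrete_fredholm (\<lambda>j l. of_real (prelimit_kernel \<alpha> \<eta> \<theta> \<epsilon> N j l))"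
  shows "((\<lambda>\<epsilon>. complex_of_real (measure (M \<epsilon>)
                {x \<in> space (M \<epsilon>). \<exists>n. L (\<omega> \<epsilon> x) = enat n \<and>
                   \<epsilon> * real n + ln (\<epsilon> * \<eta>) / \<eta> + ln (\<epsilon> * \<theta>) / \<theta> < s}))
             \<longlongrightarrow> fredholm_det (K_he_tilde \<alpha> \<eta> \<theta> \<delta>) s) (at_right 0)"
proof -
  define g where "g \<epsilon> = ln (\<epsilon> * \<eta>) / \<eta> + ln (\<epsilon> * \<theta>) / \<theta>" for \<epsilon>
  \<comment> \<open>The largest integer strictly below
    \<open>(s - g \<epsilon>) / \<epsilon>\<close> when that number is positive; ceiling minus 1
    matches the strict inequality of the event.\<close>
  define N where "N \<epsilon> = nat (\<lceil>(s - g \<epsilon>) / \<epsilon>\<rceil> - 1)" for \<epsilon>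
  have res: "rescaled \<eta> \<theta> \<epsilon> n = \<epsilon> * real n + g \<epsilon>" for \<epsilon> n by (simp add: rescaled_def g_def)
  have pos: "eventually (\<lambda>\<epsilon>. \<epsilon> > (0::real)) (at_right 0)" by (simp add: eventually_at_right_less)
  have ln_small: "eventually (\<lambda>\<epsilon>. ln (\<epsilon> * c) / c < s / 2) (at_right 0)" if c: "c > 0" for c :: real
  proof -
    have "filterlim (\<lambda>\<epsilon>. ln (\<epsilon> * c)) at_bot (at_right 0)"
      by (rule filterlim_compose[OF ln_at_0 filterlim_scale_at_right[OF c]])
    then have "eventually (\<lambda>\<epsilon>. ln (\<epsilon> * c) < s / 2 * c) (at_right 0)" unfolding filterlim_at_bot_dense by blast
    then show ?thesis by eventually_elim (use c in \<open>simp add: pos_divide_less_eq\<close>)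
  qed
  \<comment> \<open>Both logarithms tend to minus infinity, each term eventually below
    \<open>s / 2\<close>. The threshold is then positive and the conversion to \<open>nat\<close>
    does not truncate.\<close>
  have "eventually (\<lambda>\<epsilon>. g \<epsilon> < s) (at_right 0)"
    using ln_small[OF eta] ln_small[OF theta] unfolding g_def by eventually_elim linarith
  then have ev: "eventually (\<lambda>\<epsilon>. \<epsilon> > 0 \<and> g \<epsilon> < s) (at_right 0)" using pos by eventually_elim simp
  have N: "real n < (s - g \<epsilon>) / \<epsilon> \<longleftrightarrow> n \<le> N \<epsilon>" "real (N \<epsilon>) < (s - g \<epsilon>) / \<epsilon>" "(s - g \<epsilon>) / \<epsilon> \<le> real (N \<epsilon>) + 1"
    if "\<epsilon> > 0" "g \<epsilon> < s" for \<epsilon> n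
  proof -
    define u where "u = (s - g \<epsilon>) / \<epsilon>"
    have u: "u > 0" using that by (simp add: u_def)
    then have c: "\<lceil>u\<rceil> \<ge> 1" by (simp add: one_le_ceiling)
    have "real n < u \<longleftrightarrow> int n < \<lceil>u\<rceil>" using less_ceiling_iff[of "int n" u] by simp
    then show "real n < (s - g \<epsilon>) / \<epsilon> \<longleftrightarrow> n \<le> N \<epsilon>" unfolding N_def u_def[symmetric] using c by linarith
    have "real (N \<epsilon>) = of_int \<lceil>u\<rceil> - 1" unfolding N_def u_def[symmetric] using c by simp
    moreover have "u \<le> of_int \<lceil>u\<rceil>" "of_int \<lceil>u\<rceil> < u + 1" using ceiling_correct[of u] by linarith+
    ultimately show "real (N \<epsilon>) < (s - g \<epsilon>) / \<epsilon>" "(s - g \<epsilon>) / \<epsilon> \<le> real (N \<epsilon>) + 1"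
      unfolding u_def[symmetric] by linarith+
  qed
  have bd: "s \<le> rescaled \<eta> \<theta> \<epsilon> (N \<epsilon>) + \<epsilon>" "rescaled \<eta> \<theta> \<epsilon> (N \<epsilon>) \<le> s" if "\<epsilon> > 0" "g \<epsilon> < s" for \<epsilon>
    using N(2,3)[OF that] that(1) unfolding res by (auto simp: field_simps)
  have ge: "eventually (\<lambda>\<epsilon>. s \<le> rescaled \<eta> \<theta> \<epsilon> (N \<epsilon>) + \<epsilon>) (at_right 0)"
    using ev by eventually_elim (use bd in auto)
  have lo: "eventually (\<lambda>\<epsilon>. s - \<epsilon> \<le> rescaled \<eta> \<theta> \<epsilon> (N \<epsilon>)) (at_right 0)"
    using ge by eventually_elim simp
  have up: "eventually (\<lambda>\<epsilon>. rescaled \<eta> \<theta> \<epsilon> (N \<epsilon>) \<le> s) (at_right 0)"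
    using ev by eventually_elim (use bd in auto)
  have "((\<lambda>\<epsilon>. s - \<epsilon>) \<longlongrightarrow> s - 0) (at_right (0::real))" by (intro tendsto_diff tendsto_const tendsto_ident_at)
  then have "((\<lambda>\<epsilon>. rescaled \<eta> \<theta> \<epsilon> (N \<epsilon>)) \<longlongrightarrow> s) (at_right 0)"
    using tendsto_sandwich[OF lo up _ tendsto_const] by simp
  note lim = prelimit_kernel_tendsto[OF eta theta alpha this ge]
  have "eventually (\<lambda>\<epsilon>. discrete_fredholm (\<lambda>j l. of_real (prelimit_kernel \<alpha> \<eta> \<theta> \<epsilon> (N \<epsilon>) j l)) =
      complex_of_real (measure (M \<epsilon>) {x \<in> space (M \<epsilon>). \<exists>n. L (\<omega> \<epsilon> x) = enat n \<and>
                   \<epsilon> * real n + ln (\<epsilon> * \<eta>) / \<eta> + ln (\<epsilon> * \<theta>) / \<theta> < s})) (at_right 0)"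
    using ev
  proof eventually_elim
    case (elim \<epsilon>)
    have iff: "\<epsilon> * real n + ln (\<epsilon> * \<eta>) / \<eta> + ln (\<epsilon> * \<theta>) / \<theta> < s \<longleftrightarrow> n \<le> N \<epsilon>" for n
    proof -
      have "\<epsilon> * real n + ln (\<epsilon> * \<eta>) / \<eta> + ln (\<epsilon> * \<theta>) / \<theta> < s \<longleftrightarrow> real n < (s - g \<epsilon>) / \<epsilon>"
        using elim by (simp add: g_def pos_less_divide_eq algebra_simps)
      then show ?thesis using N(1) elim by simp
    qed
    have "(\<exists>n. L w = enat n \<and> n \<le> N \<epsilon>) \<longleftrightarrow> L w \<le> enat (N \<epsilon>)" for w by (cases "L w") auto
    then show ?case unfolding iff using P[of \<epsilon> "N \<epsilon>"] elim by simp
  qed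
  then show ?thesis
    using Lim_transform_eventually[OF lim] fredholm_det_limit_kernel[OF eta theta alpha delta, of s] by simp
qed

lemma reverse_permutes: "(\<lambda>i. if i < n then n - 1 - i else i) permutes {..<n :: nat}"
proof (rule bij_imp_permutes)
  show "bij_betw (\<lambda>i. if i < n then n - 1 - i else i) {..<n} {..<n}"
    by (rule bij_betw_byWitness[where f' = "\<lambda>i. n - 1 - i"]) auto
qed auto

theorem mainTheorem7:
  fixes \<alpha> \<eta> \<theta> \<delta> :: real
    and M :: "real \<Rightarrow> 'a measure"
    and \<omega> :: "real \<Rightarrow> 'a \<Rightarrow> nat \<times> nat \<Rightarrow> nat"
  assumes "\<alpha> \<ge> 0" and "\<eta> > 0" and "\<theta> > 0"
    and "0 < \<delta>" and "\<delta> < (\<alpha> + min \<eta> \<theta>) / 2"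
    and "\<And>\<epsilon>. \<epsilon> > 0 \<Longrightarrow> prob_space (M \<epsilon>)"
    and "\<And>\<epsilon>. \<epsilon> > 0 \<Longrightarrow>
           prob_space.indep_vars (M \<epsilon>) (\<lambda>_. count_space UNIV)
             (\<lambda>ij x. \<omega> \<epsilon> x ij) {(i, j). i \<ge> 1 \<and> j \<ge> 1}"
    and "\<And>\<epsilon> i j k. \<epsilon> > 0 \<Longrightarrow> i \<ge> 1 \<Longrightarrow> j \<ge> 1 \<Longrightarrow>
           measure (M \<epsilon>) {x \<in> space (M \<epsilon>). \<omega> \<epsilon> x (i, j) = k} =
             (1 - geo_param \<alpha> \<eta> \<theta> \<epsilon> i j) * geo_param \<alpha> \<eta> \<theta> \<epsilon> i j ^ k"
  shows "(\<forall>\<epsilon>>0. (AE x in M \<epsilon>. Lgeo1 (\<omega> \<epsilon> x) < \<infinity>) \<and>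
                 (AE x in M \<epsilon>. Lgeo2 (\<omega> \<epsilon> x) < \<infinity>) \<and>
                 distr (M \<epsilon>) (count_space UNIV) (\<lambda>x. Lgeo1 (\<omega> \<epsilon> x)) =
                 distr (M \<epsilon>) (count_space UNIV) (\<lambda>x. Lgeo2 (\<omega> \<epsilon> x)))
       \<and> (\<forall>L \<in> {Lgeo1, Lgeo2}. \<forall>s :: real.
            ((\<lambda>\<epsilon>. complex_of_real (measure (M \<epsilon>)
                {x \<in> space (M \<epsilon>). \<exists>n. L (\<omega> \<epsilon> x) = enat n \<and>
                   \<epsilon> * real n + ln (\<epsilon> * \<eta>) / \<eta> + ln (\<epsilon> * \<theta>) / \<theta> < s}))
             \<longlongrightarrow> fredholm_det (K_he_tilde \<alpha> \<eta> \<theta> \<delta>) s) (at_right 0))"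
proof -
  note alpha = assms(1) and eta = assms(2) and theta = assms(3) and ps = assms(6) and ind = assms(7) and law = assms(8)
  \<comment> \<open>The first model uses the weights as they are, with the identity permutation of
    the rows.\<close>
  have W1: "w (i, j) = w (Suc (id (i - 1)), j)" if "1 \<le> i" for w :: "nat \<times> nat \<Rightarrow> nat" and i j :: nat
    using that by simp
  \<comment> \<open>The second model, seen in a box of size \<open>n\<close>, is the first with its
    rows reversed.\<close>
  have W2: "reflect n w (i, j) = w (Suc (if i - 1 < n then n - 1 - (i - 1) else i - 1), j)" if "1 \<le> i" "i \<le> n" for w n i j
    using that by (auto simp: reflect_def Suc_diff_le intro!: arg_cong[where f = w])
  have L1: "{x \<in> space (M \<epsilon>). Lgeo1 (\<omega> \<epsilon> x) \<le> enat N} \<in> sets (M \<epsilon>) \<and>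
      complex_of_real (measure (M \<epsilon>) {x \<in> space (M \<epsilon>). Lgeo1 (\<omega> \<epsilon> x) \<le> enat N}) =
      discrete_fredholm (\<lambda>j l. of_real (prelimit_kernel \<alpha> \<eta> \<theta> \<epsilon> N j l))" if e: "\<epsilon> > 0" for \<epsilon> N
    by (intro conjI; rule prob_space.prob_passage_le[OF ps[OF e] eta theta alpha e ind[OF e] law[OF e] W1 permutes_id Lgeo1_le_iff
          lpt_mono[OF le_SucI le_SucI, OF order_refl order_refl]]; assumption)
  have L2: "{x \<in> space (M \<epsilon>). Lgeo2 (\<omega> \<epsilon> x) \<le> enat N} \<in> sets (M \<epsilon>) \<and>
      complex_of_real (measure (M \<epsilon>) {x \<in> space (M \<epsilon>). Lgeo2 (\<omega> \<epsilon> x) \<le> enat N}) =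
      discrete_fredholm (\<lambda>j l. of_real (prelimit_kernel \<alpha> \<eta> \<theta> \<epsilon> N j l))" if e: "\<epsilon> > 0" for \<epsilon> N
    by (intro conjI; rule prob_space.prob_passage_le[OF ps[OF e] eta theta alpha e ind[OF e] law[OF e] W2 reverse_permutes
          Lgeo2_le_iff lpt_reflect_mono]; assumption)
  have fin: "AE x in M \<epsilon>. L (\<omega> \<epsilon> x) < \<infinity>"
    if e: "\<epsilon> > 0" and L: "\<And>N. {x \<in> space (M \<epsilon>). L (\<omega> \<epsilon> x) \<le> enat N} \<in> sets (M \<epsilon>) \<and>
      complex_of_real (measure (M \<epsilon>) {x \<in> space (M \<epsilon>). L (\<omega> \<epsilon> x) \<le> enat N}) =
      discrete_fredholm (\<lambda>j l. of_real (prelimit_kernel \<alpha> \<eta> \<theta> \<epsilon> N j l))" for \<epsilon> and L :: "(nat \<times> nat \<Rightarrow> nat) \<Rightarrow> enat"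
  proof -
    interpret prob_space "M \<epsilon>" by (rule ps[OF e])
    have "(\<lambda>N. complex_of_real (prob {x \<in> space (M \<epsilon>). L (\<omega> \<epsilon> x) \<le> enat N})) \<longlonglongrightarrow> complex_of_real 1"
      using prelimit_fredholm_tendsto_1[OF eta theta alpha e] L by simp
    then have "(\<lambda>N. prob {x \<in> space (M \<epsilon>). L (\<omega> \<epsilon> x) \<le> enat N}) \<longlonglongrightarrow> 1"
      unfolding tendsto_of_real_iff .
    then have "prob {x \<in> space (M \<epsilon>). L (\<omega> \<epsilon> x) < \<infinity>} = 1"
      using prob_le_enat_tendsto[of "\<lambda>x. L (\<omega> \<epsilon> x)"] L LIMSEQ_unique by blast
    then show ?thesis using AE_prob_1 by fastforce
  qed
  have dist: "distr (M \<epsilon>) (count_space UNIV) (\<lambda>x. Lgeo1 (\<omega> \<epsilon> x)) = distr (M \<epsilon>) (count_space UNIV) (\<lambda>x. Lgeo2 (\<omega> \<epsilon> x))" if e: "\<epsilon> > 0" for \<epsilon>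
  proof (rule prob_space.distr_enat_eqI[OF ps[OF e]])
    fix N
    have "complex_of_real (measure (M \<epsilon>) {x \<in> space (M \<epsilon>). Lgeo1 (\<omega> \<epsilon> x) \<le> enat N}) =
        complex_of_real (measure (M \<epsilon>) {x \<in> space (M \<epsilon>). Lgeo2 (\<omega> \<epsilon> x) \<le> enat N})"
      using L1[OF e, of N] L2[OF e, of N] by simp
    then show "measure (M \<epsilon>) {x \<in> space (M \<epsilon>). Lgeo1 (\<omega> \<epsilon> x) \<le> enat N} = measure (M \<epsilon>) {x \<in> space (M \<epsilon>). Lgeo2 (\<omega> \<epsilon> x) \<le> enat N}"
      by (simp only: of_real_eq_iff)
  qed (use L1[OF e] L2[OF e] in auto)
  show ?thesis
  proof (intro conjI allI impI ballI)
    fix \<epsilon> :: real assume e: "\<epsilon> > 0"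
    show "AE x in M \<epsilon>. Lgeo1 (\<omega> \<epsilon> x) < \<infinity>" by (rule fin[OF e L1[OF e]])
    show "AE x in M \<epsilon>. Lgeo2 (\<omega> \<epsilon> x) < \<infinity>" by (rule fin[OF e L2[OF e]])
    show "distr (M \<epsilon>) (count_space UNIV) (\<lambda>x. Lgeo1 (\<omega> \<epsilon> x)) = distr (M \<epsilon>) (count_space UNIV) (\<lambda>x. Lgeo2 (\<omega> \<epsilon> x))"
      by (rule dist[OF e])
  next
    fix L s assume "L \<in> {Lgeo1, Lgeo2}"
    then have P: "complex_of_real (measure (M \<epsilon>) {x \<in> space (M \<epsilon>). L (\<omega> \<epsilon> x) \<le> enat N}) =
      discrete_fredholm (\<lambda>j l. of_real (prelimit_kernel \<alpha> \<eta> \<theta> \<epsilon> N j l))" if "\<epsilon> > 0" for \<epsilon> N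
      using L1[OF that, of N] L2[OF that, of N] by auto
    show "((\<lambda>\<epsilon>. complex_of_real (measure (M \<epsilon>)
                {x \<in> space (M \<epsilon>). \<exists>n. L (\<omega> \<epsilon> x) = enat n \<and>
                   \<epsilon> * real n + ln (\<epsilon> * \<eta>) / \<eta> + ln (\<epsilon> * \<theta>) / \<theta> < s}))
             \<longlongrightarrow> fredholm_det (K_he_tilde \<alpha> \<eta> \<theta> \<delta>) s) (at_right 0)"
      by (rule passage_limit[OF eta theta alpha assms(4,5) P])
  qed
qed

end
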